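(* Let $\Pi$ be a $\mathcal{V}$-coupling Poisson structure on a manifold $M$ with an orientable regular foliation $\mathcal{V}$, and let $(\gamma,\sigma,P)$ be its associated geometric data. Fix a leaf-wise volume form $\tau$ of $\mathcal{V}$ and consider the volume form $\Omega:=\sigma^{l}\wedge\tau_{\gamma}$ of $M$, where $2l=\operatorname{rank}\mathbb{H}$. If $Z:=Z_\Pi^\Omega$ is the corresponding modular vector field of $\Pi$, then the components of $Z=Z_{1,0}+Z_{0,1}$ relative to the splitting $TM=\mathbb{H}\oplus\mathbb{V}$ (with $Z_{1,0}\in\Gamma(\mathbb{H})$, $Z_{0,1}\in\Gamma(\mathbb{V})$) are given by $$Z_{1,0}=-\Pi^{\sharp}(\theta_{\tau}^{\gamma}),\qquad Z_{0,1}=Z_{P}^{\tau}.$$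
   Context: Everything is smooth. For a Poisson bivector field $\Pi$ on $M$, $\Pi^\sharp:T^*M\to TM$ is given by $\langle\beta,\Pi^\sharp\alpha\rangle=\Pi(\alpha,\beta)$. For a volume form $\Omega$, the modular vector field $Z_\Pi^\Omega$ is defined by $Z_\Pi^\Omega(f)=\operatorname{div}^\Omega(\Pi^\sharp df)$; equivalently $-\mathbf{i}_{Z_\Pi^\Omega}\Omega=d\,\mathbf{i}_\Pi\Omega$, where $\mathbf{i}_{X_1\wedge\dots\wedge X_k}=\mathbf{i}_{X_1}\circ\dots\circ\mathbf{i}_{X_k}$. Let $\mathcal{V}$ be a regular foliation on $M$, $\mathbb{V}=T\mathcal{V}$, $\mathbb{V}^0\subset T^*M$ its annihilator, $d_{\mathcal V}$ the foliated exterior derivative on $\Gamma(\wedge^\bullet\mathbb{V}^* )$. $\mathcal{V}$ is orientable if there is a nowhere vanishing $\tau\in\Gamma(\wedge^{\operatorname{top}}\mathbb{V}^* )$, called a leaf-wise volume form. Given a normal bundle $\mathbb{H}$, $TM=\mathbb{H}\oplus\mathbb{V}$, the connection form $\gamma:TM\to\mathbb{V}$ is the projection along $\mathbb{H}$. Forms are bigraded by $\wedge^{p,q}T^*M=\wedge^p\mathbb{V}^0\otimes\wedge^q\mathbb{H}^0$ ($\mathbb{H}^0$ the annihilator of $\mathbb{H}$), multivectors by $\wedge^{p,q}TM=\wedge^p\mathbb{H}\otimes\wedge^q\mathbb{V}$, and $d=d^\gamma_{1,0}+d^\gamma_{2,-1}+d^\gamma_{0,1}$ is the bigraded decomposition of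 the exterior differential. For $\tau\in\Gamma(\wedge^{\operatorname{top}}\mathbb{V}^* )$, $\tau_\gamma\in\Gamma(\wedge^{\operatorname{top}}\mathbb{H}^0)$ is the unique form whose restriction to $\mathbb{V}$ is $\tau$. The divergence form $\theta_\tau^\gamma\in\Gamma(\mathbb{V}^0)$ is uniquely determined by $d^\gamma_{1,0}\tau_\gamma=\theta_\tau^\gamma\wedge\tau_\gamma$. A Poisson bivector $\Pi$ on $M$ is $\mathcal{V}$-coupling if $\mathbb{H}:=\Pi^\sharp(\mathbb{V}^0)$ satisfies $TM=\mathbb{H}\oplus\mathbb{V}$. Then $\Pi=\Pi_H+P$ with $\Pi_H=\Pi_{2,0}\in\Gamma(\wedge^2\mathbb{H})$ and $P=\Pi_{0,2}\in\Gamma(\wedge^2\mathbb{V})$ a Poisson bivector; $\Pi_H^\sharp|_{\mathbb{V}^0}:\mathbb{V}^0\to\mathbb{H}$ is an isomorphism, and the coupling form $\sigma\in\Gamma(\wedge^2\mathbb{V}^0)$ is defined by $\sigma^\flat|_{\mathbb{H}}=-(\Pi_H^\sharp|_{\mathbb{V}^0})^{-1}$, where $\sigma^\flat(X)=\mathbf{i}_X\sigma$. With $\gamma$ the connection form of this $\mathbb{H}$, the triple $(\gamma,\sigma,P)$ is the geometric data of $\Pi$. $\sigma^l$ denotes the $l$-fold wedge product. The modular vector field $Z_P^\tau\in\Gamma(\mathbb{V})$ of the Poisson foliation $(M,\mathcal{V},P)$ is defined by $\mathbf{i}_{Z_P^\tau}\tau=-d_{\mathcal V}\mathbf{i}_P\tau$.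 *)

theory Defs
  imports "HOL-Analysis.Analysis"
begin

section \<open>Smooth maps between Euclidean spaces\<close>

primrec diff_class_on ::
  "nat \<Rightarrow> 'a::real_normed_vector set \<Rightarrow> ('a \<Rightarrow> 'b::real_normed_vector) \<Rightarrow> bool" where
  "diff_class_on 0 S f \<longleftrightarrow> continuous_on S f"
| "diff_class_on (Suc k) S f \<longleftrightarrow> (\<forall>x\<in>S. f differentiable (at x)) \<and>
     (\<forall>v. diff_class_on k S (\<lambda>x. frechet_derivative f (at x) v))"

text \<open>To be used for open \<open>S\<close> only.\<close>
definition smooth_on :: "'a::real_normed_vector set \<Rightarrow> ('a \<Rightarrow> 'b::real_normed_vector) \<Rightarrow> bool" where
  "smooth_on S f \<longleftrightarrow> (\<forall>k. diff_class_on k S f)"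


section \<open>Multilinear algebra\<close>

text \<open>
  A \<open>k\<close>-form on a subspace \<open>W\<close> of \<open>'e\<close> is a function on argument lists. It is made extensional by
  requiring the value \<open>0\<close> on lists of length other than \<open>k\<close> and on lists with an entry outside \<open>W\<close>;
  so equality of forms on \<open>W\<close> is equality of functions.
\<close>
type_synonym 'e form = "'e list \<Rightarrow> real"

definition forms :: "'e::real_vector set \<Rightarrow> nat \<Rightarrow> 'e form set" where
  "forms W k = {\<omega>.
     (\<forall>us. length us \<noteq> k \<or> \<not> set us \<subseteq> W \<longrightarrow> \<omega> us = 0) \<and>
     (\<forall>us i u v a b. length us = k \<and> set us \<subseteq> W \<and> i < k \<and> u \<in> W \<and> v \<in> W \<longrightarrow>
        \<omega> (us[i := a *\<^sub>R u + b *\<^sub>R v]) = a * \<omega> (us[i := u]) + b * \<omega> (us[i := v])) \<and>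
     (\<forall>us. length us = k \<and> \<not> distinct us \<longrightarrow> \<omega> us = 0)}"

text \<open>\<open>ann_forms W k\<close> is the \<open>k\<close>-th exterior power of the annihilator of \<open>W\<close>.\<close>
definition ann_forms :: "'e::real_vector set \<Rightarrow> nat \<Rightarrow> 'e form set" where
  "ann_forms W k = {\<omega> \<in> forms UNIV k. \<forall>us. set us \<inter> W \<noteq> {} \<longrightarrow> \<omega> us = 0}"

definition interior_prod :: "'e \<Rightarrow> 'e form \<Rightarrow> 'e form" where
  "interior_prod v \<omega> = (\<lambda>us. \<omega> (v # us))"

definition pull :: "('e \<Rightarrow> 'f) \<Rightarrow> 'f form \<Rightarrow> 'e form" where
  "pull L \<omega> = (\<lambda>us. \<omega> (map L us))"

text \<open>
  The shuffle formula: \<open>I\<close> collects the positions of the arguments fed to \<open>\<alpha>\<close>, and the exponent is the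
  number of inversions of the shuffle. As forms vanish on lists of the wrong length, the degrees of
  \<open>\<alpha>\<close> and \<open>\<beta>\<close> need not be given.  For 1-forms, \<open>\<alpha> \<and> \<beta>\<close> takes \<open>(u, v)\<close> to
  \<open>\<alpha>(u) \<beta>(v) - \<alpha>(v) \<beta>(u)\<close>.
\<close>
definition wedge :: "'e form \<Rightarrow> 'e form \<Rightarrow> 'e form" where
  "wedge \<alpha> \<beta> = (\<lambda>us. let N = {..<length us} in
     \<Sum>I\<in>Pow N. (- 1) ^ card {(i, j). i \<in> I \<and> j \<in> N - I \<and> j < i} *
       \<alpha> (nths us I) * \<beta> (nths us (N - I)))"

primrec wedge_power :: "'e form \<Rightarrow> nat \<Rightarrow> 'e form" where
  "wedge_power \<sigma> 0 = (\<lambda>us. if us = [] then 1 else 0)"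
| "wedge_power \<sigma> (Suc l) = wedge \<sigma> (wedge_power \<sigma> l)"

text \<open>
  A bivector on \<open>'e\<close> is an alternating bilinear function of covectors, a covector being an element of
  \<open>forms UNIV 1\<close>; the values on other arguments carry no meaning.
\<close>
type_synonym 'e bivec = "'e form \<Rightarrow> 'e form \<Rightarrow> real"

definition is_bivector :: "'e::real_vector bivec \<Rightarrow> bool" where
  "is_bivector B \<longleftrightarrow>
     (\<forall>\<alpha>\<in>forms UNIV 1. \<forall>\<beta>\<in>forms UNIV 1. \<forall>\<eta>\<in>forms UNIV 1. \<forall>a b.
        B (\<lambda>us. a * \<alpha> us + b * \<beta> us) \<eta> = a * B \<alpha> \<eta> + b * B \<beta> \<eta> \<and>
        B \<eta> (\<lambda>us. a * \<alpha> us + b * \<beta> us) = a * B \<eta> \<alpha> + b * B \<eta> \<beta>) \<and>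
     (\<forall>\<alpha>\<in>forms UNIV 1. B \<alpha> \<alpha> = 0)"

definition sharp :: "'e::real_vector bivec \<Rightarrow> 'e form \<Rightarrow> 'e" where
  "sharp B \<alpha> = (THE v. \<forall>\<beta>\<in>forms UNIV 1. \<beta> [v] = B \<alpha> \<beta>)"

text \<open>
  The contraction with \<open>B \<in> \<Lambda>\<^sup>2 W\<close>, i.e. the linear extension of the rule that contraction with
  \<open>X \<and> Y\<close> is contraction with \<open>Y\<close> followed by contraction with \<open>X\<close>: \<open>B\<close> is written as
  \<open>\<Sum>i<n. X i \<and> Y i\<close> with \<open>X i\<close>, \<open>Y i\<close> in \<open>W\<close>, and the result does not depend on the choice.
\<close>
definition contract :: "'e::real_vector set \<Rightarrow> 'e bivec \<Rightarrow> 'e form \<Rightarrow> 'e form" where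
  "contract W B \<omega> = (THE \<eta>. \<exists>n X Y.
     (\<forall>i<n. X i \<in> W \<and> Y i \<in> W) \<and>
     (\<forall>\<alpha>\<in>forms UNIV 1. \<forall>\<beta>\<in>forms UNIV 1.
        B \<alpha> \<beta> = (\<Sum>i<n::nat. \<alpha> [X i] * \<beta> [Y i] - \<alpha> [Y i] * \<beta> [X i])) \<and>
     \<eta> = (\<lambda>us. \<Sum>i<n. interior_prod (X i) (interior_prod (Y i) \<omega>) us))"


section \<open>Manifolds\<close>

text \<open>A chart is a pair of its domain and its coordinate map (relevant on the domain only).\<close>
type_synonym ('a, 'e) chart = "'a set \<times> ('a \<Rightarrow> 'e)"

abbreviation cdom :: "('a, 'e) chart \<Rightarrow> 'a set" where "cdom c \<equiv> fst c"
abbreviation cmap :: "('a, 'e) chart \<Rightarrow> 'a \<Rightarrow> 'e" where "cmap c \<equiv> snd c"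
abbreviation cinv :: "('a, 'e) chart \<Rightarrow> 'e \<Rightarrow> 'a" where "cinv c \<equiv> inv_into (fst c) (snd c)"
abbreviation cran :: "('a, 'e) chart \<Rightarrow> 'e set" where "cran c \<equiv> snd c ` fst c"

definition is_chart :: "('a::topological_space, 'e::euclidean_space) chart \<Rightarrow> bool" where
  "is_chart c \<longleftrightarrow> open (cdom c) \<and> open (cran c) \<and> homeomorphism (cdom c) (cran c) (cmap c) (cinv c)"

definition smooth_compat ::
  "('a::topological_space, 'e::euclidean_space) chart \<Rightarrow> ('a, 'e) chart \<Rightarrow> bool" where
  "smooth_compat c c' \<longleftrightarrow>
     smooth_on (cmap c ` (cdom c \<inter> cdom c')) (cmap c' \<circ> cinv c) \<and>
     smooth_on (cmap c' ` (cdom c \<inter> cdom c')) (cmap c \<circ> cinv c')"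

definition smooth_atlas :: "('a::topological_space, 'e::euclidean_space) chart set \<Rightarrow> bool" where
  "smooth_atlas A \<longleftrightarrow> (\<forall>c\<in>A. is_chart c) \<and> (\<forall>c\<in>A. \<forall>c'\<in>A. smooth_compat c c') \<and>
     (\<Union>c\<in>A. cdom c) = UNIV"

definition chart_at :: "('a, 'e) chart set \<Rightarrow> 'a \<Rightarrow> ('a, 'e) chart" where
  "chart_at A p = (SOME c. c \<in> A \<and> p \<in> cdom c)"

definition trans_deriv ::
  "('a, 'e::euclidean_space) chart \<Rightarrow> ('a, 'e) chart \<Rightarrow> 'a \<Rightarrow> 'e \<Rightarrow> 'e" where
  "trans_deriv c c' p = frechet_derivative (cmap c' \<circ> cinv c) (at (cmap c p))"

text \<open>
  The tangent space at \<open>p\<close> is modelled on \<open>'e\<close> by means of the chart \<open>chart_at A p\<close>: a tangent vector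
  is given by its components in that chart. Its components in another chart \<open>c\<close> around \<open>p\<close> are then
  obtained by applying \<open>to_chart A c p\<close>, and \<open>of_chart A c p\<close> is the inverse operation.
\<close>
definition to_chart :: "('a, 'e::euclidean_space) chart set \<Rightarrow> ('a, 'e) chart \<Rightarrow> 'a \<Rightarrow> 'e \<Rightarrow> 'e" where
  "to_chart A c p = trans_deriv (chart_at A p) c p"

definition of_chart :: "('a, 'e::euclidean_space) chart set \<Rightarrow> ('a, 'e) chart \<Rightarrow> 'a \<Rightarrow> 'e \<Rightarrow> 'e" where
  "of_chart A c p = trans_deriv c (chart_at A p) p"

definition smooth_fun :: "('a, 'e::euclidean_space) chart set \<Rightarrow> ('a \<Rightarrow> real) \<Rightarrow> bool" where
  "smooth_fun A f \<longleftrightarrow> (\<forall>c\<in>A. smooth_on (cran c) (f \<circ> cinv c))"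

text \<open>Local representatives of a field of forms and of a bivector field in a chart.\<close>
definition form_rep ::
  "('a, 'e::euclidean_space) chart set \<Rightarrow> ('a, 'e) chart \<Rightarrow> ('a \<Rightarrow> 'e form) \<Rightarrow> 'e \<Rightarrow> 'e form" where
  "form_rep A c \<omega> x = pull (of_chart A c (cinv c x)) (\<omega> (cinv c x))"

definition bivec_rep ::
  "('a, 'e::euclidean_space) chart set \<Rightarrow> ('a, 'e) chart \<Rightarrow> ('a \<Rightarrow> 'e bivec) \<Rightarrow> 'e \<Rightarrow> 'e bivec" where
  "bivec_rep A c B x = (\<lambda>\<alpha> \<beta>. let p = cinv c x in
     B p (pull (to_chart A c p) \<alpha>) (pull (to_chart A c p) \<beta>))"

definition bivector_field ::
  "('a, 'e::euclidean_space) chart set \<Rightarrow> ('a \<Rightarrow> 'e bivec) \<Rightarrow> bool" where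
  "bivector_field A B \<longleftrightarrow> (\<forall>p. is_bivector (B p)) \<and>
     (\<forall>c\<in>A. \<forall>\<alpha>\<in>forms UNIV 1. \<forall>\<beta>\<in>forms UNIV 1. smooth_on (cran c) (\<lambda>x. bivec_rep A c B x \<alpha> \<beta>))"

text \<open>
  The coordinate formula of the exterior derivative at \<open>p\<close>, computed in a chart \<open>c\<close> around \<open>p\<close>:
  \<open>\<Sum>i. (-1)^i D\<^sub>w\<^sub>i \<omega>(w\<^sub>0, \<dots>, w\<^sub>i omitted, \<dots>, w\<^sub>k)\<close>, where the \<open>w\<^sub>i\<close> are the components of the
  arguments in the chart \<open>c\<close>.
\<close>
definition ext_deriv_in ::
  "('a, 'e::euclidean_space) chart set \<Rightarrow> ('a, 'e) chart \<Rightarrow> ('a \<Rightarrow> 'e form) \<Rightarrow> 'a \<Rightarrow> 'e form" where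
  "ext_deriv_in A c \<omega> p = (\<lambda>us. let ws = map (to_chart A c p) us in
     \<Sum>i<length ws. (- 1) ^ i *
       frechet_derivative (\<lambda>x. form_rep A c \<omega> x (take i ws @ drop (Suc i) ws))
         (at (cmap c p)) (ws ! i))"

definition ext_deriv ::
  "('a, 'e::euclidean_space) chart set \<Rightarrow> ('a \<Rightarrow> 'e form) \<Rightarrow> 'a \<Rightarrow> 'e form" where
  "ext_deriv A \<omega> p = ext_deriv_in A (chart_at A p) \<omega> p"

definition fun_form :: "('a \<Rightarrow> real) \<Rightarrow> 'a \<Rightarrow> 'e form" where
  "fun_form f p = (\<lambda>us. if us = [] then f p else 0)"

abbreviation differential ::
  "('a, 'e::euclidean_space) chart set \<Rightarrow> ('a \<Rightarrow> real) \<Rightarrow> 'a \<Rightarrow> 'e form" where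
  "differential A f \<equiv> ext_deriv A (fun_form f)"


section \<open>Poisson structures and modular vector fields\<close>

definition bracket ::
  "('a, 'e::euclidean_space) chart set \<Rightarrow> ('a \<Rightarrow> 'e bivec) \<Rightarrow> ('a \<Rightarrow> real) \<Rightarrow> ('a \<Rightarrow> real) \<Rightarrow> 'a \<Rightarrow> real"
  where "bracket A B f g p = B p (differential A f p) (differential A g p)"

definition poisson :: "('a, 'e::euclidean_space) chart set \<Rightarrow> ('a \<Rightarrow> 'e bivec) \<Rightarrow> bool" where
  "poisson A B \<longleftrightarrow> bivector_field A B \<and>
     (\<forall>f g h. smooth_fun A f \<and> smooth_fun A g \<and> smooth_fun A h \<longrightarrow>
        (\<forall>p. bracket A B f (bracket A B g h) p + bracket A B g (bracket A B h f) p
           + bracket A B h (bracket A B f g) p = 0))"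

text \<open>The divergence with respect to a volume form \<open>\<Omega>\<close>, with the Lie derivative \<open>L\<^sub>X \<Omega>\<close> of the
  top-degree form \<open>\<Omega>\<close> written as the differential of the contraction of \<open>\<Omega>\<close> with \<open>X\<close>.\<close>
definition divergence ::
  "('a, 'e::euclidean_space) chart set \<Rightarrow> ('a \<Rightarrow> 'e form) \<Rightarrow> ('a \<Rightarrow> 'e) \<Rightarrow> 'a \<Rightarrow> real" where
  "divergence A \<Omega> X p =
     (THE r. ext_deriv A (\<lambda>q. interior_prod (X q) (\<Omega> q)) p = (\<lambda>us. r * \<Omega> p us))"

definition modular_field ::
  "('a, 'e::euclidean_space) chart set \<Rightarrow> ('a \<Rightarrow> 'e bivec) \<Rightarrow> ('a \<Rightarrow> 'e form) \<Rightarrow> 'a \<Rightarrow> 'e" where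
  "modular_field A B \<Omega> p = (THE v. \<forall>f. smooth_fun A f \<longrightarrow>
     differential A f p [v] = divergence A \<Omega> (\<lambda>q. sharp (B q) (differential A f q)) p)"


section \<open>Regular foliations\<close>

text \<open>
  A regular foliation is given by a foliation atlas \<open>F\<close>: its charts belong to the smooth structure, and
  the transition maps are locally of the form \<open>(x, y) \<mapsto> (g(x, y), h(y))\<close>, where the model space of
  the leaves is a linear subspace \<open>K\<close> of \<open>'e\<close> (in place of \<open>\<real>\<^sup>r \<times> 0\<close>) and \<open>y\<close> stands for
  the class modulo \<open>K\<close>. The leaves are the maximal connected unions of plaques.
\<close>
definition foliation_atlas ::
  "('a::topological_space, 'e::euclidean_space) chart set \<Rightarrow> ('a, 'e) chart set \<Rightarrow> 'e set \<Rightarrow> bool" where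
  "foliation_atlas A F K \<longleftrightarrow> subspace K \<and>
     (\<forall>c\<in>F. is_chart c) \<and> (\<forall>c\<in>F. \<forall>c'\<in>A. smooth_compat c c') \<and> (\<Union>c\<in>F. cdom c) = UNIV \<and>
     (\<forall>c\<in>F. \<forall>c'\<in>F. \<forall>p\<in>cdom c \<inter> cdom c'. \<exists>N. open N \<and> cmap c p \<in> N \<and>
        N \<subseteq> cmap c ` (cdom c \<inter> cdom c') \<and>
        (\<forall>x\<in>N. \<forall>y\<in>N. x - y \<in> K \<longrightarrow> cmap c' (cinv c x) - cmap c' (cinv c y) \<in> K))"

definition leaf_tangent ::
  "('a, 'e::euclidean_space) chart set \<Rightarrow> ('a, 'e) chart set \<Rightarrow> 'e set \<Rightarrow> 'a \<Rightarrow> 'e set" where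
  "leaf_tangent A F K p = {v. \<forall>c\<in>F. p \<in> cdom c \<longrightarrow> to_chart A c p v \<in> K}"

text \<open>Foliated forms are fields of forms on the spaces \<open>leaf_tangent A F K p\<close>.\<close>
definition leafwise_volume ::
  "('a, 'e::euclidean_space) chart set \<Rightarrow> ('a, 'e) chart set \<Rightarrow> 'e set \<Rightarrow> ('a \<Rightarrow> 'e form) \<Rightarrow> bool" where
  "leafwise_volume A F K \<tau> \<longleftrightarrow>
     (\<forall>p. \<tau> p \<in> forms (leaf_tangent A F K p) (dim K) \<and> (\<exists>us. \<tau> p us \<noteq> 0)) \<and>
     (\<forall>c\<in>F. \<forall>ws. set ws \<subseteq> K \<longrightarrow> smooth_on (cran c) (\<lambda>x. form_rep A c \<tau> x ws))"

definition leaf_deriv ::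
  "('a, 'e::euclidean_space) chart set \<Rightarrow> ('a, 'e) chart set \<Rightarrow> 'e set \<Rightarrow> ('a \<Rightarrow> 'e form) \<Rightarrow> 'a \<Rightarrow> 'e form"
  where "leaf_deriv A F K \<eta> p = (\<lambda>us. if set us \<subseteq> leaf_tangent A F K p
     then ext_deriv_in A (chart_at F p) \<eta> p us else 0)"

definition leaf_modular_field ::
  "('a, 'e::euclidean_space) chart set \<Rightarrow> ('a, 'e) chart set \<Rightarrow> 'e set \<Rightarrow>
    ('a \<Rightarrow> 'e bivec) \<Rightarrow> ('a \<Rightarrow> 'e form) \<Rightarrow> 'a \<Rightarrow> 'e" where
  "leaf_modular_field A F K P \<tau> p = (THE v. v \<in> leaf_tangent A F K p \<and>
     interior_prod v (\<tau> p) =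
       (\<lambda>us. - leaf_deriv A F K (\<lambda>q. contract (leaf_tangent A F K q) (P q) (\<tau> q)) p us))"


section \<open>Bigrading\<close>

text \<open>Here \<open>V\<close> and \<open>H\<close> are complementary distributions and \<open>\<gamma>\<close> is the projection onto \<open>V\<close>
  along \<open>H\<close>.\<close>
definition connection_form ::
  "('a \<Rightarrow> 'e::real_vector set) \<Rightarrow> ('a \<Rightarrow> 'e set) \<Rightarrow> 'a \<Rightarrow> 'e \<Rightarrow> 'e" where
  "connection_form H V p v = (THE w. w \<in> V p \<and> v - w \<in> H p)"

text \<open>The component in \<open>\<Lambda>\<^sup>a V\<^sup>0 \<otimes> \<Lambda>\<^sup>b H\<^sup>0\<close>: expand each argument as horizontal plus vertical part and
  keep the terms with exactly \<open>a\<close> horizontal and \<open>b\<close> vertical arguments.\<close>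
definition form_component ::
  "('a \<Rightarrow> 'e::real_vector \<Rightarrow> 'e) \<Rightarrow> nat \<Rightarrow> nat \<Rightarrow> ('a \<Rightarrow> 'e form) \<Rightarrow> 'a \<Rightarrow> 'e form" where
  "form_component \<gamma> a b \<omega> p = (\<lambda>us. if length us = a + b then
     \<Sum>I | I \<subseteq> {..<a + b} \<and> card I = a.
       \<omega> p (map (\<lambda>i. if i \<in> I then us ! i - \<gamma> p (us ! i) else \<gamma> p (us ! i)) [0..<a + b]) else 0)"

text \<open>The part of bidegree \<open>(1, 0)\<close> of the exterior differential: forms of bidegree \<open>(a, b)\<close> are mapped
  to the component of bidegree \<open>(a + 1, b)\<close> of their differential.\<close>
definition ext_deriv_10 ::
  "('a, 'e::euclidean_space) chart set \<Rightarrow> ('a \<Rightarrow> 'e \<Rightarrow> 'e) \<Rightarrow> ('a \<Rightarrow> 'e form) \<Rightarrow> 'a \<Rightarrow> 'e form" where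
  "ext_deriv_10 A \<gamma> \<omega> p = (\<lambda>us. \<Sum>a<length us. let b = length us - Suc a in
     form_component \<gamma> (Suc a) b (ext_deriv A (form_component \<gamma> a b \<omega>)) p us)"

definition vertical_ext ::
  "('a \<Rightarrow> 'e::euclidean_space set) \<Rightarrow> ('a \<Rightarrow> 'e set) \<Rightarrow> ('a \<Rightarrow> 'e form) \<Rightarrow> 'a \<Rightarrow> 'e form" where
  "vertical_ext H V \<tau> p = (THE \<omega>. \<omega> \<in> ann_forms (H p) (dim (V p)) \<and>
     (\<forall>us. set us \<subseteq> V p \<longrightarrow> \<omega> us = \<tau> p us))"

definition divergence_form ::
  "('a, 'e::euclidean_space) chart set \<Rightarrow> ('a \<Rightarrow> 'e set) \<Rightarrow> ('a \<Rightarrow> 'e set) \<Rightarrow> ('a \<Rightarrow> 'e form) \<Rightarrow>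
    'a \<Rightarrow> 'e form" where
  "divergence_form A H V \<tau> p = (THE \<theta>. \<theta> \<in> ann_forms (V p) 1 \<and>
     ext_deriv_10 A (connection_form H V) (vertical_ext H V \<tau>) p = wedge \<theta> (vertical_ext H V \<tau> p))"

definition vertical_part ::
  "('a \<Rightarrow> 'e \<Rightarrow> 'e) \<Rightarrow> ('a \<Rightarrow> 'e bivec) \<Rightarrow> 'a \<Rightarrow> 'e bivec" where
  "vertical_part \<gamma> B p = (\<lambda>\<alpha> \<beta>. B p (pull (\<gamma> p) \<alpha>) (pull (\<gamma> p) \<beta>))"

definition horizontal_part ::
  "('a \<Rightarrow> 'e::real_vector \<Rightarrow> 'e) \<Rightarrow> ('a \<Rightarrow> 'e bivec) \<Rightarrow> 'a \<Rightarrow> 'e bivec" where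
  "horizontal_part \<gamma> B p = (\<lambda>\<alpha> \<beta>. B p (pull (\<lambda>v. v - \<gamma> p v) \<alpha>) (pull (\<lambda>v. v - \<gamma> p v) \<beta>))"


section \<open>Coupling Poisson structures\<close>

definition coupling_normal ::
  "('a \<Rightarrow> 'e::real_vector set) \<Rightarrow> ('a \<Rightarrow> 'e bivec) \<Rightarrow> 'a \<Rightarrow> 'e set" where
  "coupling_normal V B p = sharp (B p) ` ann_forms (V p) 1"

definition coupling :: "('a \<Rightarrow> 'e::real_vector set) \<Rightarrow> ('a \<Rightarrow> 'e bivec) \<Rightarrow> bool" where
  "coupling V B \<longleftrightarrow> (\<forall>p. coupling_normal V B p \<inter> V p = {0} \<and>
     {h + v | h v. h \<in> coupling_normal V B p \<and> v \<in> V p} = UNIV)"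

definition coupling_form ::
  "('a \<Rightarrow> 'e::real_vector set) \<Rightarrow> ('a \<Rightarrow> 'e bivec) \<Rightarrow> 'a \<Rightarrow> 'e form" where
  "coupling_form V B p = (let H = coupling_normal V B;
       B\<^sub>H = horizontal_part (connection_form H V) B in
     (THE \<sigma>. \<sigma> \<in> ann_forms (V p) 2 \<and>
       (\<forall>h\<in>H p. interior_prod h \<sigma> = (\<lambda>us. - inv_into (ann_forms (V p) 1) (sharp (B\<^sub>H p)) h us))))"

end

theory Submission
  imports Defs
begin

text \<open>
  The claim is local at a point \<open>p\<close>. In a foliation chart, choose a basis of the model space whose first
  \<open>h = 2 l\<close> vectors span the horizontal space at \<open>p\<close> and whose remaining ones span the leaf directions.
  The modular vector field has the components
  \<open>Z\<^sub>m = \<Sum>\<^sub>j (\<partial>\<^sub>j \<pi>\<^sub>m\<^sub>j + \<pi>\<^sub>m\<^sub>j \<partial>\<^sub>j ln \<rho>)\<close>, where \<open>\<rho> = g t\<close>, \<open>g\<close> is the density of \<open>\<sigma>\<^sup>l\<close> and \<open>t\<close> that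
  of \<open>\<tau>\<close>. Since \<open>\<sigma>\<close> inverts the horizontal block of \<open>\<pi>\<close>, the logarithmic derivative of \<open>g\<close> is minus half the
  trace of \<open>\<pi>\<inverse> \<partial>\<pi>\<close>; the Jacobi identity contracted with \<open>\<sigma>\<close> shows that these terms cancel the
  horizontal part of the divergence of \<open>\<pi>\<close>, so that at \<open>p\<close>
  \<open>Z\<^sub>m = \<Sum>\<^sub>a \<partial>\<^sub>a \<pi>\<^sub>m\<^sub>a + \<Sum>\<^sub>q \<pi>\<^sub>m\<^sub>q \<partial>\<^sub>q ln t\<close> with \<open>a\<close> running over the leaf directions only.
  For \<open>m\<close> a leaf direction this is the coordinate formula of \<open>Z\<^sub>P\<^sup>\<tau>\<close>. For horizontal \<open>m\<close> it is
  \<open>\<theta> (X\<^sub>m)\<close> with \<open>X\<^sub>m\<close> the image of the \<open>m\<close>-th coordinate covector under the sharp map of \<open>\<Psi>\<close>, because the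
  leaf derivatives of \<open>\<pi>\<^sub>m\<^sub>a\<close> enter \<open>d \<tau>\<^sub>\<gamma>\<close> through the derivative of the connection.
\<close>


section \<open>Iterated Frechet differentiability: closure properties and the chain rule\<close>

section \<open>Calculus\<close>

text \<open>The horizontal distribution is in general not integrable, so no chart makes both
  summands coordinate subspaces. A foliation chart straightens the leaf directions near
  \<open>p\<close>, but the basis can be matched with the horizontal space at \<open>p\<close>
  alone: the mixed block of \<pi> vanishes at \<open>p\<close>, its derivatives, which carry the
  connection, need not. Identities are therefore differentiated near \<open>p\<close>, with frames
  that depend on the point, and only then evaluated. The structure equations of the geometric data
  are not derived; the Jacobi identity in coordinates, contracted once with the inverse of the
  horizontal block, is the only consequence of the Poisson condition that enters. The density of
  \<sigma>^l is differentiated through pullbacks, without Pfaffians or determinants. Fields given by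
  definite descriptions must be identified as well as computed: the modular field is pinned down by
  coordinates cut off with bump functions. As the model of the tangent space comes from a chart
  selected at each point separately, all differentiation passes through representatives in one fixed
  chart.\<close>

lemma differentiable_has_frechet_derivative:
  "f differentiable F \<Longrightarrow> (f has_derivative frechet_derivative f F) F"
  by (simp add: frechet_derivative_works)

lemma differentiable_transform_open:
  assumes "f differentiable (at x)" "open S" "x \<in> S" "\<And>y. y \<in> S \<Longrightarrow> f y = g y"
  shows "g differentiable (at x)"
  using assms has_derivative_transform_within_open unfolding differentiable_def by metis

lemma frechet_derivative_cong_open:
  assumes "open S" "x \<in> S" "\<And>y. y \<in> S \<Longrightarrow> f y = g y"
  shows "frechet_derivative f (at x) = frechet_derivative g (at x)"
proof -
  have "(f has_derivative D) (at x) \<longleftrightarrow> (g has_derivative D) (at x)" for D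
    using has_derivative_transform_within_open[of f D x UNIV S g]
      has_derivative_transform_within_open[of g D x UNIV S f] assms by auto
  then show ?thesis by (simp add: frechet_derivative_def)
qed

lemma frechet_derivative_eqI:
  assumes "(f has_derivative f') (at x)"
  shows "frechet_derivative f (at x) = f'"
  using frechet_derivative_at[OF assms] by simp

lemma diff_class_on_cong:
  assumes "open S" "\<And>y. y \<in> S \<Longrightarrow> f y = g y" "diff_class_on k S f"
  shows "diff_class_on k S g"
  using assms
proof (induction k arbitrary: f g)
  case 0
  then show ?case using continuous_on_cong[of S S f g] by simp
next
  case (Suc k)
  show ?case
    unfolding diff_class_on.simps
  proof (intro conjI ballI allI)
    show "g differentiable at x" if "x \<in> S" for x
      using differentiable_transform_open[of f x S g] Suc.prems that by simp
    show "diff_class_on k S (\<lambda>x. frechet_derivative g (at x) v)" for v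
      by (rule Suc.IH[of "\<lambda>x. frechet_derivative f (at x) v"])
        (use Suc.prems frechet_derivative_cong_open[of S _ f g] in auto)
  qed
qed

lemma diff_class_on_subset:
  assumes "T \<subseteq> S" "diff_class_on k S f"
  shows "diff_class_on k T f"
  using assms by (induction k arbitrary: f) (auto intro: continuous_on_subset)

lemma diff_class_on_differentiable_continuous:
  assumes "\<forall>x\<in>S. f differentiable (at x)"
  shows "continuous_on S f"
  using assms differentiable_imp_continuous_within by (blast intro: continuous_at_imp_continuous_on)

lemma diff_class_on_Suc:
  assumes "diff_class_on (Suc k) S f"
  shows "diff_class_on k S f"
  using assms
proof (induction k arbitrary: f)
  case 0
  then show ?case using diff_class_on_differentiable_continuous[of S f] by simp
next
  case (Suc k)
  then show ?case by auto
qed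

lemma diff_class_on_local:
  assumes "\<And>x. x \<in> S \<Longrightarrow> \<exists>N. open N \<and> x \<in> N \<and> diff_class_on k N f"
  shows "diff_class_on k S f"
  using assms
proof (induction k arbitrary: f)
  case 0
  then have "\<exists>N. open N \<and> x \<in> N \<and> continuous_on N f" if "x \<in> S" for x
    using that by simp
  then have "isCont f x" if "x \<in> S" for x
    using that by (meson continuous_on_eq_continuous_at)
  then show ?case by (simp add: continuous_at_imp_continuous_on)
next
  case (Suc k)
  then have *: "\<exists>N. open N \<and> x \<in> N \<and> (\<forall>y\<in>N. f differentiable at y) \<and>
     (\<forall>v. diff_class_on k N (\<lambda>y. frechet_derivative f (at y) v))" if "x \<in> S" for x
    using that by simp
  show ?case
    unfolding diff_class_on.simps
  proof (intro conjI ballI allI)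
    show "f differentiable at x" if "x \<in> S" for x
      using *[OF that] by blast
    show "diff_class_on k S (\<lambda>x. frechet_derivative f (at x) v)" for v
      by (rule Suc.IH) (use * in blast)
  qed
qed

lemma diff_class_on_const: "diff_class_on k S (\<lambda>x. c)"
  by (induction k arbitrary: c) auto

lemma frechet_derivative_bounded_linear:
  assumes "bounded_linear f"
  shows "frechet_derivative f (at x) = f"
  by (rule frechet_derivative_eqI) (rule bounded_linear_imp_has_derivative[OF assms])

lemma diff_class_on_bounded_linear:
  assumes "bounded_linear f"
  shows "diff_class_on k S f"
proof (cases k)
  case 0
  then show ?thesis using assms by (simp add: linear_continuous_on)
next
  case (Suc j)
  then show ?thesis
    using assms by (auto simp: frechet_derivative_bounded_linear diff_class_on_const
        intro: bounded_linear_imp_differentiable)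
qed

lemma diff_class_on_add:
  assumes "open S" "diff_class_on k S f" "diff_class_on k S g"
  shows "diff_class_on k S (\<lambda>x. f x + g x)"
  using assms
proof (induction k arbitrary: f g)
  case 0
  then show ?case by (simp add: continuous_on_add)
next
  case (Suc k)
  show ?case unfolding diff_class_on.simps
  proof (intro conjI ballI allI)
    show "(\<lambda>x. f x + g x) differentiable at x" if "x \<in> S" for x
      using Suc.prems that by (simp add: differentiable_add)
    show "diff_class_on k S (\<lambda>x. frechet_derivative (\<lambda>x. f x + g x) (at x) v)" for v
    proof (rule diff_class_on_cong)
      show "diff_class_on k S (\<lambda>x. frechet_derivative f (at x) v + frechet_derivative g (at x) v)"
        by (rule Suc.IH) (use Suc.prems in auto)
      show "frechet_derivative f (at y) v + frechet_derivative g (at y) v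
          = frechet_derivative (\<lambda>x. f x + g x) (at y) v" if "y \<in> S" for y
      proof -
        have "(f has_derivative frechet_derivative f (at y)) (at y)"
          "(g has_derivative frechet_derivative g (at y)) (at y)"
          using Suc.prems that by (simp_all add: differentiable_has_frechet_derivative)
        from frechet_derivative_eqI[OF has_derivative_add[OF this]] show ?thesis by simp
      qed
    qed (use Suc.prems in auto)
  qed
qed

lemma diff_class_on_scaleR:
  assumes "open S" "diff_class_on k S f" "diff_class_on k S g"
  shows "diff_class_on k S (\<lambda>x. f x *\<^sub>R g x)"
  using assms
proof (induction k arbitrary: f g)
  case 0
  then show ?case by (simp add: continuous_on_scaleR)
next
  case (Suc k)
  have fg: "diff_class_on k S f" "diff_class_on k S g"
    using Suc.prems diff_class_on_Suc by blast+
  show ?case unfolding diff_class_on.simps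
  proof (intro conjI ballI allI)
    show "(\<lambda>x. f x *\<^sub>R g x) differentiable at x" if "x \<in> S" for x
      using Suc.prems that by (simp add: differentiable_scaleR)
    show "diff_class_on k S (\<lambda>x. frechet_derivative (\<lambda>x. f x *\<^sub>R g x) (at x) v)" for v
    proof (rule diff_class_on_cong)
      show "diff_class_on k S (\<lambda>x. f x *\<^sub>R frechet_derivative g (at x) v + frechet_derivative f (at x) v *\<^sub>R g x)"
        by (intro diff_class_on_add Suc.IH fg) (use Suc.prems in auto)
      show "f y *\<^sub>R frechet_derivative g (at y) v + frechet_derivative f (at y) v *\<^sub>R g y
          = frechet_derivative (\<lambda>x. f x *\<^sub>R g x) (at y) v" if "y \<in> S" for y
      proof -
        have "(f has_derivative frechet_derivative f (at y)) (at y)"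
          "(g has_derivative frechet_derivative g (at y)) (at y)"
          using Suc.prems that by (simp_all add: differentiable_has_frechet_derivative)
        from frechet_derivative_eqI[OF has_derivative_scaleR[OF this]] show ?thesis by simp
      qed
    qed (use Suc.prems in auto)
  qed
qed

lemma diff_class_on_mult:
  fixes f g :: "_ \<Rightarrow> real"
  assumes "open S" "diff_class_on k S f" "diff_class_on k S g"
  shows "diff_class_on k S (\<lambda>x. f x * g x)"
  using diff_class_on_scaleR[OF assms] by simp

lemma diff_class_on_sum:
  assumes "open S" "finite I" "\<And>i. i \<in> I \<Longrightarrow> diff_class_on k S (f i)"
  shows "diff_class_on k S (\<lambda>x. \<Sum>i\<in>I. f i x)"
  using assms(2,3)
  by (induction I rule: finite_induct) (simp_all add: diff_class_on_const diff_class_on_add assms(1))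

lemma diff_class_on_linear_left:
  assumes "open S" "bounded_linear L" "diff_class_on k S f"
  shows "diff_class_on k S (\<lambda>x. L (f x))"
  using assms(3)
proof (induction k arbitrary: f)
  case 0
  then show ?case using assms(2) by (simp add: bounded_linear.continuous_on)
next
  case (Suc k)
  show ?case unfolding diff_class_on.simps
  proof (intro conjI ballI allI)
    have d: "((\<lambda>x. L (f x)) has_derivative (\<lambda>v. L (frechet_derivative f (at x) v))) (at x)"
      if "x \<in> S" for x
      by (rule bounded_linear.has_derivative[OF assms(2) differentiable_has_frechet_derivative])
        (use Suc.prems that in auto)
    show "(\<lambda>x. L (f x)) differentiable at x" if "x \<in> S" for x
      using d[OF that] by (rule differentiableI)
    show "diff_class_on k S (\<lambda>x. frechet_derivative (\<lambda>x. L (f x)) (at x) v)" for v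
    proof (rule diff_class_on_cong)
      show "diff_class_on k S (\<lambda>x. L (frechet_derivative f (at x) v))"
        by (rule Suc.IH) (use Suc.prems in auto)
    qed (simp_all add: frechet_derivative_eqI[OF d] assms(1))
  qed
qed

text \<open>\<open>diff_class_on\<close> differentiates along a constant vector, whereas the chain
  rule evaluates the derivative of \<open>g\<close> at the moving vector
  \<open>frechet_derivative f (at x) v\<close>. Expanding that vector in \<open>Basis\<close> leaves
  products of scalar functions with derivatives of \<open>g\<close> along constant vectors, to which
  the induction of \<open>diff_class_on_compose\<close> applies.\<close>

lemma frechet_derivative_compose_Basis:
  fixes f :: "_ \<Rightarrow> 'b::euclidean_space"
  assumes "f differentiable (at x)" "g differentiable (at (f x))"
  shows "frechet_derivative (\<lambda>x. g (f x)) (at x) v =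
    (\<Sum>b\<in>Basis. (frechet_derivative f (at x) v \<bullet> b) *\<^sub>R frechet_derivative g (at (f x)) b)"
proof -
  let ?D = "frechet_derivative f (at x) v"
  have "frechet_derivative (\<lambda>x. g (f x)) (at x) v = frechet_derivative g (at (f x)) ?D"
    using frechet_derivative_compose[OF assms] by (simp add: o_def fun_eq_iff)
  also have "\<dots> = frechet_derivative g (at (f x)) (\<Sum>b\<in>Basis. (?D \<bullet> b) *\<^sub>R b)"
    by (simp add: euclidean_representation)
  also have "\<dots> = (\<Sum>b\<in>Basis. (?D \<bullet> b) *\<^sub>R frechet_derivative g (at (f x)) b)"
    using linear_frechet_derivative[OF assms(2)] by (simp add: linear_sum linear_cmul)
  finally show ?thesis .
qed

lemma diff_class_on_compose:
  fixes f :: "_ \<Rightarrow> 'b::euclidean_space"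
  assumes "open S" "open T" "f ` S \<subseteq> T" "diff_class_on k S f" "diff_class_on k T g"
  shows "diff_class_on k S (\<lambda>x. g (f x))"
  using assms(4,5)
proof (induction k arbitrary: g)
  case 0
  then show ?case using assms(3) by (auto intro: continuous_on_compose2)
next
  case (Suc k)
  have f: "diff_class_on k S f" using Suc.prems diff_class_on_Suc by blast
  have d: "f differentiable (at x)" "g differentiable (at (f x))" if "x \<in> S" for x
    using Suc.prems that assms(3) by auto
  show ?case unfolding diff_class_on.simps
  proof (intro conjI ballI allI)
    show "(\<lambda>x. g (f x)) differentiable at x" if "x \<in> S" for x
      using differentiable_chain_at[OF d[OF that]] by (simp add: o_def)
    show "diff_class_on k S (\<lambda>x. frechet_derivative (\<lambda>x. g (f x)) (at x) v)" for v
    proof (rule diff_class_on_cong)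
      have "diff_class_on k S (\<lambda>x. frechet_derivative f (at x) v \<bullet> b)" for b
        by (rule diff_class_on_linear_left[OF assms(1) bounded_linear_inner_left]) (use Suc.prems in auto)
      moreover have "diff_class_on k S (\<lambda>x. frechet_derivative g (at (f x)) b)" for b
        by (rule Suc.IH[OF f]) (use Suc.prems in auto)
      ultimately show "diff_class_on k S (\<lambda>x. \<Sum>b\<in>Basis. (frechet_derivative f (at x) v \<bullet> b) *\<^sub>R
            frechet_derivative g (at (f x)) b)"
        by (intro diff_class_on_sum diff_class_on_scaleR assms(1) finite_Basis)
    qed (simp_all add: assms(1) frechet_derivative_compose_Basis[OF d])
  qed
qed


lemma smooth_on_compose:
  fixes f :: "_ \<Rightarrow> 'b::euclidean_space"
  assumes "open S" "open T" "f ` S \<subseteq> T" "smooth_on S f" "smooth_on T g"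
  shows "smooth_on S (\<lambda>x. g (f x))"
  unfolding smooth_on_def
proof
  show "diff_class_on k S (\<lambda>x. g (f x))" for k
    by (rule diff_class_on_compose[OF assms(1-3)]) (use assms(4,5) in \<open>auto simp: smooth_on_def\<close>)
qed

lemma smooth_on_cong:
  assumes "open S" "\<And>y. y \<in> S \<Longrightarrow> f y = g y" "smooth_on S f"
  shows "smooth_on S g"
  unfolding smooth_on_def
proof
  show "diff_class_on k S g" for k
    by (rule diff_class_on_cong[of S f]) (use assms in \<open>auto simp: smooth_on_def\<close>)
qed

lemma smooth_on_subset: "T \<subseteq> S \<Longrightarrow> smooth_on S f \<Longrightarrow> smooth_on T f"
  using diff_class_on_subset unfolding smooth_on_def by blast

lemma smooth_on_local:
  assumes "\<And>x. x \<in> S \<Longrightarrow> \<exists>N. open N \<and> x \<in> N \<and> smooth_on N f"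
  shows "smooth_on S f"
  using assms unfolding smooth_on_def by (intro allI diff_class_on_local) blast

lemma smooth_on_differentiable: "smooth_on S f \<Longrightarrow> x \<in> S \<Longrightarrow> f differentiable (at x)"
  unfolding smooth_on_def by (metis diff_class_on.simps(2))

lemma smooth_on_frechet_derivative:
  "smooth_on S f \<Longrightarrow> smooth_on S (\<lambda>x. frechet_derivative f (at x) v)"
  unfolding smooth_on_def by (metis diff_class_on.simps(2))

lemma smooth_on_continuous: "smooth_on S f \<Longrightarrow> continuous_on S f"
  unfolding smooth_on_def by (metis diff_class_on.simps(1))

lemma smooth_on_const: "smooth_on S (\<lambda>x. c)"
  by (simp add: smooth_on_def diff_class_on_const)

lemma smooth_on_linear_left:
  "open S \<Longrightarrow> bounded_linear L \<Longrightarrow> smooth_on S f \<Longrightarrow> smooth_on S (\<lambda>x. L (f x))"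
  by (simp add: smooth_on_def diff_class_on_linear_left)

lemma smooth_on_bounded_linear: "bounded_linear L \<Longrightarrow> smooth_on S L"
  by (simp add: smooth_on_def diff_class_on_bounded_linear)

lemma smooth_on_mult:
  fixes f g :: "_ \<Rightarrow> real"
  shows "open S \<Longrightarrow> smooth_on S f \<Longrightarrow> smooth_on S g \<Longrightarrow> smooth_on S (\<lambda>x. f x * g x)"
  by (simp add: smooth_on_def diff_class_on_mult)

lemma smooth_on_add:
  "open S \<Longrightarrow> smooth_on S f \<Longrightarrow> smooth_on S g \<Longrightarrow> smooth_on S (\<lambda>x. f x + g x)"
  by (simp add: smooth_on_def diff_class_on_add)

section \<open>Schwarz's theorem through second differences\<close>

subsection \<open>Symmetry of second derivatives\<close>

lemma has_derivative_along_line: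
  assumes "(F has_derivative F') (at (a + s *\<^sub>R v))"
  shows "((\<lambda>s. F (a + s *\<^sub>R v)) has_derivative (\<lambda>r. F' (r *\<^sub>R v))) (at s)"
proof -
  have "((\<lambda>s. a + s *\<^sub>R v) has_derivative (\<lambda>r. r *\<^sub>R v)) (at s)"
    by (auto intro!: derivative_eq_intros)
  from has_derivative_compose[OF this assms] show ?thesis .
qed

text \<open>The mean value theorem is applied twice: along \<open>u\<close> to the difference of
  \<open>f\<close> between two parallel edges of a parallelogram, then along \<open>v\<close> to the
  derivative of \<open>f\<close> in direction \<open>u\<close>. The second difference is symmetric
  in \<open>u\<close> and \<open>v\<close>, which is what makes it useful for mixed
  derivatives.\<close>

lemma second_difference_mvt:
  fixes f :: "'a::euclidean_space \<Rightarrow> real"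
  assumes S: "convex S" and h: "h > 0"
    and in_S: "x \<in> S" "x + h *\<^sub>R u \<in> S" "x + h *\<^sub>R v \<in> S" "x + h *\<^sub>R u + h *\<^sub>R v \<in> S"
    and df: "\<And>y. y \<in> S \<Longrightarrow> f differentiable (at y)"
    and ddf: "\<And>y. y \<in> S \<Longrightarrow> (\<lambda>y. frechet_derivative f (at y) u) differentiable (at y)"
  shows "\<exists>y\<in>S. f (x + h *\<^sub>R u + h *\<^sub>R v) - f (x + h *\<^sub>R u) - f (x + h *\<^sub>R v) + f x =
    h\<^sup>2 * frechet_derivative (\<lambda>y. frechet_derivative f (at y) u) (at y) v"
proof -
  \<comment> \<open>Every point of the parallelogram is a convex combination of points on two
    opposite edges, and these are convex combinations of the corners.\<close>
  have seg: "x + s *\<^sub>R u + t *\<^sub>R v \<in> S" if "0 \<le> s" "s \<le> h" "0 \<le> t" "t \<le> h" for s t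
  proof -
    let ?s = "s / h" and ?t = "t / h"
    have 1: "(1 - ?s) *\<^sub>R x + ?s *\<^sub>R (x + h *\<^sub>R u) \<in> S"
      by (rule convexD[OF S]) (use in_S that h in auto)
    have 2: "(1 - ?s) *\<^sub>R (x + h *\<^sub>R v) + ?s *\<^sub>R (x + h *\<^sub>R u + h *\<^sub>R v) \<in> S"
      by (rule convexD[OF S]) (use in_S that h in auto)
    have 3: "(1 - ?t) *\<^sub>R ((1 - ?s) *\<^sub>R x + ?s *\<^sub>R (x + h *\<^sub>R u)) + ?t *\<^sub>R ((1 - ?s) *\<^sub>R (x + h *\<^sub>R v) + ?s *\<^sub>R (x + h *\<^sub>R u + h *\<^sub>R v)) \<in> S"
      by (rule convexD[OF S 1 2]) (use that h in auto)
    have e1: "(1 - ?s) *\<^sub>R x + ?s *\<^sub>R (x + h *\<^sub>R u) = x + s *\<^sub>R u"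
      using h by (simp add: algebra_simps)
    have e2: "(1 - ?s) *\<^sub>R (x + h *\<^sub>R v) + ?s *\<^sub>R (x + h *\<^sub>R u + h *\<^sub>R v) = x + s *\<^sub>R u + h *\<^sub>R v"
      using h by (simp add: algebra_simps)
    have "(1 - ?t) *\<^sub>R (x + s *\<^sub>R u) + ?t *\<^sub>R (x + s *\<^sub>R u + h *\<^sub>R v) = x + s *\<^sub>R u + t *\<^sub>R v"
      using h by (simp add: algebra_simps)
    with 3 show ?thesis unfolding e1 e2 by simp
  qed
  let ?D = "\<lambda>y. frechet_derivative f (at y)"
  have f': "(f has_derivative ?D y) (at y)" if "y \<in> S" for y
    using df[OF that] by (rule differentiable_has_frechet_derivative)
  define g where "g s = f (x + s *\<^sub>R u + h *\<^sub>R v) - f (x + s *\<^sub>R u)" for s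
  have g': "(g has_derivative (\<lambda>r. r * (?D (x + s *\<^sub>R u + h *\<^sub>R v) u - ?D (x + s *\<^sub>R u) u))) (at s)"
    if "0 \<le> s" "s \<le> h" for s
  proof -
    have m: "x + s *\<^sub>R u + h *\<^sub>R v \<in> S" "x + s *\<^sub>R u \<in> S"
      using seg[of s h] seg[of s 0] that h by auto
    have "((\<lambda>s. f (x + s *\<^sub>R u + h *\<^sub>R v)) has_derivative (\<lambda>r. ?D (x + s *\<^sub>R u + h *\<^sub>R v) (r *\<^sub>R u))) (at s)"
      using has_derivative_along_line[of f _ "x + h *\<^sub>R v" s u] f'[OF m(1)] by (simp add: algebra_simps)
    moreover have "((\<lambda>s. f (x + s *\<^sub>R u)) has_derivative (\<lambda>r. ?D (x + s *\<^sub>R u) (r *\<^sub>R u))) (at s)"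
      by (rule has_derivative_along_line[OF f'[OF m(2)]])
    ultimately have "(g has_derivative (\<lambda>r. ?D (x + s *\<^sub>R u + h *\<^sub>R v) (r *\<^sub>R u) - ?D (x + s *\<^sub>R u) (r *\<^sub>R u))) (at s)"
      unfolding g_def by (rule has_derivative_diff)
    then show ?thesis
      using linear_frechet_derivative[OF df[OF m(1)]] linear_frechet_derivative[OF df[OF m(2)]]
      by (simp add: linear_cmul algebra_simps)
  qed
  obtain s where s: "0 < s" "s < h" "g h - g 0 = h * (?D (x + s *\<^sub>R u + h *\<^sub>R v) u - ?D (x + s *\<^sub>R u) u)"
  proof -
    have "continuous_on {0..h} g"
      by (intro continuous_at_imp_continuous_on ballI) (use has_derivative_continuous[OF g'] in auto)
    then obtain s where "s \<in> {0<..<h}" "g h - g 0 = (h - 0) * (?D (x + s *\<^sub>R u + h *\<^sub>R v) u - ?D (x + s *\<^sub>R u) u)"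
      using mvt[of 0 h g "\<lambda>s r. r * (?D (x + s *\<^sub>R u + h *\<^sub>R v) u - ?D (x + s *\<^sub>R u) u)"] h g' by auto
    then show ?thesis by (intro that[of s]) auto
  qed
  define k where "k t = ?D (x + s *\<^sub>R u + t *\<^sub>R v) u" for t
  let ?E = "\<lambda>y. frechet_derivative (\<lambda>y. ?D y u) (at y)"
  have k': "(k has_derivative (\<lambda>r. r * ?E (x + s *\<^sub>R u + t *\<^sub>R v) v)) (at t)" if "0 \<le> t" "t \<le> h" for t
  proof -
    have m: "x + s *\<^sub>R u + t *\<^sub>R v \<in> S" using seg s that by simp
    have "(k has_derivative (\<lambda>r. ?E (x + s *\<^sub>R u + t *\<^sub>R v) (r *\<^sub>R v))) (at t)"
      unfolding k_def
      by (rule has_derivative_along_line[OF differentiable_has_frechet_derivative[OF ddf[OF m]]])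
    then show ?thesis
      using linear_frechet_derivative[OF ddf[OF m]] by (simp add: linear_cmul)
  qed
  obtain t where t: "0 < t" "t < h" "k h - k 0 = h * ?E (x + s *\<^sub>R u + t *\<^sub>R v) v"
  proof -
    have "continuous_on {0..h} k"
      by (intro continuous_at_imp_continuous_on ballI) (use has_derivative_continuous[OF k'] in auto)
    then obtain t where "t \<in> {0<..<h}" "k h - k 0 = (h - 0) * ?E (x + s *\<^sub>R u + t *\<^sub>R v) v"
      using mvt[of 0 h k "\<lambda>t r. r * ?E (x + s *\<^sub>R u + t *\<^sub>R v) v"] h k' by auto
    then show ?thesis by (intro that[of t]) auto
  qed
  have "f (x + h *\<^sub>R u + h *\<^sub>R v) - f (x + h *\<^sub>R u) - f (x + h *\<^sub>R v) + f x = g h - g 0"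
    by (simp add: g_def)
  also have "\<dots> = h * (k h - k 0)" using s by (simp add: k_def)
  also have "\<dots> = h\<^sup>2 * ?E (x + s *\<^sub>R u + t *\<^sub>R v) v" using t by (simp add: power2_eq_square)
  moreover have "x + s *\<^sub>R u + t *\<^sub>R v \<in> S" using seg s t by simp
  ultimately show ?thesis by auto
qed

text \<open>The symmetry of the second difference shows that \<open>E u v\<close> and
  \<open>E v u\<close> take a common value, at two points \<open>y\<close> and \<open>z\<close> of
  an arbitrarily small ball; continuity at \<open>x\<close> then excludes that they differ by
  \<open>2 * e\<close> there.\<close>

lemma second_derivative_symmetric_real:
  fixes f :: "'a::euclidean_space \<Rightarrow> real"
  assumes S: "open S" "x \<in> S" and f: "smooth_on S f"
  shows "frechet_derivative (\<lambda>y. frechet_derivative f (at y) u) (at x) v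
       = frechet_derivative (\<lambda>y. frechet_derivative f (at y) v) (at x) u"
proof (rule ccontr)
  define E where "E u v y = frechet_derivative (\<lambda>y. frechet_derivative f (at y) u) (at y) v" for u v y
  assume "\<not> ?thesis"
  then have ne: "E u v x \<noteq> E v u x" by (simp add: E_def)
  define e where "e = \<bar>E u v x - E v u x\<bar> / 2"
  have e: "e > 0" using ne by (simp add: e_def)
  have sm: "smooth_on S (E u v)" for u v
    unfolding E_def by (intro smooth_on_frechet_derivative f)
  have cont: "isCont (E u v) x" for u v
    using smooth_on_continuous[OF sm] S by (simp add: continuous_on_eq_continuous_at)
  obtain r1 where r1: "r1 > 0" "\<And>y. dist y x < r1 \<Longrightarrow> \<bar>E u v y - E u v x\<bar> < e"
    using cont[of u v] e unfolding continuous_at_eps_delta by (metis dist_real_def)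
  obtain r2 where r2: "r2 > 0" "\<And>y. dist y x < r2 \<Longrightarrow> \<bar>E v u y - E v u x\<bar> < e"
    using cont[of v u] e unfolding continuous_at_eps_delta by (metis dist_real_def)
  obtain r3 where r3: "r3 > 0" "ball x r3 \<subseteq> S" using S open_contains_ball by blast
  define r where "r = min r1 (min r2 r3)"
  have r: "r > 0" using r1 r2 r3 by (simp add: r_def)
  \<comment> \<open>The summand 1 keeps the denominator positive when \<open>u\<close> and
    \<open>v\<close> are both 0; the factor 2 makes the bound by \<open>r\<close> strict.\<close>
  define h where "h = r / (2 * (norm u + norm v + 1))"
  have h: "h > 0" using r by (simp add: h_def add_nonneg_pos)
  have hb: "h * (norm u + norm v) < r"
  proof -
    have "h * (norm u + norm v) \<le> h * (norm u + norm v + 1)" using h by simp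
    also have "\<dots> = r / 2"
    proof -
      have "norm u + norm v + 1 > 0" by (simp add: add_nonneg_pos)
      then show ?thesis unfolding h_def by (simp add: field_simps)
    qed
    finally show ?thesis using r by simp
  qed
  have hu: "norm (h *\<^sub>R u) + norm (h *\<^sub>R v) < r" using h hb by (simp add: distrib_left)
  have hin: "x \<in> ball x r" "x + h *\<^sub>R u \<in> ball x r" "x + h *\<^sub>R v \<in> ball x r"
    "x + h *\<^sub>R u + h *\<^sub>R v \<in> ball x r" "x + h *\<^sub>R v + h *\<^sub>R u \<in> ball x r"
  proof -
    have b: "x + w \<in> ball x r" if "norm w < r" for w
      using that by (simp add: dist_norm)
    have "norm (h *\<^sub>R u + h *\<^sub>R v) < r" "norm (h *\<^sub>R u) < r" "norm (h *\<^sub>R v) < r"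
      using hu norm_triangle_ineq[of "h *\<^sub>R u" "h *\<^sub>R v"]
        norm_ge_zero[of "h *\<^sub>R u"] norm_ge_zero[of "h *\<^sub>R v"] by linarith+
    note b[OF this(1)] b[OF this(2)] b[OF this(3)]
    then show "x \<in> ball x r" "x + h *\<^sub>R u \<in> ball x r" "x + h *\<^sub>R v \<in> ball x r"
      "x + h *\<^sub>R u + h *\<^sub>R v \<in> ball x r" "x + h *\<^sub>R v + h *\<^sub>R u \<in> ball x r"
      using r by (auto simp: algebra_simps)
  qed
  have sub: "ball x r \<subseteq> S" using r3 by (auto simp: r_def)
  have d: "f differentiable (at y)" "(\<lambda>y. frechet_derivative f (at y) w) differentiable (at y)"
    if "y \<in> ball x r" for y w
    using that sub f smooth_on_differentiable smooth_on_frechet_derivative by blast+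
  obtain y where y: "y \<in> ball x r" "f (x + h *\<^sub>R u + h *\<^sub>R v) - f (x + h *\<^sub>R u) - f (x + h *\<^sub>R v) + f x = h\<^sup>2 * E u v y"
    using second_difference_mvt[of "ball x r" h x u v f] h hin d unfolding E_def by auto
  obtain z where z: "z \<in> ball x r" "f (x + h *\<^sub>R v + h *\<^sub>R u) - f (x + h *\<^sub>R v) - f (x + h *\<^sub>R u) + f x = h\<^sup>2 * E v u z"
    using second_difference_mvt[of "ball x r" h x v u f] h hin d unfolding E_def by auto
  have "x + h *\<^sub>R v + h *\<^sub>R u = x + h *\<^sub>R u + h *\<^sub>R v" by simp
  then have "h\<^sup>2 * E u v y = h\<^sup>2 * E v u z" using y(2) z(2) by (smt (verit))
  then have eq: "E u v y = E v u z" using h by simp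
  have "\<bar>E u v y - E u v x\<bar> < e" "\<bar>E v u z - E v u x\<bar> < e"
    using r1(2)[of y] r2(2)[of z] y(1) z(1) by (auto simp: r_def dist_commute)
  moreover have "2 * e = \<bar>E u v x - E v u x\<bar>" by (simp add: e_def)
  ultimately show False unfolding eq by (smt (verit))
qed

lemma second_derivative_symmetric:
  fixes f :: "'a::euclidean_space \<Rightarrow> 'b::euclidean_space"
  assumes S: "open S" "x \<in> S" and f: "smooth_on S f"
  shows "frechet_derivative (\<lambda>y. frechet_derivative f (at y) u) (at x) v
       = frechet_derivative (\<lambda>y. frechet_derivative f (at y) v) (at x) u"
proof (rule euclidean_eqI)
  fix b :: 'b assume b: "b \<in> Basis"
  have inner: "frechet_derivative (\<lambda>y. g y \<bullet> b) (at y) w = frechet_derivative g (at y) w \<bullet> b"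
    if "g differentiable (at y)" for g :: "'a \<Rightarrow> 'b" and y w
    using frechet_derivative_eqI[OF bounded_linear.has_derivative[OF bounded_linear_inner_left
        differentiable_has_frechet_derivative[OF that]]] by simp
  have 1: "frechet_derivative (\<lambda>y. frechet_derivative f (at y) u) (at x) v \<bullet> b
    = frechet_derivative (\<lambda>y. frechet_derivative (\<lambda>y. f y \<bullet> b) (at y) u) (at x) v" for u v
  proof -
    have "frechet_derivative f (at y) u \<bullet> b = frechet_derivative (\<lambda>y. f y \<bullet> b) (at y) u" if "y \<in> S" for y
      using inner[OF smooth_on_differentiable[OF f that]] by simp
    then have "frechet_derivative (\<lambda>y. frechet_derivative f (at y) u \<bullet> b) (at x) =
        frechet_derivative (\<lambda>y. frechet_derivative (\<lambda>y. f y \<bullet> b) (at y) u) (at x)"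
      by (rule frechet_derivative_cong_open[OF S])
    moreover have "(\<lambda>y. frechet_derivative f (at y) u) differentiable at x"
      by (rule smooth_on_differentiable[OF smooth_on_frechet_derivative[OF f] S(2)])
    ultimately show ?thesis by (metis inner)
  qed
  have sb: "smooth_on S (\<lambda>y. f y \<bullet> b)"
    by (rule smooth_on_linear_left[OF S(1) bounded_linear_inner_left f])
  show "frechet_derivative (\<lambda>y. frechet_derivative f (at y) u) (at x) v \<bullet> b
       = frechet_derivative (\<lambda>y. frechet_derivative f (at y) v) (at x) u \<bullet> b"
    unfolding 1 by (rule second_derivative_symmetric_real[OF S sb])
qed

section \<open>Smooth cutoff functions\<close>

subsection \<open>Bump functions\<close>

text \<open>The derivative of the reciprocal is a product of the reciprocal itself with the
  derivative of \<open>f\<close>, so the induction hypothesis for the same \<open>f\<close> is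
  enough.\<close>

lemma diff_class_on_inverse:
  fixes f :: "_ \<Rightarrow> real"
  assumes "open S" "diff_class_on k S f" "\<And>x. x \<in> S \<Longrightarrow> f x \<noteq> 0"
  shows "diff_class_on k S (\<lambda>x. inverse (f x))"
  using assms(2)
proof (induction k)
  case 0
  then show ?case using assms(3) by (simp add: continuous_on_inverse)
next
  case (Suc k)
  have IH: "diff_class_on k S (\<lambda>x. inverse (f x))"
    using Suc diff_class_on_Suc by blast
  show ?case unfolding diff_class_on.simps
  proof (intro conjI ballI allI)
    have d: "((\<lambda>x. inverse (f x)) has_derivative
        (\<lambda>v. - (inverse (f x) * frechet_derivative f (at x) v * inverse (f x)))) (at x)"
      if "x \<in> S" for x
      by (rule Deriv.has_derivative_inverse[of f, OF assms(3)[OF that]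
            differentiable_has_frechet_derivative]) (use Suc.prems that in auto)
    show "(\<lambda>x. inverse (f x)) differentiable at x" if "x \<in> S" for x
      using d[OF that] by (rule differentiableI)
    show "diff_class_on k S (\<lambda>x. frechet_derivative (\<lambda>x. inverse (f x)) (at x) v)" for v
    proof (rule diff_class_on_cong)
      show "diff_class_on k S (\<lambda>x. (- 1) * (inverse (f x) * frechet_derivative f (at x) v * inverse (f x)))"
        by (intro diff_class_on_mult diff_class_on_const IH assms(1)) (use Suc.prems in auto)
    qed (simp_all add: frechet_derivative_eqI[OF d] assms(1))
  qed
qed

text \<open>The exponent \<open>m\<close> is carried along so that the family is closed under
  differentiation: the derivative of a member is a combination of the members with exponents
  \<open>m + 1\<close> and \<open>m + 2\<close>.\<close>

definition flat_exp :: "nat \<Rightarrow> real \<Rightarrow> real" where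
  "flat_exp m t = (if t > 0 then inverse t ^ m * exp (- inverse t) else 0)"

lemma flat_exp_tendsto_0: "(flat_exp m \<longlongrightarrow> 0) (at 0)"
proof -
  have "((\<lambda>t. inverse t ^ m * exp (- inverse t)) \<longlongrightarrow> 0) (at_right (0::real))"
  proof -
    have "((\<lambda>s::real. s ^ m / exp s) \<longlongrightarrow> 0) at_top" by (rule tendsto_power_div_exp_0)
    then have "((\<lambda>t::real. inverse t ^ m / exp (inverse t)) \<longlongrightarrow> 0) (at_right 0)"
      using filterlim_inverse_at_top_right filterlim_compose by fastforce
    then show ?thesis by (simp add: exp_minus divide_inverse)
  qed
  then have "(flat_exp m \<longlongrightarrow> 0) (at_right 0)"
    by (rule Lim_transform_eventually)
      (auto simp: flat_exp_def eventually_at_right_field intro: exI[of _ 1])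
  moreover have "(flat_exp m \<longlongrightarrow> 0) (at_left 0)"
    by (rule Lim_transform_eventually[of "\<lambda>_. 0"])
      (auto simp: flat_exp_def eventually_at_left_field intro: exI[of _ "-1"])
  ultimately show ?thesis by (simp add: filterlim_split_at)
qed

lemma flat_exp_has_derivative:
  "(flat_exp m has_real_derivative (flat_exp (m + 2) t - real m * flat_exp (m + 1) t)) (at t)"
proof (cases t "0::real" rule: linorder_cases)
  case less
  have "((\<lambda>_. 0) has_real_derivative 0) (at t)" by simp
  then have "(flat_exp m has_real_derivative 0) (at t)"
    by (rule DERIV_cong_ev[THEN iffD1, OF refl _ refl, rotated])
      (use less in \<open>auto simp: flat_exp_def eventually_nhds intro!: exI[of _ "{..<0}"]\<close>)
  then show ?thesis using less by (simp add: flat_exp_def)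
next
  case equal
  \<comment> \<open>At 0 the difference quotient of \<open>flat_exp m\<close> is
    \<open>flat_exp (Suc m)\<close>, which tends to 0.\<close>
  have "((\<lambda>h. (flat_exp m (0 + h) - flat_exp m 0) / h) \<longlongrightarrow> 0) (at 0)"
    by (rule Lim_transform_eventually[OF flat_exp_tendsto_0[of "Suc m"]])
      (auto simp: flat_exp_def eventually_at divide_inverse intro!: exI[of _ 1])
  then show ?thesis using equal by (simp add: DERIV_def flat_exp_def)
next
  case greater
  have "((\<lambda>t. inverse t ^ m * exp (- inverse t)) has_real_derivative
      (flat_exp (m + 2) t - real m * flat_exp (m + 1) t)) (at t)"
  proof (cases m)
    case 0
    then show ?thesis using greater
      by (auto intro!: derivative_eq_intros simp: flat_exp_def power2_eq_square)
  next
    case (Suc j)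
    have "inverse t ^ j * inverse t = inverse t * inverse t ^ j" by simp
    moreover have "real j * (inverse t * inverse t ^ (j - Suc 0)) = real j * inverse t ^ j"
      by (cases j) auto
    ultimately show ?thesis using greater Suc
      by (auto intro!: derivative_eq_intros simp: flat_exp_def power2_eq_square algebra_simps)
  qed
  then show ?thesis
    by (rule DERIV_cong_ev[THEN iffD1, OF refl _ refl, rotated])
      (use greater in \<open>auto simp: flat_exp_def eventually_nhds intro!: exI[of _ "{0<..}"]\<close>)
qed

lemma smooth_on_flat_exp: "smooth_on UNIV (flat_exp m)"
proof -
  have "diff_class_on k UNIV (flat_exp m)" for k m
  proof (induction k arbitrary: m)
    case 0
    show ?case
      using flat_exp_has_derivative by (auto intro!: DERIV_isCont continuous_at_imp_continuous_on)
  next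
    case (Suc k)
    show ?case unfolding diff_class_on.simps
    proof (intro conjI ballI allI)
      have d: "(flat_exp m has_derivative
          (\<lambda>v. (flat_exp (m + 2) t - real m * flat_exp (m + 1) t) * v)) (at t)" for t
        using flat_exp_has_derivative unfolding has_field_derivative_def by blast
      show "flat_exp m differentiable at t" for t
        using d by (rule differentiableI)
      show "diff_class_on k UNIV (\<lambda>t. frechet_derivative (flat_exp m) (at t) v)" for v
      proof (rule diff_class_on_cong)
        show "diff_class_on k UNIV (\<lambda>t. flat_exp (m + 2) t * v + flat_exp (m + 1) t * (- real m * v))"
          by (intro diff_class_on_add diff_class_on_mult diff_class_on_const Suc.IH open_UNIV)
      qed (simp_all add: frechet_derivative_eqI[OF d] algebra_simps)
    qed
  qed
  then show ?thesis by (simp add: smooth_on_def)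
qed

text \<open>The quotient \<beta> is 1 where the second term of its denominator vanishes, in
  particular where \<open>q\<close> exceeds \<open>c\<close>, and 0 where \<open>q\<close> is at
  most 0, that is outside the ball. The denominator is positive because \<open>c > 0\<close> leaves
  \<open>q x > 0\<close> or \<open>c - q x > 0\<close>.\<close>

lemma smooth_bump_exists:
  fixes x0 :: "'e::euclidean_space"
  assumes "R > 0"
  obtains \<beta> :: "'e \<Rightarrow> real" and N where "smooth_on UNIV \<beta>" "open N" "x0 \<in> N"
    "\<And>x. x \<in> N \<Longrightarrow> \<beta> x = 1" "\<And>x. x \<notin> ball x0 R \<Longrightarrow> \<beta> x = 0"
proof -
  define q :: "'e \<Rightarrow> real" where "q x = R\<^sup>2 - (x - x0) \<bullet> (x - x0)" for x
  define c where "c = R\<^sup>2 / 2"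
  have c: "c > 0" using assms by (simp add: c_def)
  define \<beta> where "\<beta> x = flat_exp 0 (q x) * inverse (flat_exp 0 (q x) + flat_exp 0 (c - q x))" for x
  have sd: "smooth_on UNIV (\<lambda>x. (x - x0) \<bullet> b)" for b :: 'e
  proof -
    have "smooth_on UNIV (\<lambda>x. x \<bullet> b + - (x0 \<bullet> b))"
      by (intro smooth_on_add smooth_on_const smooth_on_bounded_linear bounded_linear_inner_left open_UNIV)
    then show ?thesis by (simp add: inner_diff_left)
  qed
  have sq: "smooth_on UNIV q"
  proof -
    have "smooth_on UNIV (\<lambda>x. R\<^sup>2 + (- 1) * (\<Sum>b\<in>Basis. ((x - x0) \<bullet> b) * ((x - x0) \<bullet> b)))"
      using sd unfolding smooth_on_def
      by (intro allI diff_class_on_add diff_class_on_mult diff_class_on_sum diff_class_on_const) auto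
    moreover have "q = (\<lambda>x. R\<^sup>2 + (- 1) * (\<Sum>b\<in>Basis. ((x - x0) \<bullet> b) * ((x - x0) \<bullet> b)))"
      unfolding q_def by (rule ext, subst euclidean_inner[of "_ - x0" "_ - x0"]) simp
    ultimately show ?thesis by simp
  qed
  have s1: "smooth_on UNIV (\<lambda>x. flat_exp 0 (q x))"
    by (rule smooth_on_compose[OF _ _ _ sq smooth_on_flat_exp]) auto
  have s2: "smooth_on UNIV (\<lambda>x. flat_exp 0 (c - q x))"
  proof (rule smooth_on_compose[of _ UNIV "\<lambda>x. c - q x"])
    have "smooth_on UNIV (\<lambda>x. c + (- 1) * q x)"
      by (intro smooth_on_add smooth_on_mult smooth_on_const sq open_UNIV)
    then show "smooth_on UNIV (\<lambda>x. c - q x)" by simp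
  qed (auto intro: smooth_on_flat_exp)
  have pos: "flat_exp 0 (q x) + flat_exp 0 (c - q x) \<noteq> 0" for x
  proof -
    have "flat_exp 0 (q x) \<ge> 0" "flat_exp 0 (c - q x) \<ge> 0" by (auto simp: flat_exp_def)
    moreover have "q x > 0 \<or> c - q x > 0" using c by linarith
    then have "flat_exp 0 (q x) > 0 \<or> flat_exp 0 (c - q x) > 0" by (auto simp: flat_exp_def)
    ultimately show ?thesis by linarith
  qed
  have "smooth_on UNIV \<beta>"
    using s1 s2 pos unfolding \<beta>_def smooth_on_def
    by (intro allI diff_class_on_mult diff_class_on_inverse diff_class_on_add) auto
  moreover have "open {x. q x > c}"
    by (rule open_Collect_less) (use smooth_on_continuous[OF sq] in auto)
  moreover have "x0 \<in> {x. q x > c}" using assms by (simp add: q_def c_def)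
  moreover have "\<beta> x = 1" if "x \<in> {x. q x > c}" for x
  proof -
    have "flat_exp 0 (c - q x) = 0" using that by (simp add: flat_exp_def)
    then show ?thesis using pos[of x] by (simp add: \<beta>_def)
  qed
  moreover have "\<beta> x = 0" if "x \<notin> ball x0 R" for x
  proof -
    have "R \<le> norm (x - x0)" using that by (simp add: dist_norm norm_minus_commute)
    then have "R\<^sup>2 \<le> (norm (x - x0))\<^sup>2" using assms by (intro power_mono) auto
    then have "q x \<le> 0" by (simp add: q_def power2_norm_eq_inner)
    then show ?thesis by (simp add: \<beta>_def flat_exp_def)
  qed
  ultimately show ?thesis using that by blast
qed


section \<open>Alternating forms as functions on lists\<close>

section \<open>Alternating forms\<close>

lemma forms_eq_0: "\<omega> \<in> forms W k \<Longrightarrow> length us \<noteq> k \<or> \<not> set us \<subseteq> W \<Longrightarrow> \<omega> us = 0"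
  by (simp add: forms_def)

lemma forms_not_distinct: "\<omega> \<in> forms W k \<Longrightarrow> \<not> distinct us \<Longrightarrow> \<omega> us = 0"
  by (cases "length us = k") (auto simp: forms_def)

lemma forms_lin:
  assumes "\<omega> \<in> forms W k" "subspace W" "u \<in> W" "v \<in> W"
  shows "\<omega> (xs @ (a *\<^sub>R u + b *\<^sub>R v) # ys) = a * \<omega> (xs @ u # ys) + b * \<omega> (xs @ v # ys)"
proof (cases "length xs + Suc (length ys) = k \<and> set xs \<subseteq> W \<and> set ys \<subseteq> W")
  case True
  have "\<omega> (us[i := a *\<^sub>R u + b *\<^sub>R v]) = a * \<omega> (us[i := u]) + b * \<omega> (us[i := v])"
    if "length us = k" "set us \<subseteq> W" "i < k" for us i
    using assms that by (simp add: forms_def)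
  from this[of "xs @ u # ys" "length xs"] show ?thesis using True assms by simp
next
  case False
  then show ?thesis using assms(1) forms_eq_0[OF assms(1)] by auto
qed

lemma forms_scale:
  assumes "\<omega> \<in> forms W k" "subspace W" "u \<in> W"
  shows "\<omega> (xs @ (a *\<^sub>R u) # ys) = a * \<omega> (xs @ u # ys)"
  using forms_lin[OF assms assms(3), of xs a 0] by simp

lemma forms_add:
  assumes "\<omega> \<in> forms W k" "subspace W" "u \<in> W" "v \<in> W"
  shows "\<omega> (xs @ (u + v) # ys) = \<omega> (xs @ u # ys) + \<omega> (xs @ v # ys)"
  using forms_lin[OF assms, of xs 1 1] by simp

lemma forms_zero_arg:
  assumes "\<omega> \<in> forms W k" "subspace W"
  shows "\<omega> (xs @ 0 # ys) = 0"
  using forms_scale[OF assms subspace_0[OF assms(2)], of xs 0] by simp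

lemma forms_sum:
  assumes "\<omega> \<in> forms W k" "subspace W" "\<And>i. i \<in> I \<Longrightarrow> u i \<in> W"
  shows "\<omega> (xs @ (\<Sum>i\<in>I. c i *\<^sub>R u i) # ys) = (\<Sum>i\<in>I. c i * \<omega> (xs @ u i # ys))"
  using assms(3)
proof (induction I rule: infinite_finite_induct)
  case (insert i I)
  have "\<omega> (xs @ (c i *\<^sub>R u i + (\<Sum>i\<in>I. c i *\<^sub>R u i)) # ys)
      = \<omega> (xs @ (c i *\<^sub>R u i) # ys) + \<omega> (xs @ (\<Sum>i\<in>I. c i *\<^sub>R u i) # ys)"
    by (rule forms_add[OF assms(1,2)])
      (use insert assms(2) in \<open>auto intro!: subspace_scale subspace_sum\<close>)
  then show ?case
    using insert forms_scale[OF assms(1,2), of "u i" xs "c i" ys] by simp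
qed (simp_all add: forms_zero_arg[OF assms(1,2)])

lemma forms_linear:
  assumes "\<omega> \<in> forms UNIV k"
  shows "linear (\<lambda>u. \<omega> (xs @ u # ys))"
  using forms_add[OF assms subspace_UNIV] forms_scale[OF assms subspace_UNIV]
  by (intro linearI) auto

lemma forms_linear_Cons:
  assumes "\<omega> \<in> forms UNIV k"
  shows "linear (\<lambda>u. \<omega> (u # ys))"
  using forms_linear[OF assms, of "[]"] by simp

text \<open>Polarization of the vanishing on repeated arguments; if one of the two vectors is
  outside \<open>W\<close>, both sides are 0 by extensionality.\<close>

lemma forms_swap:
  assumes "\<omega> \<in> forms W k" "subspace W"
  shows "\<omega> (xs @ u # v # ys) = - \<omega> (xs @ v # u # ys)"
proof (cases "u \<in> W \<and> v \<in> W")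
  case True
  then have uv: "u \<in> W" "v \<in> W" "u + v \<in> W" using assms(2) by (auto intro: subspace_add)
  have "0 = \<omega> (xs @ (u + v) # (u + v) # ys)"
    using forms_not_distinct[OF assms(1)] by simp
  also have "\<dots> = \<omega> (xs @ u # (u + v) # ys) + \<omega> (xs @ v # (u + v) # ys)"
    by (rule forms_add[OF assms]) (use uv in auto)
  also have "\<omega> (xs @ u # (u + v) # ys) = \<omega> (xs @ u # u # ys) + \<omega> (xs @ u # v # ys)"
    using forms_add[OF assms uv(1,2), of "xs @ [u]"] by simp
  also have "\<omega> (xs @ v # (u + v) # ys) = \<omega> (xs @ v # u # ys) + \<omega> (xs @ v # v # ys)"
    using forms_add[OF assms uv(1,2), of "xs @ [v]"] by simp
  finally show ?thesis using forms_not_distinct[OF assms(1)] by simp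
next
  case False
  then show ?thesis
    using forms_eq_0[OF assms(1), of "xs @ u # v # ys"] forms_eq_0[OF assms(1), of "xs @ v # u # ys"]
    by auto
qed

lemma forms_move:
  assumes "\<omega> \<in> forms W k" "subspace W"
  shows "\<omega> (xs @ ys @ u # zs) = (- 1) ^ length ys * \<omega> (xs @ u # ys @ zs)"
proof (induction ys arbitrary: xs)
  case (Cons y ys)
  have "\<omega> (xs @ (y # ys) @ u # zs) = (- 1) ^ length ys * \<omega> (xs @ y # u # ys @ zs)"
    using Cons.IH[of "xs @ [y]"] by simp
  then show ?case using forms_swap[OF assms, of xs y u "ys @ zs"] by simp
qed simp

text \<open>Membership in \<open>forms\<close> reduces to the head of the list: the slots behind it
  are covered by the interior products, and an entry equal to the head is moved next to it inside an
  interior product, where \<open>alt\<close> applies. The closure proofs for pullbacks, alternating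
  sums and wedge products are inductions on the degree through this criterion.\<close>

lemma formsI_Cons:
  assumes W: "subspace W" and nil: "\<omega> [] = 0"
    and int: "\<And>u. u \<in> W \<Longrightarrow> interior_prod u \<omega> \<in> forms W k"
    and out: "\<And>u us. u \<notin> W \<Longrightarrow> \<omega> (u # us) = 0"
    and lin: "\<And>u v a b us. u \<in> W \<Longrightarrow> v \<in> W \<Longrightarrow>
      \<omega> ((a *\<^sub>R u + b *\<^sub>R v) # us) = a * \<omega> (u # us) + b * \<omega> (v # us)"
    and alt: "\<And>u us. u \<in> W \<Longrightarrow> \<omega> (u # u # us) = 0"
  shows "\<omega> \<in> forms W (Suc k)"
proof -
  have 1: "\<omega> us = 0" if "length us \<noteq> Suc k \<or> \<not> set us \<subseteq> W" for us
  proof (cases us)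
    case (Cons u vs)
    then show ?thesis
      using forms_eq_0[OF int, of u vs] out[of u vs] that by (cases "u \<in> W") (auto simp: interior_prod_def)
  qed (simp add: nil)
  have 2: "\<omega> (us[i := a *\<^sub>R u + b *\<^sub>R v]) = a * \<omega> (us[i := u]) + b * \<omega> (us[i := v])"
    if as: "length us = Suc k" "set us \<subseteq> W" "i < Suc k" "u \<in> W" "v \<in> W" for us i u v a b
  proof -
    obtain w ws where us: "us = w # ws" using as by (cases us) auto
    show ?thesis
    proof (cases i)
      case 0
      then show ?thesis using lin as us by simp
    next
      case (Suc j)
      have "interior_prod w \<omega> (ws[j := a *\<^sub>R u + b *\<^sub>R v]) =
          a * interior_prod w \<omega> (ws[j := u]) + b * interior_prod w \<omega> (ws[j := v])"
        using int[of w] as us Suc by (auto simp: forms_def)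
      then show ?thesis using us Suc by (simp add: interior_prod_def)
    qed
  qed
  have 3: "\<omega> us = 0" if nd: "length us = Suc k" "\<not> distinct us" for us
  proof (cases "set us \<subseteq> W")
    case True
    obtain w ws where us: "us = w # ws" using nd by (cases us) auto
    have w: "w \<in> W" using True us by simp
    note iw = int[OF w]
    show ?thesis
    proof (cases "w \<in> set ws")
      case True
      then obtain ys zs where "ws = ys @ w # zs" by (meson split_list)
      then have "interior_prod w \<omega> ws = (- 1) ^ length ys * interior_prod w \<omega> (w # ys @ zs)"
        using forms_move[OF iw W, of "[]" ys w zs] by simp
      then show ?thesis using alt[OF w] us by (simp add: interior_prod_def)
    next
      case False
      then have "\<not> distinct ws" using nd us by simp
      then show ?thesis using forms_not_distinct[OF iw, of ws] us by (simp add: interior_prod_def)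
    qed
  qed (use 1 in auto)
  show ?thesis unfolding forms_def using 1 2 3 by blast
qed

lemma forms_0_iff: "\<omega> \<in> forms W 0 \<longleftrightarrow> (\<forall>us. us \<noteq> [] \<longrightarrow> \<omega> us = 0)"
  by (auto simp: forms_def)

lemma interior_prod_forms:
  assumes "\<omega> \<in> forms W (Suc k)" "subspace W"
  shows "interior_prod u \<omega> \<in> forms W k"
proof (cases "u \<in> W")
  case True
  show ?thesis unfolding forms_def
  proof (clarify, intro conjI allI impI)
    show "interior_prod u \<omega> us = 0" if "length us \<noteq> k \<or> \<not> set us \<subseteq> W" for us
      using that forms_eq_0[OF assms(1), of "u # us"] by (auto simp: interior_prod_def)
    show "interior_prod u \<omega> us = 0" if "length us = k \<and> \<not> distinct us" for us
      using that forms_not_distinct[OF assms(1), of "u # us"] by (auto simp: interior_prod_def)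
    show "interior_prod u \<omega> (us[i := a *\<^sub>R v + b *\<^sub>R w]) = a * interior_prod u \<omega> (us[i := v]) + b * interior_prod u \<omega> (us[i := w])"
      if "length us = k \<and> set us \<subseteq> W \<and> i < k \<and> v \<in> W \<and> w \<in> W" for us i v w a b
      using that forms_lin[OF assms, of v w "u # take i us" a b "drop (Suc i) us"]
      by (simp add: interior_prod_def upd_conv_take_nth_drop)
  qed
next
  case False
  then have "interior_prod u \<omega> = (\<lambda>_. 0)"
    using forms_eq_0[OF assms(1)] by (auto simp: interior_prod_def)
  then show ?thesis by (simp add: forms_def)
qed

lemma forms_zero: "(\<lambda>_. 0) \<in> forms W k"
  by (simp add: forms_def)

lemma forms_lincomb:
  assumes "\<alpha> \<in> forms W k" "\<beta> \<in> forms W k"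
  shows "(\<lambda>us. a * \<alpha> us + b * \<beta> us) \<in> forms W k"
  using assms by (simp add: forms_def algebra_simps)

lemma forms_scaled:
  assumes "\<alpha> \<in> forms W k"
  shows "(\<lambda>us. a * \<alpha> us) \<in> forms W k"
  using forms_lincomb[OF assms forms_zero, of a 0] by simp

lemma forms_diff:
  assumes "\<alpha> \<in> forms W k" "\<beta> \<in> forms W k"
  shows "(\<lambda>us. \<alpha> us - \<beta> us) \<in> forms W k"
  using forms_lincomb[OF assms, of 1 "-1"] by simp

lemma forms_sum_mem:
  assumes "\<And>i. i \<in> I \<Longrightarrow> \<alpha> i \<in> forms W k"
  shows "(\<lambda>us. \<Sum>i\<in>I. c i * \<alpha> i us) \<in> forms W k"
  using assms
proof (induction I rule: infinite_finite_induct)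
  case (insert i I)
  then show ?case using forms_lincomb[of "\<alpha> i" W k _ "c i" 1] by simp
qed (simp_all add: forms_zero)

lemma pull_forms_range:
  assumes "linear L" "range L \<subseteq> W" "subspace W" "\<omega> \<in> forms W k"
  shows "pull L \<omega> \<in> forms UNIV k"
  using assms
proof (induction k arbitrary: \<omega>)
  case 0
  then show ?case by (simp add: forms_0_iff pull_def)
next
  case (Suc k)
  show ?case
  proof (rule formsI_Cons)
    show "pull L \<omega> [] = 0" using forms_eq_0[OF Suc.prems(4), of "[]"] by (simp add: pull_def)
    show "interior_prod u (pull L \<omega>) \<in> forms UNIV k" for u
      using Suc.IH[OF Suc.prems(1-3) interior_prod_forms[OF Suc.prems(4,3), of "L u"]]
      by (simp add: interior_prod_def pull_def)
    show "pull L \<omega> ((a *\<^sub>R u + b *\<^sub>R v) # us) = a * pull L \<omega> (u # us) + b * pull L \<omega> (v # us)" for a u b v us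
      using forms_lin[OF Suc.prems(4,3), of "L u" "L v" "[]"] Suc.prems(1,2)
      by (simp add: pull_def linear_add linear_cmul image_subset_iff)
    show "pull L \<omega> (u # u # us) = 0" for u us
      using forms_not_distinct[OF Suc.prems(4)] by (simp add: pull_def)
  qed auto
qed

lemma pull_forms: "linear L \<Longrightarrow> \<omega> \<in> forms UNIV k \<Longrightarrow> pull L \<omega> \<in> forms UNIV k"
  by (rule pull_forms_range) auto

lemma pull_pull: "pull L (pull M \<omega>) = pull (\<lambda>u. M (L u)) \<omega>"
  by (simp add: pull_def comp_def)

text \<open>Only the vanishing of a value has to survive a reordering, so the sign of the
  permutation is never computed: each entry of \<open>zs\<close> is pulled forward by
  \<open>forms_move\<close> at the cost of a power of -1. The prefix \<open>xs\<close> holds the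
  entries already placed.\<close>

lemma forms_eq_0_on_permutation:
  assumes "\<omega> \<in> forms W k" "subspace W" "\<omega> (xs @ ys) = 0" "mset zs = mset ys"
  shows "\<omega> (xs @ zs) = 0"
  using assms(3,4)
proof (induction zs arbitrary: xs ys)
  case (Cons z zs)
  then have "z \<in> set ys" by (metis list.set_intros(1) mset_eq_setD)
  then obtain y1 y2 where ys: "ys = y1 @ z # y2" by (meson split_list)
  have "\<omega> (xs @ z # y1 @ y2) = 0"
    using Cons.prems(1) forms_move[OF assms(1,2), of xs y1 z y2] unfolding ys by simp
  then have "\<omega> ((xs @ [z]) @ zs) = 0"
    by (intro Cons.IH[of "xs @ [z]" "y1 @ y2"]) (use Cons.prems ys in auto)
  then show ?case by simp
qed simp

text \<open>The arguments are expanded in \<open>B\<close> one after another; \<open>xs\<close> is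
  the part of the list already replaced by members of \<open>B\<close>.\<close>

lemma forms_eq_0_spanning:
  assumes \<omega>: "\<omega> \<in> forms W k" and W: "subspace W" "W \<subseteq> span B" "B \<subseteq> W"
    and z: "\<And>us. set us \<subseteq> B \<Longrightarrow> \<omega> us = 0"
  shows "\<omega> us = 0"
proof -
  have "\<omega> (xs @ us) = 0" if "set xs \<subseteq> B" "set us \<subseteq> W" for xs
    using that
  proof (induction us arbitrary: xs)
    case (Cons u us)
    then have "u \<in> span B" using W by auto
    then obtain S c where u: "finite S" "S \<subseteq> B" "u = (\<Sum>v\<in>S. c v *\<^sub>R v)"
      unfolding span_explicit by auto
    have "\<omega> (xs @ u # us) = (\<Sum>v\<in>S. c v * \<omega> (xs @ v # us))"
      unfolding u(3) by (rule forms_sum[OF \<omega> W(1)]) (use u W in auto)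
    also have "\<dots> = 0"
    proof (rule sum.neutral, rule ballI)
      fix v assume "v \<in> S"
      then have "\<omega> ((xs @ [v]) @ us) = 0" using u Cons.prems by (intro Cons.IH) auto
      then show "c v * \<omega> (xs @ v # us) = 0" by simp
    qed
    finally show ?case by simp
  qed (simp add: z)
  from this[of "[]"] show ?thesis using forms_eq_0[OF \<omega>, of us] by auto
qed

text \<open>A list of \<open>k\<close> distinct members of \<open>set bs\<close> is a rearrangement
  of \<open>bs\<close>, since \<open>bs\<close> has at most \<open>k\<close> different entries; all
  other lists give 0 anyway. Hence one value determines a form of top degree.\<close>

lemma forms_eq_0_basis_list:
  assumes \<omega>: "\<omega> \<in> forms W k" and W: "subspace W" "W \<subseteq> span (set bs)" "set bs \<subseteq> W"
    and bs: "length bs = k" "\<omega> bs = 0"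
  shows "\<omega> us = 0"
proof (rule forms_eq_0_spanning[OF \<omega> W])
  fix us assume us: "set us \<subseteq> set bs"
  show "\<omega> us = 0"
  proof (cases "distinct us \<and> length us = k")
    case True
    have "card (set us) = k" using True distinct_card by blast
    moreover have "card (set bs) \<le> k" using bs card_length by blast
    ultimately have eq: "set us = set bs" using us by (simp add: card_seteq)
    then have "distinct bs" using \<open>card (set us) = k\<close> bs by (simp add: card_distinct)
    then have "mset us = mset bs" using eq True set_eq_iff_mset_eq_distinct by blast
    then show ?thesis using forms_eq_0_on_permutation[OF \<omega> W(1), of "[]" bs us] bs by simp
  next
    case False
    then show ?thesis using forms_not_distinct[OF \<omega>] forms_eq_0[OF \<omega>] by blast
  qed
qed

text \<open>The combination of the two forms that is 0 on \<open>bs\<close> is 0 everywhere.\<close>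

lemma forms_proportional:
  assumes "\<omega> \<in> forms W k" "\<eta> \<in> forms W k"
    and W: "subspace W" "W \<subseteq> span (set bs)" "set bs \<subseteq> W" and "length bs = k"
  shows "\<omega> bs * \<eta> us = \<eta> bs * \<omega> us"
proof -
  have "\<omega> bs * \<eta> us + (- \<eta> bs) * \<omega> us = 0"
    by (rule forms_eq_0_basis_list[OF forms_lincomb[OF assms(2,1)] W assms(6)]) simp
  then show ?thesis by simp
qed

section \<open>Antisymmetrization over the first slot\<close>

subsection \<open>Alternating sums\<close>

text \<open>Both the coordinate exterior derivative (\<open>g w\<close> the derivative of a form in
  direction \<open>w\<close>) and the wedge product with a 1-form \<alpha> (\<open>g w\<close> equal
  to \<alpha>(w) times a form) have this shape, so one recursion on the list serves both.\<close>

definition alt_sum :: "('e \<Rightarrow> 'e form) \<Rightarrow> 'e form" where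
  "alt_sum g us = (\<Sum>i<length us. (- 1) ^ i * g (us ! i) (take i us @ drop (Suc i) us))"

lemma alt_sum_Nil [simp]: "alt_sum g [] = 0"
  by (simp add: alt_sum_def)

lemma alt_sum_Cons: "alt_sum g (u # us) = g u us - alt_sum (\<lambda>w. interior_prod u (g w)) us"
  unfolding alt_sum_def length_Cons sum.lessThan_Suc_shift
  by (simp add: interior_prod_def sum_negf)

lemma alt_sum_zero: "alt_sum (\<lambda>_ _. 0) us = 0"
  by (simp add: alt_sum_def)

text \<open>Contracting with the head gives \<open>g u\<close> minus an alternating sum of the same
  kind in one degree less, as in \<open>alt_sum_Cons\<close>; on a repeated head the term
  \<open>g u (u # us)\<close> cancels against the one produced by the inner sum.\<close>

lemma alt_sum_forms:
  assumes W: "subspace W" and g: "\<And>w. w \<in> W \<Longrightarrow> g w \<in> forms W k"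
    and out: "\<And>w us. w \<notin> W \<Longrightarrow> g w us = 0"
    and lin: "\<And>u v a b us. u \<in> W \<Longrightarrow> v \<in> W \<Longrightarrow>
      g (a *\<^sub>R u + b *\<^sub>R v) us = a * g u us + b * g v us"
  shows "alt_sum g \<in> forms W (Suc k)"
  using g out lin
proof (induction k arbitrary: g)
  case 0
  have z: "alt_sum (\<lambda>w. interior_prod u (g w)) us = 0" for u us
  proof -
    have "(\<lambda>w. interior_prod u (g w)) = (\<lambda>_ _. 0)"
      using 0(1,2) by (auto simp: interior_prod_def forms_0_iff fun_eq_iff)
    then show ?thesis by (simp add: alt_sum_zero)
  qed
  show ?case
    by (rule formsI_Cons[OF W])
      (use 0 z in \<open>auto simp: alt_sum_Cons interior_prod_def forms_0_iff\<close>)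
next
  case (Suc k)
  have IH: "alt_sum (\<lambda>w. interior_prod u (g w)) \<in> forms W (Suc k)" if "u \<in> W" for u
    by (rule Suc.IH) (use Suc.prems interior_prod_forms[OF Suc.prems(1) W] in \<open>auto simp: interior_prod_def\<close>)
  have g0: "g w (u # us) = 0" if "u \<notin> W" for w u us
    using that Suc.prems(2)[of w] forms_eq_0[OF Suc.prems(1), of w "u # us"] by (cases "w \<in> W") auto
  show ?case
  proof (rule formsI_Cons[OF W])
    show "interior_prod u (alt_sum g) \<in> forms W (Suc k)" if "u \<in> W" for u
      using forms_diff[OF Suc.prems(1) IH] that by (simp add: interior_prod_def alt_sum_Cons)
    show "alt_sum g (u # us) = 0" if "u \<notin> W" for u us
    proof -
      have "(\<lambda>w. interior_prod u (g w)) = (\<lambda>_ _. 0)"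
        using g0[OF that] by (auto simp: interior_prod_def)
      then show ?thesis using Suc.prems(2)[OF that] by (simp add: alt_sum_Cons alt_sum_zero)
    qed
    show "alt_sum g ((a *\<^sub>R u + b *\<^sub>R v) # us) = a * alt_sum g (u # us) + b * alt_sum g (v # us)"
      if uv: "u \<in> W" "v \<in> W" for u v a b us
    proof -
      have "interior_prod (a *\<^sub>R u + b *\<^sub>R v) (g w) vs =
          a * interior_prod u (g w) vs + b * interior_prod v (g w) vs" for w vs
        using forms_lin[OF Suc.prems(1) W uv, of w "[]" a b vs] Suc.prems(2)[of w]
        by (cases "w \<in> W") (auto simp: interior_prod_def)
      then have "alt_sum (\<lambda>w. interior_prod (a *\<^sub>R u + b *\<^sub>R v) (g w)) us
          = a * alt_sum (\<lambda>w. interior_prod u (g w)) us + b * alt_sum (\<lambda>w. interior_prod v (g w)) us"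
        by (simp add: alt_sum_def sum_distrib_left sum.distrib algebra_simps)
      then show ?thesis using Suc.prems(3)[OF uv] by (simp add: alt_sum_Cons algebra_simps)
    qed
    show "alt_sum g (u # u # us) = 0" if "u \<in> W" for u us
    proof -
      have "interior_prod u (interior_prod u (g w)) vs = 0" for w vs
        using forms_not_distinct[OF Suc.prems(1), of w "u # u # vs"] Suc.prems(2)[of w]
        by (cases "w \<in> W") (auto simp: interior_prod_def)
      then have "(\<lambda>w. interior_prod u (interior_prod u (g w))) = (\<lambda>_ _. 0)" by auto
      then show ?thesis by (simp add: alt_sum_Cons alt_sum_zero interior_prod_def[of u "g u"])
    qed
  qed simp
qed

section \<open>The wedge product and its antiderivation rule\<close>

subsection \<open>The wedge product\<close>

lemma wedge_Nil: "wedge \<alpha> \<beta> [] = \<alpha> [] * \<beta> []"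
proof -
  have "{(i, j). i \<in> {} \<and> j \<in> {..<0::nat} - {} \<and> j < i} = {}" by auto
  then show ?thesis by (simp add: wedge_def)
qed

text \<open>Position 0 precedes every other position, so giving it to the first factor creates no
  inversion.\<close>

lemma card_inversions_insert:
  assumes "J \<subseteq> {..<m}"
  shows "card {(i, j). i \<in> insert 0 (Suc ` J) \<and> j \<in> {..<Suc m} - insert 0 (Suc ` J) \<and> j < i}
    = card {(i, j). i \<in> J \<and> j \<in> {..<m} - J \<and> j < i}"
proof -
  have "{(i, j). i \<in> insert 0 (Suc ` J) \<and> j \<in> {..<Suc m} - insert 0 (Suc ` J) \<and> j < i}
    = map_prod Suc Suc ` {(i, j). i \<in> J \<and> j \<in> {..<m} - J \<and> j < i}"
    (is "?A = ?B")
  proof (intro equalityI subsetI)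
    fix z assume "z \<in> ?A"
    then obtain i j where z: "z = (i, j)" "i \<in> insert 0 (Suc ` J)" "j \<in> {..<Suc m} - insert 0 (Suc ` J)" "j < i"
      by auto
    then obtain i' where i': "i = Suc i'" "i' \<in> J" by auto
    obtain j' where j': "j = Suc j'" using z by (cases j) auto
    show "z \<in> ?B" using z i' j' by (auto intro!: image_eqI[of _ _ "(i', j')"])
  qed auto
  then show ?thesis by (simp add: card_image inj_on_def)
qed

text \<open>Position 0 now belongs to the second factor and is inverted with each of the
  \<open>card J\<close> positions given to the first.\<close>

lemma card_inversions_Suc:
  assumes "J \<subseteq> {..<m}"
  shows "card {(i, j). i \<in> Suc ` J \<and> j \<in> {..<Suc m} - Suc ` J \<and> j < i}
    = card J + card {(i, j). i \<in> J \<and> j \<in> {..<m} - J \<and> j < i}"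
proof -
  let ?C = "{(i, j). i \<in> J \<and> j \<in> {..<m} - J \<and> j < i}"
  have J: "finite J" using assms finite_subset by blast
  have "?C \<subseteq> J \<times> {..<m}" by auto
  then have C: "finite ?C" using J finite_subset by blast
  have "{(i, j). i \<in> Suc ` J \<and> j \<in> {..<Suc m} - Suc ` J \<and> j < i}
    = (\<lambda>i. (Suc i, 0)) ` J \<union> map_prod Suc Suc ` ?C"
    (is "?A = ?B")
  proof (intro equalityI subsetI)
    fix z assume "z \<in> ?A"
    then obtain i j where z: "z = (i, j)" "i \<in> Suc ` J" "j \<in> {..<Suc m} - Suc ` J" "j < i"
      by auto
    then obtain i' where i': "i = Suc i'" "i' \<in> J" by auto
    show "z \<in> ?B"
    proof (cases j)
      case 0
      then show ?thesis using z i' by auto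
    next
      case (Suc j')
      then show ?thesis using z i' by (auto intro!: image_eqI[of _ _ "(i', j')"])
    qed
  qed auto
  moreover have "card ((\<lambda>i. (Suc i, 0::nat)) ` J \<union> map_prod Suc Suc ` ?C) = card J + card ?C"
    by (subst card_Un_disjoint) (use J C finite_imageI[OF C] in \<open>auto simp: card_image inj_on_def\<close>)
  ultimately show ?thesis by simp
qed

lemma Pow_lessThan_Suc:
  "Pow {..<Suc m} = (\<lambda>J. insert 0 (Suc ` J)) ` Pow {..<m} \<union> (\<lambda>J. Suc ` J) ` Pow {..<m}"
proof (intro equalityI subsetI)
  fix I assume "I \<in> Pow {..<Suc m}"
  then have I: "I \<subseteq> {..<Suc m}" by simp
  define J where "J = {j. Suc j \<in> I}"
  have J: "J \<in> Pow {..<m}" using I by (auto simp: J_def)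
  have "I = (if 0 \<in> I then insert 0 (Suc ` J) else Suc ` J)"
  proof (rule set_eqI)
    show "i \<in> I \<longleftrightarrow> i \<in> (if 0 \<in> I then insert 0 (Suc ` J) else Suc ` J)" for i
      by (cases i) (auto simp: J_def)
  qed
  then show "I \<in> (\<lambda>J. insert 0 (Suc ` J)) ` Pow {..<m} \<union> (\<lambda>J. Suc ` J) ` Pow {..<m}"
    using J by (cases "0 \<in> I") auto
qed auto

text \<open>The shuffles are split by the factor that receives \<open>u\<close>. If it is \<beta>,
  the vector passes all arguments of \<alpha>, and since only shuffles giving \<open>k\<close>
  arguments to \<alpha> contribute, the sign is the constant \<open>(- 1) ^ k\<close>. This
  antiderivation rule replaces the shuffle formula in the algebraic inductions that follow.\<close>

lemma wedge_Cons:
  assumes "\<And>us. length us \<noteq> k \<Longrightarrow> \<alpha> us = 0"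
  shows "wedge \<alpha> \<beta> (u # us) =
    wedge (interior_prod u \<alpha>) \<beta> us + (- 1) ^ k * wedge \<alpha> (interior_prod u \<beta>) us"
proof -
  let ?m = "length us"
  let ?inv = "\<lambda>m I. card {(i, j). i \<in> I \<and> j \<in> {..<m} - I \<and> j < i}"
  let ?t = "\<lambda>I. (- 1) ^ ?inv (Suc ?m) I * \<alpha> (nths (u # us) I) * \<beta> (nths (u # us) ({..<Suc ?m} - I))"
  have inj1: "inj_on (\<lambda>J. insert 0 (Suc ` J)) (Pow {..<?m})"
    by (rule inj_onI) (metis (no_types, lifting) Diff_insert_absorb image_iff inj_image_eq_iff inj_Suc nat.distinct(1))
  have inj2: "inj_on (\<lambda>J. Suc ` J) (Pow {..<?m})"
    by (rule inj_onI) (simp add: inj_image_eq_iff)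
  have "wedge \<alpha> \<beta> (u # us) = (\<Sum>I\<in>Pow {..<Suc ?m}. ?t I)"
    by (simp add: wedge_def Let_def)
  also have "\<dots> = (\<Sum>I\<in>(\<lambda>J. insert 0 (Suc ` J)) ` Pow {..<?m}. ?t I) + (\<Sum>I\<in>(\<lambda>J. Suc ` J) ` Pow {..<?m}. ?t I)"
    unfolding Pow_lessThan_Suc by (rule sum.union_disjoint) auto
  also have "(\<Sum>I\<in>(\<lambda>J. insert 0 (Suc ` J)) ` Pow {..<?m}. ?t I) = (\<Sum>J\<in>Pow {..<?m}. ?t (insert 0 (Suc ` J)))"
    by (subst sum.reindex[OF inj1]) simp
  also have "\<dots> = wedge (interior_prod u \<alpha>) \<beta> us"
    unfolding wedge_def Let_def
  proof (rule sum.cong[OF refl])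
    fix J assume J: "J \<in> Pow {..<?m}"
    have "{j. Suc j \<in> {..<Suc ?m} - insert 0 (Suc ` J)} = {..<?m} - J" "{j. Suc j \<in> insert 0 (Suc ` J)} = J"
      by auto
    then show "?t (insert 0 (Suc ` J)) = (- 1) ^ ?inv ?m J * interior_prod u \<alpha> (nths us J) * \<beta> (nths us ({..<?m} - J))"
      using J card_inversions_insert[of J ?m] by (simp add: nths_Cons interior_prod_def)
  qed
  also have "(\<Sum>I\<in>(\<lambda>J. Suc ` J) ` Pow {..<?m}. ?t I) = (\<Sum>J\<in>Pow {..<?m}. ?t (Suc ` J))"
    by (subst sum.reindex[OF inj2]) simp
  also have "\<dots> = (- 1) ^ k * wedge \<alpha> (interior_prod u \<beta>) us"
    unfolding wedge_def Let_def sum_distrib_left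
  proof (rule sum.cong[OF refl])
    fix J assume J: "J \<in> Pow {..<?m}"
    have "{i. i < ?m \<and> i \<in> J} = J" using J by auto
    then have len: "length (nths us J) = card J" by (simp add: length_nths)
    have "{j. Suc j \<in> {..<Suc ?m} - Suc ` J} = {..<?m} - J" "{j. Suc j \<in> Suc ` J} = J"
      by auto
    then have "?t (Suc ` J) = (- 1) ^ (card J + ?inv ?m J) * \<alpha> (nths us J) * interior_prod u \<beta> (nths us ({..<?m} - J))"
      using J card_inversions_Suc[of J ?m] by (simp add: nths_Cons interior_prod_def image_iff)
    also have "\<dots> = (- 1) ^ k * ((- 1) ^ ?inv ?m J * \<alpha> (nths us J) * interior_prod u \<beta> (nths us ({..<?m} - J)))"
      using assms[of "nths us J"] len by (cases "card J = k") (auto simp: power_add)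
    finally show "?t (Suc ` J) = (- 1) ^ k * ((- 1) ^ ?inv ?m J * \<alpha> (nths us J) * interior_prod u \<beta> (nths us ({..<?m} - J)))" .
  qed
  finally show ?thesis .
qed

lemma wedge_Cons_forms:
  assumes "\<alpha> \<in> forms W k"
  shows "wedge \<alpha> \<beta> (u # us) =
    wedge (interior_prod u \<alpha>) \<beta> us + (- 1) ^ k * wedge \<alpha> (interior_prod u \<beta>) us"
  by (rule wedge_Cons) (rule forms_eq_0[OF assms], simp)

lemma interior_prod_wedge:
  assumes "\<alpha> \<in> forms W k"
  shows "interior_prod u (wedge \<alpha> \<beta>) = (\<lambda>us. wedge (interior_prod u \<alpha>) \<beta> us + (- 1) ^ k * wedge \<alpha> (interior_prod u \<beta>) us)"
  using wedge_Cons_forms[OF assms] by (auto simp: interior_prod_def)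

lemma wedge_lincomb_left:
  "wedge (\<lambda>us. a * \<alpha> us + b * \<beta> us) \<eta> us = a * wedge \<alpha> \<eta> us + b * wedge \<beta> \<eta> us"
  by (simp add: wedge_def Let_def sum_distrib_left sum.distrib algebra_simps)

lemma wedge_lincomb_right:
  "wedge \<eta> (\<lambda>us. a * \<alpha> us + b * \<beta> us) us = a * wedge \<eta> \<alpha> us + b * wedge \<eta> \<beta> us"
  by (simp add: wedge_def Let_def sum_distrib_left sum.distrib algebra_simps)

lemma wedge_zero_left: "wedge (\<lambda>_. 0) \<eta> = (\<lambda>_. 0)"
  by (simp add: wedge_def)

lemma wedge_zero_right: "wedge \<eta> (\<lambda>_. 0) = (\<lambda>_. 0)"
  by (simp add: wedge_def)

lemma wedge_scaled_left: "wedge (\<lambda>us. a * \<alpha> us) \<eta> us = a * wedge \<alpha> \<eta> us"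
  using wedge_lincomb_left[of a \<alpha> 0 \<alpha>] by simp

lemma wedge_scaled_right: "wedge \<eta> (\<lambda>us. a * \<alpha> us) us = a * wedge \<eta> \<alpha> us"
  using wedge_lincomb_right[of \<eta> a \<alpha> 0 \<alpha>] by simp

lemma pull_wedge: "pull L (wedge \<alpha> \<beta>) = wedge (pull L \<alpha>) (pull L \<beta>)"
  by (rule ext) (simp add: pull_def wedge_def nths_map)

lemma pull_wedge_power: "pull L (wedge_power \<sigma> l) = wedge_power (pull L \<sigma>) l"
proof (induction l)
  case 0
  show ?case by (rule ext) (simp add: pull_def)
next
  case (Suc l)
  then show ?case by (simp add: pull_wedge)
qed

text \<open>Induction on the total degree by the antiderivation rule. For a repeated head the two
  mixed terms, each the product of the contractions of \<alpha> and \<beta> with \<open>u\<close>,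
  carry opposite signs. Factors of degree 0 are treated apart, because their contractions are 0
  rather than forms of lower degree.\<close>

lemma wedge_forms:
  assumes "\<alpha> \<in> forms UNIV j" "\<beta> \<in> forms UNIV k"
  shows "wedge \<alpha> \<beta> \<in> forms UNIV (j + k)"
  using assms
proof (induction "j + k" arbitrary: j k \<alpha> \<beta>)
  case 0
  have "wedge \<alpha> \<beta> (u # us) = 0" for u us
  proof -
    have "interior_prod u \<alpha> = (\<lambda>_. 0)" "interior_prod u \<beta> = (\<lambda>_. 0)"
      using 0 by (auto simp: forms_0_iff interior_prod_def)
    then show ?thesis using wedge_Cons_forms[OF 0(2)] by (simp add: wedge_zero_left wedge_zero_right)
  qed
  then show ?case using 0 by (auto simp: forms_0_iff neq_Nil_conv)
next
  case (Suc m)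
  have zint: "interior_prod u \<omega> = (\<lambda>_. 0)" if "\<omega> \<in> forms UNIV 0" for u and \<omega> :: "'a form"
    using that by (auto simp: forms_0_iff interior_prod_def)
  have l: "wedge (interior_prod u \<alpha>) \<beta> \<in> forms UNIV m" for u
  proof (cases j)
    case 0
    then show ?thesis using Suc.prems zint[of \<alpha>] by (simp add: wedge_zero_left forms_zero)
  next
    case (Suc i)
    then show ?thesis using Suc.hyps(1)[of i k] Suc.hyps(2) Suc.prems interior_prod_forms by fastforce
  qed
  have r: "wedge \<alpha> (interior_prod u \<beta>) \<in> forms UNIV m" for u
  proof (cases k)
    case 0
    then show ?thesis using Suc.prems zint[of \<beta>] by (simp add: wedge_zero_right forms_zero)
  next
    case (Suc i)
    then show ?thesis using Suc.hyps(1)[of j i] Suc.hyps(2) Suc.prems interior_prod_forms by fastforce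
  qed
  note int = interior_prod_wedge[OF Suc.prems(1)]
  have lin: "interior_prod (a *\<^sub>R u + b *\<^sub>R v) \<omega> = (\<lambda>us. a * interior_prod u \<omega> us + b * interior_prod v \<omega> us)"
    if "\<omega> \<in> forms UNIV i" for a u b v i and \<omega> :: "'a form"
    using forms_lin[OF that subspace_UNIV, of u v "[]" a b] by (simp add: interior_prod_def fun_eq_iff)
  have "wedge \<alpha> \<beta> \<in> forms UNIV (Suc m)"
  proof (rule formsI_Cons)
    show "wedge \<alpha> \<beta> [] = 0"
      using Suc.hyps(2) forms_eq_0[OF Suc.prems(1), of "[]"] forms_eq_0[OF Suc.prems(2), of "[]"]
      by (cases j; cases k) (auto simp: wedge_Nil)
    show "interior_prod u (wedge \<alpha> \<beta>) \<in> forms UNIV m" for u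
      unfolding int using forms_lincomb[OF l r, of 1] by simp
    show "wedge \<alpha> \<beta> ((a *\<^sub>R u + b *\<^sub>R v) # us) = a * wedge \<alpha> \<beta> (u # us) + b * wedge \<alpha> \<beta> (v # us)" for a u b v us
      by (simp add: wedge_Cons_forms[OF Suc.prems(1)] lin[OF Suc.prems(1)] lin[OF Suc.prems(2)]
          wedge_lincomb_left wedge_lincomb_right algebra_simps)
    show "wedge \<alpha> \<beta> (u # u # us) = 0" for u us
    proof -
      have z: "interior_prod u (interior_prod u \<omega>) = (\<lambda>_. 0)" if "\<omega> \<in> forms UNIV i" for i and \<omega> :: "'a form"
        using forms_not_distinct[OF that] by (simp add: interior_prod_def)
      have "wedge \<alpha> \<beta> (u # u # us) = interior_prod u (wedge \<alpha> \<beta>) (u # us)"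
        by (simp add: interior_prod_def)
      also have "\<dots> = wedge (interior_prod u \<alpha>) \<beta> (u # us) + (- 1) ^ j * wedge \<alpha> (interior_prod u \<beta>) (u # us)"
        unfolding int ..
      also have "wedge \<alpha> (interior_prod u \<beta>) (u # us) = wedge (interior_prod u \<alpha>) (interior_prod u \<beta>) us"
        using wedge_Cons_forms[OF Suc.prems(1)] z[OF Suc.prems(2)] by (simp add: wedge_zero_right)
      also have "wedge (interior_prod u \<alpha>) \<beta> (u # us) = - ((- 1) ^ j) * wedge (interior_prod u \<alpha>) (interior_prod u \<beta>) us"
      proof (cases j)
        case 0
        then show ?thesis using Suc.prems zint[of \<alpha>] by (simp add: wedge_zero_left)
      next
        case (Suc i)
        have "interior_prod u \<alpha> \<in> forms UNIV i" using Suc.prems(1) Suc interior_prod_forms[OF _ subspace_UNIV] by blast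
        then show ?thesis using wedge_Cons_forms[of "interior_prod u \<alpha>" UNIV i] z[OF Suc.prems(1)] Suc
          by (simp add: wedge_zero_left)
      qed
      finally show ?thesis by simp
    qed
  qed auto
  then show ?case using Suc.hyps(2) by simp
qed

lemma wedge_one_form:
  assumes "\<alpha> \<in> forms UNIV 1"
  shows "wedge \<alpha> \<beta> us = alt_sum (\<lambda>w vs. \<alpha> [w] * \<beta> vs) us"
proof (induction us arbitrary: \<beta>)
  case Nil
  then show ?case using forms_eq_0[OF assms, of "[]"] by (simp add: wedge_Nil)
next
  case (Cons u us)
  have z: "wedge (interior_prod u \<alpha>) \<beta> us = \<alpha> [u] * \<beta> us"
  proof (cases us)
    case Nil
    then show ?thesis by (simp add: wedge_Nil interior_prod_def)
  next
    case (Cons v vs)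
    have *: "wedge (interior_prod u \<alpha>) \<beta> us = \<alpha> [u] * \<beta> us" for \<beta> and us :: "'a list"
    proof (induction us arbitrary: \<beta>)
      case Nil
      then show ?case by (simp add: wedge_Nil interior_prod_def)
    next
      case (Cons v vs)
      have "interior_prod u \<alpha> \<in> forms UNIV 0" using assms interior_prod_forms by fastforce
      moreover have "interior_prod v (interior_prod u \<alpha>) = (\<lambda>_. 0)"
        using forms_eq_0[OF assms] by (auto simp: interior_prod_def)
      ultimately have "wedge (interior_prod u \<alpha>) \<beta> (v # vs) = wedge (interior_prod u \<alpha>) (interior_prod v \<beta>) vs"
        using wedge_Cons_forms[of "interior_prod u \<alpha>" UNIV 0] by (simp add: wedge_zero_left)
      then show ?case using Cons by (simp add: interior_prod_def)
    qed
    then show ?thesis .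
  qed
  have "wedge \<alpha> \<beta> (u # us) = \<alpha> [u] * \<beta> us - wedge \<alpha> (interior_prod u \<beta>) us"
    using wedge_Cons_forms[OF assms, of \<beta> u us] z by simp
  then show ?case unfolding Cons by (simp add: alt_sum_Cons interior_prod_def)
qed


section \<open>Derivatives of fields of forms in coordinates and their behaviour under
  pullback\<close>

section \<open>Fields of forms in coordinates\<close>

lemma has_derivative_eventually_unique:
  assumes "(f has_derivative f') (at x)" "(g has_derivative g') (at x)"
    and "open S" "x \<in> S" "\<And>y. y \<in> S \<Longrightarrow> f y = g y"
  shows "f' v = g' v"
proof -
  have "(g has_derivative f') (at x)"
    by (rule has_derivative_transform_within_open[OF assms(1,3,4)]) (use assms(5) in auto)
  then show ?thesis using has_derivative_unique[OF assms(2)] by metis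
qed

text \<open>Each condition defining \<open>forms\<close> is a linear relation between values of the
  form and thus passes to the derivatives of these values.\<close>

lemma has_derivative_forms:
  assumes S: "open S" "x0 \<in> S" and \<omega>: "\<And>x. x \<in> S \<Longrightarrow> \<omega> x \<in> forms W k" and W: "subspace W"
    and D: "\<And>us. ((\<lambda>x. \<omega> x us) has_derivative D us) (at x0)"
  shows "(\<lambda>us. D us v) \<in> forms W k"
proof -
  have z: "D us v = 0" if "\<And>x. x \<in> S \<Longrightarrow> \<omega> x us = 0" for us
    using has_derivative_eventually_unique[OF D has_derivative_const S, of us 0 v] that by simp
  show ?thesis unfolding forms_def
  proof (clarify, intro conjI allI impI)
    show "D us v = 0" if "length us \<noteq> k \<or> \<not> set us \<subseteq> W" for us
      using forms_eq_0[OF \<omega> that] by (rule z)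
    show "D us v = 0" if "length us = k \<and> \<not> distinct us" for us
      using forms_not_distinct[OF \<omega>] that by (intro z) blast
    show "D (us[i := a *\<^sub>R u + b *\<^sub>R w]) v = a * D (us[i := u]) v + b * D (us[i := w]) v"
      if "length us = k \<and> set us \<subseteq> W \<and> i < k \<and> u \<in> W \<and> w \<in> W" for us i u w a b
    proof (rule has_derivative_eventually_unique[OF D _ S])
      show "((\<lambda>x. a * \<omega> x (us[i := u]) + b * \<omega> x (us[i := w])) has_derivative
          (\<lambda>v. a * D (us[i := u]) v + b * D (us[i := w]) v)) (at x0)"
        by (intro has_derivative_add has_derivative_mult_right D)
      show "\<omega> y (us[i := a *\<^sub>R u + b *\<^sub>R w]) = a * \<omega> y (us[i := u]) + b * \<omega> y (us[i := w])" if "y \<in> S" for y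
        using \<omega>[OF that] \<open>length us = k \<and> _\<close> by (simp add: forms_def)
    qed
  qed
qed

text \<open>Differentiability of \<omega> is known for constant arguments only. The moving argument
  \<open>f m x\<close> is expanded in \<open>Basis\<close>, which turns the claim into the product
  rule for real functions; the induction works from the last moving argument to the first, and
  \<open>rest\<close> collects the basis vectors already substituted.\<close>

lemma has_derivative_multilinear_aux:
  fixes \<omega> :: "'b::real_normed_vector \<Rightarrow> 'e::euclidean_space form"
  assumes S: "open S" "x0 \<in> S" and \<omega>: "\<And>x. x \<in> S \<Longrightarrow> \<omega> x \<in> forms UNIV k"
    and D: "\<And>us. ((\<lambda>x. \<omega> x us) has_derivative D us) (at x0)"
    and f: "\<And>j. j < m \<Longrightarrow> (f j has_derivative f' j) (at x0)"
  shows "((\<lambda>x. \<omega> x (map (\<lambda>j. f j x) [0..<m] @ rest)) has_derivative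
    (\<lambda>v. D (map (\<lambda>j. f j x0) [0..<m] @ rest) v +
      (\<Sum>j<m. \<omega> x0 ((map (\<lambda>j. f j x0) [0..<m])[j := f' j v] @ rest)))) (at x0)"
  using f
proof (induction m arbitrary: rest)
  case 0
  then show ?case using D by simp
next
  case (Suc m)
  let ?pre = "\<lambda>x. map (\<lambda>j. f j x) [0..<m]"
  let ?A = "\<lambda>b v. D (?pre x0 @ b # rest) v + (\<Sum>j<m. \<omega> x0 ((?pre x0)[j := f' j v] @ b # rest))"
  have IH: "((\<lambda>x. \<omega> x (?pre x @ b # rest)) has_derivative ?A b) (at x0)" for b
    using Suc.IH[of "b # rest"] Suc.prems by simp
  have fm: "(f m has_derivative f' m) (at x0)" using Suc.prems by simp
  have fb: "((\<lambda>x. f m x \<bullet> b) has_derivative (\<lambda>v. f' m v \<bullet> b)) (at x0)" for b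
    by (rule bounded_linear.has_derivative[OF bounded_linear_inner_left fm])
  have A: "((\<lambda>x. \<Sum>b\<in>Basis. (f m x \<bullet> b) * \<omega> x (?pre x @ b # rest)) has_derivative
      (\<lambda>v. \<Sum>b\<in>Basis. (f m x0 \<bullet> b) * ?A b v + (f' m v \<bullet> b) * \<omega> x0 (?pre x0 @ b # rest))) (at x0)"
    by (intro has_derivative_sum has_derivative_mult fb IH)
  have exp: "\<eta> (xs @ u # ys) = (\<Sum>b\<in>Basis. (u \<bullet> b) * \<eta> (xs @ b # ys))"
    if "\<eta> \<in> forms UNIV k" for \<eta> :: "'e form" and xs u ys
    using forms_sum[OF that subspace_UNIV, of Basis "\<lambda>b. b" xs "\<lambda>b. u \<bullet> b" ys]
    by (simp add: euclidean_representation)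
  have "((\<lambda>x. \<omega> x (?pre x @ f m x # rest)) has_derivative
      (\<lambda>v. \<Sum>b\<in>Basis. (f m x0 \<bullet> b) * ?A b v + (f' m v \<bullet> b) * \<omega> x0 (?pre x0 @ b # rest))) (at x0)"
    by (rule has_derivative_transform_within_open[OF A S]) (use exp[OF \<omega>] in auto)
  moreover have "(\<Sum>b\<in>Basis. (f m x0 \<bullet> b) * ?A b v + (f' m v \<bullet> b) * \<omega> x0 (?pre x0 @ b # rest)) =
      D (map (\<lambda>j. f j x0) [0..<Suc m] @ rest) v +
      (\<Sum>j<Suc m. \<omega> x0 ((map (\<lambda>j. f j x0) [0..<Suc m])[j := f' j v] @ rest))" for v
  proof -
    have "(\<Sum>b\<in>Basis. (f m x0 \<bullet> b) * D (?pre x0 @ b # rest) v) = D (?pre x0 @ f m x0 # rest) v"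
      using exp[OF has_derivative_forms[OF S \<omega> subspace_UNIV D], of _ "f m x0"] by simp
    moreover have "(\<Sum>b\<in>Basis. (f m x0 \<bullet> b) * (\<Sum>j<m. \<omega> x0 ((?pre x0)[j := f' j v] @ b # rest)))
        = (\<Sum>j<m. \<omega> x0 ((?pre x0)[j := f' j v] @ f m x0 # rest))"
      unfolding sum_distrib_left
      by (subst sum.swap) (use exp[OF \<omega>[OF S(2)], of _ "f m x0"] in simp)
    moreover have "(\<Sum>b\<in>Basis. (f' m v \<bullet> b) * \<omega> x0 (?pre x0 @ b # rest)) = \<omega> x0 (?pre x0 @ f' m v # rest)"
      using exp[OF \<omega>[OF S(2)], of _ "f' m v"] by simp
    ultimately show ?thesis
      by (simp add: sum.distrib distrib_left list_update_append)
  qed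
  ultimately show ?case by simp
qed

lemma has_derivative_multilinear:
  fixes \<omega> :: "'b::real_normed_vector \<Rightarrow> 'e::euclidean_space form"
  assumes S: "open S" "x0 \<in> S" and \<omega>: "\<And>x. x \<in> S \<Longrightarrow> \<omega> x \<in> forms UNIV k"
    and D: "\<And>us. ((\<lambda>x. \<omega> x us) has_derivative D us) (at x0)"
    and f: "\<And>u. u \<in> set us \<Longrightarrow> ((\<lambda>x. f x u) has_derivative f' u) (at x0)"
  shows "((\<lambda>x. \<omega> x (map (f x) us)) has_derivative
    (\<lambda>v. D (map (f x0) us) v + (\<Sum>j<length us. \<omega> x0 ((map (f x0) us)[j := f' (us ! j) v])))) (at x0)"
proof -
  have "map (\<lambda>j. g (us ! j)) [0..<length us] = map g us" for g :: "_ \<Rightarrow> 'e"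
    by (rule nth_equalityI) auto
  then show ?thesis
    using has_derivative_multilinear_aux[OF S \<omega> D, of "length us" "\<lambda>j x. f x (us ! j)" "\<lambda>j. f' (us ! j)" "[]"] f
    by simp
qed

text \<open>\<open>Q u v\<close> arises twice, from the direction \<open>u\<close> acting on the
  argument \<open>v\<close> and conversely, with opposite signs. In the induction these pairs appear
  as the alternating sum of \<open>\<eta> (Q u w # map J vs)\<close>, once with the head as
  direction and once with the head as argument.\<close>

lemma alt_sum_symmetric_slot:
  fixes \<eta> :: "'e::euclidean_space form"
  assumes "\<eta> \<in> forms UNIV k" and Q: "\<And>u v. Q u v = Q v u"
  shows "alt_sum (\<lambda>w vs. \<Sum>j<length vs. \<eta> ((map J vs)[j := Q (vs ! j) w])) us = 0"
  using assms(1)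
proof (induction us arbitrary: \<eta> k)
  case (Cons u us)
  let ?E = "\<lambda>\<eta> w vs. \<Sum>j<length vs. \<eta> ((map J vs)[j := Q (vs ! j) w]) :: real"
  have iE: "interior_prod u (?E \<eta> w) vs = \<eta> (Q u w # map J vs) + ?E (interior_prod (J u) \<eta>) w vs" for w vs
    unfolding interior_prod_def length_Cons sum.lessThan_Suc_shift by simp
  have "alt_sum (?E (interior_prod (J u) \<eta>)) us = 0"
  proof (cases k)
    case 0
    then have "interior_prod (J u) \<eta> = (\<lambda>_. 0)"
      using Cons.prems by (auto simp: interior_prod_def forms_0_iff)
    then show ?thesis by (simp add: alt_sum_zero)
  next
    case (Suc i)
    then show ?thesis using Cons.IH[of "interior_prod (J u) \<eta>"] Cons.prems
        interior_prod_forms[OF _ subspace_UNIV] by blast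
  qed
  moreover have "?E \<eta> u us = alt_sum (\<lambda>w vs. \<eta> (Q u w # map J vs)) us"
    unfolding alt_sum_def
  proof (rule sum.cong[OF refl])
    fix j assume j: "j \<in> {..<length us}"
    then have "\<eta> ((map J us)[j := Q (us ! j) u]) = \<eta> ([] @ map J (take j us) @ Q (us ! j) u # map J (drop (Suc j) us))"
      by (simp add: upd_conv_take_nth_drop take_map drop_map)
    also have "\<dots> = (- 1) ^ j * \<eta> ([] @ Q (us ! j) u # map J (take j us) @ map J (drop (Suc j) us))"
      unfolding forms_move[OF Cons.prems subspace_UNIV] using j by simp
    finally show "\<eta> ((map J us)[j := Q (us ! j) u]) =
        (- 1) ^ j * \<eta> (Q u (us ! j) # map J (take j us @ drop (Suc j) us))"
      by (simp add: Q[of u])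
  qed
  moreover have "alt_sum (\<lambda>w. interior_prod u (?E \<eta> w)) us =
      alt_sum (\<lambda>w vs. \<eta> (Q u w # map J vs)) us + alt_sum (?E (interior_prod (J u) \<eta>)) us"
    by (simp add: alt_sum_def iE distrib_left sum.distrib)
  ultimately show ?case by (simp add: alt_sum_Cons)
qed simp

definition coord_deriv :: "('e::euclidean_space \<Rightarrow> 'e form) \<Rightarrow> 'e \<Rightarrow> 'e form" where
  "coord_deriv \<omega> x0 = alt_sum (\<lambda>w vs. frechet_derivative (\<lambda>x. \<omega> x vs) (at x0) w)"

lemma ext_deriv_in_coord_deriv:
  "ext_deriv_in A c \<omega> p = pull (to_chart A c p) (coord_deriv (form_rep A c \<omega>) (cmap c p))"
  by (rule ext) (simp add: ext_deriv_in_def coord_deriv_def alt_sum_def pull_def Let_def)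

lemma coord_deriv_eq:
  assumes "\<And>us. ((\<lambda>x. \<omega> x us) has_derivative D us) (at x0)"
  shows "coord_deriv \<omega> x0 = alt_sum (\<lambda>w vs. D vs w)"
  unfolding coord_deriv_def using frechet_derivative_eqI[OF assms] by simp

lemma coord_deriv_cong:
  assumes "open S" "x0 \<in> S" "\<And>x. x \<in> S \<Longrightarrow> \<omega> x = \<omega>' x"
  shows "coord_deriv \<omega> x0 = coord_deriv \<omega>' x0"
proof -
  have "frechet_derivative (\<lambda>x. \<omega> x vs) (at x0) = frechet_derivative (\<lambda>x. \<omega>' x vs) (at x0)" for vs
    by (rule frechet_derivative_cong_open[OF assms(1,2)]) (simp add: assms(3))
  then show ?thesis by (simp add: coord_deriv_def)
qed

lemma coord_deriv_forms:
  assumes S: "open S" "x0 \<in> S" and \<omega>: "\<And>x. x \<in> S \<Longrightarrow> \<omega> x \<in> forms UNIV k"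
    and d: "\<And>us. (\<lambda>x. \<omega> x us) differentiable (at x0)"
  shows "coord_deriv \<omega> x0 \<in> forms UNIV (Suc k)"
proof -
  note D = differentiable_has_frechet_derivative[OF d]
  show ?thesis unfolding coord_deriv_def
    by (rule alt_sum_forms)
      (use has_derivative_forms[OF S \<omega> subspace_UNIV D] linear_frechet_derivative[OF d]
        in \<open>auto simp: linear_add linear_cmul\<close>)
qed

text \<open>The terms with second derivatives of \<open>\<phi>\<close> cancel, as these are symmetric.\<close>
lemma coord_deriv_pull:
  fixes \<omega>' :: "'e::euclidean_space \<Rightarrow> 'e form"
  assumes S': "open S'" "\<phi> x0 \<in> S'" and \<omega>': "\<And>y. y \<in> S' \<Longrightarrow> \<omega>' y \<in> forms UNIV k"
    and d': "\<And>us. (\<lambda>y. \<omega>' y us) differentiable (at (\<phi> x0))"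
    and S: "open S" "x0 \<in> S" and \<phi>: "\<And>x. x \<in> S \<Longrightarrow> \<phi> x \<in> S'"
    and J: "(\<phi> has_derivative J x0) (at x0)" "\<And>v. ((\<lambda>x. J x v) has_derivative J' v) (at x0)"
    and sym: "\<And>u v. J' u v = J' v u"
    and \<omega>: "\<And>x us. x \<in> S \<Longrightarrow> \<omega> x us = \<omega>' (\<phi> x) (map (J x) us)"
  shows "(\<lambda>x. \<omega> x us) differentiable (at x0)"
    and "coord_deriv \<omega> x0 = pull (J x0) (coord_deriv \<omega>' (\<phi> x0))"
proof -
  let ?D = "\<lambda>us. frechet_derivative (\<lambda>y. \<omega>' y us) (at (\<phi> x0))"
  let ?Q = "\<lambda>us v. \<Sum>j<length us. \<omega>' (\<phi> x0) ((map (J x0) us)[j := J' (us ! j) v])"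
  have c: "((\<lambda>x. \<omega>' (\<phi> x) us) has_derivative (\<lambda>v. ?D us (J x0 v))) (at x0)" for us
    using has_derivative_compose[OF J(1), of "\<lambda>y. \<omega>' y us"] differentiable_has_frechet_derivative[OF d']
    by blast
  have "((\<lambda>x. \<omega>' (\<phi> x) (map (J x) us)) has_derivative
      (\<lambda>v. ?D (map (J x0) us) (J x0 v) + ?Q us v)) (at x0)" for us
    by (rule has_derivative_multilinear[OF S _ c J(2)]) (use \<omega>' \<phi> in auto)
  then have d: "((\<lambda>x. \<omega> x us) has_derivative (\<lambda>v. ?D (map (J x0) us) (J x0 v) + ?Q us v)) (at x0)" for us
    by (rule has_derivative_transform_within_open[OF _ S]) (simp add: \<omega>)
  show "(\<lambda>x. \<omega> x us) differentiable (at x0)" using d by (rule differentiableI)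
  have "alt_sum (\<lambda>w vs. ?Q vs w) us = 0" for us
    by (rule alt_sum_symmetric_slot[OF \<omega>'[OF S'(2)] sym])
  moreover have "coord_deriv \<omega> x0 us = alt_sum (\<lambda>w vs. ?D (map (J x0) vs) (J x0 w)) us + alt_sum (\<lambda>w vs. ?Q vs w) us" for us
    unfolding coord_deriv_eq[OF d] by (simp add: alt_sum_def distrib_left sum.distrib)
  ultimately have "coord_deriv \<omega> x0 us = alt_sum (\<lambda>w vs. ?D (map (J x0) vs) (J x0 w)) us" for us
    by simp
  then show "coord_deriv \<omega> x0 = pull (J x0) (coord_deriv \<omega>' (\<phi> x0))"
    by (auto simp: coord_deriv_def pull_def alt_sum_def take_map drop_map)
qed


section \<open>Covectors, bivectors and coordinates in a basis\<close>

section \<open>Covectors and bivectors\<close>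

definition covec :: "('e \<Rightarrow> real) \<Rightarrow> 'e form" where
  "covec f us = (case us of [u] \<Rightarrow> f u | _ \<Rightarrow> 0)"

lemma covec_single [simp]: "covec f [u] = f u"
  by (simp add: covec_def)

lemma covec_Nil [simp]: "covec f [] = 0"
  by (simp add: covec_def)

lemma covec_Cons_Cons [simp]: "covec f (u # v # us) = 0"
  by (simp add: covec_def)

lemma covec_forms:
  assumes "linear f"
  shows "covec f \<in> forms UNIV 1"
proof -
  have "covec f \<in> forms UNIV (Suc 0)"
    by (rule formsI_Cons)
      (use assms in \<open>auto simp: covec_def interior_prod_def forms_0_iff linear_add linear_cmul split: list.splits\<close>)
  then show ?thesis by simp
qed

lemma forms_1_covec:
  assumes "\<alpha> \<in> forms UNIV 1"
  shows "\<alpha> = covec (\<lambda>u. \<alpha> [u])" "linear (\<lambda>u. \<alpha> [u])"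
proof -
  show "\<alpha> = covec (\<lambda>u. \<alpha> [u])"
    using forms_eq_0[OF assms] by (auto simp: covec_def split: list.splits)
  show "linear (\<lambda>u. \<alpha> [u])" by (rule forms_linear_Cons[OF assms])
qed

lemma covector_sum:
  "\<alpha> \<in> forms UNIV 1 \<Longrightarrow> \<alpha> [\<Sum>i\<in>I. c i *\<^sub>R v i] = (\<Sum>i\<in>I. c i * \<alpha> [v i])"
  using forms_sum[of \<alpha> UNIV 1 I v "[]" c "[]"] by simp

lemma covector_add: "\<alpha> \<in> forms UNIV 1 \<Longrightarrow> \<alpha> [u + v] = \<alpha> [u] + \<alpha> [v]"
  using linear_add[OF forms_1_covec(2), of \<alpha> u v] by simp

lemma covector_diff: "\<alpha> \<in> forms UNIV 1 \<Longrightarrow> \<alpha> [u - v] = \<alpha> [u] - \<alpha> [v]"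
  using linear_diff[OF forms_1_covec(2), of \<alpha> u v] by simp

lemma covector_eqI:
  assumes "\<alpha> \<in> forms UNIV 1" "\<beta> \<in> forms UNIV 1" "\<And>u. \<alpha> [u] = \<beta> [u]"
  shows "\<alpha> = \<beta>"
  by (subst forms_1_covec(1)[OF assms(1)], subst forms_1_covec(1)[OF assms(2)]) (simp only: assms(3))

lemma pull_covec: "pull L (covec f) = covec (\<lambda>u. f (L u))"
  by (auto simp: pull_def covec_def split: list.splits)

lemma bivector_lincomb_left:
  assumes "is_bivector B" "\<alpha> \<in> forms UNIV 1" "\<beta> \<in> forms UNIV 1" "\<eta> \<in> forms UNIV 1"
  shows "B (\<lambda>us. a * \<alpha> us + b * \<beta> us) \<eta> = a * B \<alpha> \<eta> + b * B \<beta> \<eta>"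
    and "B \<eta> (\<lambda>us. a * \<alpha> us + b * \<beta> us) = a * B \<eta> \<alpha> + b * B \<eta> \<beta>"
  using assms by (auto simp: is_bivector_def)

lemma bivector_self: "is_bivector B \<Longrightarrow> \<alpha> \<in> forms UNIV 1 \<Longrightarrow> B \<alpha> \<alpha> = 0"
  by (simp add: is_bivector_def)

lemma bivector_antisym:
  assumes "is_bivector B" "\<alpha> \<in> forms UNIV 1" "\<beta> \<in> forms UNIV 1"
  shows "B \<alpha> \<beta> = - B \<beta> \<alpha>"
proof -
  let ?s = "\<lambda>us. 1 * \<alpha> us + 1 * \<beta> us"
  have s: "?s \<in> forms UNIV 1" using assms forms_lincomb by blast
  have "0 = B ?s ?s" using bivector_self[OF assms(1) s] by simp
  also have "\<dots> = B \<alpha> ?s + B \<beta> ?s" using bivector_lincomb_left(1)[OF assms s, of 1 1] by simp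
  also have "\<dots> = B \<alpha> \<beta> + B \<beta> \<alpha>"
    using bivector_lincomb_left(2)[OF assms(1,2,3,2), of 1 1] bivector_lincomb_left(2)[OF assms(1,2,3,3), of 1 1]
      bivector_self[OF assms(1)] assms by simp
  finally show ?thesis by simp
qed

lemma bivector_sum_right:
  assumes "is_bivector B" "\<eta> \<in> forms UNIV 1" "\<And>i. i \<in> I \<Longrightarrow> \<alpha> i \<in> forms UNIV 1"
  shows "B \<eta> (\<lambda>us. \<Sum>i\<in>I. c i * \<alpha> i us) = (\<Sum>i\<in>I. c i * B \<eta> (\<alpha> i))"
  using assms(3)
proof (induction I rule: infinite_finite_induct)
  case (insert i I)
  have "(\<lambda>us. \<Sum>i\<in>I. c i * \<alpha> i us) \<in> forms UNIV 1" using insert by (intro forms_sum_mem) auto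
  then show ?case
    using bivector_lincomb_left(2)[OF assms(1) _ _ assms(2), of "\<alpha> i" "\<lambda>us. \<Sum>i\<in>I. c i * \<alpha> i us" "c i" 1] insert
    by simp
next
  case empty
  show ?case using bivector_lincomb_left(2)[OF assms(1) assms(2) assms(2) assms(2), of 0 0] by simp
next
  case infinite
  then show ?case using bivector_lincomb_left(2)[OF assms(1) assms(2) assms(2) assms(2), of 0 0] by simp
qed

lemma bivector_sum_left:
  assumes "is_bivector B" "\<eta> \<in> forms UNIV 1" "\<And>i. i \<in> I \<Longrightarrow> \<alpha> i \<in> forms UNIV 1"
  shows "B (\<lambda>us. \<Sum>i\<in>I. c i * \<alpha> i us) \<eta> = (\<Sum>i\<in>I. c i * B (\<alpha> i) \<eta>)"
proof -
  have "(\<lambda>us. \<Sum>i\<in>I. c i * \<alpha> i us) \<in> forms UNIV 1" using assms by (intro forms_sum_mem) auto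
  then have "B (\<lambda>us. \<Sum>i\<in>I. c i * \<alpha> i us) \<eta> = - B \<eta> (\<lambda>us. \<Sum>i\<in>I. c i * \<alpha> i us)"
    using bivector_antisym assms by blast
  also have "\<dots> = (\<Sum>i\<in>I. c i * (- B \<eta> (\<alpha> i)))"
    using bivector_sum_right[OF assms(1,2,3)] by (simp add: sum_negf)
  also have "\<dots> = (\<Sum>i\<in>I. c i * B (\<alpha> i) \<eta>)"
    by (rule sum.cong[OF refl]) (use bivector_antisym[OF assms(1,2) assms(3)] in simp)
  finally show ?thesis .
qed

text \<open>A basis enumerated by natural numbers, with its coordinate functionals; the enumeration
  lets a splitting of the space be written as \<open>i < h\<close> against
  \<open>h \<le> i\<close>.\<close>

locale dual_basis =
  fixes n :: nat and b :: "nat \<Rightarrow> 'e::euclidean_space" and d :: "nat \<Rightarrow> 'e \<Rightarrow> real"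
  assumes d_linear: "i < n \<Longrightarrow> linear (d i)"
    and d_b: "i < n \<Longrightarrow> j < n \<Longrightarrow> d i (b j) = (if i = j then 1 else 0)"
    and expand: "(\<Sum>i<n. d i v *\<^sub>R b i) = v"
begin

lemma d_forms: "i < n \<Longrightarrow> covec (d i) \<in> forms UNIV 1"
  using covec_forms d_linear by blast

lemma d_eqI: "(\<And>i. i < n \<Longrightarrow> d i u = d i v) \<Longrightarrow> u = v"
proof -
  assume "\<And>i. i < n \<Longrightarrow> d i u = d i v"
  then have "(\<Sum>i<n. d i u *\<^sub>R b i) = (\<Sum>i<n. d i v *\<^sub>R b i)" by simp
  then show "u = v" by (simp only: expand)
qed

lemma d_sum: "i < n \<Longrightarrow> d i (\<Sum>j\<in>I. c j *\<^sub>R v j) = (\<Sum>j\<in>I. c j * d i (v j))"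
  using d_linear[of i] by (simp add: linear_sum linear_cmul)

lemma d_sum_b: "i < n \<Longrightarrow> d i (\<Sum>j<n. c j *\<^sub>R b j) = c i"
  by (simp add: d_sum d_b if_distrib cong: if_cong)

lemma linear_expand:
  assumes "linear f"
  shows "f v = (\<Sum>i<n. d i v *\<^sub>R f (b i))"
proof -
  have "f v = f (\<Sum>i<n. d i v *\<^sub>R b i)" by (simp only: expand)
  also have "\<dots> = (\<Sum>i<n. d i v *\<^sub>R f (b i))" using assms by (simp add: linear_sum linear_cmul)
  finally show ?thesis .
qed

lemma forms_expand:
  assumes "\<omega> \<in> forms UNIV k"
  shows "\<omega> (xs @ v # ys) = (\<Sum>i<n. d i v * \<omega> (xs @ b i # ys))"
  using linear_expand[OF forms_linear[OF assms, of xs ys], of v] by simp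

lemma covec_expand:
  assumes "\<alpha> \<in> forms UNIV 1"
  shows "\<alpha> = (\<lambda>us. \<Sum>i<n. \<alpha> [b i] * covec (d i) us)"
proof
  fix us
  show "\<alpha> us = (\<Sum>i<n. \<alpha> [b i] * covec (d i) us)"
  proof (cases "\<exists>u. us = [u]")
    case True
    then obtain u where "us = [u]" by blast
    then show ?thesis using forms_expand[OF assms, of "[]" u "[]"] by (simp add: mult.commute)
  next
    case False
    then have "length us \<noteq> 1" by (metis One_nat_def length_0_conv length_Suc_conv)
    then show ?thesis using forms_eq_0[OF assms, of us] forms_eq_0[OF d_forms, of _ us] by simp
  qed
qed

lemma bivector_expand_right:
  assumes "is_bivector B" "\<alpha> \<in> forms UNIV 1" "\<beta> \<in> forms UNIV 1"
  shows "B \<alpha> \<beta> = (\<Sum>i<n. \<beta> [b i] * B \<alpha> (covec (d i)))"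
  by (subst (1) covec_expand[OF assms(3)], rule bivector_sum_right[OF assms(1,2)]) (use d_forms in simp)

lemma bivector_expand_left:
  assumes "is_bivector B" "\<alpha> \<in> forms UNIV 1" "\<beta> \<in> forms UNIV 1"
  shows "B \<alpha> \<beta> = (\<Sum>i<n. \<alpha> [b i] * B (covec (d i)) \<beta>)"
  by (subst (1) covec_expand[OF assms(2)], rule bivector_sum_left[OF assms(1,3)]) (use d_forms in simp)

lemma sharp_eqI:
  fixes B :: "'e bivec"
  assumes "\<And>\<beta>. \<beta> \<in> forms UNIV 1 \<Longrightarrow> \<beta> [v] = B \<alpha> \<beta>"
  shows "sharp B \<alpha> = v"
  unfolding sharp_def
proof (rule the_equality)
  show "\<forall>\<beta>\<in>forms UNIV 1. \<beta> [v] = B \<alpha> \<beta>" using assms by blast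
  show "w = v" if "\<forall>\<beta>\<in>forms UNIV 1. \<beta> [w] = B \<alpha> \<beta>" for w
  proof (rule d_eqI)
    fix i assume "i < n"
    then show "d i w = d i v" using that assms d_forms[of i] by (metis covec_single)
  qed
qed

lemma sharp_expand:
  assumes "is_bivector B" "\<alpha> \<in> forms UNIV 1"
  shows "sharp B \<alpha> = (\<Sum>m<n. B \<alpha> (covec (d m)) *\<^sub>R b m)"
proof (rule sharp_eqI)
  fix \<beta> :: "'e form" assume \<beta>: "\<beta> \<in> forms UNIV 1"
  have "\<beta> [\<Sum>m<n. B \<alpha> (covec (d m)) *\<^sub>R b m] = (\<Sum>m<n. B \<alpha> (covec (d m)) * \<beta> [b m])"
    by (rule covector_sum[OF \<beta>])
  then show "\<beta> [\<Sum>m<n. B \<alpha> (covec (d m)) *\<^sub>R b m] = B \<alpha> \<beta>"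
    using bivector_expand_right[OF assms \<beta>] by (simp add: mult.commute)
qed

text \<open>The vector with the coordinates of \<open>sharp_expand\<close> satisfies the description
  in \<open>sharp\<close> for all covectors, so \<open>sharp\<close> may be used through its
  defining property.\<close>

lemma covec_sharp:
  fixes B :: "'e bivec"
  assumes "is_bivector B" "\<alpha> \<in> forms UNIV 1" "\<beta> \<in> forms UNIV 1"
  shows "\<beta> [sharp B \<alpha>] = B \<alpha> \<beta>"
proof -
  have "\<beta> [\<Sum>m<n. B \<alpha> (covec (d m)) *\<^sub>R b m] = (\<Sum>m<n. B \<alpha> (covec (d m)) * \<beta> [b m])"
    by (rule covector_sum[OF assms(3)])
  then show ?thesis
    using bivector_expand_right[OF assms] by (simp add: sharp_expand[OF assms(1,2)] mult.commute)
qed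

end

text \<open>Coefficients are chosen arbitrarily for each vector; uniqueness forces them to be linear
  functionals.\<close>

lemma dual_basisI:
  fixes E :: "nat \<Rightarrow> 'e::euclidean_space"
  assumes ex: "\<And>v. \<exists>c. v = (\<Sum>i<n. c i *\<^sub>R E i)"
    and uniq: "\<And>c i. (\<Sum>i<n. c i *\<^sub>R E i) = 0 \<Longrightarrow> i < n \<Longrightarrow> c i = 0"
  shows "\<exists>e. dual_basis n E e"
proof -
  obtain C where C: "\<And>v. (\<Sum>i<n. C v i *\<^sub>R E i) = v" using ex by metis
  have U: "c i = c' i" if "(\<Sum>i<n. c i *\<^sub>R E i) = (\<Sum>i<n. c' i *\<^sub>R E i)" "i < n" for c c' i
    using uniq[of "\<lambda>i. c i - c' i" i] that by (simp add: scaleR_diff_left sum_subtractf)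
  have "dual_basis n E (\<lambda>i v. C v i)"
  proof (rule dual_basis.intro)
    fix i j assume i: "i < n"
    show "linear (\<lambda>v. C v i)"
    proof (rule linearI)
      fix u v
      have "(\<Sum>i<n. C (u + v) i *\<^sub>R E i) = (\<Sum>i<n. (C u i + C v i) *\<^sub>R E i)"
        by (simp add: C scaleR_add_left sum.distrib)
      from U[OF this i] show "C (u + v) i = C u i + C v i" .
    next
      fix r v
      have "(\<Sum>i<n. C (r *\<^sub>R v) i *\<^sub>R E i) = r *\<^sub>R (\<Sum>i<n. C v i *\<^sub>R E i)"
        by (simp add: C)
      then have "(\<Sum>i<n. C (r *\<^sub>R v) i *\<^sub>R E i) = (\<Sum>i<n. (r * C v i) *\<^sub>R E i)"
        by (simp add: scaleR_sum_right)
      from U[OF this i] show "C (r *\<^sub>R v) i = r *\<^sub>R C v i" by simp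
    qed
    assume j: "j < n"
    have "(\<Sum>i<n. (if i = j then 1 else 0) *\<^sub>R E i) = (\<Sum>i<n. if i = j then E i else 0)"
      by (intro sum.cong) auto
    then have "(\<Sum>i<n. C (E j) i *\<^sub>R E i) = (\<Sum>i<n. (if i = j then 1 else 0) *\<^sub>R E i)"
      using j C[of "E j"] by simp
    from U[OF this i] show "C (E j) i = (if i = j then 1 else 0)" .
  next
    show "(\<Sum>i<n. C v i *\<^sub>R E i) = v" for v by (rule C)
  qed
  then show ?thesis by blast
qed

section \<open>Linear algebra of a coupling bivector at one point\<close>

section \<open>The coupling condition at a point\<close>

text \<open>The first \<open>h\<close> coordinate functionals cut out the vertical space
  \<open>W\<close>, so the corresponding covectors span its annihilator and their images
  \<open>X i\<close> under \<open>sharp\<close> span the horizontal space. The \<open>b i\<close>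
  with \<open>i < h\<close> only span some complement of \<open>W\<close>, which in general is not
  the horizontal space.\<close>

locale coupling_point = dual_basis n b d
  for n :: nat and b :: "nat \<Rightarrow> 'e::euclidean_space" and d +
  fixes h :: nat and W :: "'e set" and B :: "'e bivec"
  assumes h_le: "h \<le> n" and W_iff: "v \<in> W \<longleftrightarrow> (\<forall>i<h. d i v = 0)"
    and B: "is_bivector B"
    and H_inter: "sharp B ` ann_forms W 1 \<inter> W = {0}"
    and H_plus: "\<exists>u\<in>sharp B ` ann_forms W 1. \<exists>w\<in>W. v = u + w"
begin

definition X :: "nat \<Rightarrow> 'e" where "X i = sharp B (covec (d i))"

lemma W_subspace: "subspace W"
  using d_linear h_le by (auto simp: subspace_def W_iff linear_0 linear_add linear_cmul)

lemma b_in_W: "h \<le> a \<Longrightarrow> a < n \<Longrightarrow> b a \<in> W"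
  using d_b h_le by (auto simp: W_iff)

lemma W_expand: "w \<in> W \<Longrightarrow> w = (\<Sum>a\<in>{h..<n}. d a w *\<^sub>R b a)"
proof -
  assume w: "w \<in> W"
  have "w = (\<Sum>i<n. d i w *\<^sub>R b i)" by (simp only: expand)
  also have "\<dots> = (\<Sum>i\<in>{h..<n}. d i w *\<^sub>R b i)"
    by (rule sum.mono_neutral_right) (use w W_iff in auto)
  finally show ?thesis .
qed

lemma dX: "j < n \<Longrightarrow> i < n \<Longrightarrow> d j (X i) = B (covec (d i)) (covec (d j))"
  using covec_sharp[OF B d_forms d_forms, of i j] by (simp add: X_def)

lemma X_expand: "i < n \<Longrightarrow> X i = (\<Sum>m<n. B (covec (d i)) (covec (d m)) *\<^sub>R b m)"
  by (simp add: X_def sharp_expand[OF B d_forms])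

lemma d_ann: "i < h \<Longrightarrow> covec (d i) \<in> ann_forms W 1"
  using d_forms[of i] h_le W_iff by (auto simp: ann_forms_def covec_def split: list.splits)

lemma ann_expand:
  assumes "\<alpha> \<in> ann_forms W 1"
  shows "\<alpha> = (\<lambda>us. \<Sum>i<h. \<alpha> [b i] * covec (d i) us)"
proof -
  have \<alpha>: "\<alpha> \<in> forms UNIV 1" "\<alpha> [b a] = 0" if "h \<le> a" "a < n" for a
    using assms b_in_W[OF that] by (auto simp: ann_forms_def)
  have "\<alpha> \<in> forms UNIV 1" using assms by (auto simp: ann_forms_def)
  from covec_expand[OF this] have "\<alpha> us = (\<Sum>i<n. \<alpha> [b i] * covec (d i) us)" for us by metis
  also have "(\<Sum>i<n. \<alpha> [b i] * covec (d i) us) = (\<Sum>i<h. \<alpha> [b i] * covec (d i) us)" for us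
    by (rule sum.mono_neutral_right) (use h_le \<alpha> in auto)
  finally show ?thesis by blast
qed

lemma sharp_ann:
  assumes "\<alpha> \<in> ann_forms W 1"
  shows "sharp B \<alpha> = (\<Sum>i<h. \<alpha> [b i] *\<^sub>R X i)"
proof (rule sharp_eqI)
  fix \<beta> :: "'e form" assume \<beta>: "\<beta> \<in> forms UNIV 1"
  have "B \<alpha> \<beta> = (\<Sum>i<h. \<alpha> [b i] * B (covec (d i)) \<beta>)"
    by (subst (1) ann_expand[OF assms], rule bivector_sum_left[OF B \<beta>]) (use h_le d_forms in auto)
  moreover have "\<beta> [X i] = B (covec (d i)) \<beta>" if "i < h" for i
    unfolding X_def by (rule covec_sharp[OF B d_forms \<beta>]) (use that h_le in auto)
  ultimately show "\<beta> [\<Sum>i<h. \<alpha> [b i] *\<^sub>R X i] = B \<alpha> \<beta>"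
    by (simp add: covector_sum[OF \<beta>])
qed

lemma X_in_H: "i < h \<Longrightarrow> X i \<in> sharp B ` ann_forms W 1"
  using d_ann by (auto simp: X_def)

text \<open>Injectivity of \<open>sharp\<close> on the annihilator: if its image is 0, \<alpha>
  vanishes on all horizontal vectors by antisymmetry, and it vanishes on \<open>W\<close> anyway;
  both spaces together span.\<close>

lemma ann_eq_0:
  assumes \<alpha>: "\<alpha> \<in> ann_forms W 1" "sharp B \<alpha> = 0"
  shows "\<alpha> [u] = 0"
proof -
  have f: "\<alpha> \<in> forms UNIV 1" using \<alpha> by (simp add: ann_forms_def)
  obtain \<beta> w where u: "u = sharp B \<beta> + w" "\<beta> \<in> ann_forms W 1" "w \<in> W" using H_plus[of u] by blast
  have g: "\<beta> \<in> forms UNIV 1" using u by (simp add: ann_forms_def)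
  have "\<alpha> [sharp B \<beta>] = - \<beta> [sharp B \<alpha>]"
    using covec_sharp[OF B g f] covec_sharp[OF B f g] bivector_antisym[OF B g f] by simp
  moreover have "\<beta> [0] = 0" using forms_zero_arg[OF g subspace_UNIV, of "[]" "[]"] by simp
  moreover have "\<alpha> [w] = 0" using \<alpha> u by (simp add: ann_forms_def)
  ultimately show ?thesis
    unfolding u(1) covector_add[OF f] using \<alpha>(2) by simp
qed

definition ann_comb :: "(nat \<Rightarrow> real) \<Rightarrow> 'e form" where
  "ann_comb c = (\<lambda>us. \<Sum>i<h. c i * covec (d i) us)"

lemma ann_comb_ann: "ann_comb c \<in> ann_forms W 1"
proof -
  have "ann_comb c \<in> forms UNIV 1"
    unfolding ann_comb_def by (rule forms_sum_mem) (use d_forms h_le in auto)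
  moreover have "ann_comb c us = 0" if "set us \<inter> W \<noteq> {}" for us
  proof -
    have "covec (d i) us = 0" if "i < h" for i
      using d_ann[OF that] \<open>set us \<inter> W \<noteq> {}\<close> unfolding ann_forms_def by blast
    then show ?thesis by (simp add: ann_comb_def)
  qed
  ultimately show ?thesis unfolding ann_forms_def by blast
qed

lemma ann_comb_b: "j < h \<Longrightarrow> ann_comb c [b j] = c j"
proof -
  assume j: "j < h"
  have "ann_comb c [b j] = (\<Sum>i<h. if i = j then c i else 0)"
    unfolding ann_comb_def by (rule sum.cong) (use j h_le in \<open>auto simp: d_b\<close>)
  then show ?thesis using j by simp
qed

lemma sharp_ann_comb: "sharp B (ann_comb c) = (\<Sum>i<h. c i *\<^sub>R X i)"
  unfolding sharp_ann[OF ann_comb_ann] by (rule sum.cong) (auto simp: ann_comb_b)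

lemma X_independent:
  assumes "(\<Sum>i<h. c i *\<^sub>R X i) \<in> W" "i < h"
  shows "c i = 0"
proof -
  have "sharp B (ann_comb c) \<in> sharp B ` ann_forms W 1 \<inter> W"
    using ann_comb_ann assms(1) by (simp add: sharp_ann_comb[symmetric])
  then have "sharp B (ann_comb c) = 0" unfolding H_inter by simp
  then have "ann_comb c [b i] = 0" by (rule ann_eq_0[OF ann_comb_ann])
  then show ?thesis using ann_comb_b[OF assms(2)] by simp
qed

text \<open>Replacing only the first \<open>h\<close> vectors leaves the vertical part of the frame
  constant when the point moves in a chart, and with it the values of the dual frame on vertical
  basis vectors.\<close>

definition E :: "nat \<Rightarrow> 'e" where "E i = (if i < h then X i else b i)"

lemma E_sum: "(\<Sum>i<n. c i *\<^sub>R E i) = (\<Sum>i<h. c i *\<^sub>R X i) + (\<Sum>i\<in>{h..<n}. c i *\<^sub>R b i)"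
proof -
  have "(\<Sum>i<n. c i *\<^sub>R E i) = (\<Sum>i<h. c i *\<^sub>R E i) + (\<Sum>i\<in>{h..<n}. c i *\<^sub>R E i)"
    using h_le by (simp add: lessThan_atLeast0 sum.atLeastLessThan_concat)
  then show ?thesis by (simp add: E_def)
qed

lemma E_dual_basis: "\<exists>e. dual_basis n E e"
proof (rule dual_basisI)
  fix v
  obtain \<beta> w where u: "v = sharp B \<beta> + w" "\<beta> \<in> ann_forms W 1" "w \<in> W" using H_plus[of v] by blast
  have "v = (\<Sum>i<n. (if i < h then \<beta> [b i] else d i w) *\<^sub>R E i)"
    unfolding E_sum using u sharp_ann[OF u(2)] W_expand[OF u(3)] by simp
  then show "\<exists>c. v = (\<Sum>i<n. c i *\<^sub>R E i)"
    by (rule exI[of _ "\<lambda>i. if i < h then \<beta> [b i] else d i w"])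
next
  fix c :: "nat \<Rightarrow> real" and i assume z: "(\<Sum>i<n. c i *\<^sub>R E i) = 0" and i: "i < n"
  have w: "(\<Sum>i\<in>{h..<n}. c i *\<^sub>R b i) \<in> W"
    by (intro subspace_sum subspace_scale W_subspace) (use b_in_W in auto)
  have "(\<Sum>i<h. c i *\<^sub>R X i) = - (\<Sum>i\<in>{h..<n}. c i *\<^sub>R b i)"
    using z unfolding E_sum by (simp add: eq_neg_iff_add_eq_0)
  then have "(\<Sum>i<h. c i *\<^sub>R X i) \<in> W" using w W_subspace subspace_neg by metis
  then have c: "c j = 0" if "j < h" for j using X_independent that by blast
  then have "(\<Sum>i<n. c i *\<^sub>R b i) = (\<Sum>i<n. c i *\<^sub>R E i)"
    by (intro sum.cong) (auto simp: E_def)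
  then have "d i (\<Sum>i<n. c i *\<^sub>R b i) = 0" using z d_linear[OF i] by (simp add: linear_0)
  then show "c i = 0" using d_sum_b[OF i] by simp
qed

definition e :: "nat \<Rightarrow> 'e \<Rightarrow> real" where "e = (SOME e. dual_basis n E e)"

sublocale frame: dual_basis n E e
  unfolding e_def by (rule someI_ex[OF E_dual_basis])

lemma e_X: "j < n \<Longrightarrow> i < h \<Longrightarrow> e j (X i) = (if j = i then 1 else 0)"
  using frame.d_b[of j i] h_le by (simp add: E_def)

lemma e_b: "j < n \<Longrightarrow> h \<le> a \<Longrightarrow> a < n \<Longrightarrow> e j (b a) = (if j = a then 1 else 0)"
  using frame.d_b[of j a] h_le by (simp add: E_def)

lemma e_W: "w \<in> W \<Longrightarrow> i < h \<Longrightarrow> e i w = 0"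
proof -
  assume w: "w \<in> W" and i: "i < h"
  have "e i w = (\<Sum>a\<in>{h..<n}. d a w * e i (b a))"
    by (subst W_expand[OF w]) (use frame.d_sum[of i] i h_le in simp)
  also have "\<dots> = 0" using e_b i h_le by (intro sum.neutral) auto
  finally show ?thesis .
qed

definition proj :: "'e \<Rightarrow> 'e" where "proj v = (\<Sum>a\<in>{h..<n}. e a v *\<^sub>R b a)"

lemma proj_linear: "linear proj"
proof (rule linearI)
  show "proj (u + v) = proj u + proj v" for u v
    unfolding proj_def sum.distrib[symmetric]
    by (rule sum.cong) (use frame.d_linear in \<open>auto simp: linear_add scaleR_add_left\<close>)
  show "proj (r *\<^sub>R v) = r *\<^sub>R proj v" for r v
    unfolding proj_def scaleR_sum_right
    by (rule sum.cong) (use frame.d_linear in \<open>auto simp: linear_cmul\<close>)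
qed

lemma proj_in_W: "proj v \<in> W"
  unfolding proj_def by (intro subspace_sum subspace_scale W_subspace) (use b_in_W in auto)

lemma diff_proj: "v - proj v = (\<Sum>i<h. e i v *\<^sub>R X i)"
  using frame.expand[of v] unfolding E_sum proj_def by (simp add: algebra_simps)

lemma H_eq: "sharp B ` ann_forms W 1 = {v. proj v = 0}"
proof (intro equalityI subsetI)
  fix v assume "v \<in> sharp B ` ann_forms W 1"
  then obtain \<alpha> where v: "v = (\<Sum>i<h. \<alpha> [b i] *\<^sub>R X i)" using sharp_ann by auto
  have "e a v = 0" if "a \<in> {h..<n}" for a
  proof -
    have "e a v = (\<Sum>i<h. \<alpha> [b i] * e a (X i))" unfolding v using that by (simp add: frame.d_sum)
    also have "\<dots> = 0" using that by (intro sum.neutral) (auto simp: e_X)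
    finally show ?thesis .
  qed
  then show "v \<in> {v. proj v = 0}" by (simp add: proj_def)
next
  fix v assume "v \<in> {v. proj v = 0}"
  then have v: "v = (\<Sum>i<h. e i v *\<^sub>R X i)" using diff_proj[of v] by simp
  have "sharp B (ann_comb (\<lambda>i. e i v)) = v" unfolding sharp_ann_comb by (rule v[symmetric])
  then show "v \<in> sharp B ` ann_forms W 1" by (metis ann_comb_ann imageI)
qed

lemma diff_proj_linear: "linear (\<lambda>v. v - proj v)"
  using proj_linear by (intro linear_compose_sub linear_ident) auto

lemma proj_W: "w \<in> W \<Longrightarrow> proj w = w"
proof -
  assume w: "w \<in> W"
  have "w - proj w = 0" unfolding diff_proj using e_W[OF w] by simp
  then show ?thesis by simp
qed

lemma proj_diff_proj: "proj (v - proj v) = 0"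
  using proj_W[OF proj_in_W] proj_linear by (simp add: linear_diff)

end

locale coupling_point_of = coupling_point n b d h W "\<Psi> p"
  for n b d h W and \<Psi> :: "'a \<Rightarrow> 'e::euclidean_space bivec" and p +
  fixes V H assumes V: "V p = W" and H: "H = coupling_normal V \<Psi>"
begin

lemma Hp: "H p = {v. proj v = 0}"
  using H_eq by (simp add: H coupling_normal_def V)

lemma connection_form_eq: "connection_form H V p = proj"
proof
  fix v
  show "connection_form H V p v = proj v"
    unfolding connection_form_def V Hp
  proof (rule the_equality)
    show "proj v \<in> W \<and> v - proj v \<in> {v. proj v = 0}" using proj_in_W proj_diff_proj by simp
    show "w = proj v" if "w \<in> W \<and> v - w \<in> {v. proj v = 0}" for w
      using that proj_W[of w] proj_linear by (simp add: linear_diff)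
  qed
qed

text \<open>For uniqueness the arguments are replaced by their projections one by one: the
  difference \<open>u - proj u\<close> is horizontal, and there a competing \<omega> vanishes.
  Vertical arguments remain, on which \<omega> is prescribed.\<close>

lemma vertical_ext_eq:
  assumes \<tau>: "\<tau> p \<in> forms W (dim W)"
  shows "vertical_ext H V \<tau> p = pull proj (\<tau> p)"
  unfolding vertical_ext_def V
proof (rule the_equality)
  have f: "pull proj (\<tau> p) \<in> forms UNIV (dim W)"
    by (rule pull_forms_range[OF proj_linear _ W_subspace \<tau>]) (use proj_in_W in auto)
  have "pull proj (\<tau> p) us = 0" if ne: "set us \<inter> H p \<noteq> {}" for us
  proof -
    obtain u where u: "u \<in> set us" "proj u = 0" using ne Hp by auto
    then obtain xs ys where "us = xs @ u # ys" by (meson split_list)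
    then show ?thesis using u forms_zero_arg[OF \<tau> W_subspace] by (simp add: pull_def)
  qed
  moreover have "pull proj (\<tau> p) us = \<tau> p us" if "set us \<subseteq> W" for us
  proof -
    have "map proj us = us" using that proj_W by (intro map_idI) auto
    then show ?thesis by (simp add: pull_def)
  qed
  ultimately show "pull proj (\<tau> p) \<in> ann_forms (H p) (dim W) \<and> (\<forall>us. set us \<subseteq> W \<longrightarrow> pull proj (\<tau> p) us = \<tau> p us)"
    using f by (auto simp: ann_forms_def)
  show "\<omega> = pull proj (\<tau> p)"
    if \<omega>: "\<omega> \<in> ann_forms (H p) (dim W) \<and> (\<forall>us. set us \<subseteq> W \<longrightarrow> \<omega> us = \<tau> p us)" for \<omega>
  proof
    fix us
    have wf: "\<omega> \<in> forms UNIV (dim W)" and wz: "\<And>us. set us \<inter> H p \<noteq> {} \<Longrightarrow> \<omega> us = 0"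
      using \<omega> by (auto simp: ann_forms_def)
    have "\<omega> (xs @ us) = \<omega> (xs @ map proj us)" for xs
    proof (induction us arbitrary: xs)
      case (Cons u us)
      have "\<omega> (xs @ u # us) = \<omega> (xs @ (proj u + (u - proj u)) # us)" by simp
      also have "\<dots> = \<omega> (xs @ proj u # us) + \<omega> (xs @ (u - proj u) # us)"
        by (rule forms_add[OF wf subspace_UNIV]) auto
      also have "\<omega> (xs @ (u - proj u) # us) = 0" using proj_diff_proj Hp by (intro wz) auto
      also have "\<omega> (xs @ proj u # us) = \<omega> ((xs @ [proj u]) @ map proj us)"
        using Cons.IH[of "xs @ [proj u]"] by simp
      finally show ?case by simp
    qed simp
    from this[of "[]"] have "\<omega> us = \<omega> (map proj us)" by simp
    moreover have "set (map proj us) \<subseteq> W" using proj_in_W by auto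
    ultimately show "\<omega> us = pull proj (\<tau> p) us" using \<omega> by (simp add: pull_def)
  qed
qed

text \<open>Explicit candidate for the coupling form, minus the sum of the tensor products of
  \<open>e i\<close> and \<open>d i\<close>. It sends \<open>X i\<close> to \<open>- d i\<close>, as
  the inverse of the sharp map requires; its antisymmetry is not visible and has to come from that
  of the bivector.\<close>

definition sig :: "'e form" where
  "sig us = (case us of [u, v] \<Rightarrow> - (\<Sum>i<h. e i u * d i v) | _ \<Rightarrow> 0)"

lemma sig_pair [simp]: "sig [u, v] = - (\<Sum>i<h. e i u * d i v)"
  by (simp add: sig_def)

lemma sig_X: "i < h \<Longrightarrow> sig [X i, v] = - d i v"
proof -
  assume i: "i < h"
  have "(\<Sum>j<h. e j (X i) * d j v) = (\<Sum>j<h. if j = i then d j v else 0)"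
    using i h_le by (intro sum.cong) (auto simp: e_X)
  then show ?thesis using i by simp
qed

text \<open>For \<open>i < h\<close> the functional \<open>d i\<close> kills the vertical part of
  \<open>u\<close> and is therefore the combination of the \<open>e j\<close> with coefficients
  \<open>?p j i\<close>; the value becomes a quadratic expression with antisymmetric matrix.\<close>

lemma sig_alternating: "sig [u, u] = 0"
proof -
  let ?p = "\<lambda>i j. \<Psi> p (covec (d i)) (covec (d j))"
  have "d i u = (\<Sum>j<h. e j u * ?p j i)" if "i < h" for i
  proof -
    have i: "i < n" using that h_le by simp
    have "d i u = d i ((u - proj u) + proj u)" by simp
    also have "\<dots> = d i (u - proj u) + d i (proj u)" using d_linear[OF i] linear_add by blast
    also have "d i (proj u) = 0" using proj_in_W that W_iff by blast
    also have "d i (u - proj u) = (\<Sum>j<h. e j u * d i (X j))" unfolding diff_proj d_sum[OF i] ..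
    also have "\<dots> = (\<Sum>j<h. e j u * ?p j i)" using i h_le by (intro sum.cong) (auto simp: dX)
    finally show ?thesis by simp
  qed
  then have s: "sig [u, u] = - (\<Sum>i<h. \<Sum>j<h. e i u * e j u * ?p j i)"
    by (simp add: sum_distrib_left mult.assoc)
  have "(\<Sum>i<h. \<Sum>j<h. e i u * e j u * ?p j i) = (\<Sum>i<h. \<Sum>j<h. - (e j u * e i u * ?p i j))"
  proof (intro sum.cong refl)
    fix i j assume "i \<in> {..<h}" "j \<in> {..<h}"
    then have "?p j i = - ?p i j" by (intro bivector_antisym B d_forms) (use h_le in auto)
    then show "e i u * e j u * ?p j i = - (e j u * e i u * ?p i j)" by (simp only: mult_minus_right mult.commute)
  qed
  also have "\<dots> = - (\<Sum>j<h. \<Sum>i<h. e j u * e i u * ?p i j)"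
    by (subst sum.swap) (simp add: sum_negf)
  finally show ?thesis using s by simp
qed

lemma sig_ann: "sig \<in> ann_forms W 2"
proof -
  have "sig \<in> forms UNIV (Suc 1)"
  proof (rule formsI_Cons)
    have d: "linear (d i)" and e: "linear (e i)" if "i < h" for i
      using d_linear frame.d_linear h_le that by auto
    have "interior_prod u sig = covec (\<lambda>v. - (\<Sum>i<h. e i u * d i v))" for u
      by (auto simp: interior_prod_def sig_def covec_def split: list.splits)
    moreover have "linear (\<lambda>v. - (\<Sum>i<h. e i u * d i v))" for u
      using d by (intro linearI) (simp_all add: linear_add linear_cmul sum.distrib sum_distrib_left algebra_simps)
    ultimately show "interior_prod u sig \<in> forms UNIV 1" for u
      using covec_forms by metis
    show "sig ((a *\<^sub>R u + c *\<^sub>R v) # us) = a * sig (u # us) + c * sig (v # us)" for a u c v us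
      using e by (auto simp: sig_def linear_add linear_cmul sum.distrib sum_distrib_left algebra_simps split: list.splits)
    show "sig (u # u # us) = 0" for u us
      using sig_alternating by (cases us) (auto simp: sig_def)
  qed (auto simp: sig_def)
  then have "sig \<in> forms UNIV 2" by (simp add: numeral_2_eq_2)
  moreover have "sig us = 0" if "set us \<inter> W \<noteq> {}" for us
    using that e_W W_iff by (auto simp: sig_def split: list.splits intro!: sum.neutral)
  ultimately show ?thesis by (simp add: ann_forms_def)
qed

lemma ann_pull_diff:
  assumes "\<alpha> \<in> ann_forms W 1"
  shows "pull (\<lambda>v. v - proj v) \<alpha> = \<alpha>"
proof -
  have f: "\<alpha> \<in> forms UNIV 1" and z: "\<And>w. w \<in> W \<Longrightarrow> \<alpha> [w] = 0" using assms by (auto simp: ann_forms_def)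
  show ?thesis
  proof (rule covector_eqI[OF pull_forms[OF diff_proj_linear f] f])
    show "pull (\<lambda>v. v - proj v) \<alpha> [u] = \<alpha> [u]" for u
      by (simp add: pull_def covector_diff[OF f] z[OF proj_in_W])
  qed
qed

text \<open>The image of an annihilating covector is already horizontal, and the covector does not
  see vertical parts, so projecting both entries of the bivector changes nothing.\<close>

lemma sharp_horizontal_part:
  assumes "\<alpha> \<in> ann_forms W 1"
  shows "sharp (horizontal_part (connection_form H V) \<Psi> p) \<alpha> = sharp (\<Psi> p) \<alpha>"
proof (rule sharp_eqI)
  fix \<beta> :: "'e form" assume \<beta>: "\<beta> \<in> forms UNIV 1"
  have f: "\<alpha> \<in> forms UNIV 1" using assms by (simp add: ann_forms_def)
  have "horizontal_part (connection_form H V) \<Psi> p \<alpha> \<beta> = \<Psi> p \<alpha> (pull (\<lambda>v. v - proj v) \<beta>)"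
    by (simp add: horizontal_part_def connection_form_eq ann_pull_diff[OF assms])
  also have "\<dots> = \<beta> [sharp (\<Psi> p) \<alpha> - proj (sharp (\<Psi> p) \<alpha>)]"
    using covec_sharp[OF B f pull_forms[OF diff_proj_linear \<beta>]] by (simp add: pull_def)
  also have "proj (sharp (\<Psi> p) \<alpha>) = 0" using H_eq assms by blast
  finally show "\<beta> [sharp (\<Psi> p) \<alpha>] = horizontal_part (connection_form H V) \<Psi> p \<alpha> \<beta>" by simp
qed

text \<open>Injectivity of the sharp map on the annihilator makes \<open>inv_into\<close> a genuine
  inverse there. A competing form is prescribed on each \<open>X i\<close> and vanishes on
  \<open>W\<close>, and these vectors span.\<close>

lemma coupling_form_eq: "coupling_form V \<Psi> p = sig"
proof -
  let ?S = "sharp (horizontal_part (connection_form H V) \<Psi> p)"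
  have inj: "inj_on ?S (ann_forms W 1)"
  proof (rule inj_onI)
    fix \<alpha> \<beta> assume ab: "\<alpha> \<in> ann_forms W 1" "\<beta> \<in> ann_forms W 1" "?S \<alpha> = ?S \<beta>"
    have f: "\<alpha> \<in> forms UNIV 1" "\<beta> \<in> forms UNIV 1" using ab by (auto simp: ann_forms_def)
    let ?\<delta> = "\<lambda>us. \<alpha> us - \<beta> us"
    have \<delta>: "?\<delta> \<in> ann_forms W 1" using ab forms_diff by (auto simp: ann_forms_def)
    have "sharp (\<Psi> p) \<alpha> = sharp (\<Psi> p) \<beta>" using ab sharp_horizontal_part by simp
    then have "sharp (\<Psi> p) ?\<delta> = 0"
      unfolding sharp_ann[OF \<delta>] sharp_ann[OF ab(1)] sharp_ann[OF ab(2)]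
      by (simp add: scaleR_diff_left sum_subtractf)
    then have "\<alpha> [u] = \<beta> [u]" for u using ann_eq_0[OF \<delta>, of u] by simp
    then show "\<alpha> = \<beta>" by (rule covector_eqI[OF f])
  qed
  have inv: "inv_into (ann_forms W 1) ?S (sharp (\<Psi> p) \<alpha>) = \<alpha>" if "\<alpha> \<in> ann_forms W 1" for \<alpha>
    using inv_into_f_f[OF inj that] sharp_horizontal_part[OF that] by simp
  have HH: "H p = sharp (\<Psi> p) ` ann_forms W 1" by (simp add: H coupling_normal_def V)
  show ?thesis
    unfolding coupling_form_def Let_def H[symmetric] V
  proof (rule the_equality)
    have "interior_prod (sharp (\<Psi> p) \<alpha>) sig = (\<lambda>us. - \<alpha> us)" if \<alpha>: "\<alpha> \<in> ann_forms W 1" for \<alpha>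
    proof
      fix us
      have f: "\<alpha> \<in> forms UNIV 1" using \<alpha> by (simp add: ann_forms_def)
      have "e i (sharp (\<Psi> p) \<alpha>) = \<alpha> [b i]" if i: "i < h" for i
      proof -
        have "e i (sharp (\<Psi> p) \<alpha>) = (\<Sum>j<h. \<alpha> [b j] * e i (X j))"
          unfolding sharp_ann[OF \<alpha>] using frame.d_sum[of i] i h_le by simp
        also have "\<dots> = (\<Sum>j<h. if j = i then \<alpha> [b j] else 0)"
          using i h_le by (intro sum.cong) (auto simp: e_X)
        finally show ?thesis using i by simp
      qed
      then have "sig [sharp (\<Psi> p) \<alpha>, v] = - \<alpha> [v]" for v
        using fun_cong[OF ann_expand[OF \<alpha>], of "[v]"] by simp
      then show "interior_prod (sharp (\<Psi> p) \<alpha>) sig us = - \<alpha> us"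
        using forms_eq_0[OF f, of us] by (auto simp: interior_prod_def sig_def split: list.splits)
    qed
    then show "sig \<in> ann_forms W 2 \<and> (\<forall>h\<in>H p. interior_prod h sig = (\<lambda>us. - inv_into (ann_forms W 1) ?S h us))"
      using sig_ann inv HH by auto
    show "\<omega> = sig" if \<omega>: "\<omega> \<in> ann_forms W 2 \<and> (\<forall>h\<in>H p. interior_prod h \<omega> = (\<lambda>us. - inv_into (ann_forms W 1) ?S h us))" for \<omega>
    proof
      fix us
      have f: "\<omega> \<in> forms UNIV 2" and z: "\<And>us. set us \<inter> W \<noteq> {} \<Longrightarrow> \<omega> us = 0"
        using \<omega> by (auto simp: ann_forms_def)
      have x: "\<omega> [X i, v] = - d i v" if "i < h" for i v
      proof -
        have "interior_prod (X i) \<omega> [v] = - inv_into (ann_forms W 1) ?S (X i) [v]"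
          using \<omega> HH X_in_H[OF that] by auto
        then show ?thesis using inv[OF d_ann[OF that]] by (simp add: X_def interior_prod_def)
      qed
      have "\<omega> [u, v] = sig [u, v]" for u v
      proof -
        have "\<omega> [u, v] = \<omega> ([] @ ((u - proj u) + proj u) # [v])" by simp
        also have "\<dots> = \<omega> ([] @ (u - proj u) # [v]) + \<omega> ([] @ proj u # [v])"
          by (rule forms_add[OF f subspace_UNIV]) auto
        also have "\<omega> ([] @ proj u # [v]) = 0" using proj_in_W by (intro z) auto
        also have "\<omega> ([] @ (u - proj u) # [v]) = (\<Sum>i<h. e i u * \<omega> ([] @ X i # [v]))"
          unfolding diff_proj by (rule forms_sum[OF f subspace_UNIV]) auto
        also have "\<dots> = sig [u, v]" using x by (simp add: sum_negf)
        finally show ?thesis by simp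
      qed
      then show "\<omega> us = sig us"
        using forms_eq_0[OF f, of us] by (auto simp: sig_def split: list.splits)
    qed
  qed
qed

end


section \<open>Changes of charts, chart independence and foliated atlases\<close>

section \<open>Charts\<close>

lemma smooth_atlas_chart:
  assumes "smooth_atlas G" "c \<in> G"
  shows "open (cdom c)" "open (cran c)" "continuous_on (cdom c) (cmap c)"
    "continuous_on (cran c) (cinv c)" "\<And>p. p \<in> cdom c \<Longrightarrow> cinv c (cmap c p) = p"
    "\<And>x. x \<in> cran c \<Longrightarrow> cinv c x \<in> cdom c \<and> cmap c (cinv c x) = x"
  using assms unfolding smooth_atlas_def is_chart_def homeomorphism_def
  by (blast, blast, blast, blast, metis, metis imageI)

lemma chart_image_open:
  assumes G: "smooth_atlas G" "c \<in> G" and U: "open U" "U \<subseteq> cdom c"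
  shows "open (cmap c ` U)"
proof -
  note ch = smooth_atlas_chart[OF G]
  have "cmap c ` U = cran c \<inter> cinv c -` U"
  proof (intro equalityI subsetI)
    fix x assume "x \<in> cmap c ` U"
    then show "x \<in> cran c \<inter> cinv c -` U" using U(2) ch(5) by auto
  next
    fix x assume "x \<in> cran c \<inter> cinv c -` U"
    then show "x \<in> cmap c ` U" using ch(6) by (metis IntE imageI vimageE)
  qed
  then show ?thesis using ch(2,4) U(1) by (metis continuous_on_open_vimage Int_commute)
qed

lemma transition_smooth:
  assumes "smooth_atlas G" "c \<in> G" "c' \<in> G"
  shows "smooth_on (cmap c ` (cdom c \<inter> cdom c')) (cmap c' \<circ> cinv c)"
    and "open (cmap c ` (cdom c \<inter> cdom c'))"
proof -
  show "smooth_on (cmap c ` (cdom c \<inter> cdom c')) (cmap c' \<circ> cinv c)"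
    using assms unfolding smooth_atlas_def smooth_compat_def by blast
  show "open (cmap c ` (cdom c \<inter> cdom c'))"
    using assms chart_image_open smooth_atlas_chart(1) by (metis inf_le1 open_Int)
qed

lemma trans_deriv_has_derivative:
  assumes "smooth_atlas G" "c \<in> G" "c' \<in> G" "p \<in> cdom c" "p \<in> cdom c'"
  shows "((cmap c' \<circ> cinv c) has_derivative trans_deriv c c' p) (at (cmap c p))"
  unfolding trans_deriv_def
  by (intro differentiable_has_frechet_derivative smooth_on_differentiable[OF transition_smooth(1)[OF assms(1-3)]])
    (use assms in auto)

lemma trans_deriv_linear:
  assumes "smooth_atlas G" "c \<in> G" "c' \<in> G" "p \<in> cdom c" "p \<in> cdom c'"
  shows "linear (trans_deriv c c' p)"
  using trans_deriv_has_derivative[OF assms] has_derivative_linear by blast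

lemma trans_deriv_chain:
  assumes "smooth_atlas G" "c \<in> G" "c' \<in> G" "c'' \<in> G" "p \<in> cdom c" "p \<in> cdom c'" "p \<in> cdom c''"
  shows "trans_deriv c' c'' p (trans_deriv c c' p v) = trans_deriv c c'' p v"
proof -
  let ?S = "cmap c ` (cdom c \<inter> cdom c' \<inter> cdom c'')"
  have "open (cdom c \<inter> cdom c' \<inter> cdom c'')"
    by (intro open_Int smooth_atlas_chart(1)[OF assms(1)] assms)
  then have S: "open ?S" "cmap c p \<in> ?S"
    using assms by (auto intro!: chart_image_open[OF assms(1,2)])
  have e: "(cmap c' \<circ> cinv c) (cmap c p) = cmap c' p"
    using smooth_atlas_chart(5)[OF assms(1,2,5)] by simp
  have "((cmap c'' \<circ> cinv c') \<circ> (cmap c' \<circ> cinv c) has_derivative trans_deriv c' c'' p \<circ> trans_deriv c c' p) (at (cmap c p))"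
    by (rule diff_chain_at[OF trans_deriv_has_derivative[OF assms(1,2,3,5,6)]])
      (unfold e, rule trans_deriv_has_derivative[OF assms(1,3,4,6,7)])
  then have "((cmap c'' \<circ> cinv c) has_derivative trans_deriv c' c'' p \<circ> trans_deriv c c' p) (at (cmap c p))"
  proof (rule has_derivative_transform_within_open[OF _ S])
    fix x assume "x \<in> ?S"
    then show "((cmap c'' \<circ> cinv c') \<circ> (cmap c' \<circ> cinv c)) x = (cmap c'' \<circ> cinv c) x"
      using smooth_atlas_chart(5)[OF assms(1,3)] smooth_atlas_chart(5)[OF assms(1,2)] by auto
  qed
  then show ?thesis
    using has_derivative_unique[OF trans_deriv_has_derivative[OF assms(1,2,4,5,7)]] by (metis comp_apply)
qed

lemma trans_deriv_self:
  assumes "smooth_atlas G" "c \<in> G" "p \<in> cdom c"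
  shows "trans_deriv c c p v = v"
proof -
  have "((\<lambda>x. x) has_derivative (\<lambda>v. v)) (at (cmap c p))" by simp
  then have "((cmap c \<circ> cinv c) has_derivative (\<lambda>v. v)) (at (cmap c p))"
    by (rule has_derivative_transform_within_open[OF _ smooth_atlas_chart(2)[OF assms(1,2)]])
      (use assms smooth_atlas_chart(6)[OF assms(1,2)] in auto)
  then show ?thesis
    using has_derivative_unique[OF trans_deriv_has_derivative[OF assms(1,2,2,3,3)]] by metis
qed

lemma trans_deriv_inverse:
  assumes "smooth_atlas G" "c \<in> G" "c' \<in> G" "p \<in> cdom c" "p \<in> cdom c'"
  shows "trans_deriv c' c p (trans_deriv c c' p v) = v"
  using trans_deriv_chain[OF assms(1,2,3,2,4,5,4)] trans_deriv_self[OF assms(1,2,4)] by simp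

text \<open>A limit of difference quotients is the form in which membership in a closed subspace
  passes to the derivative.\<close>

lemma has_vector_derivative_at_within_0:
  "(f has_vector_derivative D) (at 0) \<longleftrightarrow> ((\<lambda>t. (f t - f 0) /\<^sub>R t) \<longlongrightarrow> D) (at 0)"
proof -
  have "((\<lambda>t. (f t - f 0) /\<^sub>R t) \<longlongrightarrow> D) (at 0) \<longleftrightarrow>
      ((\<lambda>t. norm (f t - f 0 - t *\<^sub>R D) / \<bar>t\<bar>) \<longlongrightarrow> 0) (at 0)"
  proof -
    have "((\<lambda>t. (f t - f 0) /\<^sub>R t) \<longlongrightarrow> D) (at 0) \<longleftrightarrow> ((\<lambda>t. norm ((f t - f 0) /\<^sub>R t - D)) \<longlongrightarrow> 0) (at 0)"
      by (subst LIM_zero_iff[symmetric], subst tendsto_norm_zero_iff[symmetric]) (rule refl)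
    also have "\<dots> \<longleftrightarrow> ((\<lambda>t. norm (f t - f 0 - t *\<^sub>R D) / \<bar>t\<bar>) \<longlongrightarrow> 0) (at 0)"
    proof (rule tendsto_cong)
      have "norm ((f t - f 0) /\<^sub>R t - D) = norm (f t - f 0 - t *\<^sub>R D) / \<bar>t\<bar>" if "t \<noteq> 0" for t
      proof -
        have "(f t - f 0) /\<^sub>R t - D = (f t - f 0 - t *\<^sub>R D) /\<^sub>R t"
          using that by (simp add: scaleR_diff_right)
        then show ?thesis by (simp add: divide_inverse mult.commute)
      qed
      then show "eventually (\<lambda>t. norm ((f t - f 0) /\<^sub>R t - D) = norm (f t - f 0 - t *\<^sub>R D) / \<bar>t\<bar>) (at 0)"
        by (auto simp: eventually_at_filter)
    qed
    finally show ?thesis .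
  qed
  then show ?thesis
    by (simp add: has_vector_derivative_def has_derivative_at bounded_linear_scaleR_left)
qed

locale foliated_atlas =
  fixes A F :: "('a::{t2_space, second_countable_topology}, 'e::euclidean_space) chart set" and K :: "'e set"
  assumes A: "smooth_atlas A" and F: "foliation_atlas A F K"
begin

lemma K_subspace: "subspace K"
  using F by (simp add: foliation_atlas_def)

lemma compat_F_A:
  assumes "c \<in> F" "c' \<in> A"
  shows "smooth_on (cmap c ` (cdom c \<inter> cdom c')) (cmap c' \<circ> cinv c)"
    and "smooth_on (cmap c' ` (cdom c' \<inter> cdom c)) (cmap c \<circ> cinv c')"
  using F assms unfolding foliation_atlas_def smooth_compat_def by (auto simp: Int_commute)

lemma F_chart: "c \<in> F \<Longrightarrow> is_chart c"
  using F by (simp add: foliation_atlas_def)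

text \<open>\<open>foliation_atlas\<close> imposes smooth compatibility between \<open>F\<close> and
  \<open>A\<close>. Near each point the transition between two charts of \<open>F\<close> factors
  through a chart of \<open>A\<close>, and smoothness is local.\<close>

lemma F_transition_smooth:
  assumes "c1 \<in> F" "c2 \<in> F"
  shows "smooth_on (cmap c1 ` (cdom c1 \<inter> cdom c2)) (cmap c2 \<circ> cinv c1)"
proof (rule smooth_on_local)
  fix x assume "x \<in> cmap c1 ` (cdom c1 \<inter> cdom c2)"
  then obtain p where p: "p \<in> cdom c1" "p \<in> cdom c2" "x = cmap c1 p" by blast
  obtain c where c: "c \<in> A" "p \<in> cdom c" using A unfolding smooth_atlas_def by blast
  have h: "open (cdom c')" "open (cran c')" "continuous_on (cran c') (cinv c')"
    "\<And>q. q \<in> cdom c' \<Longrightarrow> cinv c' (cmap c' q) = q" if "is_chart c'" for c' :: "('a, 'e) chart"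
    using that unfolding is_chart_def homeomorphism_def by auto
  have op: "open (cmap c' ` U)" if "is_chart c'" "open U" "U \<subseteq> cdom c'" for c' :: "('a, 'e) chart" and U
  proof -
    have "cmap c' ` U = cran c' \<inter> cinv c' -` U"
      using that(3) h(4)[OF that(1)] by (auto intro!: image_eqI)
    then show ?thesis using h(2,3)[OF that(1)] that(2) by (metis continuous_on_open_vimage Int_commute)
  qed
  have ch: "is_chart c" "is_chart c1" "is_chart c2"
    using c A F_chart assms by (auto simp: smooth_atlas_def)
  let ?U = "cdom c1 \<inter> cdom c2 \<inter> cdom c"
  have oU: "open ?U" by (intro open_Int h(1) ch)
  have "smooth_on (cmap c1 ` ?U) (\<lambda>x. (cmap c2 \<circ> cinv c) ((cmap c \<circ> cinv c1) x))"
  proof (rule smooth_on_compose[where S = "cmap c1 ` ?U" and T = "cmap c ` ?U" and f = "cmap c \<circ> cinv c1"])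
    show "open (cmap c1 ` ?U)" using op[OF ch(2) oU] by blast
    show "open (cmap c ` ?U)" using op[OF ch(1) oU] by blast
    show "(cmap c \<circ> cinv c1) ` cmap c1 ` ?U \<subseteq> cmap c ` ?U" using h(4)[OF ch(2)] by auto
    show "smooth_on (cmap c1 ` ?U) (cmap c \<circ> cinv c1)"
      by (rule smooth_on_subset[OF _ compat_F_A(1)[OF assms(1) c(1)]]) blast
    show "smooth_on (cmap c ` ?U) (cmap c2 \<circ> cinv c)"
      by (rule smooth_on_subset[OF _ compat_F_A(2)[OF assms(2) c(1)]]) blast
  qed
  then have "smooth_on (cmap c1 ` ?U) (cmap c2 \<circ> cinv c1)"
    by (rule smooth_on_cong[rotated 2]) (use h(4)[OF ch(1)] h(4)[OF ch(2)] op[OF ch(2) oU] in auto)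
  moreover have "open (cmap c1 ` ?U)" by (intro op oU ch) blast
  ultimately show "\<exists>N. open N \<and> x \<in> N \<and> smooth_on N (cmap c2 \<circ> cinv c1)"
    using p c by blast
qed

text \<open>Tangent vectors are modelled by charts of \<open>A\<close>, while leaves are straight in
  charts of \<open>F\<close>; the union lets one calculus of transition maps serve both.\<close>

definition G :: "('a, 'e) chart set" where "G = A \<union> F"

lemma G: "smooth_atlas G"
  unfolding smooth_atlas_def
proof (intro conjI ballI)
  show "is_chart c" if "c \<in> G" for c using that A F_chart unfolding G_def smooth_atlas_def by blast
  have tr: "smooth_on (cmap c ` (cdom c \<inter> cdom c')) (cmap c' \<circ> cinv c)" if "c \<in> G" "c' \<in> G" for c c'
  proof -
    have "smooth_on (cmap c ` (cdom c \<inter> cdom c')) (cmap c' \<circ> cinv c)" if "c \<in> A" "c' \<in> A"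
      using A that unfolding smooth_atlas_def smooth_compat_def by blast
    then show ?thesis
      using that compat_F_A[of c c'] compat_F_A[of c' c] F_transition_smooth[of c c'] unfolding G_def by blast
  qed
  show "smooth_compat c c'" if "c \<in> G" "c' \<in> G" for c c'
    unfolding smooth_compat_def using tr[OF that] tr[OF that(2,1)] by (simp add: Int_commute)
  show "(\<Union>c\<in>G. cdom c) = UNIV" using A unfolding G_def smooth_atlas_def by blast
qed

lemma chart_at_A: "chart_at A p \<in> G" "chart_at A p \<in> A" "p \<in> cdom (chart_at A p)"
proof -
  have "\<exists>c. c \<in> A \<and> p \<in> cdom c" using A unfolding smooth_atlas_def by blast
  from someI_ex[OF this] show "chart_at A p \<in> A" "p \<in> cdom (chart_at A p)" "chart_at A p \<in> G"
    unfolding chart_at_def G_def by auto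
qed

lemma chart_at_F: "chart_at F p \<in> G" "chart_at F p \<in> F" "p \<in> cdom (chart_at F p)"
proof -
  have "\<exists>c. c \<in> F \<and> p \<in> cdom c" using F unfolding foliation_atlas_def by blast
  from someI_ex[OF this] show "chart_at F p \<in> F" "p \<in> cdom (chart_at F p)" "chart_at F p \<in> G"
    unfolding chart_at_def G_def by auto
qed

lemmas chart = smooth_atlas_chart[OF G]
lemmas chart_open = chart_image_open[OF G]
lemmas transition = transition_smooth[OF G]

lemma to_chart_linear: "c \<in> G \<Longrightarrow> p \<in> cdom c \<Longrightarrow> linear (to_chart A c p)"
  unfolding to_chart_def by (intro trans_deriv_linear[OF G] chart_at_A)

lemma of_chart_linear: "c \<in> G \<Longrightarrow> p \<in> cdom c \<Longrightarrow> linear (of_chart A c p)"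
  unfolding of_chart_def by (intro trans_deriv_linear[OF G] chart_at_A)

lemma to_of_chart: "c \<in> G \<Longrightarrow> p \<in> cdom c \<Longrightarrow> to_chart A c p (of_chart A c p v) = v"
  unfolding to_chart_def of_chart_def by (intro trans_deriv_inverse[OF G] chart_at_A)

lemma of_to_chart: "c \<in> G \<Longrightarrow> p \<in> cdom c \<Longrightarrow> of_chart A c p (to_chart A c p v) = v"
  unfolding to_chart_def of_chart_def by (intro trans_deriv_inverse[OF G] chart_at_A)

lemma to_chart_change:
  "c \<in> G \<Longrightarrow> c' \<in> G \<Longrightarrow> p \<in> cdom c \<Longrightarrow> p \<in> cdom c' \<Longrightarrow>
    trans_deriv c c' p (to_chart A c p v) = to_chart A c' p v"
  unfolding to_chart_def by (intro trans_deriv_chain[OF G] chart_at_A)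

lemma of_chart_change:
  "c \<in> G \<Longrightarrow> c' \<in> G \<Longrightarrow> p \<in> cdom c \<Longrightarrow> p \<in> cdom c' \<Longrightarrow>
    of_chart A c' p (trans_deriv c c' p v) = of_chart A c p v"
  unfolding of_chart_def by (intro trans_deriv_chain[OF G] chart_at_A)

lemma form_rep_forms:
  assumes "c \<in> G" "x \<in> cran c" "\<omega> (cinv c x) \<in> forms UNIV k"
  shows "form_rep A c \<omega> x \<in> forms UNIV k"
  unfolding form_rep_def using chart(6)[OF assms(1,2)] by (intro pull_forms of_chart_linear assms) auto

lemma form_rep_apply: "form_rep A c \<omega> x us = \<omega> (cinv c x) (map (of_chart A c (cinv c x)) us)"
  by (simp add: form_rep_def pull_def)

lemma form_rep_change:
  assumes c: "c \<in> G" "c' \<in> G" and x: "x \<in> cmap c ` (cdom c \<inter> cdom c')"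
  shows "form_rep A c \<omega> x us = form_rep A c' \<omega> ((cmap c' \<circ> cinv c) x)
    (map (frechet_derivative (cmap c' \<circ> cinv c) (at x)) us)"
proof -
  obtain q where q: "q \<in> cdom c" "q \<in> cdom c'" "x = cmap c q" using x by blast
  have e: "cinv c x = q" "cinv c' (cmap c' q) = q" using q chart(5) c by auto
  have "frechet_derivative (cmap c' \<circ> cinv c) (at x) = trans_deriv c c' q"
    by (simp add: trans_deriv_def q(3))
  then show ?thesis
    using of_chart_change[OF c q(1,2)] by (simp add: form_rep_apply e comp_def)
qed

text \<open>The representatives in two charts differ by a pullback along the transition map, whose
  second derivatives are symmetric, so \<open>coord_deriv_pull\<close> applies. Differentiability is
  assumed at the single point because the forms built from moving frames are shown differentiable
  only there.\<close>

lemma form_rep_chart_change: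
  assumes c: "c \<in> G" "c' \<in> G" and p: "p \<in> cdom c" "p \<in> cdom c'"
    and \<omega>: "\<And>q. q \<in> cdom c' \<Longrightarrow> \<omega> q \<in> forms UNIV k"
    and d: "\<And>us. (\<lambda>x. form_rep A c' \<omega> x us) differentiable (at (cmap c' p))"
  shows "(\<lambda>x. form_rep A c \<omega> x us) differentiable (at (cmap c p))"
    and "ext_deriv_in A c \<omega> p = ext_deriv_in A c' \<omega> p"
proof -
  let ?\<phi> = "cmap c' \<circ> cinv c" and ?S = "cmap c ` (cdom c \<inter> cdom c')"
  let ?J = "\<lambda>x. frechet_derivative ?\<phi> (at x)"
  let ?J' = "\<lambda>v. frechet_derivative (\<lambda>x. ?J x v) (at (cmap c p))"
  have S: "open ?S" "cmap c p \<in> ?S" using transition(2)[OF c] p by auto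
  have \<phi>p: "?\<phi> (cmap c p) = cmap c' p" using chart(5)[OF c(1) p(1)] by simp
  note sm = transition(1)[OF c]
    have fr: "form_rep A c' \<omega> y \<in> forms UNIV k" if "y \<in> cran c'" for y
      using form_rep_forms[where \<omega>=\<omega>] \<omega> chart(6)[OF c(2) that] c(2) that by blast
    have cr: "?\<phi> x \<in> cran c'" if "x \<in> ?S" for x
      using that chart(5)[OF c(1)] by auto
    have J: "(?\<phi> has_derivative ?J (cmap c p)) (at (cmap c p))"
      by (intro differentiable_has_frechet_derivative smooth_on_differentiable[OF sm] S)
    have J': "((\<lambda>x. ?J x v) has_derivative ?J' v) (at (cmap c p))" for v
      by (intro differentiable_has_frechet_derivative
          smooth_on_differentiable[OF smooth_on_frechet_derivative[OF sm]] S)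
    have sym: "?J' u v = ?J' v u" for u v by (rule second_derivative_symmetric[OF S sm])
    have "?\<phi> (cmap c p) \<in> cran c'" using \<phi>p p by simp
    note cd = coord_deriv_pull[OF chart(2)[OF c(2)] this fr d[folded \<phi>p] S cr J J' sym form_rep_change[OF c]]
  show "(\<lambda>x. form_rep A c \<omega> x us) differentiable (at (cmap c p))" by (rule cd(1))
  have cd2: "coord_deriv (form_rep A c \<omega>) (cmap c p) =
      pull (?J (cmap c p)) (coord_deriv (form_rep A c' \<omega>) (cmap c' p))"
    using cd(2) unfolding \<phi>p by (simp add: comp_def)
  have "?J (cmap c p) = trans_deriv c c' p" by (simp add: trans_deriv_def)
  then show "ext_deriv_in A c \<omega> p = ext_deriv_in A c' \<omega> p"
    unfolding ext_deriv_in_coord_deriv cd2 pull_pull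
    using to_chart_change[OF c p] by simp
qed

lemma ext_deriv_chart:
  assumes c: "c \<in> G" "p \<in> cdom c"
    and \<omega>: "\<And>q. q \<in> cdom c \<Longrightarrow> \<omega> q \<in> forms UNIV k"
    and d: "\<And>us. (\<lambda>x. form_rep A c \<omega> x us) differentiable (at (cmap c p))"
  shows "ext_deriv A \<omega> p = pull (to_chart A c p) (coord_deriv (form_rep A c \<omega>) (cmap c p))"
  using form_rep_chart_change(2)[OF chart_at_A(1) c(1) chart_at_A(3) c(2) \<omega> d]
  by (simp add: ext_deriv_def ext_deriv_in_coord_deriv)

lemma differential_chart:
  assumes c: "c \<in> G" "p \<in> cdom c" and d: "(f \<circ> cinv c) differentiable (at (cmap c p))"
  shows "differential A f p =
    pull (to_chart A c p) (covec (frechet_derivative (f \<circ> cinv c) (at (cmap c p))))"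
proof -
  have r: "form_rep A c (fun_form f) x us = (if us = [] then (f \<circ> cinv c) x else 0)" for x us
    by (simp add: form_rep_apply fun_form_def)
  have "ext_deriv A (fun_form f) p = pull (to_chart A c p) (coord_deriv (form_rep A c (fun_form f)) (cmap c p))"
  proof (rule ext_deriv_chart[OF c])
    show "fun_form f q \<in> forms UNIV 0" for q by (simp add: forms_0_iff fun_form_def)
    show "(\<lambda>x. form_rep A c (fun_form f) x us) differentiable at (cmap c p)" for us
      unfolding r using d by (cases us) (auto simp: comp_def)
  qed
  moreover have "coord_deriv (form_rep A c (fun_form f)) (cmap c p) =
      covec (frechet_derivative (f \<circ> cinv c) (at (cmap c p)))"
  proof
    fix us :: "'e list"
    show "coord_deriv (form_rep A c (fun_form f)) (cmap c p) us =
      covec (frechet_derivative (f \<circ> cinv c) (at (cmap c p))) us"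
    proof (cases us)
      case (Cons u vs)
      show ?thesis
      proof (cases vs)
        case Nil
        then show ?thesis using Cons by (simp add: coord_deriv_def alt_sum_def r comp_def)
      next
        case (Cons v ws)
        then show ?thesis using \<open>us = u # vs\<close>
          by (simp add: coord_deriv_def alt_sum_def r sum.neutral)
      qed
    qed (simp add: coord_deriv_def)
  qed
  ultimately show ?thesis by simp
qed

lemma smooth_fun_chart:
  assumes f: "smooth_fun A f" and c: "c \<in> G"
  shows "smooth_on (cran c) (f \<circ> cinv c)"
proof (rule smooth_on_local)
  fix x assume x: "x \<in> cran c"
  let ?p = "cinv c x" let ?c' = "chart_at A ?p"
  let ?N = "cmap c ` (cdom c \<inter> cdom ?c')"
  note c' = chart_at_A[of ?p]
  have p: "?p \<in> cdom c" "cmap c ?p = x" using chart(6)[OF c x] by auto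
  have N: "open ?N" "x \<in> ?N" using transition(2)[OF c c'(1)] p c'(3) by (auto intro: image_eqI[of _ _ ?p])
  have "smooth_on ?N (\<lambda>x. (f \<circ> cinv ?c') ((cmap ?c' \<circ> cinv c) x))"
  proof (rule smooth_on_compose[OF N(1) chart(2)[OF c'(1)] _ transition(1)[OF c c'(1)]])
    show "(cmap ?c' \<circ> cinv c) ` ?N \<subseteq> cran ?c'" using chart(5)[OF c] by auto
    show "smooth_on (cran ?c') (f \<circ> cinv ?c')" using f c'(2) by (simp add: smooth_fun_def)
  qed
  then have "smooth_on ?N (f \<circ> cinv c)"
    by (rule smooth_on_cong[OF N(1), rotated]) (use chart(5)[OF c] chart(5)[OF c'(1)] in auto)
  then show "\<exists>N. open N \<and> x \<in> N \<and> smooth_on N (f \<circ> cinv c)" using N by blast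
qed

text \<open>\<open>g\<close> is multiplied by a cutoff that vanishes outside a small ball and
  continued by 0. The preimage of the closed ball is compact, hence closed because the manifold is
  Hausdorff, and on its open complement the continuation is 0.\<close>

lemma smooth_fun_extension:
  fixes g :: "'e \<Rightarrow> real"
  assumes c: "c \<in> G" "p \<in> cdom c" and g: "smooth_on UNIV g"
  obtains f N where "smooth_fun A f" "open N" "cmap c p \<in> N" "N \<subseteq> cran c"
    "\<And>x. x \<in> N \<Longrightarrow> f (cinv c x) = g x"
proof -
  let ?x = "cmap c p"
  have "?x \<in> cran c" using c by blast
  then obtain R where R: "R > 0" "cball ?x R \<subseteq> cran c"
    using chart(2)[OF c(1)] open_contains_cball by blast
  obtain \<beta> :: "'e \<Rightarrow> real" and N where b: "smooth_on UNIV \<beta>" "open N" "?x \<in> N"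
    "\<And>x. x \<in> N \<Longrightarrow> \<beta> x = 1" "\<And>x. x \<notin> ball ?x R \<Longrightarrow> \<beta> x = 0"
    using smooth_bump_exists[OF R(1)] by metis
  define u where "u x = \<beta> x * g x" for x
  have u: "smooth_on UNIV u" unfolding u_def by (rule smooth_on_mult[OF open_UNIV b(1) g])
  define f where "f q = (if q \<in> cdom c then u (cmap c q) else 0)" for q
  let ?C = "cinv c ` cball ?x R"
  have C: "compact ?C"
    by (rule compact_continuous_image[OF continuous_on_subset[OF chart(4)[OF c(1)] R(2)] compact_cball])
  have oC: "open (- ?C)" by (rule open_Compl[OF compact_imp_closed[OF C]])
  have f0: "f q = 0" if "q \<in> - ?C" for q
  proof (cases "q \<in> cdom c")
    case True
    then have "cinv c (cmap c q) = q" using chart(5)[OF c(1)] by blast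
    then have "cmap c q \<notin> cball ?x R" using that by force
    then have "\<beta> (cmap c q) = 0" using b(5) ball_subset_cball by blast
    then show ?thesis by (simp add: f_def u_def)
  qed (simp add: f_def)
  have "smooth_fun A f"
    unfolding smooth_fun_def
  proof (intro ballI smooth_on_local)
    fix c' x assume c'A: "c' \<in> A" and x: "x \<in> cran c'"
    have c': "c' \<in> G" using c'A by (simp add: G_def)
    let ?q = "cinv c' x"
    have q: "?q \<in> cdom c'" "cmap c' ?q = x" using chart(6)[OF c' x] by auto
    show "\<exists>N. open N \<and> x \<in> N \<and> smooth_on N (f \<circ> cinv c')"
    proof (cases "?q \<in> cdom c")
      case True
      let ?N = "cmap c' ` (cdom c' \<inter> cdom c)"
      have N: "open ?N" "x \<in> ?N" using transition(2)[OF c' c(1)] q True by (auto intro: image_eqI[of _ _ ?q])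
      have "smooth_on ?N (\<lambda>x. u ((cmap c \<circ> cinv c') x))"
        by (rule smooth_on_compose[OF N(1) open_UNIV _ transition(1)[OF c' c(1)] u]) auto
      then have "smooth_on ?N (f \<circ> cinv c')"
        by (rule smooth_on_cong[OF N(1), rotated]) (use chart(5)[OF c'] in \<open>auto simp: f_def\<close>)
      then show ?thesis using N by blast
    next
      case False
      have "?C \<subseteq> cdom c" using R chart(6)[OF c(1)] by blast
      then have qC: "?q \<in> - ?C" using False by blast
      let ?N = "cmap c' ` (cdom c' \<inter> - ?C)"
      have N: "open ?N" "x \<in> ?N"
        using chart_open[OF c', of "cdom c' \<inter> - ?C"] chart(1)[OF c'] oC q qC
        by (auto intro: image_eqI[of _ _ ?q])
      have "smooth_on ?N (f \<circ> cinv c')"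
        by (rule smooth_on_cong[OF N(1) _ smooth_on_const[of _ 0]])
          (use chart(5)[OF c'] f0 in auto)
      then show ?thesis using N by blast
    qed
  qed
  moreover have "open (N \<inter> ball ?x R)" "?x \<in> N \<inter> ball ?x R" using b R by auto
  moreover have "N \<inter> ball ?x R \<subseteq> cran c" using R(2) ball_subset_cball by blast
  moreover have "f (cinv c x) = g x" if "x \<in> N \<inter> ball ?x R" for x
  proof -
    have "x \<in> cran c" using that R(2) ball_subset_cball by blast
    then have "cinv c x \<in> cdom c" "cmap c (cinv c x) = x" using chart(6)[OF c(1)] by auto
    then show ?thesis using that b(4) by (simp add: f_def u_def)
  qed
  ultimately show ?thesis using that by blast
qed

text \<open>Near the point, moving by \<open>t *\<^sub>R v\<close> with \<open>v\<close> in
  \<open>K\<close> changes the image under the transition map by an element of \<open>K\<close>; the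
  difference quotients lie in \<open>K\<close>, and so does their limit, a subspace being
  closed.\<close>

lemma transition_derivative_K:
  assumes c: "c \<in> F" "c' \<in> F" "p \<in> cdom c" "p \<in> cdom c'" and v: "v \<in> K"
  shows "trans_deriv c c' p v \<in> K"
proof -
  let ?\<phi> = "cmap c' \<circ> cinv c" and ?x = "cmap c p"
  note smooth_G = G
  have G: "c \<in> G" "c' \<in> G" using c by (auto simp: G_def)
  obtain N where N: "open N" "?x \<in> N"
    "\<And>x y. x \<in> N \<Longrightarrow> y \<in> N \<Longrightarrow> x - y \<in> K \<Longrightarrow> ?\<phi> x - ?\<phi> y \<in> K"
    using F c unfolding foliation_atlas_def by (auto simp: comp_def) (metis IntI)
  note T = trans_deriv_has_derivative[OF smooth_G G c(3,4)]
  have lin: "linear (trans_deriv c c' p)" using T has_derivative_linear by blast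
  have "((\<lambda>t. ?\<phi> (?x + t *\<^sub>R v)) has_derivative (\<lambda>r. trans_deriv c c' p (r *\<^sub>R v))) (at 0)"
    by (rule has_derivative_along_line) (use T in \<open>simp add: comp_def\<close>)
  then have "((\<lambda>t. ?\<phi> (?x + t *\<^sub>R v)) has_vector_derivative trans_deriv c c' p v) (at 0)"
    by (simp add: has_vector_derivative_def linear_cmul[OF lin])
  then have lim: "((\<lambda>t. (?\<phi> (?x + t *\<^sub>R v) - ?\<phi> ?x) /\<^sub>R t) \<longlongrightarrow> trans_deriv c c' p v) (at 0)"
    by (simp add: has_vector_derivative_at_within_0)
  have "closed K" using K_subspace by (rule closed_subspace)
  moreover have "eventually (\<lambda>t. (?\<phi> (?x + t *\<^sub>R v) - ?\<phi> ?x) /\<^sub>R t \<in> K) (at (0::real))"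
  proof -
    have "((\<lambda>t. ?x + t *\<^sub>R v) \<longlongrightarrow> ?x + 0 *\<^sub>R v) (at (0::real))" by (intro tendsto_intros)
    then have "eventually (\<lambda>t. ?x + t *\<^sub>R v \<in> N) (at (0::real))"
      using N(1,2) by (simp add: topological_tendstoD)
    then show ?thesis
    proof eventually_elim
      case (elim t)
      have "?x + t *\<^sub>R v - ?x \<in> K" using v K_subspace by (simp add: subspace_scale)
      then show ?case using N(3)[OF elim N(2)] K_subspace by (simp add: subspace_scale)
    qed
  qed
  ultimately show ?thesis using Lim_in_closed_set[OF _ _ _ lim] by simp
qed

lemma leaf_tangent_iff:
  assumes "c \<in> F" "p \<in> cdom c"
  shows "v \<in> leaf_tangent A F K p \<longleftrightarrow> to_chart A c p v \<in> K"
proof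
  show "to_chart A c p v \<in> K" if "v \<in> leaf_tangent A F K p" using that assms by (simp add: leaf_tangent_def)
  assume v: "to_chart A c p v \<in> K"
  show "v \<in> leaf_tangent A F K p"
    unfolding leaf_tangent_def
  proof (intro CollectI ballI impI)
    fix c' assume c': "c' \<in> F" "p \<in> cdom c'"
    have "to_chart A c' p v = trans_deriv c c' p (to_chart A c p v)"
      using to_chart_change[of c c'] assms c' by (auto simp: G_def)
    then show "to_chart A c' p v \<in> K" using transition_derivative_K[OF assms(1) c'(1) assms(2) c'(2) v] by simp
  qed
qed

end


section \<open>Powers of a 2-form and their nonvanishing\<close>

section \<open>Powers of a two-form\<close>

text \<open>Counterpart of \<open>forms_eq_0_basis_list\<close> for forms that vanish as soon as an
  argument lies in a complementary set \<open>B\<close>: a list of distinct arguments avoiding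
  \<open>B\<close> can only be a rearrangement of \<open>bs\<close>.\<close>

lemma forms_eq_0_complement:
  assumes \<omega>: "\<omega> \<in> forms UNIV k" and bs: "length bs = k" "\<omega> bs = 0"
    and span: "span (set bs \<union> B) = UNIV" and kill: "\<And>us. set us \<inter> B \<noteq> {} \<Longrightarrow> \<omega> us = 0"
  shows "\<omega> us = 0"
proof (rule forms_eq_0_spanning[OF \<omega> subspace_UNIV, of "set bs \<union> B"])
  fix us assume us: "set us \<subseteq> set bs \<union> B"
  show "\<omega> us = 0"
  proof (cases "distinct us \<and> length us = k \<and> set us \<inter> B = {}")
    case True
    then have sub: "set us \<subseteq> set bs" using us by blast
    have "card (set us) = k" using True distinct_card by blast
    moreover have "card (set bs) \<le> k" using bs card_length by blast
    ultimately have eq: "set us = set bs" using sub by (simp add: card_seteq)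
    then have "distinct bs" using \<open>card (set us) = k\<close> bs by (simp add: card_distinct)
    then have "mset us = mset bs" using eq True set_eq_iff_mset_eq_distinct by blast
    then show ?thesis using forms_eq_0_on_permutation[OF \<omega> subspace_UNIV, of "[]" bs us] bs by simp
  next
    case False
    then show ?thesis using forms_not_distinct[OF \<omega>] forms_eq_0[OF \<omega>] kill by blast
  qed
qed (use span in auto)

lemma wedge_zero_form:
  assumes "\<alpha> \<in> forms UNIV 0"
  shows "wedge \<alpha> \<beta> us = \<alpha> [] * \<beta> us"
proof (induction us arbitrary: \<beta>)
  case Nil
  then show ?case by (simp add: wedge_Nil)
next
  case (Cons v vs)
  have "interior_prod v \<alpha> = (\<lambda>_. 0)" using assms by (auto simp: interior_prod_def forms_0_iff)
  then show ?case
    using wedge_Cons_forms[OF assms] Cons by (simp add: wedge_zero_left interior_prod_def)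
qed

lemma wedge_one_form_Cons:
  assumes "\<alpha> \<in> forms UNIV 1"
  shows "wedge \<alpha> \<omega> (u # us) = \<alpha> [u] * \<omega> us - wedge \<alpha> (interior_prod u \<omega>) us"
proof -
  have "interior_prod u \<alpha> \<in> forms UNIV 0" using interior_prod_forms[OF _ subspace_UNIV] assms by fastforce
  then have "wedge (interior_prod u \<alpha>) \<omega> us = \<alpha> [u] * \<omega> us"
    by (simp add: wedge_zero_form) (simp add: interior_prod_def)
  then show ?thesis using wedge_Cons_forms[OF assms, of \<omega> u us] by simp
qed

lemma interior_prod_wedge_one_form:
  assumes "\<alpha> \<in> forms UNIV 1"
  shows "interior_prod u (wedge \<alpha> \<omega>) = (\<lambda>us. \<alpha> [u] * \<omega> us + (- 1) * wedge \<alpha> (interior_prod u \<omega>) us)"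
  using wedge_one_form_Cons[OF assms] by (auto simp: interior_prod_def[of u "wedge \<alpha> \<omega>"])

lemma wedge_one_forms_anticommute:
  assumes \<alpha>: "\<alpha> \<in> forms UNIV 1" and \<beta>: "\<beta> \<in> forms UNIV 1"
  shows "wedge \<alpha> (wedge \<beta> \<omega>) us = - wedge \<beta> (wedge \<alpha> \<omega>) us"
proof (induction us arbitrary: \<omega>)
  case Nil
  then show ?case using forms_eq_0[OF \<alpha>, of "[]"] forms_eq_0[OF \<beta>, of "[]"] by (simp add: wedge_Nil)
next
  case (Cons u us)
  show ?case
    unfolding wedge_one_form_Cons[OF \<alpha>] wedge_one_form_Cons[OF \<beta>]
      interior_prod_wedge_one_form[OF \<alpha>] interior_prod_wedge_one_form[OF \<beta>] wedge_lincomb_right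
    using Cons[of "interior_prod u \<omega>"] by simp
qed

lemma interior_prod_wedge_two_form:
  assumes "\<sigma> \<in> forms UNIV 2"
  shows "interior_prod u (wedge \<sigma> \<omega>) =
    (\<lambda>us. 1 * wedge (interior_prod u \<sigma>) \<omega> us + 1 * wedge \<sigma> (interior_prod u \<omega>) us)"
  unfolding interior_prod_wedge[OF assms] by simp

lemma interior_prod_two_form: "\<sigma> \<in> forms UNIV 2 \<Longrightarrow> interior_prod u \<sigma> \<in> forms UNIV 1"
  using interior_prod_forms[of \<sigma> UNIV 1 u] by (simp add: numeral_2_eq_2)

lemma wedge_two_form_one_form_commute:
  assumes \<sigma>: "\<sigma> \<in> forms UNIV 2" and \<alpha>: "\<alpha> \<in> forms UNIV 1"
  shows "wedge \<sigma> (wedge \<alpha> \<omega>) us = wedge \<alpha> (wedge \<sigma> \<omega>) us"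
proof (induction us arbitrary: \<omega>)
  case Nil
  then show ?case using forms_eq_0[OF \<alpha>, of "[]"] by (simp add: wedge_Nil)
next
  case (Cons u us)
  have "wedge \<sigma> (wedge \<alpha> \<omega>) (u # us) = wedge (interior_prod u \<sigma>) (wedge \<alpha> \<omega>) us
      + (\<alpha> [u] * wedge \<sigma> \<omega> us - wedge \<sigma> (wedge \<alpha> (interior_prod u \<omega>)) us)"
    unfolding wedge_Cons_forms[OF \<sigma>] interior_prod_wedge_one_form[OF \<alpha>] wedge_lincomb_right by simp
  moreover have "wedge \<alpha> (wedge \<sigma> \<omega>) (u # us) = \<alpha> [u] * wedge \<sigma> \<omega> us
      - (wedge \<alpha> (wedge (interior_prod u \<sigma>) \<omega>) us + wedge \<alpha> (wedge \<sigma> (interior_prod u \<omega>)) us)"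
    unfolding wedge_one_form_Cons[OF \<alpha>] interior_prod_wedge_two_form[OF \<sigma>] wedge_lincomb_right by simp
  ultimately show ?case
    using Cons[of "interior_prod u \<omega>"] wedge_one_forms_anticommute[OF interior_prod_two_form[OF \<sigma>] \<alpha>, of u \<omega> us]
    by simp
qed

lemma wedge_power_forms: "\<sigma> \<in> forms UNIV 2 \<Longrightarrow> wedge_power \<sigma> k \<in> forms UNIV (2 * k)"
proof (induction k)
  case 0
  then show ?case by (simp add: forms_0_iff)
next
  case (Suc k)
  then show ?case using wedge_forms[OF Suc.prems Suc.IH] by simp
qed

text \<open>Leibniz rule; a 2-form commutes past the 1-form \<open>interior_prod v \<sigma>\<close>,
  so all \<open>Suc k\<close> terms agree.\<close>

lemma interior_prod_wedge_power:
  assumes \<sigma>: "\<sigma> \<in> forms UNIV 2"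
  shows "interior_prod v (wedge_power \<sigma> (Suc k)) us = real (Suc k) * wedge (interior_prod v \<sigma>) (wedge_power \<sigma> k) us"
proof (induction k arbitrary: us)
  case 0
  have "interior_prod v (wedge_power \<sigma> 0) = (\<lambda>_. 0)" by (auto simp: interior_prod_def)
  then show ?case
    unfolding wedge_power.simps(2) interior_prod_wedge_two_form[OF \<sigma>] by (simp add: wedge_zero_right)
next
  case (Suc k)
  have "interior_prod v (wedge_power \<sigma> (Suc (Suc k))) us =
      wedge (interior_prod v \<sigma>) (wedge_power \<sigma> (Suc k)) us + wedge \<sigma> (interior_prod v (wedge_power \<sigma> (Suc k))) us"
    unfolding wedge_power.simps(2)[of \<sigma> "Suc k"] interior_prod_wedge_two_form[OF \<sigma>] by simp
  also have "interior_prod v (wedge_power \<sigma> (Suc k)) = (\<lambda>us. real (Suc k) * wedge (interior_prod v \<sigma>) (wedge_power \<sigma> k) us)"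
    using Suc by blast
  also have "wedge \<sigma> (\<lambda>us. real (Suc k) * wedge (interior_prod v \<sigma>) (wedge_power \<sigma> k) us) us =
      real (Suc k) * wedge (interior_prod v \<sigma>) (wedge_power \<sigma> (Suc k)) us"
    unfolding wedge_scaled_right wedge_two_form_one_form_commute[OF \<sigma> interior_prod_two_form[OF \<sigma>]] by simp
  finally show ?case by (simp add: algebra_simps)
qed

lemma wedge_power_kill:
  assumes \<sigma>: "\<sigma> \<in> forms UNIV 2" and y: "\<And>v. \<sigma> [y, v] = 0" and us: "y \<in> set us"
  shows "wedge_power \<sigma> k us = 0"
proof -
  have z: "interior_prod y \<sigma> = (\<lambda>_. 0)"
  proof
    fix vs
    show "interior_prod y \<sigma> vs = 0"
      using y forms_eq_0[OF interior_prod_two_form[OF \<sigma>], of vs y]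
      by (cases "\<exists>v. vs = [v]") (auto simp: interior_prod_def length_Suc_conv)
  qed
  have i: "interior_prod y (wedge_power \<sigma> k) vs = 0" for vs
  proof (cases k)
    case 0
    then show ?thesis by (simp add: interior_prod_def)
  next
    case (Suc j)
    then show ?thesis using interior_prod_wedge_power[OF \<sigma>, of y j vs] by (simp add: z wedge_zero_left)
  qed
  obtain xs ys where "us = xs @ y # ys" using us by (meson split_list)
  then have "wedge_power \<sigma> k us = (- 1) ^ length xs * wedge_power \<sigma> k (y # xs @ ys)"
    using forms_move[OF wedge_power_forms[OF \<sigma>] subspace_UNIV, of k "[]" xs y ys] by simp
  then show ?thesis using i by (simp add: interior_prod_def)
qed

context dual_basis
begin

text \<open>Summing over \<open>i\<close> reassembles the argument taken by \<open>d i\<close> and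
  inserts it in front; moving it back to its own place gives \<omega> once for each of the
  \<open>k\<close> positions.\<close>

lemma euler_identity:
  assumes \<omega>: "\<omega> \<in> forms UNIV k" and h: "h \<le> n"
    and kill: "\<And>a us. h \<le> a \<Longrightarrow> a < n \<Longrightarrow> \<omega> (b a # us) = 0"
  shows "(\<Sum>i<h. wedge (covec (d i)) (interior_prod (b i) \<omega>) us) = real k * \<omega> us"
proof -
  have "(\<Sum>i<h. wedge (covec (d i)) (interior_prod (b i) \<omega>) us) =
      (\<Sum>i<h. alt_sum (\<lambda>w vs. d i w * \<omega> (b i # vs)) us)"
    using wedge_one_form[OF d_forms] h by (intro sum.cong) (auto simp: interior_prod_def)
  also have "\<dots> = alt_sum (\<lambda>w vs. \<Sum>i<h. d i w * \<omega> (b i # vs)) us"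
    unfolding alt_sum_def sum_distrib_left by (rule sum.swap)
  also have "(\<lambda>w vs. \<Sum>i<h. d i w * \<omega> (b i # vs)) = (\<lambda>w vs. \<omega> (w # vs))"
  proof (intro ext)
    fix w vs
    have "\<omega> ([] @ w # vs) = (\<Sum>i<n. d i w * \<omega> ([] @ b i # vs))" by (rule forms_expand[OF \<omega>])
    also have "\<dots> = (\<Sum>i<h. d i w * \<omega> ([] @ b i # vs))"
      by (rule sum.mono_neutral_right) (use h kill in auto)
    finally show "(\<Sum>i<h. d i w * \<omega> (b i # vs)) = \<omega> (w # vs)" by simp
  qed
  also have "alt_sum (\<lambda>w vs. \<omega> (w # vs)) us = (\<Sum>i<length us. \<omega> us)"
    unfolding alt_sum_def
  proof (rule sum.cong[OF refl])
    fix i assume i: "i \<in> {..<length us}"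
    have "\<omega> ([] @ take i us @ us ! i # drop (Suc i) us) =
        (- 1) ^ length (take i us) * \<omega> ([] @ us ! i # take i us @ drop (Suc i) us)"
      by (rule forms_move[OF \<omega> subspace_UNIV])
    then show "(- 1) ^ i * \<omega> (us ! i # take i us @ drop (Suc i) us) = \<omega> us"
      using i by (simp add: id_take_nth_drop[symmetric])
  qed
  also have "\<dots> = real k * \<omega> us" using forms_eq_0[OF \<omega>, of us] by (cases "length us = k") auto
  finally show ?thesis .
qed

text \<open>
  If \<open>\<sigma>\<^sup>m\<^sup>+\<^sup>1 = 0\<close> then \<open>d\<^sub>i \<and> \<sigma>\<^sup>m = 0\<close> for \<open>i < h\<close>; contracting with \<open>b\<^sub>i\<close> and summing gives
  \<open>(h - 2 m) \<sigma>\<^sup>m = 0\<close> by Euler's identity, so a nondegenerate \<open>\<sigma>\<close> has a nonzero top power.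
\<close>
lemma wedge_power_nonzero:
  assumes \<sigma>: "\<sigma> \<in> forms UNIV 2" and h: "2 * l \<le> n"
    and X: "\<And>i v. i < 2 * l \<Longrightarrow> \<sigma> [X i, v] = - d i v"
    and kill: "\<And>a v. 2 * l \<le> a \<Longrightarrow> a < n \<Longrightarrow> \<sigma> [b a, v] = 0"
    and m: "m \<le> l"
  shows "\<exists>us. wedge_power \<sigma> m us \<noteq> 0"
  using m
proof (induction m)
  case 0
  have "wedge_power \<sigma> 0 [] \<noteq> 0" by simp
  then show ?case by blast
next
  case (Suc m)
  show ?case
  proof (rule ccontr)
    let ?p = "wedge_power \<sigma> m"
    assume "\<not> ?thesis"
    then have "wedge_power \<sigma> (Suc m) us = 0" for us by blast
    then have "interior_prod v (wedge_power \<sigma> (Suc m)) us = 0" for v us by (simp add: interior_prod_def)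
    \<comment> \<open>By the Leibniz rule, the vanishing of the next power says that the product of
      \<sigma>^m with every contraction of \<sigma> is 0; the contractions with \<open>X i\<close>
      are the covectors \<open>- d i\<close>.\<close>
    then have z: "wedge (interior_prod v \<sigma>) ?p us = 0" for v us
      unfolding interior_prod_wedge_power[OF \<sigma>] by simp
    have iX: "interior_prod (X i) \<sigma> = (\<lambda>us. (- 1) * covec (d i) us)" if "i < 2 * l" for i
    proof (rule covector_eqI[OF interior_prod_two_form[OF \<sigma>] forms_scaled[OF d_forms]])
      show "i < n" using that h by simp
      show "interior_prod (X i) \<sigma> [u] = (- 1) * covec (d i) [u]" for u
        using X[OF that] by (simp add: interior_prod_def)
    qed
    have dz: "wedge (covec (d i)) ?p us = 0" if "i < 2 * l" for i us
      using z[of "X i" us] unfolding iX[OF that] wedge_scaled_left by simp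
    have "?p us = wedge (covec (d i)) (interior_prod (b i) ?p) us" if i: "i < 2 * l" for i us
    proof -
      have "i < n" using i h by simp
      then show ?thesis
        using dz[OF i, of "b i # us"] wedge_one_form_Cons[OF d_forms, of i ?p "b i" us] d_b[of i i] by simp
    qed
    then have "(\<Sum>i<2 * l. ?p us) = (\<Sum>i<2 * l. wedge (covec (d i)) (interior_prod (b i) ?p) us)" for us
      by (intro sum.cong) auto
    also have "\<And>us. \<dots> us = real (2 * m) * ?p us"
      by (rule euler_identity[OF wedge_power_forms[OF \<sigma>] h]) (use wedge_power_kill[OF \<sigma> kill] in simp)
    finally have "real (2 * l) * ?p us = real (2 * m) * ?p us" for us by simp
    then have "?p us = 0" for us using Suc.prems by (metis Suc_le_lessD mult_cancel_right of_nat_eq_iff nat_less_le mult_cancel1 zero_neq_numeral)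
    then show False using Suc by simp
  qed
qed

lemma span_b: "span (b ` {..<n}) = UNIV"
proof -
  have "v \<in> span (b ` {..<n})" for v
  proof -
    have "(\<Sum>i<n. d i v *\<^sub>R b i) \<in> span (b ` {..<n})"
      by (intro span_sum span_scale span_base) auto
    then show ?thesis by (simp only: expand)
  qed
  then show ?thesis by blast
qed

text \<open>Arguments \<open>b a\<close> with \<open>2 * l \<le> a\<close> kill the power, so its
  value on the first \<open>2 * l\<close> basis vectors decides whether it is 0 at all.\<close>

lemma wedge_power_top_nonzero:
  assumes \<sigma>: "\<sigma> \<in> forms UNIV 2" and h: "2 * l \<le> n"
    and X: "\<And>i v. i < 2 * l \<Longrightarrow> \<sigma> [X i, v] = - d i v"
    and kill: "\<And>a v. 2 * l \<le> a \<Longrightarrow> a < n \<Longrightarrow> \<sigma> [b a, v] = 0"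
  shows "wedge_power \<sigma> l (map b [0..<2 * l]) \<noteq> 0"
proof
  assume z: "wedge_power \<sigma> l (map b [0..<2 * l]) = 0"
  have "wedge_power \<sigma> l us = 0" for us
  proof (rule forms_eq_0_complement[OF wedge_power_forms[OF \<sigma>] _ z, of "b ` {2 * l..<n}"])
    have "set (map b [0..<2 * l]) \<union> b ` {2 * l..<n} = b ` {..<n}"
    proof -
      have "{..<n} = {0..<2 * l} \<union> {2 * l..<n}" using h by auto
      then show ?thesis by (simp only: set_map set_upt image_Un)
    qed
    then show "span (set (map b [0..<2 * l]) \<union> b ` {2 * l..<n}) = UNIV" using span_b by simp
    show "wedge_power \<sigma> l us = 0" if "set us \<inter> b ` {2 * l..<n} \<noteq> {}" for us
      using that wedge_power_kill[OF \<sigma> kill] by auto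
  qed simp
  then show False using wedge_power_nonzero[OF assms, of l] by auto
qed

end

text \<open>Elements of \<open>Y\<close> may only go to \<beta>, so of all shuffles only the one
  giving \<open>xs\<close> to \<alpha> and \<open>ys\<close> to \<beta> remains. The length
  condition is an inequality because the induction also passes through lists \<open>xs\<close> too
  short for \<alpha>, where both sides are 0.\<close>

lemma wedge_split:
  assumes \<alpha>: "\<alpha> \<in> forms UNIV k" and kill: "\<And>y us. y \<in> Y \<Longrightarrow> y \<in> set us \<Longrightarrow> \<alpha> us = 0"
    and ys: "set ys \<subseteq> Y" and len: "length xs \<le> k"
  shows "wedge \<alpha> \<beta> (xs @ ys) = \<alpha> xs * \<beta> ys"
  using \<alpha> kill len
proof (induction xs arbitrary: \<alpha> \<beta> k)
  case Nil
  have "wedge \<alpha> \<beta> ys = \<alpha> [] * \<beta> ys"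
    using ys
  proof (induction ys arbitrary: \<beta>)
    case (Cons y ys)
    have "interior_prod y \<alpha> = (\<lambda>_. 0)" using Nil(2)[of y] Cons.prems by (auto simp: interior_prod_def)
    then have "wedge \<alpha> \<beta> (y # ys) = (- 1) ^ k * (\<alpha> [] * \<beta> (y # ys))"
      using wedge_Cons_forms[OF Nil(1)] Cons by (simp add: wedge_zero_left interior_prod_def)
    then show ?case using forms_eq_0[OF Nil(1), of "[]"] by (cases "k = 0") auto
  qed (simp add: wedge_Nil)
  then show ?case by simp
next
  case (Cons u us)
  obtain j where j: "k = Suc j" using Cons.prems(3) by (cases k) auto
  have "interior_prod u \<alpha> \<in> forms UNIV j" using Cons.prems(1) j interior_prod_forms[OF _ subspace_UNIV] by blast
  then have "wedge (interior_prod u \<alpha>) \<beta> (us @ ys) = interior_prod u \<alpha> us * \<beta> ys"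
    by (rule Cons.IH) (use Cons.prems j in \<open>auto simp: interior_prod_def\<close>)
  moreover have "wedge \<alpha> (interior_prod u \<beta>) (us @ ys) = \<alpha> us * interior_prod u \<beta> ys"
    by (rule Cons.IH[OF Cons.prems(1)]) (use Cons.prems in auto)
  moreover have "\<alpha> us = 0" using forms_eq_0[OF Cons.prems(1), of us] Cons.prems(3) by simp
  ultimately show ?case using wedge_Cons_forms[OF Cons.prems(1), of \<beta> u "us @ ys"] by (simp add: interior_prod_def)
qed

lemma wedge_has_derivative:
  assumes "\<And>us. ((\<lambda>x. \<alpha> x us) has_derivative (\<lambda>v. \<alpha>' us v)) (at x0)"
    and "\<And>us. ((\<lambda>x. \<beta> x us) has_derivative (\<lambda>v. \<beta>' us v)) (at x0)"
  shows "((\<lambda>x. wedge (\<alpha> x) (\<beta> x) us) has_derivative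
    (\<lambda>v. wedge (\<alpha> x0) (\<lambda>us. \<beta>' us v) us + wedge (\<lambda>us. \<alpha>' us v) (\<beta> x0) us)) (at x0)"
proof -
  let ?N = "{..<length us}"
  have "((\<lambda>x. \<Sum>I\<in>Pow ?N. (- 1) ^ card {(i, j). i \<in> I \<and> j \<in> ?N - I \<and> j < i} *
       (\<alpha> x (nths us I) * \<beta> x (nths us (?N - I)))) has_derivative
     (\<lambda>v. \<Sum>I\<in>Pow ?N. (- 1) ^ card {(i, j). i \<in> I \<and> j \<in> ?N - I \<and> j < i} *
       (\<alpha> x0 (nths us I) * \<beta>' (nths us (?N - I)) v + \<alpha>' (nths us I) v * \<beta> x0 (nths us (?N - I))))) (at x0)"
    by (intro has_derivative_sum has_derivative_mult_right has_derivative_mult assms)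
  then show ?thesis
    by (simp add: wedge_def Let_def sum.distrib distrib_left mult.assoc)
qed

text \<open>The derivative of a power at 0 depends only on the value and first derivative of the
  curve, so curves agreeing to first order share an unnamed derivative \<Delta>. This allows
  \<sigma> along a line to be replaced by a family of pullbacks without a formula for the derivative
  of a power.\<close>

lemma wedge_power_has_derivative_unique:
  fixes \<sigma> \<sigma>' :: "real \<Rightarrow> 'e form"
  assumes "\<And>us. ((\<lambda>s. \<sigma> s us) has_derivative \<delta> us) (at 0)"
    and "\<And>us. ((\<lambda>s. \<sigma>' s us) has_derivative \<delta> us) (at 0)" and "\<sigma> 0 = \<sigma>' 0"
  shows "\<exists>\<Delta>. \<forall>us. ((\<lambda>s. wedge_power (\<sigma> s) l us) has_derivative \<Delta> us) (at 0) \<and>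
    ((\<lambda>s. wedge_power (\<sigma>' s) l us) has_derivative \<Delta> us) (at 0)"
proof (induction l)
  case 0
  then show ?case by (intro exI[of _ "\<lambda>_ _. 0"]) (auto intro!: has_derivative_const)
next
  case (Suc l)
  then obtain \<Delta> where \<Delta>: "\<And>us. ((\<lambda>s. wedge_power (\<sigma> s) l us) has_derivative \<Delta> us) (at 0)"
    "\<And>us. ((\<lambda>s. wedge_power (\<sigma>' s) l us) has_derivative \<Delta> us) (at 0)" by blast
  show ?case
    unfolding wedge_power.simps(2)
    using wedge_has_derivative[OF assms(1) \<Delta>(1)] wedge_has_derivative[OF assms(2) \<Delta>(2)] assms(3)
    by (intro exI[of _ "\<lambda>us v. wedge (\<sigma> 0) (\<lambda>us. \<Delta> us v) us + wedge (\<lambda>us. \<delta> us v) (wedge_power (\<sigma> 0) l) us"]) auto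
qed

section \<open>Differentiability of dual frames\<close>

section \<open>Frames depending on a parameter\<close>

text \<open>Continuity of \<open>f\<close> suffices because \<open>g\<close> is 0 at the point: the
  error \<open>(f y - f x0) * g' (y - x0)\<close> is a null function times a linear one, hence of
  smaller order than \<open>norm (y - x0)\<close>.\<close>

lemma has_derivative_mult_vanishing:
  fixes f g :: "'b::real_normed_vector \<Rightarrow> real"
  assumes f: "(f \<longlongrightarrow> f x0) (at x0)" and g: "(g has_derivative g') (at x0)" "g x0 = 0"
  shows "((\<lambda>x. f x * g x) has_derivative (\<lambda>v. f x0 * g' v)) (at x0)"
proof -
  have bl: "bounded_linear g'" using g(1) has_derivative_bounded_linear by blast
  then obtain C where C: "\<And>v. norm (g' v) \<le> norm v * C" using bounded_linear.bounded by blast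
  have l1: "((\<lambda>y. (g y - g' (y - x0)) /\<^sub>R norm (y - x0)) \<longlongrightarrow> 0) (at x0)"
    using g unfolding has_derivative_at_within by (simp add: diff_right_commute)
  have l2: "((\<lambda>y. (f y - f x0) * (g' (y - x0) / norm (y - x0))) \<longlongrightarrow> 0) (at x0)"
  proof (rule tendsto_0_le[where K = "\<bar>C\<bar>"])
    show "((\<lambda>y. f y - f x0) \<longlongrightarrow> 0) (at x0)" using f LIM_zero by blast
    have "norm ((f y - f x0) * (g' (y - x0) / norm (y - x0))) \<le> norm (f y - f x0) * \<bar>C\<bar>" for y
    proof -
      have "norm (g' (y - x0) / norm (y - x0)) \<le> \<bar>C\<bar>"
      proof (cases "y = x0")
        case False
        have "norm (g' (y - x0)) \<le> norm (y - x0) * \<bar>C\<bar>"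
          using C[of "y - x0"] by (meson abs_ge_self mult_left_mono norm_ge_zero order_trans)
        then show ?thesis using False by (simp add: field_simps)
      qed simp
      then show ?thesis unfolding norm_mult by (rule mult_left_mono) simp
    qed
    then show "\<forall>\<^sub>F y in at x0. norm ((f y - f x0) * (g' (y - x0) / norm (y - x0))) \<le> norm (f y - f x0) * \<bar>C\<bar>"
      by simp
  qed
  have "((\<lambda>y. f y * ((g y - g' (y - x0)) /\<^sub>R norm (y - x0)) + (f y - f x0) * (g' (y - x0) / norm (y - x0)))
      \<longlongrightarrow> f x0 * 0 + 0) (at x0)"
    by (intro tendsto_add tendsto_mult f l1 l2)
  moreover have "f y * ((g y - g' (y - x0)) /\<^sub>R norm (y - x0)) + (f y - f x0) * (g' (y - x0) / norm (y - x0))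
      = (f y * g y - f x0 * g x0 - f x0 * g' (y - x0)) /\<^sub>R norm (y - x0)" for y
    using g(2) by (simp add: divide_inverse algebra_simps)
  ultimately show ?thesis
    unfolding has_derivative_at_within
    using bounded_linear_compose[OF bounded_linear_mult_right bl] by (simp add: diff_right_commute)
qed

text \<open>The dual frame is treated without inverting a matrix: its coefficients satisfy the
  implicit equation \<open>eq\<close>, whose correction factors \<open>G i j\<close> vanish at
  \<open>x0\<close>. It yields in turn boundedness, continuity and, by
  \<open>has_derivative_mult_vanishing\<close>, differentiability.\<close>

lemma frame_coefficients_differentiable:
  fixes E :: "'b::real_normed_vector \<Rightarrow> nat \<Rightarrow> 'e::euclidean_space"
  assumes U: "open U" "x0 \<in> U" and frame: "\<And>x. x \<in> U \<Longrightarrow> dual_basis n (E x) (e x)"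
    and E: "\<And>j. j < n \<Longrightarrow> (\<lambda>x. E x j) differentiable (at x0)" and i: "i < n"
  shows "(\<lambda>x. e x i v) differentiable (at x0)"
proof -
  define G where "G i j x = e x0 i (E x j - E x0 j)" for i j x
  interpret f0: dual_basis n "E x0" "e x0" by (rule frame[OF U(2)])
  have bl: "bounded_linear (e x0 i)" if "i < n" for i
    using f0.d_linear[OF that] linear_conv_bounded_linear by blast
  have G: "G i j differentiable (at x0)" if "i < n" "j < n" for i j
  proof -
    have "((\<lambda>x. E x j - E x0 j) has_derivative (\<lambda>v. frechet_derivative (\<lambda>x. E x j) (at x0) v - 0)) (at x0)"
      by (intro has_derivative_diff has_derivative_const differentiable_has_frechet_derivative E that)
    from bounded_linear.has_derivative[OF bl[OF that(1)] this] show ?thesis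
      unfolding G_def by (rule differentiableI)
  qed
  have G0: "G i j x0 = 0" if "i < n" for i j
    using f0.d_linear[OF that] by (simp add: G_def linear_0)
  have eq: "e x i v = e x0 i v - (\<Sum>j<n. e x j v * G i j x)" if "x \<in> U" "i < n" for x i
  proof -
    interpret f: dual_basis n "E x" "e x" by (rule frame[OF that(1)])
    have "e x0 i v = e x0 i (\<Sum>j<n. e x j v *\<^sub>R E x j)" by (simp only: f.expand)
    also have "\<dots> = (\<Sum>j<n. e x j v * e x0 i (E x j))" by (rule f0.d_sum[OF that(2)])
    also have "\<dots> = (\<Sum>j<n. e x j v * G i j x + e x j v * (if i = j then 1 else 0))"
      using f0.d_linear[OF that(2)] f0.d_b[OF that(2)]
      by (intro sum.cong) (auto simp: G_def linear_diff algebra_simps)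
    also have "\<dots> = (\<Sum>j<n. e x j v * G i j x) + e x i v"
    proof -
      have "(\<Sum>j<n. e x j v * (if i = j then 1 else 0)) = (\<Sum>j<n. if i = j then e x j v else 0)"
        by (intro sum.cong) auto
      then show ?thesis using that by (simp only: sum.distrib) simp
    qed
    finally show ?thesis by simp
  qed
  \<comment> \<open>\<open>S\<close> bounds the coefficients of \<open>v\<close>, and
    \<open>g\<close> measures the deviation of the frame from its value at \<open>x0\<close>; the
    implicit equation becomes an estimate of \<open>S\<close> by itself.\<close>
  define S where "S x = (\<Sum>i<n. \<bar>e x i v\<bar>)" for x
  define g where "g x = (\<Sum>i<n. \<Sum>j<n. \<bar>G i j x\<bar>)" for x
  have g: "(g \<longlongrightarrow> 0) (at x0)"
  proof -
    have "(G i j \<longlongrightarrow> 0) (at x0)" if "i < n" "j < n" for i j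
      using differentiable_imp_continuous_within[OF G[OF that]] G0[OF that(1)] by (simp add: continuous_within)
    then have "(g \<longlongrightarrow> (\<Sum>i<n. \<Sum>j<n. \<bar>0\<bar>)) (at x0)"
      unfolding g_def by (intro tendsto_sum tendsto_rabs) auto
    then show ?thesis by simp
  qed
  have S: "S x \<le> S x0 + S x * g x" if "x \<in> U" for x
  proof -
    have "\<bar>e x i v\<bar> \<le> \<bar>e x0 i v\<bar> + (\<Sum>j<n. S x * \<bar>G i j x\<bar>)" if i: "i < n" for i
    proof -
      have "\<bar>e x i v\<bar> \<le> \<bar>e x0 i v\<bar> + \<bar>\<Sum>j<n. e x j v * G i j x\<bar>" using eq[OF \<open>x \<in> U\<close> i] by linarith
      also have "\<bar>\<Sum>j<n. e x j v * G i j x\<bar> \<le> (\<Sum>j<n. \<bar>e x j v * G i j x\<bar>)" by (rule sum_abs)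
      also have "\<dots> \<le> (\<Sum>j<n. S x * \<bar>G i j x\<bar>)"
      proof (rule sum_mono)
        fix j assume "j \<in> {..<n}"
        then have "\<bar>e x j v\<bar> \<le> S x" unfolding S_def by (intro member_le_sum) auto
        then show "\<bar>e x j v * G i j x\<bar> \<le> S x * \<bar>G i j x\<bar>" by (simp add: abs_mult mult_right_mono)
      qed
      finally show ?thesis by simp
    qed
    then have "(\<Sum>i<n. \<bar>e x i v\<bar>) \<le> (\<Sum>i<n. \<bar>e x0 i v\<bar> + (\<Sum>j<n. S x * \<bar>G i j x\<bar>))"
      by (intro sum_mono) blast
    also have "\<dots> = S x0 + S x * g x"
      by (simp only: S_def[of x0] g_def sum.distrib sum_distrib_left)
    finally show ?thesis by (simp only: S_def[of x, symmetric])
  qed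
  have evU: "eventually (\<lambda>x. x \<in> U) (at x0)" using U eventually_at_topological by blast
  have "eventually (\<lambda>x. g x < 1 / 2) (at x0)" by (rule order_tendstoD(2)[OF g]) simp
  \<comment> \<open>Once \<open>g\<close> is below 1/2, the term with \<open>S x\<close> on the
    right is absorbed by the left-hand side.\<close>
  then have bd: "eventually (\<lambda>x. S x \<le> 2 * S x0) (at x0)"
    using evU
  proof eventually_elim
    case (elim x)
    have "0 \<le> S x" by (simp add: S_def sum_nonneg)
    then have "S x * g x \<le> S x * (1 / 2)" using elim by (intro mult_left_mono) auto
    then show ?case using S[OF elim(2)] by simp
  qed
  have cont: "((\<lambda>x. e x j v) \<longlongrightarrow> e x0 j v) (at x0)" if j: "j < n" for j
  proof -
    have "((\<lambda>x. e x j v - e x0 j v) \<longlongrightarrow> 0) (at x0)"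
    proof (rule tendsto_0_le[OF g, where K = "2 * S x0"])
      show "\<forall>\<^sub>F x in at x0. norm (e x j v - e x0 j v) \<le> norm (g x) * (2 * S x0)"
        using bd evU
      proof eventually_elim
        case (elim x)
        have "e x j v - e x0 j v = - (\<Sum>k<n. e x k v * G j k x)" using eq[OF elim(2) j] by linarith
        then have "norm (e x j v - e x0 j v) = \<bar>\<Sum>k<n. e x k v * G j k x\<bar>"
          by (simp only: real_norm_def abs_minus_cancel)
        also have "\<dots> \<le> (\<Sum>k<n. \<bar>e x k v * G j k x\<bar>)" by (rule sum_abs)
        also have "\<dots> \<le> (\<Sum>k<n. 2 * S x0 * \<bar>G j k x\<bar>)"
        proof (rule sum_mono)
          fix k assume "k \<in> {..<n}"
          then have "\<bar>e x k v\<bar> \<le> S x" unfolding S_def by (intro member_le_sum) auto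
          then have "\<bar>e x k v\<bar> \<le> 2 * S x0" using elim by linarith
          then show "\<bar>e x k v * G j k x\<bar> \<le> 2 * S x0 * \<bar>G j k x\<bar>" unfolding abs_mult by (intro mult_right_mono) auto
        qed
        also have "\<dots> = 2 * S x0 * (\<Sum>k<n. \<bar>G j k x\<bar>)" by (simp add: sum_distrib_left)
        also have "\<dots> \<le> 2 * S x0 * g x"
        proof (rule mult_left_mono)
          show "(\<Sum>k<n. \<bar>G j k x\<bar>) \<le> g x"
            unfolding g_def using j by (intro member_le_sum[of j "{..<n}" "\<lambda>i. \<Sum>k<n. \<bar>G i k x\<bar>"]) (auto intro: sum_nonneg)
          show "0 \<le> 2 * S x0" by (simp add: S_def sum_nonneg)
        qed
        also have "\<dots> \<le> norm (g x) * (2 * S x0)"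
        proof -
          have "g x \<le> norm (g x)" "0 \<le> 2 * S x0" by (auto simp: S_def sum_nonneg)
          then have "2 * S x0 * g x \<le> 2 * S x0 * norm (g x)" by (rule mult_left_mono)
          then show ?thesis by (simp only: mult.commute)
        qed
        finally show ?case .
      qed
    qed
    then show ?thesis by (rule LIM_zero_cancel)
  qed
  have dG: "((\<lambda>x. e x j v * G i j x) has_derivative (\<lambda>w. e x0 j v * frechet_derivative (G i j) (at x0) w)) (at x0)"
    if "j < n" for j
    by (rule has_derivative_mult_vanishing[OF cont[OF that] differentiable_has_frechet_derivative[OF G[OF i that]] G0[OF i]])
  have "((\<lambda>x. e x0 i v - (\<Sum>j<n. e x j v * G i j x)) has_derivative
      (\<lambda>w. 0 - (\<Sum>j<n. e x0 j v * frechet_derivative (G i j) (at x0) w))) (at x0)"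
    by (rule has_derivative_diff[OF has_derivative_const has_derivative_sum]) (rule dG, simp)
  then have "((\<lambda>x. e x i v) has_derivative
      (\<lambda>w. 0 - (\<Sum>j<n. e x0 j v * frechet_derivative (G i j) (at x0) w))) (at x0)"
  proof (rule has_derivative_transform_within_open[OF _ U])
    show "e x0 i v - (\<Sum>j<n. e x j v * G i j x) = e x i v" if "x \<in> U" for x
      by (rule eq[OF that i, symmetric])
  qed
  then show ?thesis by (rule differentiableI)
qed


section \<open>The coordinate computation at one point of an adapted chart\<close>

section \<open>The modular vector field in an adapted chart\<close>

text \<open>
  The coordinates are such that \<open>b\<^sub>h, \<dots>, b\<^sub>n\<^sub>-\<^sub>1\<close> span the leaf directions everywhere and
  \<open>b\<^sub>0, \<dots>, b\<^sub>h\<^sub>-\<^sub>1\<close> span the horizontal space at \<open>x0\<close>, where \<open>h = 2 l\<close>.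
  The horizontal space at \<open>x\<close> is spanned by the Hamiltonian vectors \<open>X\<^sub>i = \<Sum>\<^sub>m \<pi>\<^sub>i\<^sub>m b\<^sub>m\<close>, \<open>i < h\<close>,
  and \<open>e x\<close> is the dual basis of \<open>X\<^sub>0, \<dots>, X\<^sub>h\<^sub>-\<^sub>1, b\<^sub>h, \<dots>, b\<^sub>n\<^sub>-\<^sub>1\<close>.
\<close>
locale local_coupling = dual_basis n b d
  for n :: nat and b :: "nat \<Rightarrow> 'e::euclidean_space" and d +
  fixes l :: nat and U :: "'e set" and x0 :: 'e
    and \<pi> :: "nat \<Rightarrow> nat \<Rightarrow> 'e \<Rightarrow> real" and e :: "'e \<Rightarrow> nat \<Rightarrow> 'e \<Rightarrow> real"
    and \<sigma> \<tau> :: "'e \<Rightarrow> 'e form"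
  assumes l: "2 * l \<le> n" and U: "open U" "x0 \<in> U"
    and \<pi>_anti: "\<And>x i j. x \<in> U \<Longrightarrow> i < n \<Longrightarrow> j < n \<Longrightarrow> \<pi> i j x = - \<pi> j i x"
    and \<pi>_diff: "\<And>i j. i < n \<Longrightarrow> j < n \<Longrightarrow> \<pi> i j differentiable (at x0)"
    and jacobi: "\<And>m k i. m < n \<Longrightarrow> k < n \<Longrightarrow> i < n \<Longrightarrow>
      (\<Sum>j<n. \<pi> m j x0 * frechet_derivative (\<pi> k i) (at x0) (b j)) +
      (\<Sum>j<n. \<pi> k j x0 * frechet_derivative (\<pi> i m) (at x0) (b j)) +
      (\<Sum>j<n. \<pi> i j x0 * frechet_derivative (\<pi> m k) (at x0) (b j)) = 0"
    and off: "\<And>i a. i < 2 * l \<Longrightarrow> 2 * l \<le> a \<Longrightarrow> a < n \<Longrightarrow> \<pi> i a x0 = 0"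
    and frame: "\<And>x. x \<in> U \<Longrightarrow>
      dual_basis n (\<lambda>i. if i < 2 * l then (\<Sum>m<n. \<pi> i m x *\<^sub>R b m) else b i) (e x)"
    and \<sigma>_forms: "\<And>x. x \<in> U \<Longrightarrow> \<sigma> x \<in> forms UNIV 2"
    and \<sigma>_X0: "\<And>x i v. x \<in> U \<Longrightarrow> i < 2 * l \<Longrightarrow> \<sigma> x [\<Sum>m<n. \<pi> i m x *\<^sub>R b m, v] = - d i v"
    and \<sigma>_kill: "\<And>x a v. x \<in> U \<Longrightarrow> 2 * l \<le> a \<Longrightarrow> a < n \<Longrightarrow> \<sigma> x [b a, v] = 0"
    and \<tau>_forms: "\<And>x. x \<in> U \<Longrightarrow> \<tau> x \<in> forms UNIV (n - 2 * l)"
    and \<tau>_diff: "\<And>us. (\<lambda>x. \<tau> x us) differentiable (at x0)"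
    and \<tau>_kill: "\<And>x i us. x \<in> U \<Longrightarrow> i < 2 * l \<Longrightarrow> b i \<in> set us \<Longrightarrow> \<tau> x us = 0"
    and \<tau>_nz: "\<And>x. x \<in> U \<Longrightarrow> \<tau> x (map b [2 * l..<n]) \<noteq> 0"
begin

abbreviation h :: nat where "h \<equiv> 2 * l"
abbreviation D :: "('e \<Rightarrow> real) \<Rightarrow> 'e \<Rightarrow> real" where "D f \<equiv> frechet_derivative f (at x0)"

definition X :: "nat \<Rightarrow> 'e \<Rightarrow> 'e" where "X i x = (\<Sum>m<n. \<pi> i m x *\<^sub>R b m)"
definition E :: "'e \<Rightarrow> nat \<Rightarrow> 'e" where "E x i = (if i < h then X i x else b i)"
definition t :: "'e \<Rightarrow> real" where "t x = \<tau> x (map b [h..<n])"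
text \<open>The connection form in the chart. As the \<open>b a\<close> are constant, its dependence
  on the point lies in the coefficients \<open>e x a\<close> alone.\<close>

definition pr :: "'e \<Rightarrow> 'e \<Rightarrow> 'e" where "pr x v = (\<Sum>a\<in>{h..<n}. e x a v *\<^sub>R b a)"
definition \<tau>\<gamma> :: "'e \<Rightarrow> 'e form" where "\<tau>\<gamma> x = pull (pr x) (\<tau> x)"
definition \<Omega> :: "'e \<Rightarrow> 'e form" where "\<Omega> x = wedge (wedge_power (\<sigma> x) l) (\<tau>\<gamma> x)"
definition g :: "'e \<Rightarrow> real" where "g x = wedge_power (\<sigma> x) l (map b [0..<h])"
definition \<rho> :: "'e \<Rightarrow> real" where "\<rho> x = \<Omega> x (map b [0..<n])"

lemma frame_E: "x \<in> U \<Longrightarrow> dual_basis n (E x) (e x)"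
proof -
  have "E x = (\<lambda>i. if i < 2 * l then (\<Sum>m<n. \<pi> i m x *\<^sub>R b m) else b i)"
    by (simp add: fun_eq_iff E_def X_def)
  then show "x \<in> U \<Longrightarrow> dual_basis n (E x) (e x)" using frame[of x] by simp
qed

lemma \<sigma>_X: "x \<in> U \<Longrightarrow> i < h \<Longrightarrow> \<sigma> x [X i x, v] = - d i v"
  using \<sigma>_X0 by (simp add: X_def)

lemma dX: "j < n \<Longrightarrow> d j (X i x) = \<pi> i j x"
  unfolding X_def by (rule d_sum_b)

lemma e_linear: "x \<in> U \<Longrightarrow> i < n \<Longrightarrow> linear (e x i)"
  by (rule dual_basis.d_linear[OF frame_E])

lemma e_X: "x \<in> U \<Longrightarrow> j < n \<Longrightarrow> i < h \<Longrightarrow> e x j (X i x) = (if j = i then 1 else 0)"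
  using dual_basis.d_b[OF frame_E, of x j i] l by (simp add: E_def)

lemma e_b: "x \<in> U \<Longrightarrow> j < n \<Longrightarrow> h \<le> a \<Longrightarrow> a < n \<Longrightarrow> e x j (b a) = (if j = a then 1 else 0)"
  using dual_basis.d_b[OF frame_E, of x j a] by (simp add: E_def)

lemma frame_expand: "x \<in> U \<Longrightarrow> v = (\<Sum>i<h. e x i v *\<^sub>R X i x) + pr x v"
proof -
  assume x: "x \<in> U"
  have "v = (\<Sum>i<n. e x i v *\<^sub>R E x i)" by (rule dual_basis.expand[OF frame_E[OF x], symmetric])
  also have "\<dots> = (\<Sum>i<h. e x i v *\<^sub>R E x i) + (\<Sum>i\<in>{h..<n}. e x i v *\<^sub>R E x i)"
    using l by (simp add: lessThan_atLeast0 sum.atLeastLessThan_concat)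
  finally show ?thesis by (simp add: E_def pr_def)
qed

lemma \<sigma>_swap: "x \<in> U \<Longrightarrow> \<sigma> x [u, v] = - \<sigma> x [v, u]"
  using forms_swap[OF \<sigma>_forms subspace_UNIV, of x "[]" u v "[]"] by simp

lemma \<sigma>_X_right: "x \<in> U \<Longrightarrow> i < h \<Longrightarrow> \<sigma> x [v, X i x] = d i v"
  using \<sigma>_swap[of x v "X i x"] \<sigma>_X by simp

lemma \<sigma>_pr: "x \<in> U \<Longrightarrow> \<sigma> x [pr x u, v] = 0"
proof -
  assume x: "x \<in> U"
  have "\<sigma> x ([] @ (\<Sum>a\<in>{h..<n}. e x a u *\<^sub>R b a) # [v]) = (\<Sum>a\<in>{h..<n}. e x a u * \<sigma> x ([] @ b a # [v]))"
    by (rule forms_sum[OF \<sigma>_forms[OF x] subspace_UNIV]) auto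
  then show ?thesis using \<sigma>_kill[OF x] by (simp add: pr_def)
qed

lemma \<sigma>_eq: "x \<in> U \<Longrightarrow> \<sigma> x [u, v] = - (\<Sum>i<h. e x i u * d i v)"
proof -
  assume x: "x \<in> U"
  have "\<sigma> x [u, v] = \<sigma> x ([] @ ((\<Sum>i<h. e x i u *\<^sub>R X i x) + pr x u) # [v])"
    using frame_expand[OF x, of u] by simp
  also have "\<dots> = \<sigma> x ([] @ (\<Sum>i<h. e x i u *\<^sub>R X i x) # [v]) + \<sigma> x ([] @ pr x u # [v])"
    by (rule forms_add[OF \<sigma>_forms[OF x] subspace_UNIV]) auto
  also have "\<sigma> x ([] @ (\<Sum>i<h. e x i u *\<^sub>R X i x) # [v]) = (\<Sum>i<h. e x i u * \<sigma> x ([] @ X i x # [v]))"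
    by (rule forms_sum[OF \<sigma>_forms[OF x] subspace_UNIV]) auto
  finally show ?thesis using \<sigma>_X[OF x] \<sigma>_pr[OF x] by (simp add: sum_negf)
qed

lemma e_low: "x \<in> U \<Longrightarrow> k < h \<Longrightarrow> j < n \<Longrightarrow> (\<Sum>i<h. e x i (b k) * \<pi> i j x) + d j (pr x (b k)) = (if j = k then 1 else 0)"
proof -
  assume x: "x \<in> U" and k: "k < h" and j: "j < n"
  have "(if j = k then 1 else 0) = d j (b k)" using d_b[of j k] k l j by simp
  also have "\<dots> = d j ((\<Sum>i<h. e x i (b k) *\<^sub>R X i x) + pr x (b k))" using frame_expand[OF x, of "b k"] by simp
  also have "\<dots> = d j (\<Sum>i<h. e x i (b k) *\<^sub>R X i x) + d j (pr x (b k))" using d_linear[OF j] linear_add by blast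
  also have "d j (\<Sum>i<h. e x i (b k) *\<^sub>R X i x) = (\<Sum>i<h. e x i (b k) * d j (X i x))" by (rule d_sum[OF j])
  finally show ?thesis using dX[OF j] by simp
qed

lemma d_pr_low: "j < h \<Longrightarrow> d j (pr x v) = 0"
proof -
  assume j: "j < h"
  then have jn: "j < n" using l by simp
  have "d j (pr x v) = (\<Sum>a\<in>{h..<n}. e x a v * d j (b a))" unfolding pr_def by (rule d_sum[OF jn])
  also have "\<dots> = 0" using j jn by (intro sum.neutral) (auto simp: d_b)
  finally show ?thesis .
qed

lemma d_pr_high: "x \<in> U \<Longrightarrow> h \<le> j \<Longrightarrow> j < n \<Longrightarrow> d j (pr x v) = e x j v"
proof -
  assume x: "x \<in> U" and j: "h \<le> j" "j < n"
  have "d j (pr x v) = (\<Sum>a\<in>{h..<n}. e x a v * d j (b a))" unfolding pr_def by (rule d_sum[OF j(2)])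
  also have "\<dots> = (\<Sum>a\<in>{h..<n}. if a = j then e x a v else 0)" using j by (intro sum.cong) (auto simp: d_b)
  finally show ?thesis using j by simp
qed

text \<open>Taking coordinates \<open>d j\<close> with \<open>j < h\<close> in the frame expansion
  of \<open>b k\<close> removes its vertical part. Thus the numbers \<open>e x i (b k)\<close> form
  the inverse of the horizontal block of \<pi>, at every point of \<open>U\<close> and not only at
  \<open>x0\<close>.\<close>

lemma e_inverse_left: "x \<in> U \<Longrightarrow> k < h \<Longrightarrow> j < h \<Longrightarrow> (\<Sum>i<h. e x i (b k) * \<pi> i j x) = (if j = k then 1 else 0)"
  using e_low[of x k j] d_pr_low[of j x] l by simp

lemma e_inverse_right: "x \<in> U \<Longrightarrow> i < h \<Longrightarrow> k < h \<Longrightarrow> (\<Sum>m<h. \<pi> i m x * e x k (b m)) = (if k = i then 1 else 0)"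
proof -
  assume x: "x \<in> U" and i: "i < h" and k: "k < h"
  have kn: "k < n" using k l by simp
  have "e x k (X i x) = (\<Sum>m<n. \<pi> i m x * e x k (b m))"
    unfolding X_def by (rule dual_basis.d_sum[OF frame_E[OF x] kn])
  also have "\<dots> = (\<Sum>m<h. \<pi> i m x * e x k (b m))"
    by (rule sum.mono_neutral_right) (use l k e_b[OF x kn] in auto)
  finally show ?thesis using e_X[OF x kn i] by simp
qed

text \<open>The mixed block of \<pi> vanishes at \<open>x0\<close>, so the frame expansion of
  \<open>b k\<close> there has no vertical part: the first \<open>h\<close> basis vectors are
  horizontal at \<open>x0\<close>.\<close>

lemma e_high_low: "h \<le> a \<Longrightarrow> a < n \<Longrightarrow> k < h \<Longrightarrow> e x0 a (b k) = 0"
proof -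
  assume a: "h \<le> a" "a < n" and k: "k < h"
  have "(\<Sum>i<h. e x0 i (b k) * \<pi> i a x0) = 0" using off a by (intro sum.neutral) auto
  then show ?thesis using e_low[OF U(2) k a(2)] d_pr_high[OF U(2) a, of "b k"] a k by simp
qed

lemma pr_x0: "pr x0 v = (\<Sum>a\<in>{h..<n}. d a v *\<^sub>R b a)"
  unfolding pr_def
proof (rule sum.cong[OF refl])
  fix a assume a: "a \<in> {h..<n}"
  then have an: "a < n" by simp
  have "e x0 a v = (\<Sum>i<n. d i v *\<^sub>R e x0 a (b i))" by (rule linear_expand[OF e_linear[OF U(2) an]])
  also have "\<dots> = (\<Sum>i<n. if i = a then d i v else 0)"
  proof (rule sum.cong[OF refl])
    fix i assume i: "i \<in> {..<n}"
    show "d i v *\<^sub>R e x0 a (b i) = (if i = a then d i v else 0)"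
      using e_high_low[of a i] e_b[OF U(2) an, of i] a i by (cases "i < h") auto
  qed
  finally show "e x0 a v *\<^sub>R b a = d a v *\<^sub>R b a" using an by simp
qed

lemma pr_b: "x \<in> U \<Longrightarrow> h \<le> a \<Longrightarrow> a < n \<Longrightarrow> pr x (b a) = b a"
proof -
  assume x: "x \<in> U" and a: "h \<le> a" "a < n"
  have "pr x (b a) = (\<Sum>c\<in>{h..<n}. if c = a then b a else 0)"
    unfolding pr_def using e_b[OF x _ a] by (intro sum.cong) auto
  then show ?thesis using a by simp
qed

lemma pr_X: "x \<in> U \<Longrightarrow> i < h \<Longrightarrow> pr x (X i x) = 0"
  unfolding pr_def using e_X by (intro sum.neutral) auto

lemma pr_linear: "x \<in> U \<Longrightarrow> linear (pr x)"
proof (rule linearI)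
  assume x: "x \<in> U"
  show "pr x (u + v) = pr x u + pr x v" for u v
    unfolding pr_def sum.distrib[symmetric]
    by (rule sum.cong) (use e_linear[OF x] in \<open>auto simp: linear_add scaleR_add_left\<close>)
  show "pr x (r *\<^sub>R v) = r *\<^sub>R pr x v" for r v
    unfolding pr_def scaleR_sum_right
    by (rule sum.cong) (use e_linear[OF x] in \<open>auto simp: linear_cmul\<close>)
qed

lemma \<tau>\<gamma>_forms: "x \<in> U \<Longrightarrow> \<tau>\<gamma> x \<in> forms UNIV (n - h)"
  unfolding \<tau>\<gamma>_def by (intro pull_forms pr_linear \<tau>_forms)

lemma \<tau>\<gamma>_X: "x \<in> U \<Longrightarrow> i < h \<Longrightarrow> \<tau>\<gamma> x (X i x # us) = 0"
  using forms_zero_arg[OF \<tau>_forms subspace_UNIV, of x "[]"] by (simp add: \<tau>\<gamma>_def pull_def pr_X)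

lemma map_pr: "x \<in> U \<Longrightarrow> set us \<subseteq> b ` {h..<n} \<Longrightarrow> map (pr x) us = us"
  using pr_b by (intro map_idI) auto

lemma \<tau>\<gamma>_vertical: "x \<in> U \<Longrightarrow> set us \<subseteq> b ` {h..<n} \<Longrightarrow> \<tau>\<gamma> x us = \<tau> x us"
  by (simp add: \<tau>\<gamma>_def pull_def map_pr)

lemma pr_x0_low: "k < h \<Longrightarrow> pr x0 (b k) = 0"
  unfolding pr_x0 using l by (intro sum.neutral) (auto simp: d_b)

lemma \<tau>\<gamma>_low: "k < h \<Longrightarrow> \<tau>\<gamma> x0 (b k # us) = 0"
  using forms_zero_arg[OF \<tau>_forms[OF U(2)] subspace_UNIV, of "[]"]
  by (simp add: \<tau>\<gamma>_def pull_def pr_x0_low)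

lemma \<Omega>_forms: "x \<in> U \<Longrightarrow> \<Omega> x \<in> forms UNIV n"
  using wedge_forms[OF wedge_power_forms[OF \<sigma>_forms] \<tau>\<gamma>_forms, of x x l] l by (simp add: \<Omega>_def)

lemma \<rho>_eq: "x \<in> U \<Longrightarrow> \<rho> x = g x * t x"
proof -
  assume x: "x \<in> U"
  have "[0..<n] = [0..<h] @ [h..<n]" using l upt_add_eq_append[of 0 h "n - h"] by simp
  then have "\<rho> x = wedge (wedge_power (\<sigma> x) l) (\<tau>\<gamma> x) (map b [0..<h] @ map b [h..<n])"
    by (simp add: \<rho>_def \<Omega>_def)
  also have "\<dots> = g x * \<tau>\<gamma> x (map b [h..<n])"
    unfolding g_def
  proof (rule wedge_split[OF wedge_power_forms[OF \<sigma>_forms[OF x]]])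
    show "wedge_power (\<sigma> x) l us = 0" if "y \<in> b ` {h..<n}" "y \<in> set us" for y us
      using wedge_power_kill[OF \<sigma>_forms[OF x] _ that(2)] \<sigma>_kill[OF x] that(1) by auto
  qed auto
  also have "\<tau>\<gamma> x (map b [h..<n]) = t x" unfolding t_def by (rule \<tau>\<gamma>_vertical[OF x]) auto
  finally show ?thesis .
qed

lemma g_nz: "x \<in> U \<Longrightarrow> g x \<noteq> 0"
  unfolding g_def by (rule wedge_power_top_nonzero[OF \<sigma>_forms l, of x "\<lambda>i. X i x"]) (use \<sigma>_X \<sigma>_kill in auto)

lemma t_nz: "x \<in> U \<Longrightarrow> t x \<noteq> 0"
  using \<tau>_nz by (simp add: t_def)

lemma \<rho>_nz: "x \<in> U \<Longrightarrow> \<rho> x \<noteq> 0"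
  using \<rho>_eq g_nz t_nz by simp

subsection \<open>Differentiability\<close>

lemma \<pi>D: "i < n \<Longrightarrow> j < n \<Longrightarrow> (\<pi> i j has_derivative D (\<pi> i j)) (at x0)"
  by (rule differentiable_has_frechet_derivative[OF \<pi>_diff])

lemma X_diff: "i < n \<Longrightarrow> X i differentiable (at x0)"
  unfolding X_def[abs_def] by (intro differentiable_sum ballI differentiable_scaleR differentiable_const \<pi>_diff) auto

lemma e_diff: "i < n \<Longrightarrow> (\<lambda>x. e x i v) differentiable (at x0)"
proof (rule frame_coefficients_differentiable[OF U frame_E])
  show "(\<lambda>x. E x j) differentiable at x0" if "j < n" for j
    using X_diff[OF that] by (cases "j < h") (simp_all add: E_def)
qed

lemma pr_diff: "(\<lambda>x. pr x v) differentiable (at x0)"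
  unfolding pr_def by (intro differentiable_sum ballI differentiable_scaleR differentiable_const e_diff) auto

lemma differentiable_cong_U:
  "f differentiable (at x0) \<Longrightarrow> (\<And>x. x \<in> U \<Longrightarrow> f x = f' x) \<Longrightarrow> f' differentiable (at x0)"
  by (rule differentiable_transform_open[OF _ U])

lemma \<sigma>_diff: "(\<lambda>x. \<sigma> x us) differentiable (at x0)"
proof (cases "\<exists>u v. us = [u, v]")
  case True
  then obtain u v where us: "us = [u, v]" by blast
  have "(\<lambda>x. - (\<Sum>i<h. e x i u * d i v)) differentiable (at x0)"
    using l by (intro differentiable_minus differentiable_sum ballI differentiable_mult differentiable_const e_diff) auto
  then show ?thesis unfolding us by (rule differentiable_cong_U) (rule \<sigma>_eq[symmetric])
next
  case False
  then have "length us \<noteq> 2" by (metis (no_types, opaque_lifting) One_nat_def Suc_length_conv length_0_conv numeral_2_eq_2)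
  then have "\<sigma> x us = 0" if "x \<in> U" for x using forms_eq_0[OF \<sigma>_forms[OF that]] by blast
  then have "0 = \<sigma> x us" if "x \<in> U" for x using that by simp
  then show ?thesis by (rule differentiable_cong_U[OF differentiable_const])
qed

lemma \<tau>\<gamma>_diff: "(\<lambda>x. \<tau>\<gamma> x us) differentiable (at x0)"
  unfolding \<tau>\<gamma>_def pull_def
  by (rule differentiableI, rule has_derivative_multilinear[OF U \<tau>_forms
        differentiable_has_frechet_derivative[OF \<tau>_diff] differentiable_has_frechet_derivative[OF pr_diff]])

lemma wedge_diff:
  assumes "\<And>us. (\<lambda>x. \<alpha> x us) differentiable (at x0)" "\<And>us. (\<lambda>x. \<beta> x us) differentiable (at x0)"
  shows "(\<lambda>x. wedge (\<alpha> x) (\<beta> x) us) differentiable (at x0)"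
  by (rule differentiableI, rule wedge_has_derivative)
    (rule differentiable_has_frechet_derivative, rule assms)+

lemma wedge_power_diff: "(\<lambda>x. wedge_power (\<sigma> x) k us) differentiable (at x0)"
proof (induction k arbitrary: us)
  case (Suc k)
  then show ?case unfolding wedge_power.simps(2) by (intro wedge_diff \<sigma>_diff)
qed simp

lemma \<Omega>_diff: "(\<lambda>x. \<Omega> x us) differentiable (at x0)"
  unfolding \<Omega>_def by (intro wedge_diff wedge_power_diff \<tau>\<gamma>_diff)

lemma g_diff: "g differentiable (at x0)"
  unfolding g_def[abs_def] by (rule wedge_power_diff)

lemma t_diff: "t differentiable (at x0)"
  unfolding t_def[abs_def] by (rule \<tau>_diff)

lemma \<rho>_diff: "\<rho> differentiable (at x0)"
  unfolding \<rho>_def[abs_def] by (rule \<Omega>_diff)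

lemma D_unique: "f differentiable (at x0) \<Longrightarrow> (f' has_derivative G) (at x0) \<Longrightarrow>
    (\<And>x. x \<in> U \<Longrightarrow> f x = f' x) \<Longrightarrow> D f w = G w"
  by (rule has_derivative_eventually_unique[OF differentiable_has_frechet_derivative _ U])

lemma D_\<pi>_anti: "i < n \<Longrightarrow> j < n \<Longrightarrow> D (\<pi> i j) w = - D (\<pi> j i) w"
  by (rule D_unique[OF \<pi>_diff has_derivative_minus[OF \<pi>D]]) (auto intro: \<pi>_anti)

lemma D_\<rho>: "D \<rho> w = g x0 * D t w + D g w * t x0"
  by (rule D_unique[OF \<rho>_diff has_derivative_mult[OF differentiable_has_frechet_derivative[OF g_diff]
          differentiable_has_frechet_derivative[OF t_diff]] \<rho>_eq])

subsection \<open>The logarithmic derivative of the horizontal volume\<close>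

text \<open>
  Differentiating \<open>\<sigma>(X\<^sub>i, v) = - d\<^sub>i v\<close> shows that the derivative of \<open>\<sigma>\<close> in direction \<open>w\<close> is that of the
  pullbacks of \<open>\<sigma>\<close> along \<open>1 + s B\<close> with \<open>B = Bop w\<close>, so that the top power has logarithmic derivative \<open>tr B\<close>.
\<close>
definition Bop :: "'e \<Rightarrow> 'e \<Rightarrow> 'e" where
  "Bop w u = (- 1 / 2) *\<^sub>R (\<Sum>i<h. e x0 i u *\<^sub>R (\<Sum>j<h. D (\<pi> i j) w *\<^sub>R b j))"

lemma Bop_linear: "linear (Bop w)"
proof -
  have e: "linear (e x0 i)" if "i < h" for i using e_linear[OF U(2)] that l by simp
  show ?thesis
  proof (rule linearI)
    show "Bop w (u + v) = Bop w u + Bop w v" for u v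
      unfolding Bop_def scaleR_add_right[symmetric] sum.distrib[symmetric] scaleR_add_left[symmetric]
      by (intro arg_cong[of _ _ "(*\<^sub>R) (- 1 / 2)"] sum.cong refl) (use e in \<open>simp add: linear_add\<close>)
    show "Bop w (r *\<^sub>R u) = r *\<^sub>R Bop w u" for r u
    proof -
      have "(\<Sum>i<h. e x0 i (r *\<^sub>R u) *\<^sub>R (\<Sum>j<h. D (\<pi> i j) w *\<^sub>R b j)) =
          r *\<^sub>R (\<Sum>i<h. e x0 i u *\<^sub>R (\<Sum>j<h. D (\<pi> i j) w *\<^sub>R b j))"
        unfolding scaleR_sum_right[of r] by (rule sum.cong) (use e in \<open>auto simp: linear_cmul\<close>)
      then show ?thesis unfolding Bop_def by (simp only: scaleR_left_commute)
    qed
  qed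
qed

lemma d_Bop: "j < h \<Longrightarrow> d j (Bop w u) = - (\<Sum>i<h. e x0 i u * D (\<pi> i j) w) / 2"
proof -
  assume j: "j < h"
  then have jn: "j < n" using l by simp
  have in1: "d j (\<Sum>k<h. D (\<pi> i k) w *\<^sub>R b k) = D (\<pi> i j) w" for i
  proof -
    have "d j (\<Sum>k<h. D (\<pi> i k) w *\<^sub>R b k) = (\<Sum>k<h. D (\<pi> i k) w * d j (b k))" by (rule d_sum[OF jn])
    also have "\<dots> = (\<Sum>k<h. if k = j then D (\<pi> i k) w else 0)"
      using jn l by (intro sum.cong) (auto simp: d_b)
    finally show ?thesis using j by simp
  qed
  have "d j (Bop w u) = (- 1 / 2) * d j (\<Sum>i<h. e x0 i u *\<^sub>R (\<Sum>j<h. D (\<pi> i j) w *\<^sub>R b j))"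
    unfolding Bop_def linear_cmul[OF d_linear[OF jn]] by simp
  also have "d j (\<Sum>i<h. e x0 i u *\<^sub>R (\<Sum>j<h. D (\<pi> i j) w *\<^sub>R b j)) =
      (\<Sum>i<h. e x0 i u * d j (\<Sum>j<h. D (\<pi> i j) w *\<^sub>R b j))"
    by (rule d_sum[OF jn])
  also have "\<dots> = (\<Sum>i<h. e x0 i u * D (\<pi> i j) w)" by (simp only: in1)
  finally show ?thesis by simp
qed

lemma D_\<sigma>_forms: "(\<lambda>us. D (\<lambda>x. \<sigma> x us) w) \<in> forms UNIV 2"
  by (rule has_derivative_forms[OF U \<sigma>_forms subspace_UNIV differentiable_has_frechet_derivative[OF \<sigma>_diff]])

lemma D_\<sigma>_kill: "h \<le> a \<Longrightarrow> a < n \<Longrightarrow> D (\<lambda>x. \<sigma> x [b a, v]) w = 0"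
  by (rule D_unique[OF \<sigma>_diff has_derivative_const]) (rule \<sigma>_kill)

text \<open>With the second argument frozen at \<open>X j x0\<close>, the value of \<sigma> on
  \<open>X i x\<close> is constant in \<open>x\<close>. The derivative of \<sigma> is therefore
  minus \<sigma> applied to the derivative of \<open>X i\<close>, and the pairing with
  \<open>X j x0\<close> extracts the coordinate \<open>j\<close>.\<close>

lemma D_\<sigma>_X_X: "i < h \<Longrightarrow> j < h \<Longrightarrow> D (\<lambda>x. \<sigma> x [X i x0, X j x0]) w = - D (\<pi> i j) w"
proof -
  assume i: "i < h" and j: "j < h"
  let ?v = "X j x0"
  have "n \<ge> i" and inn: "i < n" using i l by auto
  have A: "((\<lambda>x. \<Sum>m<n. \<pi> i m x * \<sigma> x [b m, ?v]) has_derivative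
      (\<lambda>w. \<Sum>m<n. \<pi> i m x0 * D (\<lambda>x. \<sigma> x [b m, ?v]) w + D (\<pi> i m) w * \<sigma> x0 [b m, ?v])) (at x0)"
    by (intro has_derivative_sum has_derivative_mult \<pi>D differentiable_has_frechet_derivative[OF \<sigma>_diff] inn) auto
  have "\<sigma> x [X i x, ?v] = (\<Sum>m<n. \<pi> i m x * \<sigma> x [b m, ?v])" if "x \<in> U" for x
    using forms_sum[OF \<sigma>_forms[OF that] subspace_UNIV, of "{..<n}" b "[]" "\<lambda>m. \<pi> i m x" "[?v]"]
    by (simp add: X_def)
  then have B: "- d i ?v = (\<Sum>m<n. \<pi> i m x * \<sigma> x [b m, ?v])" if "x \<in> U" for x
    using \<sigma>_X[OF that i, of ?v] that by simp
  have "0 = (\<Sum>m<n. \<pi> i m x0 * D (\<lambda>x. \<sigma> x [b m, ?v]) w + D (\<pi> i m) w * \<sigma> x0 [b m, ?v])"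
    by (rule has_derivative_eventually_unique[OF has_derivative_const A U]) (rule B)
  also have "\<dots> = (\<Sum>m<n. \<pi> i m x0 * D (\<lambda>x. \<sigma> x [b m, ?v]) w) + (\<Sum>m<n. D (\<pi> i m) w * \<sigma> x0 [b m, ?v])"
    by (rule sum.distrib)
  also have "(\<Sum>m<n. \<pi> i m x0 * D (\<lambda>x. \<sigma> x [b m, ?v]) w) = D (\<lambda>x. \<sigma> x [X i x0, ?v]) w"
    using forms_sum[OF D_\<sigma>_forms subspace_UNIV, of "{..<n}" b "[]" "\<lambda>m. \<pi> i m x0" "[?v]"] by (simp add: X_def)
  also have "(\<Sum>m<n. D (\<pi> i m) w * \<sigma> x0 [b m, ?v]) = (\<Sum>m<n. if m = j then D (\<pi> i m) w else 0)"
    using \<sigma>_X_right[OF U(2) j] j l by (intro sum.cong) (auto simp: d_b)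
  also have "\<dots> = D (\<pi> i j) w" using j l by simp
  finally show ?thesis by simp
qed

lemma e_x0_vertical: "i < h \<Longrightarrow> h \<le> a \<Longrightarrow> a < n \<Longrightarrow> e x0 i (b a) = 0"
  using e_b[OF U(2), of i a] by auto

lemma Bop_b: "h \<le> a \<Longrightarrow> a < n \<Longrightarrow> Bop w (b a) = 0"
  using e_x0_vertical by (simp add: Bop_def)

text \<open>Both sides are bilinear and are compared on the frame at \<open>x0\<close>. Vertical
  vectors give 0; on \<open>X i\<close> and \<open>X j\<close> each slot of \<sigma> contributes
  half of \<open>- D (\<pi> i j) w\<close>, which is the origin of the factor 1/2 in
  \<open>Bop\<close>.\<close>

lemma D_\<sigma>_pair: "D (\<lambda>x. \<sigma> x [u, v]) w = \<sigma> x0 [Bop w u, v] + \<sigma> x0 [u, Bop w v]"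
proof -
  interpret f: dual_basis n "E x0" "e x0" by (rule frame_E[OF U(2)])
  define Q where "Q u v = D (\<lambda>x. \<sigma> x [u, v]) w - (\<sigma> x0 [Bop w u, v] + \<sigma> x0 [u, Bop w v])" for u v
  have l1: "linear (\<lambda>u. \<omega> [u, v])" "linear (\<lambda>v. \<omega> [u, v])" if "\<omega> \<in> forms UNIV 2" for \<omega> :: "'e form" and u v
    using forms_linear[OF that, of "[]" "[v]"] forms_linear[OF that, of "[u]" "[]"] by auto
  have l2: "linear (\<lambda>u. \<omega> [Bop w u, v])" "linear (\<lambda>v. \<omega> [u, Bop w v])" if "\<omega> \<in> forms UNIV 2" for \<omega> :: "'e form" and u v
    using linear_compose[OF Bop_linear l1(1)[OF that]] linear_compose[OF Bop_linear l1(2)[OF that]]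
    by (auto simp: o_def)
  have lin1: "linear (\<lambda>u. Q u v)" for v
    unfolding Q_def by (intro linear_compose_sub linear_compose_add l1 l2 D_\<sigma>_forms \<sigma>_forms U l1(1)[OF D_\<sigma>_forms])
  have lin2: "linear (\<lambda>v. Q u v)" for u
    unfolding Q_def by (intro linear_compose_sub linear_compose_add l1 l2 D_\<sigma>_forms \<sigma>_forms U l1(2)[OF D_\<sigma>_forms])
  have s0: "\<sigma> x0 [0, v] = 0" "\<sigma> x0 [v, 0] = 0" for v
    using forms_zero_arg[OF \<sigma>_forms[OF U(2)] subspace_UNIV, of "[]" "[v]"]
      forms_zero_arg[OF \<sigma>_forms[OF U(2)] subspace_UNIV, of "[v]" "[]"] by auto
  have kill2: "\<sigma> x0 [v, b a] = 0" if "h \<le> a" "a < n" for v a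
    using \<sigma>_kill[OF U(2) that] \<sigma>_swap[OF U(2), of v "b a"] by simp
  have Dkill2: "D (\<lambda>x. \<sigma> x [v, b a]) w = 0" if "h \<le> a" "a < n" for v a
    using D_\<sigma>_kill[OF that, of v w] forms_swap[OF D_\<sigma>_forms[of w] subspace_UNIV, of "[]" v "b a" "[]"] by simp
  have "Q (E x0 i) (E x0 j) = 0" if i: "i < n" and j: "j < n" for i j
  proof -
    consider "i \<ge> h" | "j \<ge> h" | "i < h" "j < h" by linarith
    then show ?thesis
    proof cases
      case 1
      then show ?thesis using i by (simp add: Q_def E_def D_\<sigma>_kill \<sigma>_kill[OF U(2)] Bop_b s0)
    next
      case 2
      then show ?thesis using j by (simp add: Q_def E_def[of x0 j] Dkill2 kill2 Bop_b s0)
    next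
      case 3
      have ij: "i < n" "j < n" using 3 l by auto
      have BX: "d j (Bop w (X i x0)) = - D (\<pi> i j) w / 2" if "i < h" "j < h" for i j
      proof -
        have "d j (Bop w (X i x0)) = - (\<Sum>k<h. e x0 k (X i x0) * D (\<pi> k j) w) / 2"
          by (rule d_Bop[OF that(2)])
        also have "(\<Sum>k<h. e x0 k (X i x0) * D (\<pi> k j) w) = (\<Sum>k<h. if k = i then D (\<pi> k j) w else 0)"
          using that l by (intro sum.cong) (auto simp: e_X[OF U(2)])
        finally show ?thesis using that by simp
      qed
      have "\<sigma> x0 [Bop w (X i x0), X j x0] = - D (\<pi> i j) w / 2"
        using \<sigma>_X_right[OF U(2) 3(2)] BX[OF 3] by simp
      moreover have "\<sigma> x0 [X i x0, Bop w (X j x0)] = D (\<pi> j i) w / 2"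
        using \<sigma>_X[OF U(2) 3(1)] BX[OF 3(2,1)] by simp
      ultimately show ?thesis
        using D_\<sigma>_X_X[OF 3, of w] D_\<pi>_anti[OF ij, of w] 3 by (simp add: Q_def E_def)
    qed
  qed
  then have "Q (E x0 i) v = 0" if "i < n" for i
    using f.linear_expand[OF lin2[of "E x0 i"], of v] that by simp
  then have "Q u v = 0" using f.linear_expand[OF lin1[of v], of u] by simp
  then show ?thesis by (simp add: Q_def)
qed

lemma D_\<sigma>_Bop: "D (\<lambda>x. \<sigma> x us) w = (\<Sum>j<length us. \<sigma> x0 (us[j := Bop w (us ! j)]))"
proof (cases "length us = 2")
  case True
  then obtain u v where us: "us = [u, v]" by (metis (no_types, opaque_lifting) One_nat_def Suc_length_conv length_0_conv numeral_2_eq_2)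
  show ?thesis unfolding us D_\<sigma>_pair by (simp add: lessThan_Suc numeral_2_eq_2)
next
  case False
  then show ?thesis using forms_eq_0[OF D_\<sigma>_forms, of us w] forms_eq_0[OF \<sigma>_forms[OF U(2)]] by simp
qed

lemma pull_line_has_derivative:
  assumes "\<omega> \<in> forms UNIV k"
  shows "((\<lambda>s. \<omega> (map (\<lambda>u. u + s *\<^sub>R Bop w u) us)) has_derivative
    (\<lambda>r. r * (\<Sum>j<length us. \<omega> (us[j := Bop w (us ! j)])))) (at (0::real))"
proof -
  have "((\<lambda>s. \<omega> (map (\<lambda>u. u + s *\<^sub>R Bop w u) us)) has_derivative
    (\<lambda>r. 0 + (\<Sum>j<length us. \<omega> ((map (\<lambda>u. u + 0 *\<^sub>R Bop w u) us)[j := r *\<^sub>R Bop w (us ! j)])))) (at (0::real))"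
  proof (rule has_derivative_multilinear[where \<omega> = "\<lambda>_. \<omega>" and S = UNIV and f = "\<lambda>s u. u + s *\<^sub>R Bop w u"
          and f' = "\<lambda>u r. r *\<^sub>R Bop w u" and D = "\<lambda>_ _. 0"])
    show "((\<lambda>s. u + s *\<^sub>R Bop w u) has_derivative (\<lambda>r. r *\<^sub>R Bop w u)) (at 0)" for u
      by (auto intro!: derivative_eq_intros)
  qed (use assms in auto)
  moreover have "\<omega> (us[j := r *\<^sub>R Bop w (us ! j)]) = r * \<omega> (us[j := Bop w (us ! j)])" if "j < length us" for j r
    using forms_scale[OF assms subspace_UNIV, of "Bop w (us ! j)" "take j us" r "drop (Suc j) us"] that
    by (simp add: upd_conv_take_nth_drop)
  ultimately show ?thesis by (simp add: sum_distrib_left)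
qed

text \<open>The forms along the line in direction \<open>w\<close> and the pullbacks of
  \<open>\<sigma> x0\<close> agree to first order. For the pullbacks, differentiating the top power
  replaces one argument at a time by its image under \<open>Bop w\<close>, which produces the trace
  of the horizontal block of \<open>Bop w\<close> times \<open>g x0\<close>.\<close>

lemma D_g: "D g w = - (\<Sum>j<h. \<Sum>i<h. e x0 i (b j) * D (\<pi> i j) w) / 2 * g x0"
proof -
  let ?bs = "map b [0..<h]" and ?p = "wedge_power (\<sigma> x0) l"
  let ?\<delta> = "\<lambda>us r. r * D (\<lambda>x. \<sigma> x us) w"
  have \<sigma>0: "\<sigma> x0 \<in> forms UNIV 2" by (rule \<sigma>_forms[OF U(2)])
  have along: "((\<lambda>s. f (x0 + s *\<^sub>R w)) has_derivative (\<lambda>r. r * D f w)) (at 0)"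
    if "f differentiable (at x0)" for f :: "'e \<Rightarrow> real"
  proof -
    have "((\<lambda>s. f (x0 + s *\<^sub>R w)) has_derivative (\<lambda>r. D f (r *\<^sub>R w))) (at 0)"
      by (rule has_derivative_along_line) (use differentiable_has_frechet_derivative[OF that] in simp)
    then show ?thesis using linear_frechet_derivative[OF that] by (simp add: linear_cmul)
  qed
  have 1: "((\<lambda>s. \<sigma> (x0 + s *\<^sub>R w) us) has_derivative ?\<delta> us) (at 0)" for us
    by (rule along[OF \<sigma>_diff])
  have 2: "((\<lambda>s. pull (\<lambda>u. u + s *\<^sub>R Bop w u) (\<sigma> x0) us) has_derivative ?\<delta> us) (at 0)" for us
    using pull_line_has_derivative[OF \<sigma>0, of w us] by (simp add: pull_def D_\<sigma>_Bop)
  have 3: "\<sigma> (x0 + 0 *\<^sub>R w) = pull (\<lambda>u. u + 0 *\<^sub>R Bop w u) (\<sigma> x0)" by (simp add: pull_def)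
  obtain \<Delta> where \<Delta>: "((\<lambda>s. wedge_power (\<sigma> (x0 + s *\<^sub>R w)) l ?bs) has_derivative \<Delta>) (at 0)"
    "((\<lambda>s. wedge_power (pull (\<lambda>u. u + s *\<^sub>R Bop w u) (\<sigma> x0)) l ?bs) has_derivative \<Delta>) (at 0)"
    using wedge_power_has_derivative_unique[where l = l and \<sigma> = "\<lambda>s. \<sigma> (x0 + s *\<^sub>R w)"
        and \<sigma>' = "\<lambda>s. pull (\<lambda>u. u + s *\<^sub>R Bop w u) (\<sigma> x0)", OF 1 2 3] by blast
  have "D g w = \<Delta> 1"
    using has_derivative_unique[OF \<Delta>(1), of "\<lambda>r. r * D g w"] along[OF g_diff] by (simp add: g_def)
  also have "\<Delta> 1 = (\<Sum>j<h. ?p (?bs[j := Bop w (b j)]))"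
  proof -
    have "((\<lambda>s. ?p (map (\<lambda>u. u + s *\<^sub>R Bop w u) ?bs)) has_derivative
        (\<lambda>r. r * (\<Sum>j<length ?bs. ?p (?bs[j := Bop w (?bs ! j)])))) (at 0)"
      by (rule pull_line_has_derivative[OF wedge_power_forms[OF \<sigma>0]])
    moreover have eq: "(\<lambda>s. wedge_power (pull (\<lambda>u. u + s *\<^sub>R Bop w u) (\<sigma> x0)) l ?bs) =
        (\<lambda>s. ?p (map (\<lambda>u. u + s *\<^sub>R Bop w u) ?bs))"
      unfolding pull_wedge_power[symmetric] by (simp add: pull_def)
    ultimately have "\<Delta> = (\<lambda>r. r * (\<Sum>j<length ?bs. ?p (?bs[j := Bop w (?bs ! j)])))"
      using has_derivative_unique[OF \<Delta>(2)[unfolded eq]] by simp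
    then show ?thesis by simp
  qed
  also have "\<dots> = (\<Sum>j<h. d j (Bop w (b j)) * g x0)"
  proof (rule sum.cong[OF refl])
    fix j assume "j \<in> {..<h}"
    then have j: "j < h" "j < n" using l by auto
    have "?p (?bs[j := Bop w (b j)]) = ?p (take j ?bs @ Bop w (b j) # drop (Suc j) ?bs)"
      using j by (simp add: upd_conv_take_nth_drop)
    also have "\<dots> = (\<Sum>k<n. d k (Bop w (b j)) * ?p (take j ?bs @ b k # drop (Suc j) ?bs))"
      by (rule forms_expand[OF wedge_power_forms[OF \<sigma>0]])
    \<comment> \<open>Of the components of \<open>Bop w (b j)\<close> only the \<open>j\<close>-th
      survives: another horizontal index repeats an argument, a vertical one kills the
      power.\<close>
    also have "\<dots> = (\<Sum>k<n. if k = j then d k (Bop w (b j)) * g x0 else 0)"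
    proof (rule sum.cong[OF refl])
      fix k assume k: "k \<in> {..<n}"
      let ?us = "take j ?bs @ b k # drop (Suc j) ?bs"
      have us: "?us = ?bs[j := b k]" using j by (simp add: upd_conv_take_nth_drop)
      consider "k = j" | "k \<noteq> j" "k < h" | "k \<ge> h" by linarith
      then show "d k (Bop w (b j)) * ?p ?us = (if k = j then d k (Bop w (b j)) * g x0 else 0)"
      proof cases
        case 1
        have "?bs[j := b j] = ?bs" using j by (intro list_update_same_conv[THEN iffD2]) auto
        then show ?thesis using 1 unfolding us by (simp add: g_def)
      next
        case 2
        have "?us ! j = ?us ! k" "j < length ?us" "k < length ?us" unfolding us using 2 j by auto
        then have "\<not> distinct ?us" using 2(1) by (metis distinct_conv_nth)
        then show ?thesis using forms_not_distinct[OF wedge_power_forms[OF \<sigma>0]] 2 by simp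
      next
        case 3
        have "?p ?us = 0" by (rule wedge_power_kill[OF \<sigma>0 \<sigma>_kill[OF U(2) 3]]) (use k in auto)
        then show ?thesis using 3 j by simp
      qed
    qed
    finally show "?p (?bs[j := Bop w (b j)]) = d j (Bop w (b j)) * g x0" using j by simp
  qed
  also have "\<dots> = (\<Sum>j<h. - (\<Sum>i<h. e x0 i (b j) * D (\<pi> i j) w) / 2 * g x0)"
    by (intro sum.cong refl) (simp add: d_Bop)
  also have "\<dots> = - (\<Sum>j<h. \<Sum>i<h. e x0 i (b j) * D (\<pi> i j) w) / 2 * g x0"
    by (simp only: sum_distrib_right[symmetric] sum_divide_distrib[symmetric] sum_negf)
  finally show ?thesis .
qed

subsection \<open>The components of the modular vector field\<close>

definition Zc :: "nat \<Rightarrow> real" where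
  "Zc m = (\<Sum>j<n. D (\<pi> m j) (b j) + \<pi> m j x0 * (D \<rho> (b j) / \<rho> x0))"

text \<open>The Jacobi identity, contracted with the coupling form, trades the derivative of the
  horizontal volume for the horizontal part of the divergence of \<open>\<pi>\<close>.\<close>
lemma contracted_jacobi:
  assumes m: "m < n"
  shows "(\<Sum>j<n. \<pi> m j x0 * (\<Sum>k<h. \<Sum>i<h. e x0 i (b k) * D (\<pi> i k) (b j))) = 2 * (\<Sum>i<h. D (\<pi> m i) (b i))"
proof -
  let ?A = "\<lambda>m k i. \<Sum>j<n. \<pi> m j x0 * D (\<pi> k i) (b j)"
  let ?s = "\<lambda>i k. e x0 i (b k)"
  \<comment> \<open>The Jacobi identity splits the expression into two sums in which the
    differentiated entry carries the free index \<open>m\<close>.\<close>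
  have jac: "?A m i k = - ?A i k m - ?A k m i" if "i < h" "k < h" for i k
  proof -
    have "i < n" "k < n" using that l by auto
    from jacobi[OF m this] show ?thesis by linarith
  qed
  have 1: "(\<Sum>k<h. \<Sum>i<h. ?s i k * ?A i k m) = - (\<Sum>i<h. D (\<pi> m i) (b i))"
  proof -
    \<comment> \<open>The inverse block cancels the undifferentiated factor \<pi> and leaves
      \<open>j = k\<close>; vertical \<open>j\<close> contribute nothing, the mixed block being 0 at
      \<open>x0\<close>.\<close>
    have "(\<Sum>i<h. ?s i k * ?A i k m) = D (\<pi> k m) (b k)" if k: "k < h" for k
    proof -
      have "(\<Sum>i<h. ?s i k * ?A i k m) = (\<Sum>j<n. (\<Sum>i<h. ?s i k * \<pi> i j x0) * D (\<pi> k m) (b j))"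
        unfolding sum_distrib_left sum_distrib_right by (subst sum.swap) (simp add: mult.assoc)
      also have "\<dots> = (\<Sum>j<n. if j = k then D (\<pi> k m) (b j) else 0)"
      proof (rule sum.cong[OF refl])
        fix j assume j: "j \<in> {..<n}"
        have "(\<Sum>i<h. ?s i k * \<pi> i j x0) = (if j = k then 1 else 0)"
        proof (cases "j < h")
          case True
          then show ?thesis using e_inverse_left[OF U(2) k] by simp
        next
          case False
          then have "(\<Sum>i<h. ?s i k * \<pi> i j x0) = 0" using off j by (intro sum.neutral) auto
          then show ?thesis using False k by simp
        qed
        then show "(\<Sum>i<h. ?s i k * \<pi> i j x0) * D (\<pi> k m) (b j) = (if j = k then D (\<pi> k m) (b j) else 0)" by simp
      qed
      also have "\<dots> = D (\<pi> k m) (b k)" using k l by simp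
      finally show ?thesis .
    qed
    then have "(\<Sum>k<h. \<Sum>i<h. ?s i k * ?A i k m) = (\<Sum>k<h. - D (\<pi> m k) (b k))"
    proof (intro sum.cong refl)
      fix k assume "k \<in> {..<h}"
      then have k: "k < h" "k < n" using l by auto
      have "D (\<pi> k m) (b k) = - D (\<pi> m k) (b k)" by (rule D_\<pi>_anti[OF k(2) m])
      then show "(\<Sum>i<h. ?s i k * ?A i k m) = - D (\<pi> m k) (b k)"
        using \<open>\<And>k. k < h \<Longrightarrow> (\<Sum>i<h. ?s i k * ?A i k m) = D (\<pi> k m) (b k)\<close>[OF k(1)] by simp
    qed
    then show ?thesis by (simp only: sum_negf)
  qed
  have 2: "(\<Sum>k<h. \<Sum>i<h. ?s i k * ?A k m i) = - (\<Sum>i<h. D (\<pi> m i) (b i))"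
  proof -
    \<comment> \<open>Now the other index of the inverse block is contracted. Transposing \<pi>
      costs a sign, the same that \<open>D_\<pi>_anti\<close> caused in the first sum, so the two
      sums add up and give the factor 2.\<close>
    have "(\<Sum>k<h. ?s i k * ?A k m i) = - D (\<pi> m i) (b i)" if i: "i < h" for i
    proof -
      have "(\<Sum>k<h. ?s i k * ?A k m i) = (\<Sum>j<n. (\<Sum>k<h. ?s i k * \<pi> k j x0) * D (\<pi> m i) (b j))"
        unfolding sum_distrib_left sum_distrib_right by (subst sum.swap) (simp add: mult.assoc)
      also have "\<dots> = (\<Sum>j<n. if j = i then - D (\<pi> m i) (b j) else 0)"
      proof (rule sum.cong[OF refl])
        fix j assume j: "j \<in> {..<n}"
        have "(\<Sum>k<h. ?s i k * \<pi> k j x0) = (if j = i then - 1 else 0)"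
        proof (cases "j < h")
          case True
          have "(\<Sum>k<h. ?s i k * \<pi> k j x0) = (\<Sum>k<h. - (\<pi> j k x0 * ?s i k))"
          proof (rule sum.cong[OF refl])
            fix k assume "k \<in> {..<h}"
            then have "\<pi> k j x0 = - \<pi> j k x0" using j l by (intro \<pi>_anti[OF U(2)]) auto
            then show "?s i k * \<pi> k j x0 = - (\<pi> j k x0 * ?s i k)" by simp
          qed
          then show ?thesis using e_inverse_right[OF U(2) True i] by (simp add: sum_negf)
        next
          case False
          then have "(\<Sum>k<h. ?s i k * \<pi> k j x0) = 0" using off j by (intro sum.neutral) auto
          then show ?thesis using False i by simp
        qed
        then show "(\<Sum>k<h. ?s i k * \<pi> k j x0) * D (\<pi> m i) (b j) = (if j = i then - D (\<pi> m i) (b j) else 0)" by simp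
      qed
      also have "\<dots> = - D (\<pi> m i) (b i)" using i l by simp
      finally show ?thesis .
    qed
    then have "(\<Sum>i<h. \<Sum>k<h. ?s i k * ?A k m i) = (\<Sum>i<h. - D (\<pi> m i) (b i))"
      by (intro sum.cong refl) simp
    then show ?thesis by (subst sum.swap) (simp only: sum_negf)
  qed
  have "(\<Sum>j<n. \<pi> m j x0 * (\<Sum>k<h. \<Sum>i<h. ?s i k * D (\<pi> i k) (b j))) = (\<Sum>k<h. \<Sum>i<h. ?s i k * ?A m i k)"
  proof -
    have "(\<Sum>j<n. \<pi> m j x0 * (\<Sum>k<h. \<Sum>i<h. ?s i k * D (\<pi> i k) (b j))) =
        (\<Sum>j<n. \<Sum>k<h. \<Sum>i<h. ?s i k * (\<pi> m j x0 * D (\<pi> i k) (b j)))"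
      unfolding sum_distrib_left by (intro sum.cong refl) (rule mult.left_commute)
    also have "\<dots> = (\<Sum>k<h. \<Sum>j<n. \<Sum>i<h. ?s i k * (\<pi> m j x0 * D (\<pi> i k) (b j)))" by (rule sum.swap)
    also have "\<dots> = (\<Sum>k<h. \<Sum>i<h. \<Sum>j<n. ?s i k * (\<pi> m j x0 * D (\<pi> i k) (b j)))"
      by (intro sum.cong refl sum.swap)
    finally show ?thesis by (simp only: sum_distrib_left)
  qed
  also have "\<dots> = (\<Sum>k<h. \<Sum>i<h. - (?s i k * ?A i k m) - ?s i k * ?A k m i)"
  proof (intro sum.cong refl)
    fix k i assume "k \<in> {..<h}" "i \<in> {..<h}"
    then show "?s i k * ?A m i k = - (?s i k * ?A i k m) - ?s i k * ?A k m i"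
      using jac[of i k] by (simp only: lessThan_iff right_diff_distrib mult_minus_right)
  qed
  also have "\<dots> = 2 * (\<Sum>i<h. D (\<pi> m i) (b i))"
    using 1 2 by (simp add: sum_subtractf sum_negf)
  finally show ?thesis .
qed

text \<open>The logarithmic derivative of \<open>g\<close> contributes minus half of the sum in
  \<open>contracted_jacobi\<close>, which is minus the horizontal part of the divergence of row
  \<open>m\<close>.\<close>

lemma Zc_eq:
  assumes m: "m < n"
  shows "Zc m = (\<Sum>a\<in>{h..<n}. D (\<pi> m a) (b a)) + (\<Sum>q<n. \<pi> m q x0 * (D t (b q) / t x0))"
proof -
  let ?S = "\<lambda>w. \<Sum>k<h. \<Sum>i<h. e x0 i (b k) * D (\<pi> i k) w"
  have "D \<rho> w / \<rho> x0 = D t w / t x0 - ?S w / 2" for w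
  proof -
    define s where "s = ?S w"
    have "D \<rho> w = g x0 * D t w - s / 2 * g x0 * t x0" unfolding D_\<rho> D_g s_def by simp
    then have "D \<rho> w / \<rho> x0 = D t w / t x0 - s / 2"
      using \<rho>_eq[OF U(2)] g_nz[OF U(2)] t_nz[OF U(2)] by (simp add: field_simps)
    then show ?thesis by (simp only: s_def)
  qed
  then have "Zc m = (\<Sum>j<n. D (\<pi> m j) (b j) + \<pi> m j x0 * (D t (b j) / t x0 - ?S (b j) / 2))"
    by (simp only: Zc_def)
  also have "\<dots> = (\<Sum>j<n. D (\<pi> m j) (b j)) + (\<Sum>j<n. \<pi> m j x0 * (D t (b j) / t x0))
      - (\<Sum>j<n. \<pi> m j x0 * ?S (b j)) / 2"
  proof -
    define s where "s j = ?S (b j)" for j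
    have "(\<Sum>j<n. D (\<pi> m j) (b j) + \<pi> m j x0 * (D t (b j) / t x0 - s j / 2)) =
        (\<Sum>j<n. D (\<pi> m j) (b j) + \<pi> m j x0 * (D t (b j) / t x0) - \<pi> m j x0 * s j / 2)"
      by (intro sum.cong refl) (simp add: right_diff_distrib)
    also have "\<dots> = (\<Sum>j<n. D (\<pi> m j) (b j)) + (\<Sum>j<n. \<pi> m j x0 * (D t (b j) / t x0))
      - (\<Sum>j<n. \<pi> m j x0 * s j) / 2"
      unfolding sum_subtractf sum.distrib sum_divide_distrib ..
    finally show ?thesis unfolding s_def .
  qed
  also have "(\<Sum>j<n. \<pi> m j x0 * ?S (b j)) = 2 * (\<Sum>i<h. D (\<pi> m i) (b i))" by (rule contracted_jacobi[OF m])
  also have "(\<Sum>j<n. D (\<pi> m j) (b j)) = (\<Sum>i<h. D (\<pi> m i) (b i)) + (\<Sum>a\<in>{h..<n}. D (\<pi> m a) (b a))"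
    using l by (simp add: lessThan_atLeast0 sum.atLeastLessThan_concat)
  finally show ?thesis by simp
qed

lemma D_linear: "f differentiable (at x0) \<Longrightarrow> linear (D f)"
  by (rule linear_frechet_derivative)

text \<open>\<open>\<tau>\<gamma> x\<close> kills \<open>X i x\<close> at every point, so with
  \<open>X i x0\<close> frozen in a slot the derivative falls on \<open>X i\<close>: this is
  \<open>T\<close>, and in the alternating sum it produces the leaf derivatives of
  \<open>\<pi> i a\<close>. The remaining term, with \<open>X i x0\<close> as direction, is the
  derivative of \<open>t\<close> along \<open>X i\<close>.\<close>

lemma coord_deriv_\<tau>\<gamma>:
  assumes i: "i < h"
  shows "coord_deriv \<tau>\<gamma> x0 (X i x0 # map b [h..<n]) = Zc i * t x0"
proof -
  have inn: "i < n" using i l by simp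
  let ?bs = "map b [h..<n]" and ?T = "\<lambda>us. D (\<lambda>x. \<tau>\<gamma> x us)"
  have Tf: "(\<lambda>us. ?T us w) \<in> forms UNIV (n - h)" for w
    by (rule has_derivative_forms[OF U \<tau>\<gamma>_forms subspace_UNIV differentiable_has_frechet_derivative[OF \<tau>\<gamma>_diff]])
  have T: "?T (X i x0 # us) w = - (\<Sum>m<n. D (\<pi> i m) w * \<tau>\<gamma> x0 (b m # us))" for us w
  proof -
    have A: "((\<lambda>x. \<Sum>m<n. \<pi> i m x * \<tau>\<gamma> x (b m # us)) has_derivative
        (\<lambda>w. \<Sum>m<n. \<pi> i m x0 * ?T (b m # us) w + D (\<pi> i m) w * \<tau>\<gamma> x0 (b m # us))) (at x0)"
      by (intro has_derivative_sum has_derivative_mult \<pi>D differentiable_has_frechet_derivative[OF \<tau>\<gamma>_diff] inn) auto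
    have B: "0 = (\<Sum>m<n. \<pi> i m x * \<tau>\<gamma> x (b m # us))" if "x \<in> U" for x
      using forms_sum[OF \<tau>\<gamma>_forms[OF that] subspace_UNIV, of "{..<n}" b "[]" "\<lambda>m. \<pi> i m x" us] \<tau>\<gamma>_X[OF that i, of us]
      by (simp add: X_def)
    have "0 = (\<Sum>m<n. \<pi> i m x0 * ?T (b m # us) w + D (\<pi> i m) w * \<tau>\<gamma> x0 (b m # us))"
      by (rule has_derivative_eventually_unique[OF has_derivative_const A U]) (rule B)
    then have "0 = (\<Sum>m<n. \<pi> i m x0 * ?T (b m # us) w) + (\<Sum>m<n. D (\<pi> i m) w * \<tau>\<gamma> x0 (b m # us))"
      by (simp only: sum.distrib)
    moreover have "(\<Sum>m<n. \<pi> i m x0 * ?T (b m # us) w) = ?T (X i x0 # us) w"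
      using forms_sum[OF Tf subspace_UNIV, of "{..<n}" b "[]" "\<lambda>m. \<pi> i m x0" us] by (simp add: X_def)
    ultimately show ?thesis by simp
  qed
  have Tt: "?T ?bs w = D t w" for w
    by (rule D_unique[OF \<tau>\<gamma>_diff differentiable_has_frechet_derivative[OF t_diff]])
      (unfold t_def, rule \<tau>\<gamma>_vertical, auto)
  have "alt_sum (\<lambda>w. interior_prod (X i x0) (\<lambda>vs. ?T vs w)) ?bs = - (\<Sum>a\<in>{h..<n}. D (\<pi> i a) (b a) * t x0)"
  proof -
    have "alt_sum (\<lambda>w. interior_prod (X i x0) (\<lambda>vs. ?T vs w)) ?bs =
        (\<Sum>k<n - h. - (D (\<pi> i (h + k)) (b (h + k)) * t x0))"
      unfolding alt_sum_def
    proof (rule sum.cong)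
      show "{..<length ?bs} = {..<n - h}" by simp
      fix k assume "k \<in> {..<n - h}"
      then have k: "k < n - h" by simp
      let ?o = "take k ?bs @ drop (Suc k) ?bs"
      have bk: "?bs ! k = b (h + k)" using k by simp
      \<comment> \<open>Only \<open>b (h + k)\<close> fills the gap left by the omitted argument:
        horizontal basis vectors are killed at \<open>x0\<close>, and the other vertical ones are
        repeated.\<close>
      have r: "\<tau>\<gamma> x0 (b m # ?o) = (if m = h + k then (- 1) ^ k * t x0 else 0)" if m: "m < n" for m
      proof -
        consider "m < h" | "m = h + k" | "m \<ge> h" "m \<noteq> h + k" by linarith
        then show ?thesis
        proof cases
          case 1
          then show ?thesis using \<tau>\<gamma>_low by simp
        next
          case 2
          have "\<tau>\<gamma> x0 ([] @ take k ?bs @ b m # drop (Suc k) ?bs) = (- 1) ^ length (take k ?bs) * \<tau>\<gamma> x0 ([] @ b m # ?o)"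
            by (rule forms_move[OF \<tau>\<gamma>_forms[OF U(2)] subspace_UNIV])
          moreover have "take k ?bs @ b m # drop (Suc k) ?bs = ?bs"
            using id_take_nth_drop[of k ?bs] k 2 bk by simp
          moreover have "\<tau>\<gamma> x0 ?bs = t x0" unfolding t_def by (rule \<tau>\<gamma>_vertical[OF U(2)]) auto
          moreover have "length (take k ?bs) = k" using k by simp
          ultimately have "t x0 = (- 1) ^ k * \<tau>\<gamma> x0 (b m # ?o)" by (simp only: append_Nil)
          then show ?thesis using 2 by (simp only: simp_thms if_True power_mult_distrib[symmetric]
                mult.assoc[symmetric] power_add[symmetric]) simp
        next
          case 3
          define q where "q = m - h"
          have q: "q < n - h" "m = h + q" "q \<noteq> k" using 3 m by (auto simp: q_def)
          have "b m \<in> set ?o"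
          proof (cases "q < k")
            case True
            then have nq: "take k ?bs ! q = b m" and "q < length (take k ?bs)" using q k by auto
            from nth_mem[OF this(2)] have "b m \<in> set (take k ?bs)" unfolding nq .
            then show ?thesis by (simp only: set_append Un_iff simp_thms)
          next
            case False
            then have nq: "drop (Suc k) ?bs ! (q - Suc k) = b m" and "q - Suc k < length (drop (Suc k) ?bs)"
              using q k by auto
            from nth_mem[OF this(2)] have "b m \<in> set (drop (Suc k) ?bs)" unfolding nq .
            then show ?thesis by (simp only: set_append Un_iff simp_thms)
          qed
          then have "\<not> distinct (b m # ?o)" by (simp only: distinct.simps simp_thms)
          then have "\<tau>\<gamma> x0 (b m # ?o) = 0" by (rule forms_not_distinct[OF \<tau>\<gamma>_forms[OF U(2)]])
          then show ?thesis using 3 by (simp only: if_False)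
        qed
      qed
      have "?T (X i x0 # ?o) (b (h + k)) = - (\<Sum>m<n. if m = h + k then D (\<pi> i m) (b (h + k)) * ((- 1) ^ k * t x0) else 0)"
        unfolding T by (intro arg_cong[of _ _ uminus] sum.cong) (auto simp: r)
      also have "\<dots> = - (D (\<pi> i (h + k)) (b (h + k)) * ((- 1) ^ k * t x0))" using k by simp
      finally show "(- 1) ^ k * interior_prod (X i x0) (\<lambda>vs. ?T vs (?bs ! k)) ?o = - (D (\<pi> i (h + k)) (b (h + k)) * t x0)"
        unfolding interior_prod_def bk by simp
    qed
    also have "\<dots> = - (\<Sum>a\<in>{h..<n}. D (\<pi> i a) (b a) * t x0)"
      using sum.atLeastLessThan_shift_0[of "\<lambda>a. D (\<pi> i a) (b a) * t x0" h n]
      by (simp add: sum_negf lessThan_atLeast0 comp_def add.commute)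
    finally show ?thesis .
  qed
  moreover have "D t (X i x0) = (\<Sum>q<n. \<pi> i q x0 * D t (b q))"
    unfolding X_def using D_linear[OF t_diff] by (simp add: linear_sum linear_cmul)
  ultimately have "coord_deriv \<tau>\<gamma> x0 (X i x0 # ?bs) =
      (\<Sum>q<n. \<pi> i q x0 * D t (b q)) + (\<Sum>a\<in>{h..<n}. D (\<pi> i a) (b a)) * t x0"
    unfolding coord_deriv_def alt_sum_Cons Tt by (simp add: sum_distrib_right)
  also have "\<dots> = Zc i * t x0"
  proof -
    have "(\<Sum>q<n. \<pi> i q x0 * (D t (b q) / t x0)) * t x0 = (\<Sum>q<n. \<pi> i q x0 * D t (b q))"
      unfolding sum_distrib_right using t_nz[OF U(2)] by (intro sum.cong refl) simp
    then show ?thesis unfolding Zc_eq[OF inn] distrib_right by simp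
  qed
  finally show ?thesis .
qed

end


section \<open>The contraction of the leafwise volume and its derivative at the point\<close>

subsection \<open>The leafwise modular vector field\<close>

context local_coupling
begin

text \<open>Both forms vanish on the first \<open>h\<close> basis vectors and have the top degree on
  the remaining ones.\<close>

lemma \<tau>_proportional: "x \<in> U \<Longrightarrow> \<tau> x us * t x0 = \<tau> x0 us * t x"
proof -
  assume x: "x \<in> U"
  have "t x0 * \<tau> x us + (- t x) * \<tau> x0 us = 0"
  proof (rule forms_eq_0_complement[OF forms_lincomb[OF \<tau>_forms[OF x] \<tau>_forms[OF U(2)]], of "map b [h..<n]" _ _ "b ` {..<h}"])
    show "t x0 * \<tau> x (map b [h..<n]) + (- t x) * \<tau> x0 (map b [h..<n]) = 0" by (simp add: t_def)
    have "{..<n} = {h..<n} \<union> {..<h}" using l by auto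
    then have "set (map b [h..<n]) \<union> b ` {..<h} = b ` {..<n}" by (simp only: set_map set_upt image_Un)
    then show "span (set (map b [h..<n]) \<union> b ` {..<h}) = UNIV" using span_b by simp
    show "t x0 * \<tau> x us + (- t x) * \<tau> x0 us = 0" if "set us \<inter> b ` {..<h} \<noteq> {}" for us
      using that \<tau>_kill[OF x] \<tau>_kill[OF U(2)] by auto
  qed simp
  then show ?thesis by (simp add: mult.commute)
qed

lemma D_\<tau>: "D (\<lambda>x. \<tau> x us) w = \<tau> x0 us * (D t w / t x0)"
proof -
  have "((\<lambda>x. \<tau> x0 us / t x0 * t x) has_derivative (\<lambda>w. \<tau> x0 us / t x0 * D t w)) (at x0)"
    by (rule has_derivative_mult_right[OF differentiable_has_frechet_derivative[OF t_diff]])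
  then have "D (\<lambda>x. \<tau> x us) w = \<tau> x0 us / t x0 * D t w"
  proof (rule D_unique[OF \<tau>_diff])
    fix x assume "x \<in> U"
    then show "\<tau> x us = \<tau> x0 us / t x0 * t x"
      using \<tau>_proportional[of x us] t_nz[OF U(2)] by (simp add: field_simps)
  qed
  then show ?thesis by simp
qed

text \<open>Components of the vertical part of the bivector along the \<open>b a\<close>, obtained
  by projecting both entries with the connection; away from \<open>x0\<close> they differ in general
  from \<open>\<pi> a c\<close>.\<close>

definition Pc :: "nat \<Rightarrow> nat \<Rightarrow> 'e \<Rightarrow> real" where
  "Pc a c x = (\<Sum>i<n. \<Sum>j<n. (e x a (b i) * e x c (b j)) * \<pi> i j x)"

lemma e_x0: "h \<le> a \<Longrightarrow> a < n \<Longrightarrow> i < n \<Longrightarrow> e x0 a (b i) = (if i = a then 1 else 0)"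
  using e_high_low[of a i] e_b[OF U(2), of a i] by (cases "i < h") auto

lemma double_delta:
  fixes f :: "nat \<Rightarrow> nat \<Rightarrow> real"
  assumes "a < n" "c < n"
  shows "(\<Sum>i<n. \<Sum>j<n. ((if i = a then 1 else 0) * (if j = c then 1 else 0)) * f i j) = f a c"
proof -
  have "(\<Sum>i<n. \<Sum>j<n. ((if i = a then 1 else 0) * (if j = c then 1 else 0)) * f i j) =
      (\<Sum>i<n. \<Sum>j<n. if j = c then (if i = a then f i j else 0) else 0)"
    by (intro sum.cong refl) simp
  then show ?thesis using assms by simp
qed

lemma Pc_x0: "h \<le> a \<Longrightarrow> a < n \<Longrightarrow> h \<le> c \<Longrightarrow> c < n \<Longrightarrow> Pc a c x0 = \<pi> a c x0"
proof -
  assume a: "h \<le> a" "a < n" and c: "h \<le> c" "c < n"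
  have "Pc a c x0 = (\<Sum>i<n. \<Sum>j<n. ((if i = a then 1 else 0) * (if j = c then 1 else 0)) * \<pi> i j x0)"
    unfolding Pc_def by (intro sum.cong refl) (simp add: e_x0 a c)
  then show ?thesis using double_delta[OF a(2) c(2)] by simp
qed

lemma D_e_vertical: "a < n \<Longrightarrow> h \<le> c \<Longrightarrow> c < n \<Longrightarrow> D (\<lambda>x. e x a (b c)) w = 0"
  by (rule D_unique[OF e_diff has_derivative_const[of "if a = c then 1 else 0"]]) (auto simp: e_b)

lemma off': "i < h \<Longrightarrow> h \<le> a \<Longrightarrow> a < n \<Longrightarrow> \<pi> a i x0 = 0"
  using off[of i a] \<pi>_anti[OF U(2), of a i] l by simp

text \<open>At \<open>x0\<close> the components \<open>Pc\<close> agree with \<pi> to first order.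
  The derivative of \<open>e\<close> is 0 on vertical basis vectors, where \<open>e\<close> is
  constant, and on horizontal ones it is multiplied by an entry of the mixed block of \<pi>, which
  is 0 at \<open>x0\<close>.\<close>

lemma Pc_has_derivative:
  assumes a: "h \<le> a" "a < n" and c: "h \<le> c" "c < n"
  shows "(Pc a c has_derivative D (\<pi> a c)) (at x0)"
proof -
  let ?e = "\<lambda>a i x. e x a (b i)"
  have eD: "(?e a i has_derivative D (?e a i)) (at x0)" if "a < n" for a i
    by (rule differentiable_has_frechet_derivative[OF e_diff[OF that]])
  have A: "(Pc a c has_derivative (\<lambda>w. \<Sum>i<n. \<Sum>j<n. (?e a i x0 * ?e c j x0) * D (\<pi> i j) w +
      (?e a i x0 * D (?e c j) w + D (?e a i) w * ?e c j x0) * \<pi> i j x0)) (at x0)"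
    unfolding Pc_def[abs_def]
    by (intro has_derivative_sum has_derivative_mult eD \<pi>D a c) auto
  have eq: "(\<Sum>i<n. \<Sum>j<n. (?e a i x0 * ?e c j x0) * D (\<pi> i j) w +
      (?e a i x0 * D (?e c j) w + D (?e a i) w * ?e c j x0) * \<pi> i j x0) = D (\<pi> a c) w" for w
  proof -
    have "(\<Sum>i<n. \<Sum>j<n. (?e a i x0 * ?e c j x0) * D (\<pi> i j) w +
      (?e a i x0 * D (?e c j) w + D (?e a i) w * ?e c j x0) * \<pi> i j x0) =
      (\<Sum>i<n. \<Sum>j<n. ((if i = a then 1 else 0) * (if j = c then 1 else 0)) * D (\<pi> i j) w)"
    proof (intro sum.cong refl)
      fix i j assume "i \<in> {..<n}" "j \<in> {..<n}"
      then have i: "i < n" and j: "j < n" by auto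
      have 1: "?e a i x0 * D (?e c j) w * \<pi> i j x0 = 0"
      proof (cases "i = a \<and> j < h")
        case True
        then show ?thesis using off'[of j a] a by simp
      next
        case False
        then show ?thesis using e_x0[OF a i] D_e_vertical[OF c(2) _ j, of w] by (cases "i = a") auto
      qed
      have 2: "D (?e a i) w * ?e c j x0 * \<pi> i j x0 = 0"
      proof (cases "j = c \<and> i < h")
        case True
        then show ?thesis using off[of i c] c by simp
      next
        case False
        then show ?thesis using e_x0[OF c j] D_e_vertical[OF a(2) _ i, of w] by (cases "j = c") auto
      qed
      show "(?e a i x0 * ?e c j x0) * D (\<pi> i j) w + (?e a i x0 * D (?e c j) w + D (?e a i) w * ?e c j x0) * \<pi> i j x0
          = ((if i = a then 1 else 0) * (if j = c then 1 else 0)) * D (\<pi> i j) w"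
        unfolding distrib_right 1 2 unfolding e_x0[OF a i] e_x0[OF c j] by simp
    qed
    then show ?thesis using double_delta[OF a(2) c(2)] by simp
  qed
  show ?thesis using A unfolding eq by simp
qed

text \<open>The contraction of \<tau> with the vertical bivector. The half accounts for both orders
  of each pair of indices, and \<open>b c\<close> stands before \<open>b a\<close> because
  contraction with the product of \<open>b a\<close> and \<open>b c\<close> contracts with
  \<open>b c\<close> first.\<close>

definition iP :: "'e \<Rightarrow> 'e form" where
  "iP x us = (\<Sum>a\<in>{h..<n}. \<Sum>c\<in>{h..<n}. Pc a c x * \<tau> x (b c # b a # us)) / 2"

text \<open>The derivative of \<open>\<pi> a c * t\<close> in direction \<open>w\<close>, divided by
  \<open>t\<close>, at \<open>x0\<close>.\<close>

definition Fc :: "nat \<Rightarrow> nat \<Rightarrow> 'e \<Rightarrow> real" where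
  "Fc a c w = D (\<pi> a c) w + \<pi> a c x0 * (D t w / t x0)"

lemma Fc_linear: "a < n \<Longrightarrow> c < n \<Longrightarrow> linear (Fc a c)"
  using D_linear[OF \<pi>_diff, of a c] D_linear[OF t_diff] unfolding Fc_def[abs_def]
  by (intro linearI) (simp_all add: linear_add linear_cmul add_divide_distrib algebra_simps)

lemma Fc_anti: "a < n \<Longrightarrow> c < n \<Longrightarrow> Fc a c w = - Fc c a w"
  unfolding Fc_def using D_\<pi>_anti[of a c w] \<pi>_anti[OF U(2), of a c] by simp

lemma iP_has_derivative:
  "((\<lambda>x. iP x us) has_derivative
    (\<lambda>w. (\<Sum>a\<in>{h..<n}. \<Sum>c\<in>{h..<n}. Fc a c w * \<tau> x0 (b c # b a # us)) / 2)) (at x0)"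
proof -
  let ?d = "\<lambda>a c w. Pc a c x0 * D (\<lambda>x. \<tau> x (b c # b a # us)) w + D (\<pi> a c) w * \<tau> x0 (b c # b a # us)"
  have "((\<lambda>x. Pc a c x * \<tau> x (b c # b a # us)) has_derivative ?d a c) (at x0)"
    if "a \<in> {h..<n}" "c \<in> {h..<n}" for a c
    by (rule has_derivative_mult[OF Pc_has_derivative differentiable_has_frechet_derivative[OF \<tau>_diff]])
      (use that in auto)
  then have "((\<lambda>x. iP x us) has_derivative (\<lambda>w. (\<Sum>a\<in>{h..<n}. \<Sum>c\<in>{h..<n}. ?d a c w) / 2)) (at x0)"
    unfolding iP_def divide_inverse by (intro has_derivative_mult_left has_derivative_sum) auto
  moreover have "?d a c w = Fc a c w * \<tau> x0 (b c # b a # us)" if "a \<in> {h..<n}" "c \<in> {h..<n}" for a c w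
    using that by (simp add: Fc_def D_\<tau> Pc_x0 algebra_simps)
  then have "(\<Sum>a\<in>{h..<n}. \<Sum>c\<in>{h..<n}. ?d a c w) = (\<Sum>a\<in>{h..<n}. \<Sum>c\<in>{h..<n}. Fc a c w * \<tau> x0 (b c # b a # us))" for w
    by (intro sum.cong refl) auto
  ultimately show ?thesis by simp
qed

text \<open>The sum is the value of \<open>f \<and> \<tau>\<close>, a leafwise form of degree above the dimension of the leaves.\<close>
lemma alt_sum_leaf_volume:
  assumes f: "linear f" and us: "\<And>u i. u \<in> set us \<Longrightarrow> i < h \<Longrightarrow> d i u = 0"
  shows "alt_sum (\<lambda>w vs. f w * \<tau> x0 vs) us = (0::real)"
proof -
  \<comment> \<open>Projecting the direction to the leaf makes the expression a form on the whole
    model space that is 0 on lists containing a horizontal basis vector; on vertical arguments the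
    projection changes nothing.\<close>
  let ?k = "Suc (n - h)" and ?\<omega> = "alt_sum (\<lambda>w vs. f (pr x0 w) * \<tau> x0 vs)"
  have fp: "linear (\<lambda>w. f (pr x0 w))"
    using linear_compose[OF pr_linear[OF U(2)] f] by (simp add: o_def)
  have form: "?\<omega> \<in> forms UNIV ?k"
    by (rule alt_sum_forms[OF subspace_UNIV])
      (use forms_scaled[OF \<tau>_forms[OF U(2)]] linear_add[OF fp] linear_cmul[OF fp] in \<open>auto simp: distrib_right\<close>)
  have "?\<omega> vs = 0" for vs
  proof (rule forms_eq_0_spanning[OF form subspace_UNIV, of "b ` {..<n}"])
    fix vs assume vs: "set vs \<subseteq> b ` {..<n}"
    show "?\<omega> vs = 0"
    proof (cases "\<exists>i<h. b i \<in> set vs")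
      case True
      then obtain i where i: "i < h" "b i \<in> set vs" by blast
      show ?thesis
        unfolding alt_sum_def
      proof (rule sum.neutral, rule ballI)
        fix k assume "k \<in> {..<length vs}"
        then have k: "k < length vs" by simp
        show "(- 1) ^ k * (f (pr x0 (vs ! k)) * \<tau> x0 (take k vs @ drop (Suc k) vs)) = 0"
        proof (cases "vs ! k = b i")
          case True
          then show ?thesis using pr_x0_low[OF i(1)] linear_0[OF f] by simp
        next
          case False
          have "set vs = set (take k vs @ vs ! k # drop (Suc k) vs)" using id_take_nth_drop[OF k] by metis
          then have "b i \<in> set (take k vs @ drop (Suc k) vs)" using False i(2) by auto
          then show ?thesis using \<tau>_kill[OF U(2) i(1)] by simp
        qed
      qed
    next
      case False
      have "set vs \<subseteq> b ` {h..<n}"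
      proof
        fix v assume "v \<in> set vs"
        then obtain i where "v = b i" "i < n" using vs by auto
        then show "v \<in> b ` {h..<n}" using False \<open>v \<in> set vs\<close> by (cases "i < h") auto
      qed
      \<comment> \<open>There are at most \<open>n - h\<close> vertical basis vectors, one fewer
        than the degree, so an entry must be repeated.\<close>
      then have "card (set vs) \<le> card (b ` {h..<n})" by (intro card_mono) auto
      also have "\<dots> \<le> n - h" using card_image_le[of "{h..<n}" b] by simp
      finally have "card (set vs) < ?k" by simp
      then have "\<not> distinct vs \<or> length vs \<noteq> ?k" by (metis distinct_card less_irrefl)
      then show ?thesis using forms_not_distinct[OF form] forms_eq_0[OF form] by blast
    qed
  qed (use span_b in auto)
  moreover have "?\<omega> us = alt_sum (\<lambda>w vs. f w * \<tau> x0 vs) us"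
    unfolding alt_sum_def
  proof (rule sum.cong[OF refl])
    fix k assume "k \<in> {..<length us}"
    then have m: "us ! k \<in> set us" by simp
    have "us ! k = (\<Sum>i<n. d i (us ! k) *\<^sub>R b i)" by (rule expand[symmetric])
    also have "\<dots> = pr x0 (us ! k)" unfolding pr_x0
      by (rule sum.mono_neutral_right) (use us[OF m] in auto)
    finally have "pr x0 (us ! k) = us ! k" by (rule sym)
    then show "(- 1) ^ k * (f (pr x0 (us ! k)) * \<tau> x0 (take k us @ drop (Suc k) us)) =
        (- 1) ^ k * (f (us ! k) * \<tau> x0 (take k us @ drop (Suc k) us))" by (simp only:)
  qed
  ultimately show ?thesis by simp
qed

text \<open>The product of a covector with the top-degree form \<tau> is 0 on the leaf; contracting
  it with \<open>b c\<close> and \<open>b a\<close> moves the differentiation from the arguments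
  \<open>ws\<close> to \<open>b a\<close> and \<open>b c\<close>, which is \<open>S\<close>.
  Antisymmetry of \<open>Fc\<close> makes the two resulting sums add up and cancels the half, and
  the row sums of \<open>Fc\<close> that remain are the components \<open>Zc\<close>.\<close>

lemma coord_deriv_iP:
  assumes ws: "\<And>u i. u \<in> set ws \<Longrightarrow> i < h \<Longrightarrow> d i u = 0"
  shows "alt_sum (\<lambda>w vs. D (\<lambda>x. iP x vs) w) ws = - \<tau> x0 ((\<Sum>m\<in>{h..<n}. Zc m *\<^sub>R b m) # ws)"
proof -
  let ?I = "{h..<n}" and ?T = "\<lambda>a. \<tau> x0 (b a # ws)"
  have S: "alt_sum (\<lambda>w vs. f w * \<tau> x0 (b c # b a # vs)) ws = f (b a) * ?T c - f (b c) * ?T a"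
    if "a \<in> ?I" "c \<in> ?I" "linear f" for a c and f :: "'e \<Rightarrow> real"
  proof -
    have "alt_sum (\<lambda>w vs. f w * \<tau> x0 vs) (b c # b a # ws) = 0"
      by (rule alt_sum_leaf_volume[OF that(3)]) (use that ws l d_b in auto)
    then show ?thesis by (simp add: alt_sum_Cons interior_prod_def)
  qed
  have "alt_sum (\<lambda>w vs. D (\<lambda>x. iP x vs) w) ws =
      alt_sum (\<lambda>w vs. (\<Sum>a\<in>?I. \<Sum>c\<in>?I. Fc a c w * \<tau> x0 (b c # b a # vs)) / 2) ws"
    by (simp only: frechet_derivative_eqI[OF iP_has_derivative])
  also have "\<dots> = (\<Sum>a\<in>?I. \<Sum>c\<in>?I. alt_sum (\<lambda>w vs. Fc a c w * \<tau> x0 (b c # b a # vs)) ws) / 2"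
  proof -
    have "alt_sum (\<lambda>w vs. (\<Sum>a\<in>?I. \<Sum>c\<in>?I. Fc a c w * \<tau> x0 (b c # b a # vs)) / 2) ws =
      (\<Sum>k<length ws. \<Sum>a\<in>?I. \<Sum>c\<in>?I. (- 1) ^ k * (Fc a c (ws ! k) * \<tau> x0 (b c # b a # take k ws @ drop (Suc k) ws))) / 2"
      unfolding alt_sum_def by (simp only: sum_distrib_left sum_divide_distrib times_divide_eq_right)
    also have "(\<Sum>k<length ws. \<Sum>a\<in>?I. \<Sum>c\<in>?I. (- 1) ^ k * (Fc a c (ws ! k) * \<tau> x0 (b c # b a # take k ws @ drop (Suc k) ws))) =
      (\<Sum>a\<in>?I. \<Sum>k<length ws. \<Sum>c\<in>?I. (- 1) ^ k * (Fc a c (ws ! k) * \<tau> x0 (b c # b a # take k ws @ drop (Suc k) ws)))"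
      by (rule sum.swap)
    also have "\<dots> = (\<Sum>a\<in>?I. \<Sum>c\<in>?I. \<Sum>k<length ws. (- 1) ^ k * (Fc a c (ws ! k) * \<tau> x0 (b c # b a # take k ws @ drop (Suc k) ws)))"
      by (rule sum.cong[OF refl], rule sum.swap)
    finally show ?thesis by (simp only: alt_sum_def)
  qed
  also have "(\<Sum>a\<in>?I. \<Sum>c\<in>?I. alt_sum (\<lambda>w vs. Fc a c w * \<tau> x0 (b c # b a # vs)) ws) =
      (\<Sum>a\<in>?I. \<Sum>c\<in>?I. Fc a c (b a) * ?T c - Fc a c (b c) * ?T a)"
    by (intro sum.cong refl S Fc_linear) auto
  also have "\<dots> = (\<Sum>a\<in>?I. \<Sum>c\<in>?I. Fc a c (b a) * ?T c) - (\<Sum>a\<in>?I. \<Sum>c\<in>?I. Fc a c (b c) * ?T a)"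
    by (simp only: sum_subtractf)
  also have "(\<Sum>a\<in>?I. \<Sum>c\<in>?I. Fc a c (b a) * ?T c) = (\<Sum>c\<in>?I. \<Sum>a\<in>?I. - (Fc c a (b a) * ?T c))"
  proof (subst sum.swap, intro sum.cong refl)
    fix c a assume "c \<in> ?I" "a \<in> ?I"
    then have "Fc a c (b a) = - Fc c a (b a)" by (intro Fc_anti) auto
    then show "Fc a c (b a) * ?T c = - (Fc c a (b a) * ?T c)" by simp
  qed
  also have "\<dots> = - (\<Sum>a\<in>?I. \<Sum>c\<in>?I. Fc a c (b c) * ?T a)" by (simp only: sum_negf)
  also have "(- (\<Sum>a\<in>?I. \<Sum>c\<in>?I. Fc a c (b c) * ?T a) - (\<Sum>a\<in>?I. \<Sum>c\<in>?I. Fc a c (b c) * ?T a)) / 2 =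
      - (\<Sum>a\<in>?I. \<Sum>c\<in>?I. Fc a c (b c) * ?T a)" by simp
  also have "(\<Sum>a\<in>?I. \<Sum>c\<in>?I. Fc a c (b c) * ?T a) = (\<Sum>a\<in>?I. Zc a * ?T a)"
  proof (rule sum.cong[OF refl])
    fix a assume "a \<in> ?I"
    then have a: "h \<le> a" "a < n" by auto
    \<comment> \<open>For vertical \<open>a\<close> the horizontal \<open>q\<close> drop out at
      \<open>x0\<close>, so that both sums of \<open>Zc_eq\<close> run over the leaf
      directions.\<close>
    have "(\<Sum>q<n. \<pi> a q x0 * (D t (b q) / t x0)) = (\<Sum>q\<in>?I. \<pi> a q x0 * (D t (b q) / t x0))"
      by (rule sum.mono_neutral_right) (use off'[OF _ a] in auto)
    then have "Zc a = (\<Sum>c\<in>?I. Fc a c (b c))"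
      unfolding Zc_eq[OF a(2)] Fc_def sum.distrib by simp
    then show "(\<Sum>c\<in>?I. Fc a c (b c) * ?T a) = Zc a * ?T a" by (simp only: sum_distrib_right)
  qed
  also have "\<dots> = \<tau> x0 ((\<Sum>m\<in>?I. Zc m *\<^sub>R b m) # ws)"
    using forms_sum[OF \<tau>_forms[OF U(2)] subspace_UNIV, of ?I b "[]" Zc ws] by simp
  finally show ?thesis .
qed

end

section \<open>Bivector fields and Poisson brackets in the charts of the combined atlas\<close>

section \<open>Bivector fields and the Jacobi identity in a chart\<close>

context foliated_atlas
begin

lemma bivec_rep_bivector:
  assumes c: "c \<in> G" "x \<in> cran c" and B: "is_bivector (B (cinv c x))"
  shows "is_bivector (bivec_rep A c B x)"
proof -
  have lin: "linear (to_chart A c (cinv c x))" using chart(6)[OF c] by (intro to_chart_linear c) auto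
  have p: "pull (to_chart A c (cinv c x)) \<alpha> \<in> forms UNIV 1" if "\<alpha> \<in> forms UNIV 1" for \<alpha>
    by (rule pull_forms[OF lin that])
  have pl: "pull L (\<lambda>us. a * \<alpha> us + b * \<beta> us) = (\<lambda>us. a * pull L \<alpha> us + b * pull L \<beta> us)"
    for L :: "'e \<Rightarrow> 'e" and a b and \<alpha> \<beta> :: "'e form"
    by (simp add: pull_def)
  show ?thesis
    unfolding is_bivector_def bivec_rep_def Let_def pl
    using bivector_lincomb_left[OF B p p p] bivector_self[OF B p] by blast
qed

text \<open>\<open>bivector_field\<close> gives smoothness in charts of \<open>A\<close>. In another
  chart the components are those in \<open>chart_at A p\<close> with derivatives of the transition
  map inserted, and these derivatives are smooth as well.\<close>

lemma bivec_rep_differentiable: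
  fixes b :: "nat \<Rightarrow> 'e"
  assumes c: "c \<in> G" "p \<in> cdom c" and B: "bivector_field A B" and db: "dual_basis n b d"
    and \<alpha>: "\<alpha> \<in> forms UNIV 1" and \<beta>: "\<beta> \<in> forms UNIV 1"
  shows "(\<lambda>x. bivec_rep A c B x \<alpha> \<beta>) differentiable (at (cmap c p))"
proof -
  interpret dual_basis n b d by (rule db)
  let ?c' = "chart_at A p"
  note c' = chart_at_A[of p]
  let ?\<phi> = "cmap ?c' \<circ> cinv c" and ?\<psi> = "cmap c \<circ> cinv ?c'"
  let ?S = "cmap c ` (cdom c \<inter> cdom ?c')" and ?S' = "cmap ?c' ` (cdom ?c' \<inter> cdom c)"
  let ?x = "cmap c p" and ?L = "\<lambda>x. frechet_derivative ?\<psi> (at (?\<phi> x))"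
  have S: "open ?S" "?x \<in> ?S" using transition(2)[OF c(1) c'(1)] c c' by auto
  have \<phi>x: "?\<phi> ?x = cmap ?c' p" using chart(5)[OF c] by simp
  have \<phi>d: "?\<phi> differentiable (at ?x)" by (rule smooth_on_differentiable[OF transition(1)[OF c(1) c'(1)] S(2)])
  let ?g = "\<lambda>i j x. bivec_rep A ?c' B (?\<phi> x) (covec (d i)) (covec (d j))"
  have eq: "(\<Sum>i<n. \<Sum>j<n. (\<alpha> [?L x (b i)] * \<beta> [?L x (b j)]) * ?g i j x) = bivec_rep A c B x \<alpha> \<beta>"
    if x: "x \<in> ?S" for x
  proof -
    obtain q where q: "q \<in> cdom c" "q \<in> cdom ?c'" "x = cmap c q" using x by blast
    have e: "cinv c x = q" "?\<phi> x = cmap ?c' q" "cinv ?c' (cmap ?c' q) = q"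
      using chart(5)[OF c(1) q(1)] chart(5)[OF c'(1) q(2)] q(3) by auto
    have L: "?L x = trans_deriv ?c' c q" by (simp add: trans_deriv_def e del: comp_apply)
    have lin: "linear (trans_deriv ?c' c q)" by (rule trans_deriv_linear[OF G c'(1) c(1) q(2,1)])
    have tc: "to_chart A c q = (\<lambda>v. trans_deriv ?c' c q (to_chart A ?c' q v))"
      using to_chart_change[OF c'(1) c(1) q(2,1)] by auto
    have "bivec_rep A c B x \<alpha> \<beta> = bivec_rep A ?c' B (?\<phi> x) (pull (trans_deriv ?c' c q) \<alpha>) (pull (trans_deriv ?c' c q) \<beta>)"
      unfolding bivec_rep_def Let_def e pull_pull tc ..
    also have "\<dots> = (\<Sum>i<n. pull (trans_deriv ?c' c q) \<alpha> [b i] *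
        bivec_rep A ?c' B (?\<phi> x) (covec (d i)) (pull (trans_deriv ?c' c q) \<beta>))"
      and "\<And>i. i < n \<Longrightarrow> bivec_rep A ?c' B (?\<phi> x) (covec (d i)) (pull (trans_deriv ?c' c q) \<beta>) =
        (\<Sum>j<n. pull (trans_deriv ?c' c q) \<beta> [b j] * ?g i j x)"
    proof -
      have bv: "is_bivector (bivec_rep A ?c' B (?\<phi> x))"
        by (rule bivec_rep_bivector[OF c'(1)]) (use e q B in \<open>auto simp: bivector_field_def\<close>)
      show "bivec_rep A ?c' B (?\<phi> x) (pull (trans_deriv ?c' c q) \<alpha>) (pull (trans_deriv ?c' c q) \<beta>) =
        (\<Sum>i<n. pull (trans_deriv ?c' c q) \<alpha> [b i] *
        bivec_rep A ?c' B (?\<phi> x) (covec (d i)) (pull (trans_deriv ?c' c q) \<beta>))"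
        by (rule bivector_expand_left[OF bv pull_forms[OF lin \<alpha>] pull_forms[OF lin \<beta>]])
      show "\<And>i. i < n \<Longrightarrow> bivec_rep A ?c' B (?\<phi> x) (covec (d i)) (pull (trans_deriv ?c' c q) \<beta>) =
        (\<Sum>j<n. pull (trans_deriv ?c' c q) \<beta> [b j] * ?g i j x)"
        by (rule bivector_expand_right[OF bv d_forms pull_forms[OF lin \<beta>]])
    qed
    ultimately show ?thesis
      unfolding L by (simp add: pull_def sum_distrib_left mult.assoc)
  qed
  have gd: "?g i j differentiable (at ?x)" if "i < n" "j < n" for i j
  proof -
    have "smooth_on (cran ?c') (\<lambda>y. bivec_rep A ?c' B y (covec (d i)) (covec (d j)))"
      using B c'(2) d_forms that unfolding bivector_field_def by blast
    then have "(\<lambda>y. bivec_rep A ?c' B y (covec (d i)) (covec (d j))) differentiable (at (?\<phi> ?x))"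
      by (rule smooth_on_differentiable) (use \<phi>x c'(3) in simp)
    from differentiable_chain_at[OF \<phi>d this] show ?thesis by (simp add: o_def)
  qed
  have Ld: "(\<lambda>x. \<omega> [?L x v]) differentiable (at ?x)" if \<omega>: "\<omega> \<in> forms UNIV 1" for \<omega> v
  proof -
    have "?\<phi> ?x \<in> ?S'" using \<phi>x c'(3) c(2) by auto
    then have "(\<lambda>y. frechet_derivative ?\<psi> (at y) v) differentiable (at (?\<phi> ?x))"
      by (rule smooth_on_differentiable[OF smooth_on_frechet_derivative[OF transition(1)[OF c'(1) c(1)]]])
    from differentiable_chain_at[OF \<phi>d this] have 1: "(\<lambda>x. ?L x v) differentiable (at ?x)" by (simp add: o_def)
    have bl: "bounded_linear (\<lambda>u. \<omega> [u])" using forms_1_covec(2)[OF \<omega>] linear_conv_bounded_linear by blast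
    show ?thesis
      by (rule differentiableI[OF bounded_linear.has_derivative[OF bl differentiable_has_frechet_derivative[OF 1]]])
  qed
  show ?thesis
  proof (rule differentiable_transform_open[OF _ S eq])
    show "(\<lambda>x. \<Sum>i<n. \<Sum>j<n. (\<alpha> [?L x (b i)] * \<beta> [?L x (b j)]) * ?g i j x) differentiable (at ?x)"
      by (intro differentiable_sum ballI differentiable_mult Ld gd \<alpha> \<beta>) auto
  qed
qed

lemma bracket_chart:
  assumes c: "c \<in> G" "q \<in> cdom c"
    and f: "(f \<circ> cinv c) differentiable (at (cmap c q))" and g: "(g \<circ> cinv c) differentiable (at (cmap c q))"
  shows "bracket A B f g q = bivec_rep A c B (cmap c q)
    (covec (frechet_derivative (f \<circ> cinv c) (at (cmap c q)))) (covec (frechet_derivative (g \<circ> cinv c) (at (cmap c q))))"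
  using chart(5)[OF c] by (simp add: bracket_def differential_chart[OF c f] differential_chart[OF c g] bivec_rep_def)

text \<open>The coordinates \<open>d i\<close> are local; cut off, they become global smooth
  functions \<open>f i\<close> with unchanged germs at \<open>p\<close>. Near \<open>p\<close> the
  bracket of \<open>f k\<close> and \<open>f i\<close> is the component \<open>\<pi> k i\<close>, so
  the Jacobi identity for these functions is the identity for \<pi>.\<close>

lemma jacobi_chart:
  fixes b :: "nat \<Rightarrow> 'e"
  assumes c: "c \<in> G" "p \<in> cdom c" and B: "poisson A B" and db: "dual_basis n b d"
    and mki: "m < n" "k < n" "i < n"
    and \<pi>: "\<And>i j x. \<pi> i j x = bivec_rep A c B x (covec (d i)) (covec (d j))"
  shows "(\<Sum>j<n. \<pi> m j (cmap c p) * frechet_derivative (\<pi> k i) (at (cmap c p)) (b j)) +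
      (\<Sum>j<n. \<pi> k j (cmap c p) * frechet_derivative (\<pi> i m) (at (cmap c p)) (b j)) +
      (\<Sum>j<n. \<pi> i j (cmap c p) * frechet_derivative (\<pi> m k) (at (cmap c p)) (b j)) = 0"
proof -
  interpret dual_basis n b d by (rule db)
  let ?x = "cmap c p"
  have Bf: "bivector_field A B" using B by (simp add: poisson_def)
  have bl: "bounded_linear (d i)" if "i < n" for i using d_linear[OF that] linear_conv_bounded_linear by blast
  have "\<exists>f N. smooth_fun A f \<and> open N \<and> ?x \<in> N \<and> N \<subseteq> cran c \<and> (\<forall>x\<in>N. f (cinv c x) = d i x)" if "i < n" for i
    using smooth_fun_extension[OF c smooth_on_bounded_linear[OF bl[OF that]]] by metis
  then obtain f N where f: "\<And>i. i < n \<Longrightarrow> smooth_fun A (f i)"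
    and N: "\<And>i. i < n \<Longrightarrow> open (N i) \<and> ?x \<in> N i \<and> N i \<subseteq> cran c"
    and fN: "\<And>i x. i < n \<Longrightarrow> x \<in> N i \<Longrightarrow> f i (cinv c x) = d i x" by metis
  have fd: "((f i \<circ> cinv c) has_derivative d i) (at x)" if "i < n" "x \<in> N i" for i x
    by (rule has_derivative_transform_within_open[OF bounded_linear_imp_has_derivative[OF bl[OF that(1)]], of "N i"])
      (use N[OF that(1)] fN[OF that(1)] that in auto)
  have br: "(bracket A B (f k) (f i) \<circ> cinv c) x = \<pi> k i x" if "k < n" "i < n" "x \<in> N k \<inter> N i" for k i x
  proof -
    have "x \<in> cran c" using N that by blast
    then have q: "cinv c x \<in> cdom c" "cmap c (cinv c x) = x" using chart(6)[OF c(1)] by auto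
    have dk: "(f k \<circ> cinv c has_derivative d k) (at (cmap c (cinv c x)))"
      and di: "(f i \<circ> cinv c has_derivative d i) (at (cmap c (cinv c x)))"
      using fd that q by auto
    show ?thesis
      using bracket_chart[OF c(1) q(1) differentiableI[OF dk] differentiableI[OF di], of B]
      unfolding frechet_derivative_eqI[OF dk] frechet_derivative_eqI[OF di] by (simp add: \<pi> q(2))
  qed
  have \<pi>d: "\<pi> k i differentiable (at ?x)" if "k < n" "i < n" for k i
    using bivec_rep_differentiable[OF c Bf db d_forms[OF that(1)] d_forms[OF that(2)]]
    by (simp add: \<pi>[abs_def])
  have main: "bracket A B (f m) (bracket A B (f k) (f i)) p =
      (\<Sum>j<n. \<pi> m j ?x * frechet_derivative (\<pi> k i) (at ?x) (b j))" if mki: "m < n" "k < n" "i < n" for m k i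
  proof -
    have o: "open (N k \<inter> N i)" "?x \<in> N k \<inter> N i" using N[OF mki(2)] N[OF mki(3)] by auto
    have dm: "(f m \<circ> cinv c has_derivative d m) (at ?x)" by (rule fd[OF mki(1)]) (use N[OF mki(1)] in blast)
    have db: "((bracket A B (f k) (f i) \<circ> cinv c) has_derivative frechet_derivative (\<pi> k i) (at ?x)) (at ?x)"
      by (rule has_derivative_transform_within_open[OF differentiable_has_frechet_derivative[OF \<pi>d[OF mki(2,3)]] o])
        (rule br[OF mki(2,3), symmetric])
    have "bracket A B (f m) (bracket A B (f k) (f i)) p =
        bivec_rep A c B ?x (covec (d m)) (covec (frechet_derivative (\<pi> k i) (at ?x)))"
      using bracket_chart[OF c differentiableI[OF dm] differentiableI[OF db], of B]
      unfolding frechet_derivative_eqI[OF dm] frechet_derivative_eqI[OF db] .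
    also have "\<dots> = (\<Sum>j<n. covec (frechet_derivative (\<pi> k i) (at ?x)) [b j] * bivec_rep A c B ?x (covec (d m)) (covec (d j)))"
    proof (rule bivector_expand_right)
      show "is_bivector (bivec_rep A c B ?x)"
        by (rule bivec_rep_bivector[OF c(1)]) (use c Bf in \<open>auto simp: bivector_field_def\<close>)
      show "covec (d m) \<in> forms UNIV 1" by (rule d_forms[OF mki(1)])
      show "covec (frechet_derivative (\<pi> k i) (at ?x)) \<in> forms UNIV 1"
        by (rule covec_forms[OF linear_frechet_derivative[OF \<pi>d[OF mki(2,3)]]])
    qed
    finally show ?thesis by (simp add: \<pi> mult.commute)
  qed
  have "bracket A B (f m) (bracket A B (f k) (f i)) p + bracket A B (f k) (bracket A B (f i) (f m)) p
      + bracket A B (f i) (bracket A B (f m) (f k)) p = 0"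
    using B f mki unfolding poisson_def by blast
  then show ?thesis unfolding main[OF mki] main[OF mki(2,3,1)] main[OF mki(3,1,2)] .
qed

end

section \<open>Bases adapted to a splitting\<close>

section \<open>Adapted bases\<close>

lemma basis_enumeration:
  fixes S :: "'e::euclidean_space set"
  assumes "subspace S" "dim S = m"
  shows "\<exists>f. (\<forall>i<m. f i \<in> S) \<and> (\<forall>v\<in>S. \<exists>c. v = (\<Sum>i<m. c i *\<^sub>R f i)) \<and>
    (\<forall>c::nat \<Rightarrow> real. (\<Sum>i<m. c i *\<^sub>R f i) = 0 \<longrightarrow> (\<forall>i<m. c i = 0))"
proof -
  obtain B where B: "B \<subseteq> S" "independent B" "S \<subseteq> span B" "card B = m"
    using basis_exists[of S] assms(2) by blast
  have fin: "finite B" using B(2) by (rule finiteI_independent)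
  obtain f where f: "bij_betw f {0..<m} B" using ex_bij_betw_nat_finite[OF fin] B(4) by auto
  then have f: "inj_on f {..<m}" "f ` {..<m} = B" by (auto simp: bij_betw_def lessThan_atLeast0)
  show ?thesis
  proof (rule exI[of _ f], intro conjI allI impI ballI)
    show "f i \<in> S" if "i < m" for i using f(2) B(1) that by auto
    show "\<exists>c. v = (\<Sum>i<m. c i *\<^sub>R f i)" if "v \<in> S" for v
    proof -
      have "v \<in> span B" using B(3) that by blast
      then obtain u where "v = (\<Sum>w\<in>B. u w *\<^sub>R w)" using span_finite[OF fin] by auto
      then have "v = (\<Sum>i<m. u (f i) *\<^sub>R f i)" unfolding f(2)[symmetric] sum.reindex[OF f(1)] by simp
      then show ?thesis by (rule exI[of _ "\<lambda>i. u (f i)"])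
    qed
    show "c i = 0" if z: "(\<Sum>i<m. c i *\<^sub>R f i) = 0" and i: "i < m" for c i
    proof -
      let ?u = "\<lambda>w. c (inv_into {..<m} f w)"
      have "(\<Sum>w\<in>B. ?u w *\<^sub>R w) = (\<Sum>i<m. c i *\<^sub>R f i)"
        unfolding f(2)[symmetric] sum.reindex[OF f(1)]
        by (rule sum.cong) (simp_all add: inv_into_f_f[OF f(1)])
      then have "(\<Sum>w\<in>B. ?u w *\<^sub>R w) = 0" using z by simp
      moreover have "f i \<in> B" using f(2) i by auto
      moreover have "(\<Sum>w\<in>B. ?u w *\<^sub>R w) = 0 \<longrightarrow> (\<forall>w\<in>B. ?u w = 0)"
        using B(2) unfolding independent_explicit by (elim conjE allE[of _ ?u])
      ultimately have "?u (f i) = 0" by blast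
      then show ?thesis using inv_into_f_f[OF f(1)] i by simp
    qed
  qed
qed

text \<open>A basis of \<open>S\<close> is followed by one of \<open>K\<close>; then the first
  \<open>m\<close> coordinates vanish exactly on \<open>K\<close>.\<close>

lemma adapted_basis_exists:
  fixes S K :: "'e::euclidean_space set"
  assumes S: "subspace S" "dim S = m" and K: "subspace K"
    and int: "S \<inter> K = {0}" and plus: "\<And>v. \<exists>u\<in>S. \<exists>w\<in>K. v = u + w"
  obtains n b d where "dual_basis n b d" "m \<le> n" "n - m = dim K" "\<And>i. i < m \<Longrightarrow> b i \<in> S"
    "\<And>v. v \<in> K \<longleftrightarrow> (\<forall>i<m. d i v = 0)"
proof -
  let ?r = "dim K"
  from basis_enumeration[OF S] obtain f where f: "\<forall>i<m. f i \<in> S" "\<forall>v\<in>S. \<exists>c. v = (\<Sum>i<m. c i *\<^sub>R f i)"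
    "\<forall>c::nat \<Rightarrow> real. (\<Sum>i<m. c i *\<^sub>R f i) = 0 \<longrightarrow> (\<forall>i<m. c i = 0)" by (elim exE conjE)
  from basis_enumeration[OF K refl] obtain g where g: "\<forall>i<?r. g i \<in> K" "\<forall>v\<in>K. \<exists>c. v = (\<Sum>i<?r. c i *\<^sub>R g i)"
    "\<forall>c::nat \<Rightarrow> real. (\<Sum>i<?r. c i *\<^sub>R g i) = 0 \<longrightarrow> (\<forall>i<?r. c i = 0)" by (elim exE conjE)
  define b where "b i = (if i < m then f i else g (i - m))" for i
  have split: "(\<Sum>i<m + ?r. c i *\<^sub>R b i) = (\<Sum>i<m. c i *\<^sub>R f i) + (\<Sum>j<?r. c (m + j) *\<^sub>R g j)" for c :: "nat \<Rightarrow> real"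
  proof -
    have "(\<Sum>i<m + r. c i *\<^sub>R b i) = (\<Sum>i<m. c i *\<^sub>R b i) + (\<Sum>j<r. c (m + j) *\<^sub>R b (m + j))" for r
      by (induction r) (simp_all add: add.assoc)
    then show ?thesis by (simp add: b_def)
  qed
  have "\<exists>d. dual_basis (m + ?r) b d"
  proof (rule dual_basisI)
    fix v
    obtain u w where uw: "u \<in> S" "w \<in> K" "v = u + w" using plus[of v] by blast
    from bspec[OF f(2) uw(1)] obtain c1 where c1: "u = (\<Sum>i<m. c1 i *\<^sub>R f i)" by (elim exE)
    from bspec[OF g(2) uw(2)] obtain c2 where c2: "w = (\<Sum>i<?r. c2 i *\<^sub>R g i)" by (elim exE)
    have "v = (\<Sum>i<m + ?r. (if i < m then c1 i else c2 (i - m)) *\<^sub>R b i)"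
      unfolding split uw(3) c1 c2 by simp
    then show "\<exists>c. v = (\<Sum>i<m + ?r. c i *\<^sub>R b i)" by (rule exI[of _ "\<lambda>i. if i < m then c1 i else c2 (i - m)"])
  next
    fix c :: "nat \<Rightarrow> real" and i assume z: "(\<Sum>i<m + ?r. c i *\<^sub>R b i) = 0" and i: "i < m + ?r"
    let ?u = "\<Sum>i<m. c i *\<^sub>R f i" and ?w = "\<Sum>j<?r. c (m + j) *\<^sub>R g j"
    have uS: "?u \<in> S" using f(1) S(1) by (intro subspace_sum subspace_scale) auto
    have wK: "?w \<in> K" using g(1) K by (intro subspace_sum subspace_scale) auto
    have uw: "?u = - ?w" using z unfolding split by (simp add: eq_neg_iff_add_eq_0)
    then have "?u \<in> K" using wK K subspace_neg by metis
    then have u0: "?u = 0" using uS int by blast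
    then have w0: "?w = 0" using uw by simp
    show "c i = 0"
    proof (cases "i < m")
      case True
      then show ?thesis using f(3) u0 by simp
    next
      case False
      then have "i - m < ?r" "m + (i - m) = i" using i by auto
      then show ?thesis using g(3)[rule_format, OF w0, of "i - m"] by simp
    qed
  qed
  then obtain d where d: "dual_basis (m + ?r) b d" by blast
  interpret dual_basis "m + ?r" b d by (rule d)
  show ?thesis
  proof
    show "dual_basis (m + ?r) b d" by (rule d)
    show "b i \<in> S" if "i < m" for i using f(1) that by (simp add: b_def)
    show "v \<in> K \<longleftrightarrow> (\<forall>i<m. d i v = 0)" for v
    proof
      assume "v \<in> K"
      from bspec[OF g(2) this] obtain c where c: "v = (\<Sum>i<?r. c i *\<^sub>R g i)" by (elim exE)
      show "\<forall>i<m. d i v = 0"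
      proof (intro allI impI)
        fix i assume i: "i < m"
        have "d i v = (\<Sum>j<?r. c j * d i (g j))" unfolding c by (rule d_sum) (use i in simp)
        also have "\<dots> = 0"
        proof (rule sum.neutral, rule ballI)
          fix j assume "j \<in> {..<?r}"
          then have "d i (b (m + j)) = 0" using d_b[of i "m + j"] i by simp
          then show "c j * d i (g j) = 0" by (simp add: b_def)
        qed
        finally show "d i v = 0" .
      qed
    next
      assume z: "\<forall>i<m. d i v = 0"
      have "v = (\<Sum>i<m + ?r. d i v *\<^sub>R b i)" by (rule expand[symmetric])
      also have "\<dots> = (\<Sum>j<?r. d (m + j) v *\<^sub>R g j)" unfolding split using z by simp
      also have "\<dots> \<in> K" using g(1) K by (intro subspace_sum subspace_scale) auto
      finally show "v \<in> K" .
    qed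
  qed simp_all
qed


text \<open>Putting an entry of \<open>bs\<close> in front of the list with the \<open>k\<close>-th
  entry removed either restores \<open>bs\<close> up to order or repeats an entry.\<close>

lemma forms_omit:
  assumes \<omega>: "\<omega> \<in> forms W m" and W: "subspace W" and j: "j < length bs" and k: "k < length bs"
  shows "\<omega> (bs ! j # take k bs @ drop (Suc k) bs) = (if j = k then (- 1) ^ k * \<omega> bs else 0)"
proof (cases "j = k")
  case True
  have "\<omega> ([] @ take k bs @ bs ! k # drop (Suc k) bs) = (- 1) ^ length (take k bs) * \<omega> ([] @ bs ! k # take k bs @ drop (Suc k) bs)"
    by (rule forms_move[OF \<omega> W])
  moreover have "take k bs @ bs ! k # drop (Suc k) bs = bs" by (rule id_take_nth_drop[OF k, symmetric])
  moreover have "length (take k bs) = k" using k by simp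
  ultimately have "\<omega> bs = (- 1) ^ k * \<omega> (bs ! k # take k bs @ drop (Suc k) bs)" by (simp only: append_Nil)
  then have "(- 1) ^ k * \<omega> bs = ((- 1) ^ k * (- 1) ^ k) * \<omega> (bs ! k # take k bs @ drop (Suc k) bs)"
    by (simp only: mult.assoc)
  then show ?thesis using True by (simp add: power_add[symmetric])
next
  case False
  have "bs ! j \<in> set (take k bs) \<union> set (drop (Suc k) bs)"
  proof (cases "j < k")
    case True
    then have e: "take k bs ! j = bs ! j" and "j < length (take k bs)" using k by auto
    from nth_mem[OF this(2)] show ?thesis unfolding e by blast
  next
    case F: False
    then have e: "drop (Suc k) bs ! (j - Suc k) = bs ! j" and "j - Suc k < length (drop (Suc k) bs)"
      using False j by auto
    from nth_mem[OF this(2)] show ?thesis unfolding e by blast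
  qed
  then have "\<not> distinct (bs ! j # take k bs @ drop (Suc k) bs)" by auto
  then have "\<omega> (bs ! j # take k bs @ drop (Suc k) bs) = 0" by (rule forms_not_distinct[OF \<omega>])
  then show ?thesis using False by simp
qed

section \<open>The coordinate formula of the modular vector field\<close>

section \<open>The modular vector field in a chart\<close>

context foliated_atlas
begin

lemma sharp_chart:
  fixes b :: "nat \<Rightarrow> 'e"
  assumes c: "c \<in> G" and x: "x \<in> cran c" and B: "is_bivector (B (cinv c x))" and db: "dual_basis n b d"
    and \<alpha>: "\<alpha> \<in> forms UNIV 1"
  shows "sharp (B (cinv c x)) (pull (to_chart A c (cinv c x)) \<alpha>) =
    of_chart A c (cinv c x) (\<Sum>j<n. (\<Sum>m<n. \<alpha> [b m] * bivec_rep A c B x (covec (d m)) (covec (d j))) *\<^sub>R b j)"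
proof -
  interpret dual_basis n b d by (rule db)
  let ?q = "cinv c x"
  have q: "?q \<in> cdom c" using chart(6)[OF c x] by blast
  have bv: "is_bivector (bivec_rep A c B x)" by (rule bivec_rep_bivector[where B=B, OF c x B])
  have lin: "linear (of_chart A c ?q)" by (rule of_chart_linear[OF c q])
  show ?thesis
  proof (rule sharp_eqI)
    fix \<beta> :: "'e form" assume \<beta>: "\<beta> \<in> forms UNIV 1"
    let ?\<beta> = "pull (of_chart A c ?q) \<beta>"
    have \<beta>': "?\<beta> \<in> forms UNIV 1" by (rule pull_forms[OF lin \<beta>])
    have "pull (to_chart A c ?q) ?\<beta> = \<beta>"
      unfolding pull_pull of_to_chart[OF c q] by (simp add: pull_def)
    then have "B ?q (pull (to_chart A c ?q) \<alpha>) \<beta> = bivec_rep A c B x \<alpha> ?\<beta>"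
      by (simp only: bivec_rep_def Let_def)
    also have "\<dots> = (\<Sum>j<n. ?\<beta> [b j] * bivec_rep A c B x \<alpha> (covec (d j)))"
      by (rule bivector_expand_right[OF bv \<alpha> \<beta>'])
    also have "\<dots> = (\<Sum>j<n. ?\<beta> [b j] * (\<Sum>m<n. \<alpha> [b m] * bivec_rep A c B x (covec (d m)) (covec (d j))))"
    proof (rule sum.cong[OF refl])
      fix j assume "j \<in> {..<n}"
      then have "bivec_rep A c B x \<alpha> (covec (d j)) = (\<Sum>m<n. \<alpha> [b m] * bivec_rep A c B x (covec (d m)) (covec (d j)))"
        by (intro bivector_expand_left[OF bv \<alpha>] d_forms) simp
      then show "?\<beta> [b j] * bivec_rep A c B x \<alpha> (covec (d j)) =
          ?\<beta> [b j] * (\<Sum>m<n. \<alpha> [b m] * bivec_rep A c B x (covec (d m)) (covec (d j)))" by (simp only:)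
    qed
    finally have "B ?q (pull (to_chart A c ?q) \<alpha>) \<beta> =
      (\<Sum>j<n. (\<Sum>m<n. \<alpha> [b m] * bivec_rep A c B x (covec (d m)) (covec (d j))) * ?\<beta> [b j])"
      by (simp only: mult.commute[of "?\<beta> _"])
    also have "\<dots> = ?\<beta> [\<Sum>j<n. (\<Sum>m<n. \<alpha> [b m] * bivec_rep A c B x (covec (d m)) (covec (d j))) *\<^sub>R b j]"
      by (rule covector_sum[OF \<beta>', symmetric])
    finally show "\<beta> [of_chart A c ?q (\<Sum>j<n. (\<Sum>m<n. \<alpha> [b m] * bivec_rep A c B x (covec (d m)) (covec (d j))) *\<^sub>R b j)] =
        B ?q (pull (to_chart A c ?q) \<alpha>) \<beta>"
      by (simp add: pull_def)
  qed
qed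

text \<open>The Hessian of the function \<open>f\<close> drops out because the bivector is alternating.\<close>
lemma divergence_hamiltonian_chart:
  fixes b :: "nat \<Rightarrow> 'e"
  assumes c: "c \<in> G" "p \<in> cdom c" and B: "bivector_field A B" and db: "dual_basis n b d"
    and \<Omega>: "\<And>q. q \<in> cdom c \<Longrightarrow> \<Omega> q \<in> forms UNIV n"
    and \<Omega>d: "\<And>us. (\<lambda>x. form_rep A c \<Omega> x us) differentiable (at (cmap c p))"
    and \<pi>: "\<And>i j x. \<pi> i j x = bivec_rep A c B x (covec (d i)) (covec (d j))"
    and \<rho>: "\<And>x. \<rho> x = form_rep A c \<Omega> x (map b [0..<n])" and \<rho>0: "\<rho> (cmap c p) \<noteq> 0"
    and f: "smooth_fun A f"
  shows "divergence A \<Omega> (\<lambda>q. sharp (B q) (differential A f q)) p =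
    (\<Sum>m<n. frechet_derivative (f \<circ> cinv c) (at (cmap c p)) (b m) *
      (\<Sum>j<n. frechet_derivative (\<pi> m j) (at (cmap c p)) (b j) +
        \<pi> m j (cmap c p) * (frechet_derivative \<rho> (at (cmap c p)) (b j) / \<rho> (cmap c p))))"
proof -
  interpret dual_basis n b d by (rule db)
  let ?x = "cmap c p"
  let ?D = "\<lambda>g. frechet_derivative g (at ?x)"
  define F where "F x v = frechet_derivative (f \<circ> cinv c) (at x) v" for x v
  define Y where "Y j x = (\<Sum>m<n. F x (b m) * \<pi> m j x)" for j x
  define X where "X q = sharp (B q) (differential A f q)" for q
  define \<eta> where "\<eta> q = interior_prod (X q) (\<Omega> q)" for q
  define r where "r = (\<Sum>i<n. ?D (Y i) (b i) + Y i ?x * (?D \<rho> (b i) / \<rho> ?x))"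
  let ?bs = "map b [0..<n]"
  \<comment> \<open>Ensures \<open>Suc (n - 1) = n\<close>, so that contraction lowers the degree by
    one and differentiation restores it.\<close>
  have n: "n > 0"
  proof (rule ccontr)
    assume "\<not> n > 0"
    then have "v = 0" for v :: 'e using expand[of v] by simp
    then show False using nonempty_Basis nonzero_Basis by blast
  qed
  have S: "open (cran c)" "?x \<in> cran c" using chart(2) c by auto
  have smF: "smooth_on (cran c) (f \<circ> cinv c)" by (rule smooth_fun_chart[OF f c(1)])
  have FD: "(f \<circ> cinv c) differentiable (at x)" if "x \<in> cran c" for x
    by (rule smooth_on_differentiable[OF smF that])
  have F_lin: "linear (F x)" if "x \<in> cran c" for x
    unfolding F_def[abs_def] using linear_frechet_derivative[OF FD[OF that]] by simp
  have Fd: "(\<lambda>x. F x v) differentiable (at ?x)" for v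
    unfolding F_def by (rule smooth_on_differentiable[OF smooth_on_frechet_derivative[OF smF] S(2)])
  have F_sym: "?D (\<lambda>x. F x u) v = ?D (\<lambda>x. F x v) u" for u v
    unfolding F_def by (rule second_derivative_symmetric[OF S smF])
  have \<pi>d: "\<pi> i j differentiable (at ?x)" if "i < n" "j < n" for i j
    using bivec_rep_differentiable[OF c B db d_forms[OF that(1)] d_forms[OF that(2)]]
    by (simp add: \<pi>[abs_def])
  have Yd: "Y j differentiable (at ?x)" if "j < n" for j
    unfolding Y_def[abs_def] by (intro differentiable_sum ballI differentiable_mult Fd \<pi>d that) auto
  have X_eq: "X (cinv c x) = of_chart A c (cinv c x) (\<Sum>j<n. Y j x *\<^sub>R b j)" if x: "x \<in> cran c" for x
  proof -
    have q: "cinv c x \<in> cdom c" "cmap c (cinv c x) = x" using chart(6)[OF c(1) x] by auto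
    have "differential A f (cinv c x) = pull (to_chart A c (cinv c x)) (covec (F x))"
      using differential_chart[OF c(1) q(1)] FD[OF x] by (simp add: q(2) F_def[abs_def])
    then show ?thesis
      unfolding X_def Y_def \<pi> using sharp_chart[where B=B, OF c(1) x _ db covec_forms[OF F_lin[OF x]]] B
      by (simp add: bivector_field_def)
  qed
  have rep: "form_rep A c \<eta> x us = (\<Sum>j<n. Y j x * form_rep A c \<Omega> x (b j # us))" if x: "x \<in> cran c" for x us
  proof -
    have q: "cinv c x \<in> cdom c" using chart(6)[OF c(1) x] by auto
    have "form_rep A c \<eta> x us = form_rep A c \<Omega> x ([] @ (\<Sum>j<n. Y j x *\<^sub>R b j) # us)"
      by (simp add: form_rep_apply \<eta>_def interior_prod_def X_eq[OF x])
    also have "\<dots> = (\<Sum>j<n. Y j x * form_rep A c \<Omega> x ([] @ b j # us))"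
      by (rule forms_sum[OF form_rep_forms[where \<omega> = \<Omega>, OF c(1) x \<Omega>[OF q]] subspace_UNIV]) auto
    finally show ?thesis by simp
  qed
  have \<eta>d: "(\<lambda>x. form_rep A c \<eta> x us) differentiable (at ?x)" for us
  proof (rule differentiable_transform_open[OF _ S])
    show "(\<lambda>x. \<Sum>j<n. Y j x * form_rep A c \<Omega> x (b j # us)) differentiable at ?x"
      by (intro differentiable_sum ballI differentiable_mult Yd \<Omega>d) auto
  qed (rule rep[symmetric])
  have \<eta>f: "\<eta> q \<in> forms UNIV (n - 1)" if "q \<in> cdom c" for q
    unfolding \<eta>_def by (rule interior_prod_forms[OF _ subspace_UNIV]) (use \<Omega>[OF that] n in simp)
  have cd_form: "coord_deriv (form_rep A c \<eta>) ?x \<in> forms UNIV n"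
  proof -
    have "coord_deriv (form_rep A c \<eta>) ?x \<in> forms UNIV (Suc (n - 1))"
    proof (rule coord_deriv_forms[OF S _ \<eta>d])
      fix x assume "x \<in> cran c"
      then show "form_rep A c \<eta> x \<in> forms UNIV (n - 1)"
        using chart(6)[OF c(1)] by (intro form_rep_forms[OF c(1)] \<eta>f) auto
    qed
    then show ?thesis using n by simp
  qed
  \<comment> \<open>On the coordinate frame this is the classical formula: the sum of the
    derivatives of \<open>Y i * \<rho>\<close> in direction \<open>b i\<close>.\<close>
  have cd_bs: "coord_deriv (form_rep A c \<eta>) ?x ?bs = r * \<rho> ?x"
  proof -
    have "coord_deriv (form_rep A c \<eta>) ?x ?bs = (\<Sum>i<n. ?D (Y i) (b i) * \<rho> ?x + Y i ?x * ?D \<rho> (b i))"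
      unfolding coord_deriv_def alt_sum_def
    proof (rule sum.cong)
      show "{..<length ?bs} = {..<n}" by simp
      fix i assume "i \<in> {..<n}"
      then have i: "i < n" by simp
      let ?o = "take i ?bs @ drop (Suc i) ?bs"
      have o: "form_rep A c \<eta> x ?o = (- 1) ^ i * (Y i x * \<rho> x)" if x: "x \<in> cran c" for x
      proof -
        have q: "cinv c x \<in> cdom c" using chart(6)[OF c(1) x] by auto
        have "form_rep A c \<eta> x ?o = (\<Sum>j<n. if j = i then Y j x * ((- 1) ^ i * \<rho> x) else 0)"
          unfolding rep[OF x]
        proof (rule sum.cong[OF refl])
          fix j assume "j \<in> {..<n}"
          then have j: "j < n" by simp
          have "form_rep A c \<Omega> x (?bs ! j # ?o) = (if j = i then (- 1) ^ i * form_rep A c \<Omega> x ?bs else 0)"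
            by (rule forms_omit[OF form_rep_forms[where \<omega> = \<Omega>, OF c(1) x \<Omega>[OF q]] subspace_UNIV]) (use i j in auto)
          then show "Y j x * form_rep A c \<Omega> x (b j # ?o) = (if j = i then Y j x * ((- 1) ^ i * \<rho> x) else 0)"
            using j by (simp add: \<rho>)
        qed
        then show ?thesis using i by simp
      qed
      have "((\<lambda>x. (- 1) ^ i * (Y i x * \<rho> x)) has_derivative
          (\<lambda>w. (- 1) ^ i * (Y i ?x * ?D \<rho> w + ?D (Y i) w * \<rho> ?x))) (at ?x)"
        by (intro has_derivative_mult_right has_derivative_mult differentiable_has_frechet_derivative Yd i)
          (unfold \<rho>[abs_def], rule \<Omega>d)
      then have "((\<lambda>x. form_rep A c \<eta> x ?o) has_derivative
          (\<lambda>w. (- 1) ^ i * (Y i ?x * ?D \<rho> w + ?D (Y i) w * \<rho> ?x))) (at ?x)"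
        by (rule has_derivative_transform_within_open[OF _ S]) (rule o[symmetric])
      from frechet_derivative_eqI[OF this]
      have "?D (\<lambda>x. form_rep A c \<eta> x ?o) (?bs ! i) = (- 1) ^ i * (Y i ?x * ?D \<rho> (b i) + ?D (Y i) (b i) * \<rho> ?x)"
        using i by simp
      then show "(- 1) ^ i * ?D (\<lambda>x. form_rep A c \<eta> x ?o) (?bs ! i) = ?D (Y i) (b i) * \<rho> ?x + Y i ?x * ?D \<rho> (b i)"
        by (simp add: mult.assoc[symmetric] power_add[symmetric] add.commute)
    qed
    also have "\<dots> = r * \<rho> ?x"
      unfolding r_def sum_distrib_right distrib_right using \<rho>0 by simp
    finally show ?thesis .
  qed
  have \<Omega>f: "form_rep A c \<Omega> ?x \<in> forms UNIV n"
    by (rule form_rep_forms[OF c(1) S(2)]) (use \<Omega> chart(5)[OF c] c in auto)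
  \<comment> \<open>Forms of degree \<open>n\<close> are proportional, so the value on one frame
    determines the divergence.\<close>
  have cd: "coord_deriv (form_rep A c \<eta>) ?x us = r * form_rep A c \<Omega> ?x us" for us
  proof -
    have "form_rep A c \<Omega> ?x ?bs * coord_deriv (form_rep A c \<eta>) ?x us =
        coord_deriv (form_rep A c \<eta>) ?x ?bs * form_rep A c \<Omega> ?x us"
    proof (rule forms_proportional[OF \<Omega>f cd_form subspace_UNIV])
      show "UNIV \<subseteq> span (set ?bs)" using span_b by (simp add: lessThan_atLeast0)
    qed auto
    then have "\<rho> ?x * coord_deriv (form_rep A c \<eta>) ?x us = \<rho> ?x * (r * form_rep A c \<Omega> ?x us)"
      unfolding cd_bs \<rho>[symmetric] by simp
    then show ?thesis using \<rho>0 by simp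
  qed
  have \<Omega>p: "form_rep A c \<Omega> ?x us = \<Omega> p (map (of_chart A c p) us)" for us
    using chart(5)[OF c] by (simp add: form_rep_apply)
  have ST: "map (of_chart A c p) (map (to_chart A c p) us) = us" for us
    by (simp add: of_to_chart[OF c] comp_def)
  have ext: "ext_deriv A \<eta> p = (\<lambda>us. r * \<Omega> p us)"
  proof -
    have "ext_deriv A \<eta> p = pull (to_chart A c p) (coord_deriv (form_rep A c \<eta>) ?x)"
      by (rule ext_deriv_chart[where \<omega> = \<eta>, OF c \<eta>f \<eta>d])
    then show ?thesis by (simp add: pull_def cd \<Omega>p ST del: map_map)
  qed
  have div: "divergence A \<Omega> X p = r"
    unfolding divergence_def \<eta>_def[symmetric, abs_def] ext
  proof (rule the_equality)
    show "(\<lambda>us. r * \<Omega> p us) = (\<lambda>us. r * \<Omega> p us)" ..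
  next
    fix r' assume "(\<lambda>us. r * \<Omega> p us) = (\<lambda>us. r' * \<Omega> p us)"
    from fun_cong[OF this, of "map (of_chart A c p) ?bs"] have "r * \<rho> ?x = r' * \<rho> ?x"
      by (simp only: \<rho> \<Omega>p)
    then show "r' = r" using \<rho>0 by simp
  qed
  have DY: "?D (Y i) w = (\<Sum>m<n. F ?x (b m) * ?D (\<pi> m i) w + ?D (\<lambda>x. F x (b m)) w * \<pi> m i ?x)" if "i < n" for i w
  proof -
    have "(Y i has_derivative (\<lambda>w. \<Sum>m<n. F ?x (b m) * ?D (\<pi> m i) w + ?D (\<lambda>x. F x (b m)) w * \<pi> m i ?x)) (at ?x)"
      unfolding Y_def[abs_def]
      by (intro has_derivative_sum has_derivative_mult differentiable_has_frechet_derivative Fd \<pi>d that) auto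
    from frechet_derivative_eqI[OF this] show ?thesis by simp
  qed
  have bvx: "is_bivector (bivec_rep A c B ?x)"
    by (rule bivec_rep_bivector[OF c(1) S(2)]) (use B in \<open>simp add: bivector_field_def\<close>)
  have hess: "(\<Sum>i<n. \<Sum>m<n. ?D (\<lambda>x. F x (b m)) (b i) * \<pi> m i ?x) = 0"
  proof -
    have "(\<Sum>i<n. \<Sum>m<n. ?D (\<lambda>x. F x (b m)) (b i) * \<pi> m i ?x) = (\<Sum>i<n. \<Sum>m<n. - (?D (\<lambda>x. F x (b i)) (b m) * \<pi> i m ?x))"
    proof (intro sum.cong refl)
      fix i m assume "i \<in> {..<n}" "m \<in> {..<n}"
      then have "\<pi> m i ?x = - \<pi> i m ?x" unfolding \<pi> by (intro bivector_antisym[OF bvx] d_forms) auto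
      then show "?D (\<lambda>x. F x (b m)) (b i) * \<pi> m i ?x = - (?D (\<lambda>x. F x (b i)) (b m) * \<pi> i m ?x)"
        using F_sym[of "b m" "b i"] by simp
    qed
    also have "\<dots> = - (\<Sum>i<n. \<Sum>m<n. ?D (\<lambda>x. F x (b m)) (b i) * \<pi> m i ?x)"
      by (subst sum.swap) (simp only: sum_negf)
    finally show ?thesis by simp
  qed
  have "r = (\<Sum>i<n. (\<Sum>m<n. F ?x (b m) * ?D (\<pi> m i) (b i)) + (\<Sum>m<n. ?D (\<lambda>x. F x (b m)) (b i) * \<pi> m i ?x)
      + (\<Sum>m<n. F ?x (b m) * \<pi> m i ?x * (?D \<rho> (b i) / \<rho> ?x)))"
    unfolding r_def by (intro sum.cong refl) (simp add: DY Y_def sum.distrib sum_distrib_right sum_divide_distrib)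
  also have "\<dots> = (\<Sum>i<n. \<Sum>m<n. F ?x (b m) * (?D (\<pi> m i) (b i) + \<pi> m i ?x * (?D \<rho> (b i) / \<rho> ?x)))"
    unfolding sum.distrib hess distrib_left by (simp add: mult.assoc)
  also have "\<dots> = (\<Sum>m<n. \<Sum>i<n. F ?x (b m) * (?D (\<pi> m i) (b i) + \<pi> m i ?x * (?D \<rho> (b i) / \<rho> ?x)))"
    by (rule sum.swap)
  finally have "r = (\<Sum>m<n. F ?x (b m) * (\<Sum>i<n. ?D (\<pi> m i) (b i) + \<pi> m i ?x * (?D \<rho> (b i) / \<rho> ?x)))"
    by (simp only: sum_distrib_left)
  then show ?thesis using div unfolding X_def F_def by simp
qed

text \<open>The divergence of a Hamiltonian field is linear in the differential of the function at
  \<open>p\<close>, which gives existence. For uniqueness the test functions are the cut off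
  coordinates \<open>d k\<close>; they read off each component of a competing vector.\<close>

lemma modular_field_chart:
  fixes b :: "nat \<Rightarrow> 'e"
  assumes c: "c \<in> G" "p \<in> cdom c" and B: "bivector_field A B" and db: "dual_basis n b d"
    and \<Omega>: "\<And>q. q \<in> cdom c \<Longrightarrow> \<Omega> q \<in> forms UNIV n"
    and \<Omega>d: "\<And>us. (\<lambda>x. form_rep A c \<Omega> x us) differentiable (at (cmap c p))"
    and \<pi>: "\<And>i j x. \<pi> i j x = bivec_rep A c B x (covec (d i)) (covec (d j))"
    and \<rho>: "\<And>x. \<rho> x = form_rep A c \<Omega> x (map b [0..<n])" and \<rho>0: "\<rho> (cmap c p) \<noteq> 0"
  shows "modular_field A B \<Omega> p = of_chart A c p (\<Sum>m<n.
      (\<Sum>j<n. frechet_derivative (\<pi> m j) (at (cmap c p)) (b j) +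
        \<pi> m j (cmap c p) * (frechet_derivative \<rho> (at (cmap c p)) (b j) / \<rho> (cmap c p))) *\<^sub>R b m)"
proof -
  interpret dual_basis n b d by (rule db)
  let ?x = "cmap c p"
  define z where "z m = (\<Sum>j<n. frechet_derivative (\<pi> m j) (at ?x) (b j) +
        \<pi> m j ?x * (frechet_derivative \<rho> (at ?x) (b j) / \<rho> ?x))" for m
  have x: "?x \<in> cran c" using c by blast
  have df: "differential A f p [v] = frechet_derivative (f \<circ> cinv c) (at ?x) (to_chart A c p v)"
    if "smooth_fun A f" for f v
    using differential_chart[OF c smooth_on_differentiable[OF smooth_fun_chart[OF that c(1)] x]]
    by (simp add: pull_def)
  have dv: "divergence A \<Omega> (\<lambda>q. sharp (B q) (differential A f q)) p =
      (\<Sum>m<n. frechet_derivative (f \<circ> cinv c) (at ?x) (b m) * z m)" if "smooth_fun A f" for f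
    unfolding z_def by (rule divergence_hamiltonian_chart[OF c B db \<Omega> \<Omega>d \<pi> \<rho> \<rho>0 that])
  have "modular_field A B \<Omega> p = of_chart A c p (\<Sum>m<n. z m *\<^sub>R b m)"
    unfolding modular_field_def
  proof (rule the_equality)
    show "\<forall>f. smooth_fun A f \<longrightarrow> differential A f p [of_chart A c p (\<Sum>m<n. z m *\<^sub>R b m)] =
        divergence A \<Omega> (\<lambda>q. sharp (B q) (differential A f q)) p"
    proof (intro allI impI)
      fix f assume f: "smooth_fun A f"
      have "linear (frechet_derivative (f \<circ> cinv c) (at ?x))"
        by (rule linear_frechet_derivative[OF smooth_on_differentiable[OF smooth_fun_chart[OF f c(1)] x]])
      then show "differential A f p [of_chart A c p (\<Sum>m<n. z m *\<^sub>R b m)] =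
        divergence A \<Omega> (\<lambda>q. sharp (B q) (differential A f q)) p"
        unfolding df[OF f] dv[OF f] to_of_chart[OF c] by (simp add: linear_sum linear_cmul mult.commute)
    qed
    fix v assume v: "\<forall>f. smooth_fun A f \<longrightarrow> differential A f p [v] =
        divergence A \<Omega> (\<lambda>q. sharp (B q) (differential A f q)) p"
    have "d k (to_chart A c p v) = z k" if k: "k < n" for k
    proof -
      have bl: "bounded_linear (d k)" using d_linear[OF k] linear_conv_bounded_linear by blast
      obtain f N where f: "smooth_fun A f" "open N" "?x \<in> N" "\<And>x. x \<in> N \<Longrightarrow> f (cinv c x) = d k x"
        using smooth_fun_extension[OF c smooth_on_bounded_linear[OF bl]] by metis
      have "((f \<circ> cinv c) has_derivative d k) (at ?x)"
        by (rule has_derivative_transform_within_open[OF bounded_linear_imp_has_derivative[OF bl] f(2,3)])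
          (simp add: f(4))
      from frechet_derivative_eqI[OF this] have D: "frechet_derivative (f \<circ> cinv c) (at ?x) = d k" .
      have "d k (to_chart A c p v) = (\<Sum>m<n. d k (b m) * z m)"
        using v f(1) df[OF f(1), of v] dv[OF f(1)] unfolding D by simp
      also have "\<dots> = (\<Sum>m<n. if m = k then z m else 0)" using k by (intro sum.cong) (auto simp: d_b)
      finally show ?thesis using k by simp
    qed
    then have "to_chart A c p v = (\<Sum>m<n. z m *\<^sub>R b m)" by (intro d_eqI) (simp add: d_sum_b)
    then show "v = of_chart A c p (\<Sum>m<n. z m *\<^sub>R b m)" using of_to_chart[OF c, of v] by simp
  qed
  then show ?thesis by (simp only: z_def)
qed

end


section \<open>Well-definedness of the contraction with a bivector\<close>

section \<open>Contraction with a vertical bivector\<close>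

text \<open>For existence the bivector is decomposed with \<open>b i\<close> and half of the
  combination given by row \<open>p i\<close>. For uniqueness, any decomposition yields a matrix
  \<open>?q\<close> with \<open>p a c = ?q a c - ?q c a\<close>, and the antisymmetry of \<omega> in
  its first two arguments makes the contraction by \<open>?q\<close> half of that by
  \<open>p\<close>.\<close>

lemma (in dual_basis) contract_eq:
  assumes h: "h \<le> n" and W_iff: "\<And>v. v \<in> W \<longleftrightarrow> (\<forall>i<h. d i v = 0)"
    and \<omega>: "\<omega> \<in> forms W r"
    and anti: "\<And>a c. h \<le> a \<Longrightarrow> a < n \<Longrightarrow> h \<le> c \<Longrightarrow> c < n \<Longrightarrow> p a c = - p c a"
    and B: "\<And>\<alpha> \<beta>. \<alpha> \<in> forms UNIV 1 \<Longrightarrow> \<beta> \<in> forms UNIV 1 \<Longrightarrow>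
      B \<alpha> \<beta> = (\<Sum>a\<in>{h..<n}. \<Sum>c\<in>{h..<n}. p a c * (\<alpha> [b a] * \<beta> [b c]))"
  shows "contract W B \<omega> = (\<lambda>us. (\<Sum>a\<in>{h..<n}. \<Sum>c\<in>{h..<n}. p a c * \<omega> (b c # b a # us)) / 2)"
proof -
  let ?I = "{h..<n}"
  let ?\<eta> = "\<lambda>us. (\<Sum>a\<in>?I. \<Sum>c\<in>?I. p a c * \<omega> (b c # b a # us)) / 2"
  have W: "subspace W"
    using d_linear h by (auto simp: subspace_def W_iff linear_0 linear_add linear_cmul)
  have bW: "b a \<in> W" if "a \<in> ?I" for a using that h by (auto simp: W_iff d_b)
  have ex: "w = (\<Sum>a\<in>?I. d a w *\<^sub>R b a)" if "w \<in> W" for w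
  proof -
    have "w = (\<Sum>i<n. d i w *\<^sub>R b i)" by (rule expand[symmetric])
    also have "\<dots> = (\<Sum>a\<in>?I. d a w *\<^sub>R b a)" by (rule sum.mono_neutral_right) (use that W_iff in auto)
    finally show ?thesis .
  qed
  have om: "\<omega> (y # x # us) = (\<Sum>a\<in>?I. \<Sum>c\<in>?I. d a x * d c y * \<omega> (b c # b a # us))" if "x \<in> W" "y \<in> W" for x y us
  proof -
    have "\<omega> ([] @ y # x # us) = \<omega> ([] @ (\<Sum>c\<in>?I. d c y *\<^sub>R b c) # x # us)" using ex[OF that(2)] by simp
    also have "\<dots> = (\<Sum>c\<in>?I. d c y * \<omega> ([] @ b c # x # us))" by (rule forms_sum[OF \<omega> W bW])
    also have "\<dots> = (\<Sum>c\<in>?I. \<Sum>a\<in>?I. d a x * d c y * \<omega> (b c # b a # us))"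
    proof (rule sum.cong[OF refl])
      fix c
      have "\<omega> ([b c] @ x # us) = \<omega> ([b c] @ (\<Sum>a\<in>?I. d a x *\<^sub>R b a) # us)" using ex[OF that(1)] by simp
      also have "\<dots> = (\<Sum>a\<in>?I. d a x * \<omega> ([b c] @ b a # us))" by (rule forms_sum[OF \<omega> W bW])
      finally have "\<omega> (b c # x # us) = (\<Sum>a\<in>?I. d a x * \<omega> (b c # b a # us))" by simp
      then show "d c y * \<omega> ([] @ b c # x # us) = (\<Sum>a\<in>?I. d a x * d c y * \<omega> (b c # b a # us))"
        by (simp add: sum_distrib_left mult.left_commute mult.assoc)
    qed
    also have "\<dots> = (\<Sum>a\<in>?I. \<Sum>c\<in>?I. d a x * d c y * \<omega> (b c # b a # us))" by (rule sum.swap)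
    finally show ?thesis by simp
  qed
  show ?thesis
    unfolding contract_def
  proof (rule the_equality)
    \<comment> \<open>The index runs over all of \<open>{..<n}\<close>; the horizontal indices get a
      pair of zero vectors, which lies in \<open>W\<close> and contributes nothing.\<close>
    let ?X = "\<lambda>i. if h \<le> i then b i else 0" and ?Y = "\<lambda>i. if h \<le> i then (\<Sum>c\<in>?I. (p i c / 2) *\<^sub>R b c) else 0"
    have YW: "(\<Sum>c\<in>?I. (p i c / 2) *\<^sub>R b c) \<in> W" for i using bW W by (intro subspace_sum subspace_scale) auto
    have restr: "(\<Sum>i<n. if h \<le> i then f i else 0) = (\<Sum>i\<in>?I. f i)" for f :: "nat \<Rightarrow> real"
      by (rule sum.mono_neutral_cong_right) auto
    have 1: "\<forall>i<n. ?X i \<in> W \<and> ?Y i \<in> W" using bW YW subspace_0[OF W] by simp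
    have 2: "B \<alpha> \<beta> = (\<Sum>i<n. \<alpha> [?X i] * \<beta> [?Y i] - \<alpha> [?Y i] * \<beta> [?X i])"
      if ab: "\<alpha> \<in> forms UNIV 1" "\<beta> \<in> forms UNIV 1" for \<alpha> \<beta>
    proof -
      have z: "\<alpha> [0] = 0" "\<beta> [0] = 0"
        using forms_zero_arg[OF ab(1) subspace_UNIV, of "[]" "[]"] forms_zero_arg[OF ab(2) subspace_UNIV, of "[]" "[]"] by auto
      have "(\<Sum>i<n. \<alpha> [?X i] * \<beta> [?Y i] - \<alpha> [?Y i] * \<beta> [?X i]) =
          (\<Sum>i<n. if h \<le> i then (\<Sum>c\<in>?I. p i c / 2 * (\<alpha> [b i] * \<beta> [b c]) - p i c / 2 * (\<alpha> [b c] * \<beta> [b i])) else 0)"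
      proof (rule sum.cong[OF refl])
        fix i
        show "\<alpha> [?X i] * \<beta> [?Y i] - \<alpha> [?Y i] * \<beta> [?X i] =
            (if h \<le> i then (\<Sum>c\<in>?I. p i c / 2 * (\<alpha> [b i] * \<beta> [b c]) - p i c / 2 * (\<alpha> [b c] * \<beta> [b i])) else 0)"
        proof (cases "h \<le> i")
          case True
          have "\<alpha> [\<Sum>c\<in>?I. (p i c / 2) *\<^sub>R b c] = (\<Sum>c\<in>?I. p i c / 2 * \<alpha> [b c])"
            "\<beta> [\<Sum>c\<in>?I. (p i c / 2) *\<^sub>R b c] = (\<Sum>c\<in>?I. p i c / 2 * \<beta> [b c])"
            by (rule covector_sum[OF ab(1)], rule covector_sum[OF ab(2)])
          then show ?thesis using True
            by (simp only: if_True sum_subtractf sum_distrib_left sum_distrib_right) (simp add: mult.commute mult.left_commute)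
        qed (simp add: z)
      qed
      also have "\<dots> = (\<Sum>a\<in>?I. \<Sum>c\<in>?I. p a c / 2 * (\<alpha> [b a] * \<beta> [b c])) - (\<Sum>a\<in>?I. \<Sum>c\<in>?I. p a c / 2 * (\<alpha> [b c] * \<beta> [b a]))"
        unfolding restr by (simp only: sum_subtractf)
      also have "(\<Sum>a\<in>?I. \<Sum>c\<in>?I. p a c / 2 * (\<alpha> [b c] * \<beta> [b a])) = (\<Sum>c\<in>?I. \<Sum>a\<in>?I. - (p c a / 2 * (\<alpha> [b c] * \<beta> [b a])))"
      proof (subst sum.swap, intro sum.cong refl)
        fix c a assume "c \<in> ?I" "a \<in> ?I"
        then have "p a c = - p c a" by (intro anti) auto
        then show "p a c / 2 * (\<alpha> [b c] * \<beta> [b a]) = - (p c a / 2 * (\<alpha> [b c] * \<beta> [b a]))" by simp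
      qed
      also have "\<dots> = - (\<Sum>a\<in>?I. \<Sum>c\<in>?I. p a c / 2 * (\<alpha> [b a] * \<beta> [b c]))" by (simp only: sum_negf)
      finally have "(\<Sum>i<n. \<alpha> [?X i] * \<beta> [?Y i] - \<alpha> [?Y i] * \<beta> [?X i]) =
          2 * (\<Sum>a\<in>?I. \<Sum>c\<in>?I. p a c / 2 * (\<alpha> [b a] * \<beta> [b c]))" by simp
      also have "\<dots> = (\<Sum>a\<in>?I. \<Sum>c\<in>?I. p a c * (\<alpha> [b a] * \<beta> [b c]))" by (simp add: sum_distrib_left)
      finally show ?thesis using B[OF ab] by simp
    qed
    have 3: "?\<eta> = (\<lambda>us. \<Sum>i<n. interior_prod (?X i) (interior_prod (?Y i) \<omega>) us)"
    proof
      fix us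
      have "(\<Sum>i<n. interior_prod (?X i) (interior_prod (?Y i) \<omega>) us) =
          (\<Sum>i<n. if h \<le> i then (\<Sum>c\<in>?I. p i c / 2 * \<omega> (b c # b i # us)) else 0)"
      proof (rule sum.cong[OF refl])
        fix i
        show "interior_prod (?X i) (interior_prod (?Y i) \<omega>) us = (if h \<le> i then (\<Sum>c\<in>?I. p i c / 2 * \<omega> (b c # b i # us)) else 0)"
          using forms_sum[OF \<omega> W bW, of ?I "\<lambda>c. c" "[]" "\<lambda>c. p i c / 2" "b i # us"] forms_zero_arg[OF \<omega> W, of "[]"]
          by (simp add: interior_prod_def)
      qed
      also have "\<dots> = ?\<eta> us" unfolding restr by (simp only: sum_divide_distrib times_divide_eq_left)
      finally show "?\<eta> us = (\<Sum>i<n. interior_prod (?X i) (interior_prod (?Y i) \<omega>) us)" by simp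
    qed
    show "\<exists>(n::nat) X Y. (\<forall>i<n. X i \<in> W \<and> Y i \<in> W) \<and>
       (\<forall>\<alpha>\<in>forms UNIV 1. \<forall>\<beta>\<in>forms UNIV 1. B \<alpha> \<beta> = (\<Sum>i<n. \<alpha> [X i] * \<beta> [Y i] - \<alpha> [Y i] * \<beta> [X i])) \<and>
       ?\<eta> = (\<lambda>us. \<Sum>i<n. interior_prod (X i) (interior_prod (Y i) \<omega>) us)"
      by (rule exI[of _ n], rule exI[of _ ?X], rule exI[of _ ?Y]) (intro conjI ballI 1 2 3)
  next
    fix \<eta> assume "\<exists>(n::nat) X Y. (\<forall>i<n. X i \<in> W \<and> Y i \<in> W) \<and>
       (\<forall>\<alpha>\<in>forms UNIV 1. \<forall>\<beta>\<in>forms UNIV 1. B \<alpha> \<beta> = (\<Sum>i<n. \<alpha> [X i] * \<beta> [Y i] - \<alpha> [Y i] * \<beta> [X i])) \<and>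
       \<eta> = (\<lambda>us. \<Sum>i<n. interior_prod (X i) (interior_prod (Y i) \<omega>) us)"
    then obtain N :: nat and X Y where XY: "\<forall>i<N. X i \<in> W \<and> Y i \<in> W"
      "\<forall>\<alpha>\<in>forms UNIV 1. \<forall>\<beta>\<in>forms UNIV 1. B \<alpha> \<beta> = (\<Sum>i<N. \<alpha> [X i] * \<beta> [Y i] - \<alpha> [Y i] * \<beta> [X i])"
      "\<eta> = (\<lambda>us. \<Sum>i<N. interior_prod (X i) (interior_prod (Y i) \<omega>) us)" by (elim exE conjE)
    have pB: "p a c = (\<Sum>i<N. d a (X i) * d c (Y i) - d a (Y i) * d c (X i))" if a: "a \<in> ?I" and c: "c \<in> ?I" for a c
    proof -
      have "B (covec (d a)) (covec (d c)) = (\<Sum>i\<in>?I. \<Sum>j\<in>?I. if i = a then if j = c then p i j else 0 else 0)"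
        using a c unfolding B[OF d_forms d_forms, of a c, OF atLeastLessThan_iff[THEN iffD1, OF a, THEN conjunct2]
            atLeastLessThan_iff[THEN iffD1, OF c, THEN conjunct2]]
        by (intro sum.cong refl) (auto simp: d_b)
      also have "\<dots> = p a c"
      proof -
        have "(\<Sum>j\<in>?I. if i = a then if j = c then p i j else 0 else 0) = (if i = a then p i c else 0)" for i
          using c by auto
        then show ?thesis using a by simp
      qed
      finally have "p a c = B (covec (d a)) (covec (d c))" ..
      also have "\<dots> = (\<Sum>i<N. covec (d a) [X i] * covec (d c) [Y i] - covec (d a) [Y i] * covec (d c) [X i])"
        using XY(2) d_forms a c by simp
      finally show ?thesis by simp
    qed
    show "\<eta> = ?\<eta>"
    proof
      fix us
      let ?w = "\<lambda>a c. \<omega> (b c # b a # us)"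
      let ?q = "\<lambda>a c. \<Sum>i<N. d a (X i) * d c (Y i)"
      have w: "?w a c = - ?w c a" for a c using forms_swap[OF \<omega> W, of "[]" "b c" "b a" us] by simp
      have "\<eta> us = (\<Sum>i<N. \<Sum>a\<in>?I. \<Sum>c\<in>?I. d a (X i) * d c (Y i) * ?w a c)"
        unfolding XY(3) interior_prod_def by (intro sum.cong refl om) (use XY(1) in auto)
      also have "\<dots> = (\<Sum>a\<in>?I. \<Sum>i<N. \<Sum>c\<in>?I. d a (X i) * d c (Y i) * ?w a c)" by (rule sum.swap)
      also have "\<dots> = (\<Sum>a\<in>?I. \<Sum>c\<in>?I. \<Sum>i<N. d a (X i) * d c (Y i) * ?w a c)"
        by (rule sum.cong[OF refl], rule sum.swap)
      also have "\<dots> = (\<Sum>a\<in>?I. \<Sum>c\<in>?I. ?q a c * ?w a c)" by (simp only: sum_distrib_right)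
      finally have e1: "\<eta> us = (\<Sum>a\<in>?I. \<Sum>c\<in>?I. ?q a c * ?w a c)" .
      have "(\<Sum>a\<in>?I. \<Sum>c\<in>?I. ?q a c * ?w a c) = (\<Sum>c\<in>?I. \<Sum>a\<in>?I. - (?q a c * ?w c a))"
        by (subst sum.swap, intro sum.cong refl) (subst w, simp)
      also have "\<dots> = - (\<Sum>a\<in>?I. \<Sum>c\<in>?I. ?q c a * ?w a c)" by (simp only: sum_negf)
      finally have e2: "\<eta> us = - (\<Sum>a\<in>?I. \<Sum>c\<in>?I. ?q c a * ?w a c)" using e1 by simp
      have "(\<Sum>a\<in>?I. \<Sum>c\<in>?I. p a c * ?w a c) = (\<Sum>a\<in>?I. \<Sum>c\<in>?I. ?q a c * ?w a c - ?q c a * ?w a c)"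
      proof (intro sum.cong refl)
        fix a c assume "a \<in> ?I" "c \<in> ?I"
        then have "p a c = ?q a c - ?q c a" using pB by (simp add: sum_subtractf mult.commute)
        then show "p a c * ?w a c = ?q a c * ?w a c - ?q c a * ?w a c" by (simp only: left_diff_distrib)
      qed
      also have "\<dots> = 2 * \<eta> us" using e1 e2 by (simp only: sum_subtractf)
      finally show "\<eta> us = ?\<eta> us" by simp
    qed
  qed
qed


section \<open>Global data and their representatives in an adapted chart\<close>

section \<open>Coupling Poisson structures on foliated manifolds\<close>

locale coupled_foliation = foliated_atlas A F K
  for A F :: "('a::{t2_space, second_countable_topology}, 'e::euclidean_space) chart set" and K +
  fixes \<Psi> :: "'a \<Rightarrow> 'e bivec" and \<tau> :: "'a \<Rightarrow> 'e form" and V H :: "'a \<Rightarrow> 'e set" and l :: nat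
  assumes V: "V = leaf_tangent A F K" and poisson: "poisson A \<Psi>" and coupling: "coupling V \<Psi>"
    and H: "H = coupling_normal V \<Psi>" and vol: "leafwise_volume A F K \<tau>" and dim_H: "dim (H p) = 2 * l"
begin

definition \<gamma> :: "'a \<Rightarrow> 'e \<Rightarrow> 'e" where "\<gamma> = connection_form H V"
definition \<sigma> :: "'a \<Rightarrow> 'e form" where "\<sigma> = coupling_form V \<Psi>"
definition \<tau>\<gamma> :: "'a \<Rightarrow> 'e form" where "\<tau>\<gamma> = vertical_ext H V \<tau>"
definition \<Omega> :: "'a \<Rightarrow> 'e form" where "\<Omega> = (\<lambda>p. wedge (wedge_power (\<sigma> p) l) (\<tau>\<gamma> p))"

lemma bivector: "is_bivector (\<Psi> q)" "bivector_field A \<Psi>"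
  using poisson by (auto simp: poisson_def bivector_field_def)

lemma H_V_inter: "sharp (\<Psi> q) ` ann_forms (V q) 1 \<inter> V q = {0}"
  using coupling unfolding coupling_def coupling_normal_def by blast

lemma H_V_plus: "\<exists>u\<in>sharp (\<Psi> q) ` ann_forms (V q) 1. \<exists>w\<in>V q. v = u + w"
proof -
  have "{h + v | h v. h \<in> coupling_normal V \<Psi> q \<and> v \<in> V q} = UNIV"
    using coupling unfolding coupling_def by blast
  then have "v \<in> {h + v | h v. h \<in> coupling_normal V \<Psi> q \<and> v \<in> V q}" by simp
  then show ?thesis unfolding coupling_normal_def by blast
qed

end

text \<open>The basis is constant in the chart. Its last vectors span \<open>K\<close>, hence the
  leaf directions at every point of the foliation chart, while the first ones are horizontal at
  \<open>p\<close> alone, which is all that a nonintegrable distribution permits.\<close>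

locale adapted_chart = coupled_foliation A F K \<Psi> \<tau> V H l + dual_basis n b d
  for A F :: "('a::{t2_space, second_countable_topology}, 'e::euclidean_space) chart set" and K \<Psi> \<tau> V H l
    and n b d +
  fixes c :: "('a, 'e) chart" and p :: 'a
  assumes c: "c \<in> F" and p: "p \<in> cdom c"
    and h_le: "2 * l \<le> n" and dim_K: "n - 2 * l = dim K"
    and b_H: "i < 2 * l \<Longrightarrow> b i \<in> to_chart A c p ` H p"
    and K_iff: "v \<in> K \<longleftrightarrow> (\<forall>i<2 * l. d i v = 0)"
begin

abbreviation h :: nat where "h \<equiv> 2 * l"
abbreviation T :: "'a \<Rightarrow> 'e \<Rightarrow> 'e" where "T \<equiv> to_chart A c"
abbreviation S :: "'a \<Rightarrow> 'e \<Rightarrow> 'e" where "S \<equiv> of_chart A c"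
abbreviation x0 :: 'e where "x0 \<equiv> cmap c p"

lemma cG: "c \<in> G"
  using c by (simp add: G_def)

lemmas T_linear = to_chart_linear[OF cG]
lemmas S_linear = of_chart_linear[OF cG]
lemmas T_S = to_of_chart[OF cG]
lemmas S_T = of_to_chart[OF cG]

lemma x0_in: "x0 \<in> cran c" "cinv c x0 = p"
  using p chart(5)[OF cG p] by auto

lemma cinv_in: "x \<in> cran c \<Longrightarrow> cinv c x \<in> cdom c"
  using chart(6)[OF cG] by blast

lemma V_iff: "q \<in> cdom c \<Longrightarrow> v \<in> V q \<longleftrightarrow> T q v \<in> K"
  unfolding V by (rule leaf_tangent_iff[OF c])

lemma S_in_V: "q \<in> cdom c \<Longrightarrow> S q v \<in> V q \<longleftrightarrow> v \<in> K"
  using V_iff T_S by simp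

lemma b_in_K: "h \<le> a \<Longrightarrow> a < n \<Longrightarrow> b a \<in> K"
  using h_le by (auto simp: K_iff d_b)

text \<open>The tangent space at \<open>q\<close> is modelled by \<open>chart_at A q\<close>, which
  may jump as \<open>q\<close> varies. The pointwise linear algebra is done in that model, with the
  basis carried over by \<open>S q\<close>, and its results are brought back to the fixed chart
  \<open>c\<close>.\<close>

lemma transported_basis:
  assumes q: "q \<in> cdom c"
  shows "dual_basis n (\<lambda>i. S q (b i)) (\<lambda>i v. d i (T q v))"
proof (rule dual_basis.intro)
  show "linear (\<lambda>v. d i (T q v))" if "i < n" for i
    using linear_compose[OF T_linear[OF q] d_linear[OF that]] by (simp add: o_def)
  show "d i (T q (S q (b j))) = (if i = j then 1 else 0)" if "i < n" "j < n" for i j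
    using d_b[OF that] T_S[OF q] by simp
  show "(\<Sum>i<n. d i (T q v) *\<^sub>R S q (b i)) = v" for v
  proof -
    have "(\<Sum>i<n. d i (T q v) *\<^sub>R S q (b i)) = S q (\<Sum>i<n. d i (T q v) *\<^sub>R b i)"
      using S_linear[OF q] by (simp add: linear_sum linear_cmul)
    then show ?thesis using S_T[OF q] by (simp add: expand)
  qed
qed

lemma point:
  assumes q: "q \<in> cdom c"
  shows "coupling_point_of n (\<lambda>i. S q (b i)) (\<lambda>i v. d i (T q v)) h (V q) \<Psi> q V H"
proof -
  interpret db: dual_basis n "\<lambda>i. S q (b i)" "\<lambda>i v. d i (T q v)" by (rule transported_basis[OF q])
  show ?thesis
  proof unfold_locales
    show "h \<le> n" by (rule h_le)
    show "v \<in> V q \<longleftrightarrow> (\<forall>i<h. d i (T q v) = 0)" for v using V_iff[OF q] K_iff by simp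
    show "is_bivector (\<Psi> q)" by (rule bivector)
    show "sharp (\<Psi> q) ` ann_forms (V q) 1 \<inter> V q = {0}" by (rule H_V_inter)
    show "\<exists>u\<in>sharp (\<Psi> q) ` ann_forms (V q) 1. \<exists>w\<in>V q. v = u + w" for v by (rule H_V_plus)
    show "H = coupling_normal V \<Psi>" by (rule H)
  qed simp
qed

definition \<pi> :: "nat \<Rightarrow> nat \<Rightarrow> 'e \<Rightarrow> real" where
  "\<pi> i j x = bivec_rep A c \<Psi> x (covec (d i)) (covec (d j))"

lemma \<pi>_eq: "x \<in> cran c \<Longrightarrow> \<pi> i j x = \<Psi> (cinv c x) (covec (\<lambda>v. d i (T (cinv c x) v))) (covec (\<lambda>v. d j (T (cinv c x) v)))"
  by (simp add: \<pi>_def bivec_rep_def Let_def pull_covec)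

definition Xc :: "nat \<Rightarrow> 'e \<Rightarrow> 'e" where "Xc i x = (\<Sum>m<n. \<pi> i m x *\<^sub>R b m)"

lemma point_X:
  assumes x: "x \<in> cran c" and i: "i < n"
  shows "sharp (\<Psi> (cinv c x)) (covec (\<lambda>v. d i (T (cinv c x) v))) = S (cinv c x) (Xc i x)"
proof -
  let ?q = "cinv c x"
  note q = cinv_in[OF x]
  interpret pt: coupling_point_of n "\<lambda>i. S ?q (b i)" "\<lambda>i v. d i (T ?q v)" h "V ?q" \<Psi> ?q V H by (rule point[OF q])
  show ?thesis
    using pt.X_expand[OF i] S_linear[OF q] unfolding pt.X_def Xc_def \<pi>_eq[OF x]
    by (simp add: linear_sum linear_cmul)
qed

text \<open>Both properties are stated for one and the same \<open>e\<close>, so that the choice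
  made next refers to a single dual frame. Nothing is asked about the dependence on
  \<open>x\<close>; differentiability comes later from that of the frame itself.\<close>

lemma point_frame:
  assumes x: "x \<in> cran c"
  shows "\<exists>e. dual_basis n (\<lambda>i. if i < h then Xc i x else b i) e \<and>
    (\<forall>v. \<gamma> (cinv c x) (S (cinv c x) v) = S (cinv c x) (\<Sum>a\<in>{h..<n}. e a v *\<^sub>R b a))"
proof -
  let ?q = "cinv c x"
  note q = cinv_in[OF x]
  interpret pt: coupling_point_of n "\<lambda>i. S ?q (b i)" "\<lambda>i v. d i (T ?q v)" h "V ?q" \<Psi> ?q V H by (rule point[OF q])
  let ?e = "\<lambda>i v. pt.e i (S ?q v)"
  have E: "pt.E i = S ?q (if i < h then Xc i x else b i)" if "i < n" for i
    using point_X[OF x that] by (simp add: pt.E_def pt.X_def)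
  have "dual_basis n (\<lambda>i. if i < h then Xc i x else b i) ?e"
  proof (rule dual_basis.intro)
    show "linear (?e i)" if "i < n" for i
      using linear_compose[OF S_linear[OF q] pt.frame.d_linear[OF that]] by (simp add: o_def)
    show "?e i (if j < h then Xc j x else b j) = (if i = j then 1 else 0)" if "i < n" "j < n" for i j
      using pt.frame.d_b[OF that] unfolding E[OF that(2)] .
    show "(\<Sum>i<n. ?e i v *\<^sub>R (if i < h then Xc i x else b i)) = v" for v
    proof -
      have "S ?q (\<Sum>i<n. ?e i v *\<^sub>R (if i < h then Xc i x else b i)) = (\<Sum>i<n. pt.e i (S ?q v) *\<^sub>R pt.E i)"
        using S_linear[OF q] E by (simp add: linear_sum linear_cmul)
      also have "\<dots> = S ?q v" by (rule pt.frame.expand)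
      finally have "T ?q (S ?q (\<Sum>i<n. ?e i v *\<^sub>R (if i < h then Xc i x else b i))) = T ?q (S ?q v)" by (simp only:)
      then show ?thesis by (simp only: T_S[OF q])
    qed
  qed
  moreover have "\<gamma> ?q (S ?q v) = S ?q (\<Sum>a\<in>{h..<n}. ?e a v *\<^sub>R b a)" for v
    using S_linear[OF q] by (simp add: \<gamma>_def pt.connection_form_eq pt.proj_def linear_sum linear_cmul)
  ultimately show ?thesis by blast
qed

definition e :: "'e \<Rightarrow> nat \<Rightarrow> 'e \<Rightarrow> real" where
  "e x = (SOME e. dual_basis n (\<lambda>i. if i < h then Xc i x else b i) e \<and>
    (\<forall>v. \<gamma> (cinv c x) (S (cinv c x) v) = S (cinv c x) (\<Sum>a\<in>{h..<n}. e a v *\<^sub>R b a)))"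

lemma e_frame: "x \<in> cran c \<Longrightarrow> dual_basis n (\<lambda>i. if i < h then Xc i x else b i) (e x)"
  and \<gamma>_S: "x \<in> cran c \<Longrightarrow> \<gamma> (cinv c x) (S (cinv c x) v) = S (cinv c x) (\<Sum>a\<in>{h..<n}. e x a v *\<^sub>R b a)"
  using someI_ex[OF point_frame, of x] unfolding e_def[symmetric] by blast+

definition prK :: "'e \<Rightarrow> 'e" where "prK v = (\<Sum>a\<in>{h..<n}. d a v *\<^sub>R b a)"

lemma prK_linear: "linear prK"
proof (rule linearI)
  show "prK (u + v) = prK u + prK v" for u v
    unfolding prK_def sum.distrib[symmetric]
    by (rule sum.cong) (use d_linear in \<open>auto simp: linear_add scaleR_add_left\<close>)
  show "prK (r *\<^sub>R v) = r *\<^sub>R prK v" for r v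
    unfolding prK_def scaleR_sum_right
    by (rule sum.cong) (use d_linear in \<open>auto simp: linear_cmul\<close>)
qed

lemma prK_in_K: "prK v \<in> K"
  unfolding prK_def by (intro subspace_sum subspace_scale K_subspace) (use b_in_K in auto)

lemma prK_K: "v \<in> K \<Longrightarrow> prK v = v"
proof -
  assume v: "v \<in> K"
  have "v = (\<Sum>i<n. d i v *\<^sub>R b i)" by (rule expand[symmetric])
  also have "\<dots> = prK v" unfolding prK_def by (rule sum.mono_neutral_right) (use v K_iff in auto)
  finally show ?thesis by (rule sym)
qed

lemma prK_low: "i < h \<Longrightarrow> prK (b i) = 0"
  unfolding prK_def using h_le by (intro sum.neutral) (auto simp: d_b)

lemma V_eq_image: "q \<in> cdom c \<Longrightarrow> V q = S q ` K"
proof (intro equalityI subsetI)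
  fix v assume q: "q \<in> cdom c" and "v \<in> V q"
  then have "T q v \<in> K" "v = S q (T q v)" using V_iff S_T by auto
  then show "v \<in> S q ` K" by blast
next
  fix v assume "q \<in> cdom c" "v \<in> S q ` K"
  then show "v \<in> V q" using S_in_V by auto
qed

lemma inj_S: "q \<in> cdom c \<Longrightarrow> inj (S q)"
  using T_S by (metis injI)

lemma dim_V: "q \<in> cdom c \<Longrightarrow> dim (V q) = dim K"
  unfolding V_eq_image by (rule dim_image_eq[OF S_linear inj_on_subset[OF inj_S]]) auto

lemma V_subspace: "q \<in> cdom c \<Longrightarrow> subspace (V q)"
  unfolding V_eq_image by (rule linear_subspace_image[OF S_linear K_subspace])

lemma \<tau>_V: "q \<in> cdom c \<Longrightarrow> \<tau> q \<in> forms (V q) (dim K)"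
  using vol by (simp add: leafwise_volume_def V)

text \<open>\<tau> takes leaf directions only. A constant projection onto \<open>K\<close> extends
  it to all arguments; what is used later are its values on \<open>K\<close>, or those on arguments
  already projected by the connection.\<close>

definition \<tau>c :: "'e \<Rightarrow> 'e form" where "\<tau>c x us = \<tau> (cinv c x) (map (\<lambda>v. S (cinv c x) (prK v)) us)"

lemma \<tau>c_K: "x \<in> cran c \<Longrightarrow> set us \<subseteq> K \<Longrightarrow> \<tau>c x us = \<tau> (cinv c x) (map (S (cinv c x)) us)"
proof -
  assume "set us \<subseteq> K"
  then have "map (\<lambda>v. S (cinv c x) (prK v)) us = map (S (cinv c x)) us" using prK_K by (intro map_cong) auto
  then show ?thesis by (simp only: \<tau>c_def)
qed

lemma \<tau>c_forms: "x \<in> cran c \<Longrightarrow> \<tau>c x \<in> forms UNIV (n - h)"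
proof -
  assume x: "x \<in> cran c"
  note q = cinv_in[OF x]
  have "pull (\<lambda>v. S (cinv c x) (prK v)) (\<tau> (cinv c x)) \<in> forms UNIV (dim K)"
  proof (rule pull_forms_range[OF _ _ V_subspace[OF q] \<tau>_V[OF q]])
    show "linear (\<lambda>v. S (cinv c x) (prK v))"
      using linear_compose[OF prK_linear S_linear[OF q]] by (simp add: o_def)
    show "range (\<lambda>v. S (cinv c x) (prK v)) \<subseteq> V (cinv c x)" using S_in_V[OF q] prK_in_K by auto
  qed
  moreover have "pull (\<lambda>v. S (cinv c x) (prK v)) (\<tau> (cinv c x)) = \<tau>c x" by (auto simp: pull_def \<tau>c_def)
  ultimately show ?thesis unfolding dim_K by simp
qed

lemma \<tau>c_nonzero: "x \<in> cran c \<Longrightarrow> \<tau>c x (map b [h..<n]) \<noteq> 0"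
proof
  assume x: "x \<in> cran c" and z: "\<tau>c x (map b [h..<n]) = 0"
  let ?q = "cinv c x"
  note q = cinv_in[OF x]
  let ?bs = "map (S ?q) (map b [h..<n])"
  have "\<exists>us. \<tau> ?q us \<noteq> 0" using vol unfolding leafwise_volume_def by blast
  then obtain us where us: "\<tau> ?q us \<noteq> 0" by blast
  have bK: "set (map b [h..<n]) \<subseteq> K" using b_in_K by auto
  have "\<tau> ?q us = 0"
  proof (rule forms_eq_0_basis_list[OF \<tau>_V[OF q] V_subspace[OF q]])
    show "V ?q \<subseteq> span (set ?bs)"
    proof
      fix v assume "v \<in> V ?q"
      then have w: "T ?q v \<in> K" using V_iff[OF q] by simp
      have "v = S ?q (prK (T ?q v))" using prK_K[OF w] S_T[OF q] by simp
      also have "\<dots> = (\<Sum>a\<in>{h..<n}. d a (T ?q v) *\<^sub>R S ?q (b a))"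
        unfolding prK_def using S_linear[OF q] by (simp add: linear_sum linear_cmul)
      also have "\<dots> \<in> span (set ?bs)" by (intro span_sum span_scale span_base) auto
      finally show "v \<in> span (set ?bs)" .
    qed
    show "set ?bs \<subseteq> V ?q" using bK S_in_V[OF q] by auto
    show "length ?bs = dim K" using dim_K by simp
    show "\<tau> ?q ?bs = 0" using z \<tau>c_K[OF x bK] by simp
  qed
  then show False using us by simp
qed

lemma sigma_point:
  assumes q: "q \<in> cdom c"
  shows "\<sigma> q \<in> forms UNIV 2"
    and "\<And>i v. i < h \<Longrightarrow> \<sigma> q [sharp (\<Psi> q) (covec (\<lambda>v. d i (T q v))), v] = - d i (T q v)"
    and "\<And>u v. u \<in> V q \<Longrightarrow> \<sigma> q [u, v] = 0"
proof -
  interpret pt: coupling_point_of n "\<lambda>i. S q (b i)" "\<lambda>i v. d i (T q v)" h "V q" \<Psi> q V H by (rule point[OF q])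
  have s: "\<sigma> q = pt.sig" by (simp add: \<sigma>_def pt.coupling_form_eq)
  show "\<sigma> q \<in> forms UNIV 2" unfolding s using pt.sig_ann by (simp add: ann_forms_def)
  show "\<sigma> q [sharp (\<Psi> q) (covec (\<lambda>v. d i (T q v))), v] = - d i (T q v)" if "i < h" for i v
    using pt.sig_X[OF that] unfolding s pt.X_def .
  show "\<sigma> q [u, v] = 0" if "u \<in> V q" for u v
  proof -
    have "set [u, v] \<inter> V q \<noteq> {}" using that by auto
    then show ?thesis using pt.sig_ann unfolding s ann_forms_def by blast
  qed
qed

lemma \<tau>\<gamma>_eq: "q \<in> cdom c \<Longrightarrow> \<tau>\<gamma> q = pull (\<gamma> q) (\<tau> q)"
proof -
  assume q: "q \<in> cdom c"
  interpret pt: coupling_point_of n "\<lambda>i. S q (b i)" "\<lambda>i v. d i (T q v)" h "V q" \<Psi> q V H by (rule point[OF q])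
  have "\<tau> q \<in> forms (V q) (dim (V q))" using \<tau>_V[OF q] dim_V[OF q] by simp
  from pt.vertical_ext_eq[where \<tau> = \<tau>, OF this] show ?thesis by (simp add: \<tau>\<gamma>_def \<gamma>_def pt.connection_form_eq)
qed

text \<open>At \<open>p\<close> the vectors \<open>b k\<close> with \<open>k < h\<close> are
  horizontal, and so is \<open>X i\<close>. Subtracting from \<open>X i\<close> its components along
  them leaves a horizontal vector whose coordinates \<open>d k\<close> vanish; it is vertical as
  well, hence 0.\<close>

lemma off_diagonal: "i < h \<Longrightarrow> h \<le> a \<Longrightarrow> a < n \<Longrightarrow> \<pi> i a x0 = 0"
proof -
  assume i: "i < h" and a: "h \<le> a" "a < n"
  interpret pt: coupling_point_of n "\<lambda>i. S p (b i)" "\<lambda>i v. d i (T p v)" h "V p" \<Psi> p V H by (rule point[OF p])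
  have bH: "S p (b k) \<in> H p" if k: "k < h" for k
    using b_H[OF k] S_T[OF p] by auto
  have bX: "S p (b k) = (\<Sum>j<h. pt.e j (S p (b k)) *\<^sub>R pt.X j)" if k: "k < h" for k
    using pt.diff_proj[of "S p (b k)"] bH[OF k] pt.Hp by simp
  have "d a (T p (pt.X i)) = 0"
  proof -
    have XH: "pt.X i \<in> H p" using pt.X_in_H[OF i] by (simp add: H coupling_normal_def)
    define w where "w = pt.X i - (\<Sum>k<h. d k (T p (pt.X i)) *\<^sub>R S p (b k))"
    have Hs: "subspace (H p)"
      unfolding pt.Hp using pt.proj_linear by (auto simp: subspace_def linear_0 linear_add linear_cmul)
    have "w \<in> H p"
      unfolding w_def by (intro subspace_diff[OF Hs XH] subspace_sum[OF Hs] subspace_scale[OF Hs]) (use bH in auto)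
    moreover have "w \<in> V p"
      unfolding pt.W_iff
    proof (intro allI impI)
      fix m assume m: "m < h"
      have mn: "m < n" using m h_le by simp
      have "d m (T p w) = d m (T p (pt.X i)) - d m (T p (\<Sum>k<h. d k (T p (pt.X i)) *\<^sub>R S p (b k)))"
        unfolding w_def by (rule linear_diff[OF pt.d_linear[OF mn]])
      also have "d m (T p (\<Sum>k<h. d k (T p (pt.X i)) *\<^sub>R S p (b k))) = (\<Sum>k<h. d k (T p (pt.X i)) * d m (T p (S p (b k))))"
        by (rule pt.d_sum[OF mn])
      also have "\<dots> = (\<Sum>k<h. if k = m then d k (T p (pt.X i)) else 0)"
        using mn h_le by (intro sum.cong) (auto simp: T_S[OF p] d_b)
      finally show "d m (T p w) = 0" using m by simp
    qed
    ultimately have "w = 0" using pt.H_inter H by (auto simp: coupling_normal_def)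
    then have "pt.X i = (\<Sum>k<h. d k (T p (pt.X i)) *\<^sub>R S p (b k))" by (simp add: w_def)
    then have "d a (T p (pt.X i)) = d a (T p (\<Sum>k<h. d k (T p (pt.X i)) *\<^sub>R S p (b k)))" by (rule arg_cong)
    also have "\<dots> = (\<Sum>k<h. d k (T p (pt.X i)) * d a (T p (S p (b k))))" by (rule pt.d_sum[OF a(2)])
    also have "\<dots> = 0" using a by (intro sum.neutral) (auto simp: T_S[OF p] d_b)
    finally show ?thesis .
  qed
  moreover have "i < n" using i h_le by simp
  ultimately show ?thesis using pt.dX[OF a(2)] \<pi>_eq[OF x0_in(1)] x0_in(2) by simp
qed

definition \<sigma>c :: "'e \<Rightarrow> 'e form" where "\<sigma>c = form_rep A c \<sigma>"

lemma local_data: "local_coupling n b d l (cran c) x0 \<pi> e \<sigma>c \<tau>c"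
proof (rule local_coupling.intro[OF dual_basis_axioms], rule local_coupling_axioms.intro)
  show "h \<le> n" by (rule h_le)
  show "open (cran c)" by (rule chart(2)[OF cG])
  show "x0 \<in> cran c" by (rule x0_in)
  show "\<pi> i j x = - \<pi> j i x" if "x \<in> cran c" "i < n" "j < n" for x i j
    unfolding \<pi>_def by (intro bivector_antisym bivec_rep_bivector[OF cG that(1)] bivector d_forms that)
  show "\<pi> i j differentiable (at x0)" if "i < n" "j < n" for i j
    using bivec_rep_differentiable[OF cG p bivector(2) dual_basis_axioms d_forms[OF that(1)] d_forms[OF that(2)]]
    by (simp add: \<pi>_def[abs_def])
  show "(\<Sum>j<n. \<pi> m j x0 * frechet_derivative (\<pi> k i) (at x0) (b j)) +
      (\<Sum>j<n. \<pi> k j x0 * frechet_derivative (\<pi> i m) (at x0) (b j)) +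
      (\<Sum>j<n. \<pi> i j x0 * frechet_derivative (\<pi> m k) (at x0) (b j)) = 0"
    if "m < n" "k < n" "i < n" for m k i
    by (rule jacobi_chart[OF cG p poisson dual_basis_axioms that \<pi>_def])
  show "\<pi> i a x0 = 0" if "i < h" "h \<le> a" "a < n" for i a by (rule off_diagonal[OF that])
  show "dual_basis n (\<lambda>i. if i < h then \<Sum>m<n. \<pi> i m x *\<^sub>R b m else b i) (e x)" if "x \<in> cran c" for x
    using e_frame[OF that] unfolding Xc_def .
  show "\<sigma>c x \<in> forms UNIV 2" if x: "x \<in> cran c" for x
    unfolding \<sigma>c_def by (rule form_rep_forms[where \<omega>=\<sigma>, OF cG x sigma_point(1)[OF cinv_in[OF x]]])
  show "\<sigma>c x [\<Sum>m<n. \<pi> i m x *\<^sub>R b m, v] = - d i v" if x: "x \<in> cran c" and i: "i < h" for x i v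
  proof -
    have "i < n" using i h_le by simp
    then show ?thesis
      using sigma_point(2)[OF cinv_in[OF x] i, of "S (cinv c x) v"] point_X[OF x, of i] T_S[OF cinv_in[OF x]]
      by (simp add: \<sigma>c_def form_rep_apply Xc_def)
  qed
  show "\<sigma>c x [b a, v] = 0" if x: "x \<in> cran c" and a: "h \<le> a" "a < n" for x a v
    using sigma_point(3)[OF cinv_in[OF x], of "S (cinv c x) (b a)"] S_in_V[OF cinv_in[OF x]] b_in_K[OF a]
    by (simp add: \<sigma>c_def form_rep_apply)
  show "\<tau>c x \<in> forms UNIV (n - h)" if "x \<in> cran c" for x by (rule \<tau>c_forms[OF that])
  show "(\<lambda>x. \<tau>c x us) differentiable (at x0)" for us
  proof -
    have "set (map prK us) \<subseteq> K" using prK_in_K by auto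
    then have "smooth_on (cran c) (\<lambda>x. form_rep A c \<tau> x (map prK us))"
      using vol c unfolding leafwise_volume_def by blast
    then have "(\<lambda>x. form_rep A c \<tau> x (map prK us)) differentiable (at x0)"
      by (rule smooth_on_differentiable) (rule x0_in)
    then show ?thesis by (simp add: \<tau>c_def form_rep_apply comp_def)
  qed
  show "\<tau>c x us = 0" if x: "x \<in> cran c" and i: "i < h" "b i \<in> set us" for x i us
  proof -
    obtain ys zs where us: "us = ys @ b i # zs" using i(2) by (meson split_list)
    show ?thesis
      using forms_zero_arg[OF \<tau>_V[OF cinv_in[OF x]] V_subspace[OF cinv_in[OF x]]] linear_0[OF S_linear[OF cinv_in[OF x]]]
      by (simp add: \<tau>c_def us prK_low[OF i(1)])
  qed
  show "\<tau>c x (map b [h..<n]) \<noteq> 0" if "x \<in> cran c" for x by (rule \<tau>c_nonzero[OF that])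
qed

end


lemma (in foliated_atlas) ext_deriv_cong:
  assumes U: "open U" "p \<in> U" and eq: "\<And>q. q \<in> U \<Longrightarrow> \<omega> q = \<omega>' q"
  shows "ext_deriv A \<omega> p = ext_deriv A \<omega>' p"
proof -
  let ?c = "chart_at A p"
  note c = chart_at_A[of p]
  let ?S = "cmap ?c ` (cdom ?c \<inter> U)"
  have S: "open ?S" "cmap ?c p \<in> ?S"
    using chart_open[OF c(1), of "cdom ?c \<inter> U"] chart(1)[OF c(1)] U c(3) by auto
  have r: "form_rep A ?c \<omega> x = form_rep A ?c \<omega>' x" if "x \<in> ?S" for x
  proof -
    have "cinv ?c x \<in> U" using that chart(5)[OF c(1)] by auto
    then show ?thesis by (simp add: form_rep_def eq)
  qed
  have "coord_deriv (form_rep A ?c \<omega>) (cmap ?c p) = coord_deriv (form_rep A ?c \<omega>') (cmap ?c p)"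
    by (rule coord_deriv_cong[OF S r])
  then show ?thesis by (simp only: ext_deriv_def ext_deriv_in_coord_deriv)
qed

lemma (in foliated_atlas) ext_deriv_zero: "ext_deriv A (\<lambda>_ _. 0) p us = 0"
  by (simp add: ext_deriv_def ext_deriv_in_def form_rep_def pull_def Let_def)

context adapted_chart
begin

sublocale loc: local_coupling n b d l "cran c" x0 \<pi> e \<sigma>c \<tau>c
  by (rule local_data)

lemma pr_in_K: "loc.pr x v \<in> K"
  unfolding loc.pr_def by (intro subspace_sum subspace_scale K_subspace) (use b_in_K in auto)

lemma \<gamma>_S_pr: "x \<in> cran c \<Longrightarrow> \<gamma> (cinv c x) (S (cinv c x) v) = S (cinv c x) (loc.pr x v)"
  unfolding loc.pr_def by (rule \<gamma>_S)

lemma rep_\<tau>\<gamma>: "x \<in> cran c \<Longrightarrow> form_rep A c \<tau>\<gamma> x = loc.\<tau>\<gamma> x"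
proof
  fix us assume x: "x \<in> cran c"
  note q = cinv_in[OF x]
  have "form_rep A c \<tau>\<gamma> x us = \<tau> (cinv c x) (map (\<lambda>u. S (cinv c x) (loc.pr x u)) us)"
    by (simp add: form_rep_apply \<tau>\<gamma>_eq[OF q] pull_def \<gamma>_S_pr[OF x] comp_def)
  also have "\<dots> = loc.\<tau>\<gamma> x us"
    by (simp add: loc.\<tau>\<gamma>_def pull_def \<tau>c_def comp_def prK_K[OF pr_in_K])
  finally show "form_rep A c \<tau>\<gamma> x us = loc.\<tau>\<gamma> x us" .
qed

lemma rep_\<Omega>: "x \<in> cran c \<Longrightarrow> form_rep A c \<Omega> x = loc.\<Omega> x"
proof -
  assume x: "x \<in> cran c"
  have "form_rep A c \<Omega> x = wedge (wedge_power (\<sigma>c x) l) (form_rep A c \<tau>\<gamma> x)"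
    unfolding \<Omega>_def \<sigma>c_def form_rep_def pull_wedge pull_wedge_power ..
  then show ?thesis unfolding rep_\<tau>\<gamma>[OF x] loc.\<Omega>_def .
qed

lemma cmap_in: "q \<in> cdom c \<Longrightarrow> cmap c q \<in> cran c"
  by blast

lemma form_from_rep:
  assumes q: "q \<in> cdom c"
  shows "\<omega> q = pull (T q) (form_rep A c \<omega> (cmap c q))"
proof
  fix us
  have "map (S q) (map (T q) us) = us" by (simp add: comp_def S_T[OF q])
  then show "\<omega> q us = pull (T q) (form_rep A c \<omega> (cmap c q)) us"
    by (simp only: pull_def form_rep_apply chart(5)[OF cG q])
qed

lemma \<Omega>_forms:
  assumes q: "q \<in> cdom c"
  shows "\<Omega> q \<in> forms UNIV n"
  unfolding form_from_rep[where \<omega> = \<Omega>, OF q] rep_\<Omega>[OF cmap_in[OF q]]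
  by (rule pull_forms[OF T_linear[OF q] loc.\<Omega>_forms[OF cmap_in[OF q]]])

lemma \<tau>\<gamma>_forms:
  assumes q: "q \<in> cdom c"
  shows "\<tau>\<gamma> q \<in> forms UNIV (n - h)"
  unfolding form_from_rep[where \<omega> = \<tau>\<gamma>, OF q] rep_\<tau>\<gamma>[OF cmap_in[OF q]]
  by (rule pull_forms[OF T_linear[OF q] loc.\<tau>\<gamma>_forms[OF cmap_in[OF q]]])

lemma rep_diff_cong:
  assumes "\<And>us. (\<lambda>x. \<omega>' x us) differentiable (at x0)" "\<And>x. x \<in> cran c \<Longrightarrow> form_rep A c \<omega> x = \<omega>' x"
  shows "(\<lambda>x. form_rep A c \<omega> x us) differentiable (at x0)"
  by (rule differentiable_transform_open[OF assms(1) loc.U]) (simp add: assms(2))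

section \<open>Evaluation of the modular field and of the divergence form at the point\<close>

subsection \<open>The modular vector field\<close>

lemma modular_field_eq: "modular_field A \<Psi> \<Omega> p = S p (\<Sum>m<n. loc.Zc m *\<^sub>R b m)"
proof -
  let ?\<rho> = "\<lambda>x. form_rep A c \<Omega> x (map b [0..<n])"
  have \<rho>: "?\<rho> x = loc.\<rho> x" if "x \<in> cran c" for x
    by (simp only: loc.\<rho>_def rep_\<Omega>[OF that])
  have D: "frechet_derivative ?\<rho> (at x0) = frechet_derivative loc.\<rho> (at x0)"
    by (rule frechet_derivative_cong_open[OF loc.U \<rho>])
  have "modular_field A \<Psi> \<Omega> p = S p (\<Sum>m<n.
      (\<Sum>j<n. frechet_derivative (\<pi> m j) (at x0) (b j) +
        \<pi> m j x0 * (frechet_derivative ?\<rho> (at x0) (b j) / ?\<rho> x0)) *\<^sub>R b m)"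
  proof (rule modular_field_chart[OF cG p bivector(2) dual_basis_axioms])
    show "\<Omega> q \<in> forms UNIV n" if "q \<in> cdom c" for q by (rule \<Omega>_forms[OF that])
    show "(\<lambda>x. form_rep A c \<Omega> x us) differentiable at x0" for us
      by (rule rep_diff_cong[OF loc.\<Omega>_diff rep_\<Omega>])
    show "\<pi> i j x = bivec_rep A c \<Psi> x (covec (d i)) (covec (d j))" for i j x by (rule \<pi>_def)
    show "?\<rho> x0 \<noteq> 0" unfolding \<rho>[OF x0_in(1)] by (rule loc.\<rho>_nz[OF x0_in(1)])
  qed simp
  then show ?thesis unfolding D \<rho>[OF x0_in(1)] loc.Zc_def .
qed

subsection \<open>The divergence form\<close>

lemma T_\<gamma>: "T p (\<gamma> p u) = loc.pr x0 (T p u)"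
  using \<gamma>_S_pr[OF x0_in(1), of "T p u"] T_S[OF p] S_T[OF p] by (simp add: x0_in(2))

lemma \<gamma>_linear: "q \<in> cdom c \<Longrightarrow> linear (\<gamma> q)"
  and \<gamma>_diff: "q \<in> cdom c \<Longrightarrow> \<gamma> q (v - \<gamma> q v) = 0"
  and \<gamma>_idem: "q \<in> cdom c \<Longrightarrow> \<gamma> q (\<gamma> q v) = \<gamma> q v"
proof -
  assume q: "q \<in> cdom c"
  interpret pt: coupling_point_of n "\<lambda>i. S q (b i)" "\<lambda>i v. d i (T q v)" h "V q" \<Psi> q V H by (rule point[OF q])
  show "linear (\<gamma> q)" "\<gamma> q (v - \<gamma> q v) = 0" "\<gamma> q (\<gamma> q v) = \<gamma> q v"
    unfolding \<gamma>_def pt.connection_form_eq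
    using pt.proj_linear pt.proj_diff_proj pt.proj_W[OF pt.proj_in_W] by auto
qed

text \<open>The connection kills every horizontal argument, so \<tau>\<gamma> has the pure bidegree
  \<open>(0, n - h)\<close>. As \<open>ext_deriv_10\<close> sums over all bidegrees, the other
  components have to be shown to vanish.\<close>

lemma form_component_\<tau>\<gamma>:
  assumes q: "q \<in> cdom c"
  shows "form_component \<gamma> k m \<tau>\<gamma> q = (if k = 0 \<and> m = n - h then \<tau>\<gamma> q else (\<lambda>_. 0))"
proof
  fix vs
  let ?L = "\<lambda>I. map (\<lambda>i. if i \<in> I then vs ! i - \<gamma> q (vs ! i) else \<gamma> q (vs ! i)) [0..<k + m]"
  let ?\<I> = "{I. I \<subseteq> {..<k + m} \<and> card I = k}"
  have fc: "form_component \<gamma> k m \<tau>\<gamma> q vs = (if length vs = k + m then \<Sum>I\<in>?\<I>. \<tau>\<gamma> q (?L I) else 0)"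
    by (simp add: form_component_def)
  show "form_component \<gamma> k m \<tau>\<gamma> q vs = (if k = 0 \<and> m = n - h then \<tau>\<gamma> q else (\<lambda>_. 0)) vs"
  proof (cases "k + m = n - h")
    case False
    then have "\<tau>\<gamma> q (?L I) = 0" for I using forms_eq_0[OF \<tau>\<gamma>_forms[OF q], of "?L I"] by simp
    then show ?thesis using False unfolding fc by auto
  next
    case km: True
    show ?thesis
    proof (cases "k = 0")
      case True
      have I: "?\<I> = {{}}" using True by (auto dest: finite_subset)
      have "\<tau>\<gamma> q (?L {}) = \<tau>\<gamma> q vs" if len: "length vs = m"
      proof -
        have "map (\<lambda>i. \<gamma> q (vs ! i)) [0..<m] = map (\<gamma> q) vs"
          using len by (intro nth_equalityI) auto
        then show ?thesis using True by (simp add: \<tau>\<gamma>_eq[OF q] pull_def \<gamma>_idem[OF q] comp_def)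
      qed
      moreover have "\<tau>\<gamma> q vs = 0" if "length vs \<noteq> m"
        using forms_eq_0[OF \<tau>\<gamma>_forms[OF q], of vs] that km True by simp
      ultimately show ?thesis using km True unfolding fc I by simp
    next
      case False
      have "\<tau>\<gamma> q (?L I) = 0" if "I \<in> ?\<I>" for I
      proof -
        have "card I \<noteq> 0" using that False by simp
        then obtain i where i: "i \<in> I" by fastforce
        then have "i < k + m" using that by auto
        then have "0 \<in> set (map (\<gamma> q) (?L I))"
          using i \<gamma>_diff[OF q, of "vs ! i"] by (auto simp: image_iff intro!: bexI[of _ i])
        then obtain xs ys where "map (\<gamma> q) (?L I) = xs @ 0 # ys" by (meson split_list)
        then show ?thesis
          using forms_zero_arg[OF \<tau>_V[OF q] V_subspace[OF q], of xs ys] by (simp only: \<tau>\<gamma>_eq[OF q] pull_def)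
      qed
      then show ?thesis using False unfolding fc by simp
    qed
  qed
qed

definition N1 :: "'e form" where "N1 = coord_deriv loc.\<tau>\<gamma> x0"

lemma N1_forms: "N1 \<in> forms UNIV (Suc (n - h))"
  unfolding N1_def by (rule coord_deriv_forms[OF loc.U loc.\<tau>\<gamma>_forms loc.\<tau>\<gamma>_diff])

lemma ext_deriv_\<tau>\<gamma>: "ext_deriv A \<tau>\<gamma> p = pull (T p) N1"
proof -
  have "ext_deriv A \<tau>\<gamma> p = pull (T p) (coord_deriv (form_rep A c \<tau>\<gamma>) x0)"
  proof (rule ext_deriv_chart[where \<omega> = \<tau>\<gamma>, OF cG p])
    show "\<tau>\<gamma> q \<in> forms UNIV (n - h)" if "q \<in> cdom c" for q by (rule \<tau>\<gamma>_forms[OF that])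
    show "(\<lambda>x. form_rep A c \<tau>\<gamma> x us) differentiable at x0" for us
      by (rule rep_diff_cong[OF loc.\<tau>\<gamma>_diff rep_\<tau>\<gamma>])
  qed
  also have "coord_deriv (form_rep A c \<tau>\<gamma>) x0 = N1"
    unfolding N1_def by (rule coord_deriv_cong[OF loc.U rep_\<tau>\<gamma>])
  finally show ?thesis .
qed

text \<open>On a horizontal vector \<open>v\<close> followed by the leaf frame, \<theta> \<and>
  \<tau>\<gamma> takes the value \<theta>(v) times \<open>loc.t x0\<close>; equating this with the
  differential of \<tau>\<gamma> and solving for \<theta>(v) gives the formula.\<close>

definition \<theta>c :: "'e \<Rightarrow> real" where "\<theta>c v = N1 ((v - loc.pr x0 v) # map b [h..<n]) / loc.t x0"

lemma pr_linear: "linear (loc.pr x0)"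
  by (rule loc.pr_linear[OF x0_in(1)])

lemma \<theta>c_linear: "linear \<theta>c"
proof -
  have l: "linear (\<lambda>v. N1 (v # map b [h..<n]))" by (rule forms_linear_Cons[OF N1_forms])
  have "linear (\<lambda>v. v - loc.pr x0 v)" by (intro linear_compose_sub linear_ident pr_linear)
  from linear_compose[OF this l] have l2: "linear (\<lambda>v. N1 ((v - loc.pr x0 v) # map b [h..<n]))" by (simp add: o_def)
  show ?thesis
    unfolding \<theta>c_def[abs_def]
    by (rule linearI) (simp_all only: linear_add[OF l2] linear_cmul[OF l2] add_divide_distrib real_scaleR_def times_divide_eq_right)
qed

lemma pr_K: "v \<in> K \<Longrightarrow> loc.pr x0 v = v"
  using prK_K[of v] by (simp add: loc.pr_x0 prK_def)

lemma \<theta>c_K: "v \<in> K \<Longrightarrow> \<theta>c v = 0"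
  using pr_K[of v] forms_zero_arg[OF N1_forms subspace_UNIV, of "[]"] by (simp add: \<theta>c_def)

text \<open>With the first argument fixed and the others projected, a form of top vertical degree
  remains. It is proportional to \<tau>\<gamma>, and the factor is read off on the leaf
  frame.\<close>

lemma N1_vertical: "N1 ((v - loc.pr x0 v) # map (loc.pr x0) vs) = \<theta>c v * loc.\<tau>\<gamma> x0 vs"
proof -
  let ?u = "v - loc.pr x0 v" and ?bs = "map b [h..<n]"
  let ?\<eta> = "pull (loc.pr x0) (interior_prod ?u N1)"
  have \<eta>: "?\<eta> \<in> forms UNIV (n - h)"
    by (rule pull_forms[OF pr_linear interior_prod_forms[OF N1_forms subspace_UNIV]])
  have mp: "map (loc.pr x0) ?bs = ?bs" by (rule loc.map_pr[OF x0_in(1)]) auto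
  have \<tau>bs: "loc.\<tau>\<gamma> x0 ?bs = loc.t x0" unfolding loc.t_def by (rule loc.\<tau>\<gamma>_vertical[OF x0_in(1)]) auto
  have "loc.t x0 * ?\<eta> vs + (- N1 (?u # ?bs)) * loc.\<tau>\<gamma> x0 vs = 0"
  proof (rule forms_eq_0_complement[OF forms_lincomb[OF \<eta> loc.\<tau>\<gamma>_forms[OF x0_in(1)]], of ?bs _ _ "b ` {..<h}"])
    show "loc.t x0 * ?\<eta> ?bs + (- N1 (?u # ?bs)) * loc.\<tau>\<gamma> x0 ?bs = 0"
      unfolding \<tau>bs pull_def mp by (simp add: interior_prod_def)
    have "{..<n} = {h..<n} \<union> {..<h}" using h_le by auto
    then have "set ?bs \<union> b ` {..<h} = b ` {..<n}" by (simp only: set_map set_upt image_Un)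
    then show "span (set ?bs \<union> b ` {..<h}) = UNIV" using span_b by simp
    show "loc.t x0 * ?\<eta> us + (- N1 (?u # ?bs)) * loc.\<tau>\<gamma> x0 us = 0" if ne: "set us \<inter> b ` {..<h} \<noteq> {}" for us
    proof -
      obtain i where i: "i < h" "b i \<in> set us" using ne by auto
      obtain xs ys where us: "us = xs @ b i # ys" using i(2) by (meson split_list)
      have "?\<eta> us = 0"
        using forms_zero_arg[OF interior_prod_forms[OF N1_forms subspace_UNIV] subspace_UNIV]
        unfolding us pull_def by (simp add: loc.pr_x0_low[OF i(1)])
      moreover have "loc.\<tau>\<gamma> x0 us = 0"
        using forms_zero_arg[OF loc.\<tau>_forms[OF x0_in(1)] subspace_UNIV]
        unfolding us loc.\<tau>\<gamma>_def pull_def by (simp add: loc.pr_x0_low[OF i(1)])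
      ultimately show ?thesis by simp
    qed
  qed simp
  then show ?thesis
    using loc.t_nz[OF x0_in(1)] by (simp add: \<theta>c_def pull_def interior_prod_def field_simps)
qed

definition \<theta>0 :: "'e form" where "\<theta>0 = covec (\<lambda>u. \<theta>c (T p u))"

lemma \<theta>0_ann: "\<theta>0 \<in> ann_forms (V p) 1"
proof -
  have "linear (\<lambda>u. \<theta>c (T p u))" using linear_compose[OF T_linear[OF p] \<theta>c_linear] by (simp add: o_def)
  then have "\<theta>0 \<in> forms UNIV 1" unfolding \<theta>0_def by (rule covec_forms)
  moreover have "\<theta>0 us = 0" if "set us \<inter> V p \<noteq> {}" for us
    using that \<theta>c_K V_iff[OF p] by (auto simp: \<theta>0_def covec_def split: list.splits)
  ultimately show ?thesis by (simp add: ann_forms_def)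
qed

lemma \<theta>0_forms: "\<theta>0 \<in> forms UNIV 1"
  using \<theta>0_ann by (simp add: ann_forms_def)

lemma \<tau>\<gamma>_p: "\<tau>\<gamma> p us = loc.\<tau>\<gamma> x0 (map (T p) us)"
  using fun_cong[OF form_from_rep[where \<omega> = \<tau>\<gamma>, OF p], of us] unfolding rep_\<tau>\<gamma>[OF x0_in(1)] pull_def .

text \<open>Bidegree \<open>(1, n - h)\<close> leaves one horizontal slot. Its position
  \<open>i\<close> plays the part of the omitted argument in the alternating sum of a product with a
  1-form, and bringing it to the front gives the sign.\<close>

lemma form_component_d\<tau>\<gamma>:
  assumes len: "length us = Suc (n - h)"
  shows "form_component \<gamma> (Suc 0) (n - h) (ext_deriv A \<tau>\<gamma>) p us = wedge \<theta>0 (\<tau>\<gamma> p) us"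
proof -
  let ?r = "n - h" and ?\<omega> = "ext_deriv A \<tau>\<gamma> p"
  let ?L = "\<lambda>I. map (\<lambda>i. if i \<in> I then us ! i - \<gamma> p (us ! i) else \<gamma> p (us ! i)) [0..<Suc 0 + ?r]"
  have I: "{I. I \<subseteq> {..<Suc 0 + ?r} \<and> card I = Suc 0} = (\<lambda>i. {i}) ` {..<length us}"
    unfolding len by (auto simp: card_Suc_eq)
  have "form_component \<gamma> (Suc 0) ?r (ext_deriv A \<tau>\<gamma>) p us = (\<Sum>I\<in>(\<lambda>i. {i}) ` {..<length us}. ?\<omega> (?L I))"
    unfolding form_component_def I using len by simp
  also have "\<dots> = (\<Sum>i<length us. ?\<omega> (?L {i}))"
    by (subst sum.reindex) (auto simp: inj_on_def)
  also have "\<dots> = (\<Sum>i<length us. (- 1) ^ i * (\<theta>0 [us ! i] * \<tau>\<gamma> p (take i us @ drop (Suc i) us)))"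
  proof (rule sum.cong[OF refl])
    fix i assume "i \<in> {..<length us}"
    then have i: "i < length us" by simp
    let ?w = "us ! i - \<gamma> p (us ! i)" and ?o = "take i us @ drop (Suc i) us"
    have n: "Suc 0 + ?r = length us" using len by simp
    have "?L {i} = (map (\<gamma> p) us)[i := ?w]"
      unfolding n by (rule nth_equalityI) (auto simp: nth_list_update)
    also have "\<dots> = [] @ map (\<gamma> p) (take i us) @ ?w # map (\<gamma> p) (drop (Suc i) us)"
      using i by (simp add: upd_conv_take_nth_drop take_map drop_map)
    finally have L: "?L {i} = [] @ map (\<gamma> p) (take i us) @ ?w # map (\<gamma> p) (drop (Suc i) us)" .
    have f: "?\<omega> \<in> forms UNIV (Suc ?r)" unfolding ext_deriv_\<tau>\<gamma> by (rule pull_forms[OF T_linear[OF p] N1_forms])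
    have "?\<omega> (?L {i}) = (- 1) ^ i * ?\<omega> (?w # map (\<gamma> p) ?o)"
      unfolding L forms_move[OF f subspace_UNIV] using i by simp
    also have "?\<omega> (?w # map (\<gamma> p) ?o) = N1 ((T p (us ! i) - loc.pr x0 (T p (us ! i))) # map (loc.pr x0) (map (T p) ?o))"
      unfolding ext_deriv_\<tau>\<gamma> pull_def using T_linear[OF p] by (simp add: linear_diff T_\<gamma> comp_def)
    also have "\<dots> = \<theta>0 [us ! i] * \<tau>\<gamma> p ?o" unfolding N1_vertical \<tau>\<gamma>_p by (simp add: \<theta>0_def)
    finally show "?\<omega> (?L {i}) = (- 1) ^ i * (\<theta>0 [us ! i] * \<tau>\<gamma> p ?o)" .
  qed
  finally show ?thesis unfolding wedge_one_form[OF \<theta>0_forms] alt_sum_def .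
qed

lemma ext_deriv_10_\<tau>\<gamma>: "ext_deriv_10 A \<gamma> \<tau>\<gamma> p = wedge \<theta>0 (\<tau>\<gamma> p)"
proof
  fix us
  have fc: "ext_deriv A (form_component \<gamma> k m \<tau>\<gamma>) p = (if k = 0 \<and> m = n - h then ext_deriv A \<tau>\<gamma> p else (\<lambda>_. 0))" for k m
  proof -
    have "ext_deriv A (form_component \<gamma> k m \<tau>\<gamma>) p = ext_deriv A (if k = 0 \<and> m = n - h then \<tau>\<gamma> else (\<lambda>_ _. 0)) p"
      by (rule ext_deriv_cong[OF chart(1)[OF cG] p]) (simp add: form_component_\<tau>\<gamma>)
    then show ?thesis using ext_deriv_zero by auto
  qed
  have fc2: "form_component \<gamma> (Suc k) m (ext_deriv A (form_component \<gamma> k m \<tau>\<gamma>)) p us =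
      (if k = 0 \<and> m = n - h then form_component \<gamma> (Suc 0) (n - h) (ext_deriv A \<tau>\<gamma>) p us else 0)" for k m
    unfolding form_component_def[of _ "Suc k"] form_component_def[of _ "Suc 0"] fc by auto
  have e: "ext_deriv_10 A \<gamma> \<tau>\<gamma> p us = (\<Sum>a<length us. if a = 0 \<and> length us - Suc a = n - h
      then form_component \<gamma> (Suc 0) (n - h) (ext_deriv A \<tau>\<gamma>) p us else 0)"
    by (simp add: ext_deriv_10_def Let_def fc2)
  show "ext_deriv_10 A \<gamma> \<tau>\<gamma> p us = wedge \<theta>0 (\<tau>\<gamma> p) us"
  proof (cases "length us = Suc (n - h)")
    case True
    have "ext_deriv_10 A \<gamma> \<tau>\<gamma> p us = (\<Sum>a<length us. if a = 0
        then form_component \<gamma> (Suc 0) (n - h) (ext_deriv A \<tau>\<gamma>) p us else 0)"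
      unfolding e by (rule sum.cong) (use True in auto)
    also have "\<dots> = form_component \<gamma> (Suc 0) (n - h) (ext_deriv A \<tau>\<gamma>) p us" using True by simp
    finally show ?thesis using form_component_d\<tau>\<gamma>[OF True] by simp
  next
    case False
    have "ext_deriv_10 A \<gamma> \<tau>\<gamma> p us = 0" unfolding e
    proof (rule sum.neutral, rule ballI)
      fix a assume "a \<in> {..<length us}"
      then have "\<not> (a = 0 \<and> length us - Suc a = n - h)" using False by (cases us) auto
      then show "(if a = 0 \<and> length us - Suc a = n - h
          then form_component \<gamma> (Suc 0) (n - h) (ext_deriv A \<tau>\<gamma>) p us else 0) = 0" by (simp only: if_False)
    qed
    moreover have "wedge \<theta>0 (\<tau>\<gamma> p) us = 0"
      using forms_eq_0[OF wedge_forms[OF \<theta>0_forms \<tau>\<gamma>_forms[OF p]], of us] False by simp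
    ultimately show ?thesis by simp
  qed
qed

lemma S_p_bs: "set (map (S p) (map b [h..<n])) \<subseteq> V p"
  using S_in_V[OF p] b_in_K by auto

lemma \<tau>\<gamma>_p_bs: "\<tau>\<gamma> p (map (S p) (map b [h..<n])) = loc.t x0"
proof -
  have "\<tau>\<gamma> p (map (S p) (map b [h..<n])) = loc.\<tau>\<gamma> x0 (map b [h..<n])"
    unfolding \<tau>\<gamma>_p by (simp add: comp_def T_S[OF p])
  also have "\<dots> = loc.t x0" unfolding loc.t_def by (rule loc.\<tau>\<gamma>_vertical[OF x0_in(1)]) auto
  finally show ?thesis .
qed

text \<open>The product with \<tau>\<gamma> is injective on annihilating covectors: on
  \<open>u\<close> followed by the leaf frame only \<open>\<alpha> [u] * loc.t x0\<close> survives,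
  because \<alpha> vanishes on the frame.\<close>

lemma divergence_form_eq: "divergence_form A H V \<tau> p = \<theta>0"
  unfolding divergence_form_def \<gamma>_def[symmetric] \<tau>\<gamma>_def[symmetric] ext_deriv_10_\<tau>\<gamma>
proof (rule the_equality)
  show "\<theta>0 \<in> ann_forms (V p) 1 \<and> wedge \<theta>0 (\<tau>\<gamma> p) = wedge \<theta>0 (\<tau>\<gamma> p)" using \<theta>0_ann by simp
  fix \<theta> assume \<theta>: "\<theta> \<in> ann_forms (V p) 1 \<and> wedge \<theta>0 (\<tau>\<gamma> p) = wedge \<theta> (\<tau>\<gamma> p)"
  let ?bs = "map (S p) (map b [h..<n])"
  have f: "\<theta> \<in> forms UNIV 1" using \<theta> by (simp add: ann_forms_def)
  have w: "wedge \<alpha> (\<tau>\<gamma> p) (u # ?bs) = \<alpha> [u] * loc.t x0" if \<alpha>: "\<alpha> \<in> ann_forms (V p) 1" for \<alpha> u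
  proof -
    have \<alpha>f: "\<alpha> \<in> forms UNIV 1" and z: "\<And>v. v \<in> V p \<Longrightarrow> \<alpha> [v] = 0" using \<alpha> by (auto simp: ann_forms_def)
    have "alt_sum (\<lambda>w. interior_prod u (\<lambda>vs. \<alpha> [w] * \<tau>\<gamma> p vs)) ?bs = 0"
      unfolding alt_sum_def interior_prod_def
    proof (rule sum.neutral, rule ballI)
      fix k assume "k \<in> {..<length ?bs}"
      then have "?bs ! k \<in> V p" using S_p_bs nth_mem[of k ?bs] by auto
      then show "(- 1) ^ k * (\<alpha> [?bs ! k] * \<tau>\<gamma> p (u # take k ?bs @ drop (Suc k) ?bs)) = 0" by (simp only: z mult_zero_left mult_zero_right)
    qed
    then show ?thesis unfolding wedge_one_form[OF \<alpha>f] alt_sum_Cons \<tau>\<gamma>_p_bs by simp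
  qed
  have "\<theta> [u] = \<theta>0 [u]" for u
  proof -
    have "\<theta>0 [u] * loc.t x0 = \<theta> [u] * loc.t x0"
      using w[OF \<theta>0_ann, of u] w[of \<theta> u] \<theta> by simp
    then show ?thesis using loc.t_nz[OF x0_in(1)] by simp
  qed
  then show "\<theta> = \<theta>0" by (rule covector_eqI[OF f \<theta>0_forms])
qed

lemma \<theta>c_X: "i < h \<Longrightarrow> \<theta>c (loc.X i x0) = loc.Zc i"
  using loc.coord_deriv_\<tau>\<gamma>[of i] loc.pr_X[OF x0_in(1), of i] loc.t_nz[OF x0_in(1)]
  by (simp add: \<theta>c_def N1_def)

text \<open>By antisymmetry of the bivector, the \<open>m\<close>-th coordinate of the image of
  \<theta> is minus \<theta> of \<open>X m\<close>, that is \<open>- loc.Zc m\<close>; this is the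
  origin of the sign in the theorem. The image is horizontal, and at \<open>p\<close> this means
  that its vertical coordinates are 0.\<close>

lemma sharp_\<theta>: "sharp (\<Psi> p) \<theta>0 = - S p (\<Sum>m<h. loc.Zc m *\<^sub>R b m)"
proof -
  interpret pt: coupling_point_of n "\<lambda>i. S p (b i)" "\<lambda>i v. d i (T p v)" h "V p" \<Psi> p V H by (rule point[OF p])
  let ?v = "sharp (\<Psi> p) \<theta>0"
  have low: "d m (T p ?v) = - loc.Zc m" if m: "m < h" for m
  proof -
    have mn: "m < n" using m h_le by simp
    have "d m (T p ?v) = \<Psi> p \<theta>0 (covec (\<lambda>v. d m (T p v)))"
      using pt.covec_sharp[OF bivector(1) \<theta>0_forms pt.d_forms[OF mn]] by simp
    also have "\<dots> = - \<Psi> p (covec (\<lambda>v. d m (T p v))) \<theta>0"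
      by (rule bivector_antisym[OF bivector(1) \<theta>0_forms pt.d_forms[OF mn]])
    also have "\<Psi> p (covec (\<lambda>v. d m (T p v))) \<theta>0 = \<theta>0 [sharp (\<Psi> p) (covec (\<lambda>v. d m (T p v)))]"
      by (rule pt.covec_sharp[OF bivector(1) pt.d_forms[OF mn] \<theta>0_forms, symmetric])
    also have "sharp (\<Psi> p) (covec (\<lambda>v. d m (T p v))) = S p (loc.X m x0)"
      using point_X[OF x0_in(1) mn] by (simp add: x0_in(2) Xc_def loc.X_def)
    also have "\<theta>0 [S p (loc.X m x0)] = loc.Zc m" using \<theta>c_X[OF m] T_S[OF p] by (simp add: \<theta>0_def)
    finally show ?thesis .
  qed
  have "?v \<in> sharp (\<Psi> p) ` ann_forms (V p) 1" using \<theta>0_ann by blast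
  then have "pt.proj ?v = 0" using pt.H_eq by blast
  then have "loc.pr x0 (T p ?v) = T p 0" using T_\<gamma>[of ?v] by (simp add: \<gamma>_def pt.connection_form_eq)
  then have pr0: "prK (T p ?v) = 0" using linear_0[OF T_linear[OF p]] by (simp add: loc.pr_x0 prK_def)
  have "T p ?v = (\<Sum>i<n. d i (T p ?v) *\<^sub>R b i)" by (rule expand[symmetric])
  also have "\<dots> = (\<Sum>i<h. d i (T p ?v) *\<^sub>R b i) + prK (T p ?v)"
    unfolding prK_def using h_le by (simp add: lessThan_atLeast0 sum.atLeastLessThan_concat)
  also have "\<dots> = - (\<Sum>m<h. loc.Zc m *\<^sub>R b m)" unfolding pr0 by (simp add: low sum_negf)
  finally have "S p (T p ?v) = S p (- (\<Sum>m<h. loc.Zc m *\<^sub>R b m))" by (rule arg_cong)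
  then show ?thesis unfolding S_T[OF p] linear_neg[OF S_linear[OF p]] .
qed

lemma horizontal_part_eq:
  "modular_field A \<Psi> \<Omega> p - \<gamma> p (modular_field A \<Psi> \<Omega> p) = - sharp (\<Psi> p) (divergence_form A H V \<tau> p)"
  and vertical_part_eq: "\<gamma> p (modular_field A \<Psi> \<Omega> p) = S p (\<Sum>m\<in>{h..<n}. loc.Zc m *\<^sub>R b m)"
proof -
  let ?z = "\<Sum>m<n. loc.Zc m *\<^sub>R b m"
  have "loc.pr x0 ?z = (\<Sum>m\<in>{h..<n}. loc.Zc m *\<^sub>R b m)"
    unfolding loc.pr_x0 by (rule sum.cong) (auto simp: d_sum_b)
  then show v: "\<gamma> p (modular_field A \<Psi> \<Omega> p) = S p (\<Sum>m\<in>{h..<n}. loc.Zc m *\<^sub>R b m)"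
    unfolding modular_field_eq using \<gamma>_S_pr[OF x0_in(1), of ?z] by (simp only: x0_in(2))
  have "?z = (\<Sum>m<h. loc.Zc m *\<^sub>R b m) + (\<Sum>m\<in>{h..<n}. loc.Zc m *\<^sub>R b m)"
    using h_le by (simp add: lessThan_atLeast0 sum.atLeastLessThan_concat)
  then have "modular_field A \<Psi> \<Omega> p = S p (\<Sum>m<h. loc.Zc m *\<^sub>R b m) + S p (\<Sum>m\<in>{h..<n}. loc.Zc m *\<^sub>R b m)"
    unfolding modular_field_eq using linear_add[OF S_linear[OF p]] by (simp only:)
  then show "modular_field A \<Psi> \<Omega> p - \<gamma> p (modular_field A \<Psi> \<Omega> p) = - sharp (\<Psi> p) (divergence_form A H V \<tau> p)"
    unfolding v divergence_form_eq sharp_\<theta> by simp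
qed

end


section \<open>Identification of the vertical component with the leafwise modular field\<close>

context adapted_chart
begin

subsection \<open>The modular vector field of the leaves\<close>

lemma vertical_part_expand:
  assumes q: "q \<in> cdom c" and \<alpha>: "\<alpha> \<in> forms UNIV 1" and \<beta>: "\<beta> \<in> forms UNIV 1"
  shows "vertical_part \<gamma> \<Psi> q \<alpha> \<beta> =
    (\<Sum>a\<in>{h..<n}. \<Sum>c'\<in>{h..<n}. loc.Pc a c' (cmap c q) * (\<alpha> [S q (b a)] * \<beta> [S q (b c')]))"
proof -
  let ?x = "cmap c q" and ?I = "{h..<n}"
  interpret tb: dual_basis n "\<lambda>i. S q (b i)" "\<lambda>i v. d i (T q v)" by (rule transported_basis[OF q])
  have x: "?x \<in> cran c" and xq: "cinv c ?x = q" using q chart(5)[OF cG q] by auto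
  have pf: "pull (\<gamma> q) \<eta> \<in> forms UNIV 1" if "\<eta> \<in> forms UNIV 1" for \<eta>
    by (rule pull_forms[OF \<gamma>_linear[OF q] that])
  have pe: "pull (\<gamma> q) \<eta> [S q (b i)] = (\<Sum>a\<in>?I. e ?x a (b i) * \<eta> [S q (b a)])" if \<eta>: "\<eta> \<in> forms UNIV 1" for \<eta> i
  proof -
    have "\<gamma> q (S q (b i)) = (\<Sum>a\<in>?I. e ?x a (b i) *\<^sub>R S q (b a))"
      using \<gamma>_S[OF x, of "b i"] S_linear[OF q] by (simp add: xq linear_sum linear_cmul)
    then show ?thesis by (simp add: pull_def covector_sum[OF \<eta>])
  qed
  have "vertical_part \<gamma> \<Psi> q \<alpha> \<beta> = (\<Sum>i<n. pull (\<gamma> q) \<alpha> [S q (b i)] *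
      (\<Sum>j<n. pull (\<gamma> q) \<beta> [S q (b j)] * \<Psi> q (covec (\<lambda>v. d i (T q v))) (covec (\<lambda>v. d j (T q v)))))"
    unfolding vertical_part_def tb.bivector_expand_left[OF bivector(1) pf[OF \<alpha>] pf[OF \<beta>]]
    by (intro sum.cong refl arg_cong2[where f = "(*)"] tb.bivector_expand_right[OF bivector(1) tb.d_forms pf[OF \<beta>]]) simp
  also have "\<dots> = (\<Sum>i<n. (\<Sum>a\<in>?I. e ?x a (b i) * \<alpha> [S q (b a)]) *
      (\<Sum>j<n. (\<Sum>c'\<in>?I. e ?x c' (b j) * \<beta> [S q (b c')]) * \<pi> i j ?x))"
    by (simp only: pe[OF \<alpha>] pe[OF \<beta>] \<pi>_eq[OF x] xq)
  also have "\<dots> = (\<Sum>i<n. \<Sum>j<n. \<Sum>a\<in>?I. \<Sum>c'\<in>?I.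
      (e ?x a (b i) * e ?x c' (b j)) * \<pi> i j ?x * (\<alpha> [S q (b a)] * \<beta> [S q (b c')]))"
  proof (rule sum.cong[OF refl])
    fix i
    let ?A = "\<Sum>a\<in>?I. e ?x a (b i) * \<alpha> [S q (b a)]" and ?B = "\<lambda>j. \<Sum>c'\<in>?I. e ?x c' (b j) * \<beta> [S q (b c')]"
    have "r * (\<Sum>j<n. B j * \<pi> i j ?x) = (\<Sum>j<n. (r * B j) * \<pi> i j ?x)" for r B
      by (simp only: sum_distrib_left mult.assoc)
    then have "?A * (\<Sum>j<n. ?B j * \<pi> i j ?x) = (\<Sum>j<n. (?A * ?B j) * \<pi> i j ?x)" .
    also have "\<dots> = (\<Sum>j<n. \<Sum>a\<in>?I. \<Sum>c'\<in>?I.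
        (e ?x a (b i) * e ?x c' (b j)) * \<pi> i j ?x * (\<alpha> [S q (b a)] * \<beta> [S q (b c')]))"
      by (simp only: sum_product, simp only: sum_distrib_right, simp only: ac_simps)
    finally show "?A * (\<Sum>j<n. ?B j * \<pi> i j ?x) = (\<Sum>j<n. \<Sum>a\<in>?I. \<Sum>c'\<in>?I.
        (e ?x a (b i) * e ?x c' (b j)) * \<pi> i j ?x * (\<alpha> [S q (b a)] * \<beta> [S q (b c')]))" .
  qed
  also have "\<dots> = (\<Sum>i<n. \<Sum>a\<in>?I. \<Sum>c'\<in>?I. \<Sum>j<n.
      (e ?x a (b i) * e ?x c' (b j)) * \<pi> i j ?x * (\<alpha> [S q (b a)] * \<beta> [S q (b c')]))"
    by (simp only: sum.swap[of _ "{..<n}" ?I])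
  also have "\<dots> = (\<Sum>a\<in>?I. \<Sum>c'\<in>?I. \<Sum>i<n. \<Sum>j<n.
      (e ?x a (b i) * e ?x c' (b j)) * \<pi> i j ?x * (\<alpha> [S q (b a)] * \<beta> [S q (b c')]))"
    by (simp only: sum.swap[of _ "{..<n}" ?I])
  finally show ?thesis by (simp only: loc.Pc_def sum_distrib_right)
qed

lemma Pc_antisym: "x \<in> cran c \<Longrightarrow> loc.Pc a c' x = - loc.Pc c' a x"
proof -
  assume x: "x \<in> cran c"
  have "loc.Pc a c' x = (\<Sum>j<n. \<Sum>i<n. (e x a (b i) * e x c' (b j)) * \<pi> i j x)"
    unfolding loc.Pc_def by (rule sum.swap)
  also have "\<dots> = (\<Sum>j<n. \<Sum>i<n. - ((e x c' (b j) * e x a (b i)) * \<pi> j i x))"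
  proof (intro sum.cong refl)
    fix j i assume "j \<in> {..<n}" "i \<in> {..<n}"
    then have "\<pi> i j x = - \<pi> j i x" by (intro loc.\<pi>_anti[OF x]) auto
    then show "(e x a (b i) * e x c' (b j)) * \<pi> i j x = - ((e x c' (b j) * e x a (b i)) * \<pi> j i x)" by simp
  qed
  finally show ?thesis by (simp only: loc.Pc_def sum_negf)
qed

lemma contract_vertical_part:
  assumes q: "q \<in> cdom c"
  shows "contract (V q) (vertical_part \<gamma> \<Psi> q) (\<tau> q) = (\<lambda>us. (\<Sum>a\<in>{h..<n}. \<Sum>c'\<in>{h..<n}.
    loc.Pc a c' (cmap c q) * \<tau> q (S q (b c') # S q (b a) # us)) / 2)"
proof (rule dual_basis.contract_eq[OF transported_basis[OF q] h_le])
  show "v \<in> V q \<longleftrightarrow> (\<forall>i<h. d i (T q v) = 0)" for v using V_iff[OF q] K_iff by simp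
  show "\<tau> q \<in> forms (V q) (dim K)" by (rule \<tau>_V[OF q])
  show "loc.Pc a c' (cmap c q) = - loc.Pc c' a (cmap c q)" for a c'
    by (rule Pc_antisym[OF cmap_in[OF q]])
  show "vertical_part \<gamma> \<Psi> q \<alpha> \<beta> =
    (\<Sum>a\<in>{h..<n}. \<Sum>c'\<in>{h..<n}. loc.Pc a c' (cmap c q) * (\<alpha> [S q (b a)] * \<beta> [S q (b c')]))"
    if "\<alpha> \<in> forms UNIV 1" "\<beta> \<in> forms UNIV 1" for \<alpha> \<beta> by (rule vertical_part_expand[OF q that])
qed

text \<open>The contraction is a form on the leaf directions, and \<open>\<tau>c\<close> represents
  \<tau> on \<open>K\<close> only; hence the restriction on \<open>vs\<close>.\<close>

lemma rep_iP:
  assumes x: "x \<in> cran c" and vs: "set vs \<subseteq> K"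
  shows "form_rep A c (\<lambda>q. contract (V q) (vertical_part \<gamma> \<Psi> q) (\<tau> q)) x vs = loc.iP x vs"
proof -
  have xq: "cmap c (cinv c x) = x" using chart(6)[OF cG x] by simp
  have "\<tau> (cinv c x) (S (cinv c x) (b c') # S (cinv c x) (b a) # map (S (cinv c x)) vs) = \<tau>c x (b c' # b a # vs)"
    if "a \<in> {h..<n}" "c' \<in> {h..<n}" for a c'
    using \<tau>c_K[OF x, of "b c' # b a # vs"] that vs b_in_K by simp
  then show ?thesis
    unfolding form_rep_apply contract_vertical_part[OF cinv_in[OF x]] loc.iP_def xq
    by (intro arg_cong2[where f = "(/)"] sum.cong refl) auto
qed

lemma leaf_deriv_eq:
  assumes us: "set us \<subseteq> V p"
  shows "ext_deriv_in A c (\<lambda>q. contract (V q) (vertical_part \<gamma> \<Psi> q) (\<tau> q)) p us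
    = - \<tau> p (S p (\<Sum>m\<in>{h..<n}. loc.Zc m *\<^sub>R b m) # us)"
proof -
  let ?\<eta> = "\<lambda>q. contract (V q) (vertical_part \<gamma> \<Psi> q) (\<tau> q)" and ?ws = "map (T p) us"
  let ?z = "\<Sum>m\<in>{h..<n}. loc.Zc m *\<^sub>R b m"
  have ws: "set ?ws \<subseteq> K" using us V_iff[OF p] by auto
  have z: "?z \<in> K" by (intro subspace_sum subspace_scale K_subspace) (use b_in_K in auto)
  have D: "frechet_derivative (\<lambda>x. form_rep A c ?\<eta> x vs) (at x0) = frechet_derivative (\<lambda>x. loc.iP x vs) (at x0)"
    if "set vs \<subseteq> K" for vs
    by (rule frechet_derivative_cong_open[OF loc.U rep_iP[OF _ that]])
  have "ext_deriv_in A c ?\<eta> p us = alt_sum (\<lambda>w vs. frechet_derivative (\<lambda>x. form_rep A c ?\<eta> x vs) (at x0) w) ?ws"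
    by (simp add: ext_deriv_in_coord_deriv pull_def coord_deriv_def)
  also have "\<dots> = alt_sum (\<lambda>w vs. frechet_derivative (\<lambda>x. loc.iP x vs) (at x0) w) ?ws"
    unfolding alt_sum_def
  proof (rule sum.cong[OF refl])
    fix i
    \<comment> \<open>The derivative is evaluated on sublists of \<open>?ws\<close>, which stay in
      \<open>K\<close>, so the contraction may be replaced by \<open>loc.iP\<close> in every
      term.\<close>
    have "set (take i ?ws @ drop (Suc i) ?ws) \<subseteq> K"
      using ws set_take_subset[of i ?ws] set_drop_subset[of "Suc i" ?ws] by (simp only: set_append) blast
    then show "(- 1) ^ i * frechet_derivative (\<lambda>x. form_rep A c ?\<eta> x (take i ?ws @ drop (Suc i) ?ws)) (at x0) (?ws ! i) =
        (- 1) ^ i * frechet_derivative (\<lambda>x. loc.iP x (take i ?ws @ drop (Suc i) ?ws)) (at x0) (?ws ! i)"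
      by (simp only: D)
  qed
  also have "\<dots> = - \<tau>c x0 (?z # ?ws)"
    by (rule loc.coord_deriv_iP) (use ws K_iff in blast)
  also have "\<tau>c x0 (?z # ?ws) = \<tau> p (S p ?z # us)"
  proof -
    have "set (?z # ?ws) \<subseteq> K" using z ws by simp
    from \<tau>c_K[OF x0_in(1) this] have "\<tau>c x0 (?z # ?ws) = \<tau> p (map (S p) (?z # ?ws))" by (simp only: x0_in(2))
    moreover have "map (S p) (map (T p) us) = us" by (simp add: comp_def S_T[OF p])
    ultimately show ?thesis by (simp only: list.map)
  qed
  finally show ?thesis .
qed

text \<open>Each coordinate of \<open>v\<close> is isolated by completing \<open>v\<close> with the
  leaf frame from which the corresponding vector has been removed.\<close>

lemma \<tau>_nondegenerate:
  assumes v: "v \<in> V p" and z: "\<And>us. \<tau> p (v # us) = 0"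
  shows "v = 0"
proof -
  let ?bs = "map (S p) (map b [h..<n])" and ?w = "T p v"
  note f = \<tau>_V[OF p] V_subspace[OF p]
  have len: "length ?bs = n - h" by simp
  have \<tau>bs: "\<tau> p ?bs \<noteq> 0"
  proof -
    have "set (map b [h..<n]) \<subseteq> K" using b_in_K by auto
    from \<tau>c_K[OF x0_in(1) this] show ?thesis using \<tau>c_nonzero[OF x0_in(1)] by (simp only: x0_in(2) not_False_eq_True)
  qed
  have ve: "v = (\<Sum>j<n - h. d (h + j) ?w *\<^sub>R ?bs ! j)"
  proof -
    have "v = S p (prK ?w)" using prK_K[of ?w] V_iff[OF p] v S_T[OF p] by simp
    also have "\<dots> = (\<Sum>a\<in>{h..<n}. d a ?w *\<^sub>R S p (b a))"
      unfolding prK_def using S_linear[OF p] by (simp add: linear_sum linear_cmul)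
    also have "\<dots> = (\<Sum>j<n - h. d (h + j) ?w *\<^sub>R ?bs ! j)"
      by (rule sum.reindex_bij_witness[of _ "\<lambda>j. h + j" "\<lambda>a. a - h"]) auto
    finally show ?thesis .
  qed
  have "d (h + k) ?w = 0" if k: "k < n - h" for k
  proof -
    let ?us = "take k ?bs @ drop (Suc k) ?bs"
    have bV: "?bs ! j \<in> V p" if "j < n - h" for j using S_p_bs that nth_mem[of j ?bs] by auto
    have "0 = \<tau> p ([] @ v # ?us)" using z by simp
    also have "\<dots> = \<tau> p ([] @ (\<Sum>j<n - h. d (h + j) ?w *\<^sub>R ?bs ! j) # ?us)"
      by (rule arg_cong[OF ve, of "\<lambda>v. \<tau> p ([] @ v # ?us)"])
    also have "\<dots> = (\<Sum>j<n - h. d (h + j) ?w * \<tau> p ([] @ ?bs ! j # ?us))"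
      by (rule forms_sum[OF f bV]) simp
    also have "\<dots> = (\<Sum>j<n - h. d (h + j) ?w * (if j = k then (- 1) ^ k * \<tau> p ?bs else 0))"
    proof (rule sum.cong[OF refl])
      fix j assume "j \<in> {..<n - h}"
      then have "j < length ?bs" "k < length ?bs" using k len by auto
      from forms_omit[OF f this]
      show "d (h + j) ?w * \<tau> p ([] @ ?bs ! j # ?us) = d (h + j) ?w * (if j = k then (- 1) ^ k * \<tau> p ?bs else 0)"
        by (simp only: append_Nil)
    qed
    also have "\<dots> = (\<Sum>j<n - h. if j = k then d (h + j) ?w * ((- 1) ^ k * \<tau> p ?bs) else 0)"
      by (rule sum.cong) auto
    also have "\<dots> = d (h + k) ?w * ((- 1) ^ k * \<tau> p ?bs)" using k by simp
    finally show ?thesis using \<tau>bs by simp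
  qed
  then have "v = (\<Sum>j<n - h. 0 *\<^sub>R ?bs ! j)" using ve by simp
  then show ?thesis by simp
qed

text \<open>\<open>leaf_deriv\<close> is computed in \<open>chart_at F p\<close>, so the adapted
  chart is taken to be this one. Uniqueness comes from the nondegeneracy of \<tau> on vertical
  vectors.\<close>

lemma leaf_modular_field_eq:
  assumes c_at: "c = chart_at F p"
  shows "leaf_modular_field A F K (vertical_part \<gamma> \<Psi>) \<tau> p = S p (\<Sum>m\<in>{h..<n}. loc.Zc m *\<^sub>R b m)"
proof -
  let ?z = "\<Sum>m\<in>{h..<n}. loc.Zc m *\<^sub>R b m"
  have "?z \<in> K" by (intro subspace_sum subspace_scale K_subspace) (use b_in_K in auto)
  then have zV: "S p ?z \<in> V p" using S_in_V[OF p] by simp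
  \<comment> \<open>If some argument is not vertical, both sides are 0 by the extensional convention
    for forms on the leaves.\<close>
  have L: "- leaf_deriv A F K (\<lambda>q. contract (leaf_tangent A F K q) (vertical_part \<gamma> \<Psi> q) (\<tau> q)) p us = \<tau> p (S p ?z # us)" for us
  proof (cases "set us \<subseteq> V p")
    case True
    then show ?thesis using leaf_deriv_eq[OF True] unfolding leaf_deriv_def V[symmetric] c_at[symmetric] by simp
  next
    case False
    then have "\<tau> p (S p ?z # us) = 0" using \<tau>_V[OF p] unfolding forms_def by auto
    then show ?thesis using False unfolding leaf_deriv_def V[symmetric] by simp
  qed
  show ?thesis
    unfolding leaf_modular_field_def L
    unfolding V[symmetric]
  proof (rule the_equality)
    show "S p ?z \<in> V p \<and> interior_prod (S p ?z) (\<tau> p) = (\<lambda>us. \<tau> p (S p ?z # us))"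
      using zV by (simp add: interior_prod_def)
    fix v assume v: "v \<in> V p \<and> interior_prod v (\<tau> p) = (\<lambda>us. \<tau> p (S p ?z # us))"
    have "v - S p ?z = 0"
    proof (rule \<tau>_nondegenerate)
      show "v - S p ?z \<in> V p" using v zV by (intro subspace_diff V_subspace[OF p]) auto
      show "\<tau> p ((v - S p ?z) # us) = 0" for us
      proof -
        have e: "\<tau> p (v # us) = \<tau> p (S p ?z # us)" using v by (simp add: interior_prod_def fun_eq_iff)
        let ?w = "\<lambda>i::nat. if i = 0 then v else S p ?z" and ?k = "\<lambda>i::nat. if i = 0 then 1 else - 1 :: real"
        have "\<tau> p ([] @ (\<Sum>i\<in>{0, 1}. ?k i *\<^sub>R ?w i) # us) = (\<Sum>i\<in>{0, 1}. ?k i * \<tau> p ([] @ ?w i # us))"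
          by (rule forms_sum[OF \<tau>_V[OF p] V_subspace[OF p]]) (use v zV in auto)
        then show ?thesis using e by simp
      qed
    qed
    then show "v = S p ?z" by simp
  qed
qed

end


section \<open>Existence of adapted charts and the conclusion\<close>

lemma sharp_image_subspace:
  fixes B :: "'e::euclidean_space bivec"
  assumes B: "is_bivector B"
  shows "subspace (sharp B ` ann_forms W 1)"
proof -
  \<comment> \<open>Any basis will do for the coordinate expression of \<open>sharp\<close>; the
    trivial splitting with \<open>{0}\<close> as second summand provides one.\<close>
  obtain n d and b :: "nat \<Rightarrow> 'e" where "dual_basis n b d"
    using adapted_basis_exists[of "UNIV :: 'e set" "DIM('e)" "{0}"] by fastforce
  then interpret dual_basis n b d .
  have lc: "(\<lambda>us. r * \<alpha> us + s * \<beta> us) \<in> ann_forms W 1"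
      "sharp B (\<lambda>us. r * \<alpha> us + s * \<beta> us) = r *\<^sub>R sharp B \<alpha> + s *\<^sub>R sharp B \<beta>"
    if \<alpha>: "\<alpha> \<in> ann_forms W 1" and \<beta>: "\<beta> \<in> ann_forms W 1" for \<alpha> \<beta> r s
  proof -
    have f: "\<alpha> \<in> forms UNIV 1" "\<beta> \<in> forms UNIV 1" using \<alpha> \<beta> by (auto simp: ann_forms_def)
    have fl: "(\<lambda>us. r * \<alpha> us + s * \<beta> us) \<in> forms UNIV 1" by (rule forms_lincomb[OF f])
    then show "(\<lambda>us. r * \<alpha> us + s * \<beta> us) \<in> ann_forms W 1" using \<alpha> \<beta> by (auto simp: ann_forms_def)
    have "B (\<lambda>us. r * \<alpha> us + s * \<beta> us) (covec (d m)) = r * B \<alpha> (covec (d m)) + s * B \<beta> (covec (d m))" if "m < n" for m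
      by (rule bivector_lincomb_left[OF B f d_forms[OF that]])
    then show "sharp B (\<lambda>us. r * \<alpha> us + s * \<beta> us) = r *\<^sub>R sharp B \<alpha> + s *\<^sub>R sharp B \<beta>"
      unfolding sharp_expand[OF B fl] sharp_expand[OF B f(1)] sharp_expand[OF B f(2)]
      by (simp add: scaleR_add_left sum.distrib scaleR_sum_right)
  qed
  have z: "(\<lambda>_. 0) \<in> ann_forms W 1" by (simp add: ann_forms_def forms_def)
  show ?thesis
    unfolding subspace_def
  proof (intro conjI ballI allI)
    show "0 \<in> sharp B ` ann_forms W 1"
      using lc[OF z z, of 0 0] by (auto simp: image_iff intro!: bexI[OF _ z])
    fix u assume "u \<in> sharp B ` ann_forms W 1"
    then obtain \<alpha> where \<alpha>: "u = sharp B \<alpha>" "\<alpha> \<in> ann_forms W 1" by blast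
    show "u + v \<in> sharp B ` ann_forms W 1" if v: "v \<in> sharp B ` ann_forms W 1" for v
    proof -
      obtain \<beta> where \<beta>: "v = sharp B \<beta>" "\<beta> \<in> ann_forms W 1" using v by blast
      then have "u + v = sharp B (\<lambda>us. 1 * \<alpha> us + 1 * \<beta> us)" using lc(2)[OF \<alpha>(2) \<beta>(2), of 1 1] \<alpha>(1) by simp
      then show ?thesis using lc(1)[OF \<alpha>(2) \<beta>(2)] by blast
    qed
    show "r *\<^sub>R u \<in> sharp B ` ann_forms W 1" for r
    proof -
      have "r *\<^sub>R u = sharp B (\<lambda>us. r * \<alpha> us + 0 * \<alpha> us)" using lc(2)[OF \<alpha>(2) \<alpha>(2), of r 0] \<alpha>(1) by simp
      then show ?thesis using lc(1)[OF \<alpha>(2) \<alpha>(2)] by blast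
    qed
  qed
qed

text \<open>The chart carries the splitting of the tangent space at \<open>p\<close> to a splitting
  of the model space with \<open>K\<close> as one summand, and a basis adapted to the latter is
  horizontal at \<open>p\<close> in its first part.\<close>

lemma (in coupled_foliation) adapted_chart_exists:
  "\<exists>n b d. adapted_chart A F K \<Psi> \<tau> V H l n b d (chart_at F p) p"
proof -
  let ?c = "chart_at F p"
  note c = chart_at_F[of p]
  let ?T = "to_chart A ?c p" and ?S = "of_chart A ?c p"
  note T = to_chart_linear[OF c(1,3)] and TS = to_of_chart[OF c(1,3)] and ST = of_to_chart[OF c(1,3)]
  have H_p: "H p = sharp (\<Psi> p) ` ann_forms (V p) 1" by (simp add: H coupling_normal_def)
  have V_p: "v \<in> V p \<longleftrightarrow> ?T v \<in> K" for v unfolding V by (rule leaf_tangent_iff[OF c(2,3)])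
  have H_sub: "subspace (H p)" unfolding H_p by (rule sharp_image_subspace[OF bivector(1)])
  have inj: "inj ?T" by (rule injI) (metis ST)
  obtain n b d where "dual_basis n b d" "2 * l \<le> n" "n - 2 * l = dim K" "\<And>i. i < 2 * l \<Longrightarrow> b i \<in> ?T ` H p"
    "\<And>v. v \<in> K \<longleftrightarrow> (\<forall>i<2 * l. d i v = 0)"
  proof (rule adapted_basis_exists[of "?T ` H p" "2 * l" K])
    show "subspace (?T ` H p)" by (rule linear_subspace_image[OF T H_sub])
    show "dim (?T ` H p) = 2 * l"
      using dim_image_eq[OF T inj_on_subset[OF inj subset_UNIV]] dim_H by simp
    show "subspace K" by (rule K_subspace)
    show "?T ` H p \<inter> K = {0}"
    proof (intro equalityI subsetI)
      fix w assume "w \<in> ?T ` H p \<inter> K"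
      then obtain u where u: "u \<in> H p" "w = ?T u" "w \<in> K" by blast
      then have "u \<in> H p \<inter> V p" using V_p by simp
      then have "u = 0" using H_V_inter[of p] H_p by auto
      then show "w \<in> {0}" using u linear_0[OF T] by simp
    next
      fix w :: 'e assume "w \<in> {0}"
      then show "w \<in> ?T ` H p \<inter> K"
        using subspace_0[OF K_subspace] subspace_0[OF linear_subspace_image[OF T H_sub]] by simp
    qed
    show "\<exists>u\<in>?T ` H p. \<exists>w\<in>K. v = u + w" for v
    proof -
      obtain u w where uw: "u \<in> H p" "w \<in> V p" "?S v = u + w" using H_V_plus[of p "?S v"] H_p by blast
      have "v = ?T (u + w)" using TS[of v] uw(3) by simp
      then have "v = ?T u + ?T w" by (simp only: linear_add[OF T])
      then show ?thesis using uw V_p by blast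
    qed
  qed (use that in blast)
  then have "adapted_chart A F K \<Psi> \<tau> V H l n b d ?c p"
    by (intro adapted_chart.intro coupled_foliation_axioms adapted_chart_axioms.intro c) auto
  then show ?thesis by blast
qed

theorem proposition4p1:
  fixes A :: "('a::{t2_space, second_countable_topology}, 'e::euclidean_space) chart set"
    and F :: "('a, 'e) chart set"
    and K :: "'e set"
    and \<Psi> :: "'a \<Rightarrow> 'e bivec"
    and \<tau> :: "'a \<Rightarrow> 'e form"
    and V H :: "'a \<Rightarrow> 'e set"
    and \<gamma> :: "'a \<Rightarrow> 'e \<Rightarrow> 'e"
    and \<sigma> \<tau>\<^sub>\<gamma> \<theta> \<Omega> :: "'a \<Rightarrow> 'e form"
    and P :: "'a \<Rightarrow> 'e bivec"
    and Z :: "'a \<Rightarrow> 'e"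
    and l :: nat
  assumes "smooth_atlas A"
    and "foliation_atlas A F K"
    and "V = leaf_tangent A F K"
    and "poisson A \<Psi>"
    and "coupling V \<Psi>"
    and "H = coupling_normal V \<Psi>"
    and "\<gamma> = connection_form H V"
    and "\<sigma> = coupling_form V \<Psi>"
    and "P = vertical_part \<gamma> \<Psi>"
    and "leafwise_volume A F K \<tau>"
    and "\<tau>\<^sub>\<gamma> = vertical_ext H V \<tau>"
    and "\<theta> = divergence_form A H V \<tau>"
    and "\<forall>p. dim (H p) = 2 * l"
    and "\<Omega> = (\<lambda>p. wedge (wedge_power (\<sigma> p) l) (\<tau>\<^sub>\<gamma> p))"
    and "Z = modular_field A \<Psi> \<Omega>"
  shows "\<forall>p. Z p - \<gamma> p (Z p) = - sharp (\<Psi> p) (\<theta> p)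
           \<and> \<gamma> p (Z p) = leaf_modular_field A F K P \<tau> p"
proof
  fix p
  interpret cf: coupled_foliation A F K \<Psi> \<tau> V H l
    using assms by (intro coupled_foliation.intro foliated_atlas.intro coupled_foliation_axioms.intro) auto
  from cf.adapted_chart_exists obtain n b d where "adapted_chart A F K \<Psi> \<tau> V H l n b d (chart_at F p) p" by blast
  \<comment> \<open>The claim is pointwise, so each \<open>p\<close> gets its own chart and a basis
    adapted to the horizontal space at that point.\<close>
  then interpret ac: adapted_chart A F K \<Psi> \<tau> V H l n b d "chart_at F p" p .
  have eqs: "\<gamma> = cf.\<gamma>" "\<Omega> = cf.\<Omega>" "P = vertical_part cf.\<gamma> \<Psi>"
    unfolding cf.\<Omega>_def cf.\<sigma>_def cf.\<tau>\<gamma>_def cf.\<gamma>_def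
      \<open>\<gamma> = connection_form H V\<close>[symmetric] \<open>\<sigma> = coupling_form V \<Psi>\<close>[symmetric]
      \<open>\<tau>\<^sub>\<gamma> = vertical_ext H V \<tau>\<close>[symmetric]
    by (rule refl, rule assms, rule assms)
  show "Z p - \<gamma> p (Z p) = - sharp (\<Psi> p) (\<theta> p) \<and> \<gamma> p (Z p) = leaf_modular_field A F K P \<tau> p"
    using ac.horizontal_part_eq ac.vertical_part_eq ac.leaf_modular_field_eq[OF refl]
    by (simp only: \<open>Z = modular_field A \<Psi> \<Omega>\<close> \<open>\<theta> = divergence_form A H V \<tau>\<close> eqs simp_thms)
qed

end
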